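(* Let $n\ge0$. The set $\rho_n^{-1}(\xi)$ is a finite tree for every $\xi\in\mathcal{S}_n$. The map $p_n:\mathcal{M}_{n+1}\to\mathcal{M}_n$ restricts for every $\xi\in\mathcal{S}_{n+1}$ to a degree two branched covering $\rho_{n+1}^{-1}(\xi)\to\rho_n^{-1}(q_n(\xi))$. Denote by $Z_{n+1}(\xi)$ its critical point. The intersections of $Z_{\alpha,n}$, $Z_{\beta,n}$, and $Z_{\gamma,n}$ with $\rho_n^{-1}(\xi)$ are singletons for every $\xi\in\mathcal S_n$. Denote them by $Z_{\alpha,n}(\xi)$, $Z_{\beta,n}(\xi)$, $Z_{\gamma,n}(\xi)$, respectively. Let $\xi=[\zeta\otimes x]\in\mathcal{S}_{n+1}$, where $\zeta\in\mathcal{D}_n$ and $x\in\{\mathbf{1},\mathbf{1}\cdot a,\mathbf{2},\mathbf{2}\cdot a\}$. The tree $\rho_{n+1}^{-1}(\xi)$ is a union of two trees $T_1$ and $T_2$ such that (i) the common point of $T_1$ and $T_2$ is $Z_{n+1}(\xi)$; (ii) the restrictions of $p_n:\rho_{n+1}^{-1}(\xi)\to\rho_n^{-1}(q_n(\xi))$ onto $T_1$ and $T_2$ are homeomorphisms; (iii) $p_n(Z_{n+1}(\xi))=Z_{\alpha,n}(q_n(\xi))$; (iv) $p_n^{-1}(Z_{\beta,n}(q_n(\xi)))\cap T_1=Z_{\alpha,n+1}(\xi)$ and $p_n^{-1}(Z_{\beta,n}(q_n(\xi)))\cap T_2=Z_{\gamma,n+1}(\xi)$; (v) if $x\in\{\mathbf{1},\mathbf{1}\cdot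 a\}$, then $p_n^{-1}(Z_{\gamma,n}(q_n(\xi)))\cap T_1=Z_{\beta,n+1}(\xi)$; (vi) if $x\in\{\mathbf{2},\mathbf{2}\cdot a\}$, then $p_n^{-1}(Z_{\gamma,n}(q_n(\xi)))\cap T_2=Z_{\beta,n+1}(\xi)$.
   Context: Let $\mathsf{X}=\{1,2,3,4\}$ and $\mathsf{X}^*$ the rooted tree of finite words. For a permutation $\tau$ of $\mathsf{X}$ and automorphisms $g_i$ of $\mathsf{X}^*$, $\tau(g_1,g_2,g_3,g_4)$ denotes $xv\mapsto\tau(x)g_x(v)$ (trivial entries omitted). Left actions; $\varepsilon$ is the identity. Sections: $g(xv)=g(x)\,g|_x(v)$, $g|_{xv}=g|_x|_v$. Let $\sigma=(1\,2)(3\,4)$, $\pi=(1\,3)(2\,4)$. $\Gamma$ is generated by $\alpha=\sigma$, $a=\pi$, $\beta=(\alpha,\gamma,\alpha,\gamma)$, $b=(a\alpha,a\alpha,c,c)$, $\gamma=(\beta,\varepsilon,\varepsilon,\beta)$, $c=(b\beta,b\beta,b,b)$. $\Gamma_A=\langle\beta,\gamma,b,c\rangle$, $\Gamma_B=\langle\alpha,\gamma,a,c\rangle$, $\Gamma_C=\langle\alpha,\beta,a,b\rangle$, $\Gamma_{A_1}=\langle\alpha,b,c\rangle$, $\Gamma_{B_1}=\langle\beta,a,c\gamma\rangle$, $\Gamma_{C_1}=\langle\gamma,a\alpha,b\beta\rangle$. $\mathcal{G}$ is the set of these six finite groups and all their pairwise and triple intersections. $\Xi$ is the simplicial complex of chains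 of the poset of subsets $G\cdot g\subset\Gamma$ ($G\in\mathcal{G}$, $g\in\Gamma$), with $\Gamma$ acting by right translations; $\mathcal{T}_0\subset\Xi$ is the subcomplex of chains in $\mathcal{G}$. $\mathcal{T}_0$ is identified with the union of three tetrahedra $A_1ABC$, $B_1ABC$, $C_1ABC$ with common face $ABC$: $\Gamma_X$ is the vertex $X$, $\Gamma_X\cap\Gamma_Y$ the midpoint of the edge $XY$, a non-trivial triple intersection $\Gamma_X\cap\Gamma_Y\cap\Gamma_Z$ the barycenter of the triangle $XYZ$, $\{\varepsilon\}$ the barycenter of $ABC$. Bimodule: $\mathfrak{M}^{\otimes n}=\mathsf{X}^n\times\Gamma$, elements $v\cdot h$, with $(v\cdot h)\cdot g=v\cdot hg$, $g\cdot(v\cdot h)=g(v)\cdot g|_vh$. $\Xi_n=\Xi\otimes\mathfrak{M}^{\otimes n}$ is the quotient of $\Xi\times\mathfrak{M}^{\otimes n}$ by $\xi\cdot g\otimes m=\xi\otimes g\cdot m$, with the right action on the last factor. $\mathcal{T}_n=\{\xi\otimes v:\xi\in\mathcal{T}_0,v\in\mathsf{X}^n\}$. $K_{g,n}=\mathcal{T}_n\cap\mathcal{T}_n\cdot g$, $\kappa_{g,n}:K_{g,n}\to K_{g^{-1},n}$, $\xi\mapsto\xi\cdot g^{-1}$. $\mathrm{IMG}(f)$ denotes the index two subgroup $\langle\alpha,\beta,\gamma,ab,bc\rangle$ of $\Gamma$, with bimodule $\mathfrak{M}_f=\{1,2,3\cdot b,4\cdot b\}\cdot\mathrm{IMG}(f)\subset\mathfrak{M}$;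 $\Xi_{n+1}=\Xi_n\otimes_{\mathrm{IMG}(f)}\mathfrak{M}_f$ naturally. $\mathcal{M}_n=\Xi_n/\mathrm{IMG}(f)$, $[\xi]$ is the orbit of $\xi$, and $p_n:\mathcal{M}_{n+1}\to\mathcal{M}_n$ is induced by $\xi\otimes x\mapsto\xi$ for $\xi\in\Xi_n$, $x\in\mathfrak{M}_f$. $\widehat\Gamma$ is the group of automorphisms of the binary tree $\{\mathbf1,\mathbf2\}^*$ generated by $a$ (the transposition of the first letter), $b=(a,c)$, $c=(b,b)$. It acts from the right on the Euclidean plane $\widehat\Xi=\mathbb{R}^2$, the generators $a,b,c$ acting as reflections in the lines $B'C'$, $A'C'$, $A'B'$, where $A'=(1,0)$, $B'=(0,0)$, $C'=(0,1)$; $\mathcal{D}$ is the triangle $A'B'C'$. $\mathfrak{M}_{\widehat\Gamma}=\{\mathbf1,\mathbf2\}\times\widehat\Gamma$ is its bimodule (defined as for $\Gamma$), $\widehat\Xi_n=\widehat\Xi\otimes\mathfrak{M}_{\widehat\Gamma}^{\otimes n}$, $\mathcal{D}_n=\mathcal{D}\otimes\{\mathbf1,\mathbf2\}^n$. $\nu:\Gamma\to\widehat\Gamma$ is the epimorphism with $\alpha,\beta,\gamma\mapsto\varepsilon$, $a\mapsto a$, $b\mapsto b$, $c\mapsto c$; $\mu:\mathfrak{M}\to\mathfrak{M}_{\widehat\Gamma}$ is given by $\mu(1)=\mu(2)=\mathbf1$, $\mu(3)=\mu(4)=\mathbf2$, $\mu(x\cdot g)=\mu(x)\cdot\nu(g)$,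 extended to tensor powers. $P:\Xi\to\widehat\Xi$ is affine on the three tetrahedra of $\mathcal{T}_0$, maps $A,A_1$ to $A'$, $B,B_1$ to $B'$, $C,C_1$ to $C'$, and $P(\xi\cdot g)=P(\xi)\cdot\nu(g)$. $P_n(\xi\otimes v)=P(\xi)\otimes\mu(v)$. $\mathcal{S}_n=\widehat\Xi_n/\nu(\mathrm{IMG}(f))$ ($[\cdot]$ denotes orbits), $\rho_n:\mathcal{M}_n\to\mathcal{S}_n$ is induced by $P_n$, and $q_n:\mathcal{S}_{n+1}\to\mathcal{S}_n$ is induced by $\zeta\otimes x\mapsto\zeta$ for $\zeta\in\widehat\Xi_n$, $x\in\mu(\mathfrak{M}_f)$; $q_n\circ\rho_{n+1}=\rho_n\circ p_n$. For $g\in\{\alpha,\beta,\gamma\}$, $Z_{g,n}\subset\mathcal{M}_n$ is the set of points $[\xi]$ and $[\xi\cdot a]$ where $\xi\in\mathcal{T}_n$ is a fixed point of $\kappa_{g,n}$. *)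

theory Defs
  imports "HOL-Analysis.Analysis" "HOL-Algebra.Generated_Groups"
begin

section \<open>Automorphism groups of rooted trees and their bimodules\<close>

definition tree_aut :: "('x list \<Rightarrow> 'x list) monoid" where
  "tree_aut = \<lparr>carrier = {g. bij g \<and> (\<forall>v. length (g v) = length v)
      \<and> (\<forall>u v. take (length u) (g (u @ v)) = g u)},
    monoid.mult = (\<circ>), one = id\<rparr>"

definition sect :: "('x list \<Rightarrow> 'x list) \<Rightarrow> 'x list \<Rightarrow> 'x list \<Rightarrow> 'x list" where
  "sect g u v = drop (length u) (g (u @ v))"

text \<open>The element \<open>v \<cdot> h\<close> of the \<open>n\<close>-th tensor power of the bimodule of a group \<open>G\<close> is the
  pair \<open>(v, h)\<close>.\<close>

type_synonym 'x bimod = "'x list \<times> ('x list \<Rightarrow> 'x list)"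

definition bimod_power :: "('x list \<Rightarrow> 'x list) set \<Rightarrow> nat \<Rightarrow> 'x bimod set" where
  "bimod_power G n = {v. length v = n} \<times> G"

definition bimod_right :: "'x bimod \<Rightarrow> ('x list \<Rightarrow> 'x list) \<Rightarrow> 'x bimod" where
  "bimod_right m g = (fst m, snd m \<circ> g)"

definition bimod_left :: "('x list \<Rightarrow> 'x list) \<Rightarrow> 'x bimod \<Rightarrow> 'x bimod" where
  "bimod_left g m = (g (fst m), sect g (fst m) \<circ> snd m)"

text \<open>Identification of the tensor product of two tensor powers with a higher one:
  \<open>(v \<cdot> g) \<otimes> (w \<cdot> h) = v g(w) \<cdot> g|\<^sub>w h\<close>.\<close>

definition bimod_mult :: "'x bimod \<Rightarrow> 'x bimod \<Rightarrow> 'x bimod" where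
  "bimod_mult m m' = (fst m @ fst (bimod_left (snd m) m'), snd (bimod_left (snd m) m'))"

text \<open>Tensor products of a space \<open>S\<close> with a right action \<open>act\<close> of \<open>G\<close> and powers of the bimodule.\<close>

definition tensor_rel ::
  "'p set \<Rightarrow> ('p \<Rightarrow> ('x list \<Rightarrow> 'x list) \<Rightarrow> 'p) \<Rightarrow> ('x list \<Rightarrow> 'x list) set
    \<Rightarrow> (('p \<times> 'x bimod) \<times> ('p \<times> 'x bimod)) set" where
  "tensor_rel S act G =
    {((act \<xi> g, m), (\<xi>, bimod_left g m)) | \<xi> g m. \<xi> \<in> S \<and> g \<in> G \<and> snd m \<in> G}"

definition tensor ::
  "'p set \<Rightarrow> ('p \<Rightarrow> ('x list \<Rightarrow> 'x list) \<Rightarrow> 'p) \<Rightarrow> ('x list \<Rightarrow> 'x list) set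
    \<Rightarrow> 'p \<Rightarrow> 'x bimod \<Rightarrow> ('p \<times> 'x bimod) set" where
  "tensor S act G \<xi> m = tensor_rel S act G `` {(\<xi>, m)}"

definition tensor_space ::
  "'p set \<Rightarrow> ('p \<Rightarrow> ('x list \<Rightarrow> 'x list) \<Rightarrow> 'p) \<Rightarrow> ('x list \<Rightarrow> 'x list) set
    \<Rightarrow> nat \<Rightarrow> ('p \<times> 'x bimod) set set" where
  "tensor_space S act G n = (S \<times> bimod_power G n) // tensor_rel S act G"

definition tensor_right ::
  "('p \<times> 'x bimod) set \<Rightarrow> ('x list \<Rightarrow> 'x list) \<Rightarrow> ('p \<times> 'x bimod) set" where
  "tensor_right y g = (\<lambda>(\<xi>, m). (\<xi>, bimod_right m g)) ` y"

text \<open>\<open>(\<xi> \<otimes> m) \<otimes> x = \<xi> \<otimes> (m \<otimes> x)\<close>.\<close>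

definition tensor_append ::
  "'p set \<Rightarrow> ('p \<Rightarrow> ('x list \<Rightarrow> 'x list) \<Rightarrow> 'p) \<Rightarrow> ('x list \<Rightarrow> 'x list) set
    \<Rightarrow> ('p \<times> 'x bimod) set \<Rightarrow> 'x bimod \<Rightarrow> ('p \<times> 'x bimod) set" where
  "tensor_append S act G y x = the_elem ((\<lambda>(\<xi>, m). tensor S act G \<xi> (bimod_mult m x)) ` y)"

definition tensor_orbit ::
  "('x list \<Rightarrow> 'x list) set \<Rightarrow> ('p \<times> 'x bimod) set \<Rightarrow> ('p \<times> 'x bimod) set set" where
  "tensor_orbit H y = tensor_right y ` H"


section \<open>Topological notions\<close>

text \<open>Points of the geometric realization of an abstract simplicial complex \<open>K\<close> (a set of finite
  non-empty sets) are given by barycentric coordinates.  Each finite simplex gets its Euclidean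
  topology, which is induced from the product topology on functions, and the realization gets
  the weak topology.\<close>

definition realization :: "'v set set \<Rightarrow> ('v \<Rightarrow> real) set" where
  "realization K = {f. (\<forall>v. 0 \<le> f v) \<and> {v. f v \<noteq> 0} \<in> K \<and> (\<Sum>v | f v \<noteq> 0. f v) = 1}"

definition realization_topology :: "'v set set \<Rightarrow> ('v \<Rightarrow> real) topology" where
  "realization_topology K = topology (\<lambda>U. U \<subseteq> realization K \<and>
    (\<forall>s\<in>K. openin (top_of_set (realization (Pow s - {{}}))) (U \<inter> realization (Pow s - {{}}))))"

definition quotient_topology :: "'a topology \<Rightarrow> ('a \<Rightarrow> 'b) \<Rightarrow> 'b topology" where
  "quotient_topology X f =
    topology (\<lambda>U. U \<subseteq> f ` topspace X \<and> openin X {x \<in> topspace X. f x \<in> U})"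

definition graph_connected :: "'v set \<Rightarrow> 'v set set \<Rightarrow> bool" where
  "graph_connected V E \<longleftrightarrow> (\<forall>u\<in>V. \<forall>v\<in>V. (u, v) \<in> {(x, y). {x, y} \<in> E}\<^sup>*)"

definition graph_cycle :: "'v set set \<Rightarrow> 'v list \<Rightarrow> bool" where
  "graph_cycle E vs \<longleftrightarrow> 3 \<le> length vs \<and> distinct vs \<and>
    (\<forall>i. Suc i < length vs \<longrightarrow> {vs ! i, vs ! Suc i} \<in> E) \<and> {last vs, hd vs} \<in> E"

definition finite_graph_tree :: "'v set \<Rightarrow> 'v set set \<Rightarrow> bool" where
  "finite_graph_tree V E \<longleftrightarrow> finite V \<and> V \<noteq> {} \<and> E \<subseteq> {{u, v} | u v. u \<in> V \<and> v \<in> V \<and> u \<noteq> v} \<and>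
    graph_connected V E \<and> \<not> (\<exists>vs. graph_cycle E vs)"

definition finite_tree :: "'a topology \<Rightarrow> bool" where
  "finite_tree X \<longleftrightarrow> (\<exists>(V :: nat set) E. finite_graph_tree V E \<and>
    X homeomorphic_space realization_topology ((\<lambda>v. {v}) ` V \<union> E))"

definition covering_of_degree :: "nat \<Rightarrow> 'a topology \<Rightarrow> 'b topology \<Rightarrow> ('a \<Rightarrow> 'b) \<Rightarrow> bool" where
  "covering_of_degree d X Y f \<longleftrightarrow> continuous_map X Y f \<and>
    (\<forall>y \<in> topspace Y. \<exists>U. openin Y U \<and> y \<in> U \<and>
      (\<exists>\<V>. finite \<V> \<and> card \<V> = d \<and> pairwise disjnt \<V> \<and> \<Union>\<V> = {x \<in> topspace X. f x \<in> U} \<and>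
        (\<forall>V\<in>\<V>. openin X V \<and> homeomorphic_map (subtopology X V) (subtopology Y U) f)))"

definition branched_covering_of_degree ::
  "nat \<Rightarrow> 'a topology \<Rightarrow> 'b topology \<Rightarrow> ('a \<Rightarrow> 'b) \<Rightarrow> bool" where
  "branched_covering_of_degree d X Y f \<longleftrightarrow>
    continuous_map X Y f \<and> open_map X Y f \<and> proper_map X Y f \<and> f ` topspace X = topspace Y \<and>
    (\<forall>y \<in> topspace Y. finite {x \<in> topspace X. f x = y}) \<and>
    (\<exists>B. finite B \<and> B \<subseteq> topspace Y \<and>
      covering_of_degree d (subtopology X {x \<in> topspace X. f x \<notin> B}) (subtopology Y (- B)) f)"

definition critical_points :: "'a topology \<Rightarrow> 'b topology \<Rightarrow> ('a \<Rightarrow> 'b) \<Rightarrow> 'a set" where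
  "critical_points X Y f = {x \<in> topspace X. \<not> (\<exists>U. openin X U \<and> x \<in> U \<and> openin Y (f ` U) \<and>
    homeomorphic_map (subtopology X U) (subtopology Y (f ` U)) f)}"


section \<open>The group \<open>\<Gamma>\<close>\<close>

datatype letter = L1 | L2 | L3 | L4

type_synonym aut = "letter list \<Rightarrow> letter list"

fun g_alpha :: aut where
  "g_alpha [] = []"
| "g_alpha (L1 # v) = L2 # v"
| "g_alpha (L2 # v) = L1 # v"
| "g_alpha (L3 # v) = L4 # v"
| "g_alpha (L4 # v) = L3 # v"

fun g_a :: aut where
  "g_a [] = []"
| "g_a (L1 # v) = L3 # v"
| "g_a (L2 # v) = L4 # v"
| "g_a (L3 # v) = L1 # v"
| "g_a (L4 # v) = L2 # v"

fun g_beta :: aut and g_gamma :: aut where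
  "g_beta [] = []"
| "g_beta (L1 # v) = L1 # g_alpha v"
| "g_beta (L2 # v) = L2 # g_gamma v"
| "g_beta (L3 # v) = L3 # g_alpha v"
| "g_beta (L4 # v) = L4 # g_gamma v"
| "g_gamma [] = []"
| "g_gamma (L1 # v) = L1 # g_beta v"
| "g_gamma (L2 # v) = L2 # v"
| "g_gamma (L3 # v) = L3 # v"
| "g_gamma (L4 # v) = L4 # g_beta v"

lemma length_g_alpha [simp]: "length (g_alpha v) = length v"
  by (cases v rule: g_alpha.cases) auto

lemma length_g_beta [simp]: "length (g_beta v) = length v"
  and length_g_gamma [simp]: "length (g_gamma v) = length v"
  by (induction v and v rule: g_beta_g_gamma.induct) auto

function g_b :: aut and g_c :: aut where
  "g_b [] = []"
| "g_b (L1 # v) = L1 # g_a (g_alpha v)"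
| "g_b (L2 # v) = L2 # g_a (g_alpha v)"
| "g_b (L3 # v) = L3 # g_c v"
| "g_b (L4 # v) = L4 # g_c v"
| "g_c [] = []"
| "g_c (L1 # v) = L1 # g_b (g_beta v)"
| "g_c (L2 # v) = L2 # g_b (g_beta v)"
| "g_c (L3 # v) = L3 # g_b v"
| "g_c (L4 # v) = L4 # g_b v"
  by pat_completeness auto
termination
  by (relation "Wellfounded.measure (\<lambda>x. case x of Inl v \<Rightarrow> length v | Inr v \<Rightarrow> length v)") auto

definition Gam :: "aut set" where
  "Gam = generate tree_aut {g_alpha, g_beta, g_gamma, g_a, g_b, g_c}"

definition IMGf :: "aut set" where
  "IMGf = generate tree_aut {g_alpha, g_beta, g_gamma, g_a \<circ> g_b, g_b \<circ> g_c}"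

definition bimod_f :: "letter bimod set" where
  "bimod_f = {bimod_right m h | m h.
    m \<in> {([L1], id), ([L2], id), ([L3], g_b), ([L4], g_b)} \<and> h \<in> IMGf}"


section \<open>The complexes \<open>\<Xi>\<close> and \<open>\<T>\<^sub>0\<close>\<close>

datatype vert = vA | vB | vC | vA1 | vB1 | vC1

fun stab :: "vert \<Rightarrow> aut set" where
  "stab vA = generate tree_aut {g_beta, g_gamma, g_b, g_c}"
| "stab vB = generate tree_aut {g_alpha, g_gamma, g_a, g_c}"
| "stab vC = generate tree_aut {g_alpha, g_beta, g_a, g_b}"
| "stab vA1 = generate tree_aut {g_alpha, g_b, g_c}"
| "stab vB1 = generate tree_aut {g_beta, g_a, g_c \<circ> g_gamma}"
| "stab vC1 = generate tree_aut {g_gamma, g_a \<circ> g_alpha, g_b \<circ> g_beta}"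

definition subgroups :: "aut set set" where
  "subgroups = {\<Inter>(stab ` F) | F. F \<noteq> {} \<and> card F \<le> 3}"

definition coset_poset :: "aut set set" where
  "coset_poset = {(\<lambda>h. h \<circ> g) ` G | G g. G \<in> subgroups \<and> g \<in> Gam}"

definition order_complex :: "'a set set \<Rightarrow> 'a set set set" where
  "order_complex Q = {C. finite C \<and> C \<noteq> {} \<and> C \<subseteq> Q \<and> chain\<^sub>\<subseteq> C}"

type_synonym pt = "aut set \<Rightarrow> real"

definition Xi :: "pt set" where
  "Xi = realization (order_complex coset_poset)"

definition Xi_top :: "pt topology" where
  "Xi_top = realization_topology (order_complex coset_poset)"

definition T0 :: "pt set" where
  "T0 = realization (order_complex subgroups)"

text \<open>The coordinate of \<open>\<xi> \<cdot> g\<close> at a coset \<open>V\<close> is the coordinate of \<open>\<xi>\<close> at \<open>V \<cdot> g\<^sup>-\<^sup>1\<close>.\<close>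

definition Xi_right :: "pt \<Rightarrow> aut \<Rightarrow> pt" where
  "Xi_right \<xi> g = (\<lambda>V. \<xi> ((\<lambda>h. h \<circ> inv_into UNIV g) ` V))"


section \<open>The spaces \<open>\<Xi>\<^sub>n\<close> and \<open>\<M>\<^sub>n\<close>\<close>

definition Xi_n :: "nat \<Rightarrow> (pt \<times> letter bimod) set set" where
  "Xi_n n = tensor_space Xi Xi_right Gam n"

definition Xi_n_top :: "nat \<Rightarrow> (pt \<times> letter bimod) set topology" where
  "Xi_n_top n = quotient_topology
    (prod_topology Xi_top (discrete_topology (bimod_power Gam n)))
    (\<lambda>(\<xi>, m). tensor Xi Xi_right Gam \<xi> m)"

definition T_n :: "nat \<Rightarrow> (pt \<times> letter bimod) set set" where
  "T_n n = {tensor Xi Xi_right Gam \<xi> (v, id) | \<xi> v. \<xi> \<in> T0 \<and> length v = n}"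

definition K_set :: "aut \<Rightarrow> nat \<Rightarrow> (pt \<times> letter bimod) set set" where
  "K_set g n = T_n n \<inter> (\<lambda>y. tensor_right y g) ` T_n n"

definition kappa :: "aut \<Rightarrow> (pt \<times> letter bimod) set \<Rightarrow> (pt \<times> letter bimod) set" where
  "kappa g y = tensor_right y (inv_into UNIV g)"

type_synonym mpt = "(pt \<times> letter bimod) set set"

definition M_n :: "nat \<Rightarrow> mpt set" where
  "M_n n = tensor_orbit IMGf ` Xi_n n"

definition M_top :: "nat \<Rightarrow> mpt topology" where
  "M_top n = quotient_topology (Xi_n_top n) (tensor_orbit IMGf)"

definition p_map :: "nat \<Rightarrow> mpt \<Rightarrow> mpt" where
  "p_map n y = the_elem {tensor_orbit IMGf \<xi> | \<xi> x.
    \<xi> \<in> Xi_n n \<and> x \<in> bimod_f \<and> y = tensor_orbit IMGf (tensor_append Xi Xi_right Gam \<xi> x)}"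

definition Z_set :: "aut \<Rightarrow> nat \<Rightarrow> mpt set" where
  "Z_set g n = (\<Union>\<xi> \<in> {\<xi> \<in> K_set g n. kappa g \<xi> = \<xi>}.
    {tensor_orbit IMGf \<xi>, tensor_orbit IMGf (tensor_right \<xi> g_a)})"


section \<open>The group acting on the plane and the spaces \<open>\<S>\<^sub>n\<close>\<close>

datatype bletter = B1 | B2

type_synonym baut = "bletter list \<Rightarrow> bletter list"

fun h_a :: baut where
  "h_a [] = []"
| "h_a (B1 # v) = B2 # v"
| "h_a (B2 # v) = B1 # v"

fun h_b :: baut and h_c :: baut where
  "h_b [] = []"
| "h_b (B1 # v) = B1 # h_a v"
| "h_b (B2 # v) = B2 # h_c v"
| "h_c [] = []"
| "h_c (x # v) = x # h_b v"

definition Gam_hat :: "baut set" where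
  "Gam_hat = generate tree_aut {h_a, h_b, h_c}"

definition nu :: "aut \<Rightarrow> baut" where
  "nu = (THE f. f \<in> extensional Gam \<and>
    f \<in> hom (tree_aut\<lparr>carrier := Gam\<rparr>) (tree_aut\<lparr>carrier := Gam_hat\<rparr>) \<and>
    f g_alpha = id \<and> f g_beta = id \<and> f g_gamma = id \<and> f g_a = h_a \<and> f g_b = h_b \<and> f g_c = h_c)"

fun mu_letter :: "letter \<Rightarrow> bletter" where
  "mu_letter L1 = B1" | "mu_letter L2 = B1" | "mu_letter L3 = B2" | "mu_letter L4 = B2"

definition mu :: "letter bimod \<Rightarrow> bletter bimod" where
  "mu m = (map mu_letter (fst m), nu (snd m))"

type_synonym plane = "real \<times> real"

definition pA :: plane where "pA = (1, 0)"
definition pB :: plane where "pB = (0, 0)"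
definition pC :: plane where "pC = (0, 1)"

definition reflect_line :: "plane \<Rightarrow> plane \<Rightarrow> plane \<Rightarrow> plane" where
  "reflect_line P Q z = 2 *\<^sub>R closest_point (affine hull {P, Q}) z - z"

text \<open>The right action of \<open>Gam_hat\<close> on the plane, determined by the action of the generators.\<close>

definition plane_act :: "baut \<Rightarrow> plane \<Rightarrow> plane" where
  "plane_act = (THE \<phi>. \<phi> \<in> extensional Gam_hat \<and>
    \<phi> id = id \<and> (\<forall>g\<in>Gam_hat. \<forall>h\<in>Gam_hat. \<phi> (g \<circ> h) = \<phi> h \<circ> \<phi> g) \<and>
    \<phi> h_a = reflect_line pB pC \<and> \<phi> h_b = reflect_line pA pC \<and> \<phi> h_c = reflect_line pA pB)"

definition plane_right :: "plane \<Rightarrow> baut \<Rightarrow> plane" where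
  "plane_right z g = plane_act g z"

definition Xi_hat_n :: "nat \<Rightarrow> (plane \<times> bletter bimod) set set" where
  "Xi_hat_n n = tensor_space UNIV plane_right Gam_hat n"

definition D_n :: "nat \<Rightarrow> (plane \<times> bletter bimod) set set" where
  "D_n n = {tensor UNIV plane_right Gam_hat z (v, id) | z v.
    z \<in> convex hull {pA, pB, pC} \<and> length v = n}"

type_synonym spt = "(plane \<times> bletter bimod) set set"

definition S_orbit :: "(plane \<times> bletter bimod) set \<Rightarrow> spt" where
  "S_orbit = tensor_orbit (nu ` IMGf)"

definition S_n :: "nat \<Rightarrow> spt set" where
  "S_n n = S_orbit ` Xi_hat_n n"

definition hat_append ::
  "(plane \<times> bletter bimod) set \<Rightarrow> bletter bimod \<Rightarrow> (plane \<times> bletter bimod) set" where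
  "hat_append = tensor_append UNIV plane_right Gam_hat"

definition q_map :: "nat \<Rightarrow> spt \<Rightarrow> spt" where
  "q_map n s = the_elem {S_orbit \<zeta> | \<zeta> x.
    \<zeta> \<in> Xi_hat_n n \<and> x \<in> mu ` bimod_f \<and> s = S_orbit (hat_append \<zeta> x)}"


section \<open>The maps \<open>P\<close> and \<open>\<rho>\<^sub>n\<close> and the special points of the fibres\<close>

definition tetrahedra :: "vert set set" where
  "tetrahedra = {{vA1, vA, vB, vC}, {vB1, vA, vB, vC}, {vC1, vA, vB, vC}}"

fun vert_image :: "vert \<Rightarrow> plane" where
  "vert_image vA = pA" | "vert_image vA1 = pA"
| "vert_image vB = pB" | "vert_image vB1 = pB"
| "vert_image vC = pC" | "vert_image vC1 = pC"

text \<open>The intersection of \<open>stab X\<close> over the vertices \<open>X\<close> of a face \<open>F\<close> of dimension at most two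
  of one of the tetrahedra is identified with the barycenter of \<open>F\<close> (for \<open>F = {vA, vB, vC}\<close> it
  is the trivial group), so an affine map sends it to the barycenter of the image of \<open>F\<close>.
  Every element of \<open>subgroups\<close> arises from exactly one such face.  The vertices of \<open>\<Xi>\<close> are
  translates of these, and \<open>P\<close> is affine on the simplices of \<open>\<Xi>\<close>.\<close>

definition P_vertex :: "aut set \<Rightarrow> plane" where
  "P_vertex V = (THE z. \<exists>F g. F \<noteq> {} \<and> card F \<le> 3 \<and> (\<exists>\<Delta>\<in>tetrahedra. F \<subseteq> \<Delta>) \<and> g \<in> Gam \<and>
    V = (\<lambda>h. h \<circ> g) ` \<Inter>(stab ` F) \<and>
    z = plane_right ((1 / real (card F)) *\<^sub>R (\<Sum>X\<in>F. vert_image X)) (nu g))"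

definition P_map :: "pt \<Rightarrow> plane" where
  "P_map \<xi> = (\<Sum>V | \<xi> V \<noteq> 0. \<xi> V *\<^sub>R P_vertex V)"

definition P_n :: "(pt \<times> letter bimod) set \<Rightarrow> (plane \<times> bletter bimod) set" where
  "P_n y = the_elem ((\<lambda>(\<xi>, m). tensor UNIV plane_right Gam_hat (P_map \<xi>) (mu m)) ` y)"

definition rho :: "mpt \<Rightarrow> spt" where
  "rho y = the_elem ((\<lambda>\<xi>. S_orbit (P_n \<xi>)) ` y)"

definition fibre :: "nat \<Rightarrow> spt \<Rightarrow> mpt set" where
  "fibre n s = {y \<in> M_n n. rho y = s}"

definition fibre_top :: "nat \<Rightarrow> spt \<Rightarrow> mpt topology" where
  "fibre_top n s = subtopology (M_top n) (fibre n s)"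

text \<open>\<open>crit_set n s\<close> consists of the critical points of \<open>p\<^sub>n\<close> on the fibre over
  \<open>s \<in> \<S>\<^sub>n\<^sub>+\<^sub>1\<close>, and \<open>crit_pt n s\<close> is \<open>Z\<^sub>n\<^sub>+\<^sub>1(s)\<close>.\<close>

definition crit_set :: "nat \<Rightarrow> spt \<Rightarrow> mpt set" where
  "crit_set n s = critical_points (fibre_top (Suc n) s) (fibre_top n (q_map n s)) (p_map n)"

definition crit_pt :: "nat \<Rightarrow> spt \<Rightarrow> mpt" where
  "crit_pt n s = the_elem (crit_set n s)"

definition Z_pt :: "aut \<Rightarrow> nat \<Rightarrow> spt \<Rightarrow> mpt" where
  "Z_pt g n s = the_elem (Z_set g n \<inter> fibre n s)"

end

theory Submission imports Defs begin

text \<open>The points of the fibre over \<open>[z \<otimes> v \<cdot> h]\<close>, where \<open>z\<close> lies in the triangle \<open>\<D>\<close>, are the classes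
  \<open>[\<xi> \<otimes> w \<cdot> h]\<close>, where \<open>\<xi>\<close> runs through the tripod of points of \<open>\<T>\<^sub>0\<close> over \<open>z\<close> and \<open>w\<close> through the words
  over \<open>v\<close>.  Orientation preserving elements of the stabilizer of \<open>\<xi>\<close> permute the words over \<open>v\<close> in the same
  way as the group generated by those of \<open>\<alpha>\<close>, \<open>\<beta>\<close>, \<open>\<gamma>\<close> which fix \<open>\<xi>\<close>.  Hence two classes
  agree if and only if they have the same \<open>\<xi>\<close> and their words lie in one orbit of that group, which
  is trivial except at the ends of the legs of the tripod.

  Elements of these groups moving a word to another can be chosen with trivial section.
  Therefore appending a fixed letter to \<open>w\<close> embeds the fibre of level \<open>n\<close> into that of level \<open>n + 1\<close> as a sheet
  of \<open>p\<^sub>n\<close>.  The sheets of the two possible letters are glued where \<open>\<alpha>\<close> is the section at \<open>w\<close> of an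
  element fixing \<open>\<xi>\<close> and \<open>w\<close>; inductively, for each of \<open>\<alpha>\<close>, \<open>\<beta>\<close>, \<open>\<gamma>\<close> this happens at exactly one
  point of the fibre, since \<open>\<alpha>\<close> and \<open>\<gamma>\<close> arise as sections of \<open>\<beta>\<close> only and \<open>\<beta>\<close> as a section of \<open>\<gamma>\<close> only.  Two trees
  glued at a point form a tree.\<close>

section \<open>The group \<Gamma>: sections, relations and parity homomorphisms\<close>

section \<open>Tree automorphisms generated by involutions\<close>

text \<open>Neither group comes with a presentation. Relations are verified on words by passing to
  sections; elements are told apart by homomorphisms to the two-element group, built by summing such
  homomorphisms over sections, and by their action on the plane. The existence of that action is not
  evident, since \<Gamma>-hat is given by tree automorphisms; it rests on a contraction argument.

  IMG(f) consists of the orientation preserving elements. Hence its orbits remember only a sign of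
  the group component of a bimodule element, and a letter changes this sign by a cocycle.

  The complex \<open>T0\<close> is not the barycentric subdivision of the three tetrahedra. The
  group of the face ABC is trivial, so it is contained in all others, and each tetrahedron is a cone
  from the barycenter of ABC. This face is therefore treated separately whenever coordinates are
  converted.

  For the induction it does not suffice that the fibres are trees: a gluing point has to be a vertex
  on both sheets, so the special points are carried along as vertices.\<close>

abbreviation TA :: "('x list \<Rightarrow> 'x list) set" where "TA \<equiv> carrier tree_aut"

lemma TA_iff: "g \<in> TA \<longleftrightarrow> bij g \<and> (\<forall>v. length (g v) = length v)
      \<and> (\<forall>u v. take (length u) (g (u @ v)) = g u)"
  by (simp add: tree_aut_def)

lemma tree_aut_simps [simp]: "monoid.mult tree_aut g h = g \<circ> h" "one tree_aut = id"
  by (simp_all add: tree_aut_def)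

lemma TA_length: "g \<in> TA \<Longrightarrow> length (g v) = length v" by (simp add: TA_iff)

lemma TA_append: "g \<in> TA \<Longrightarrow> g (u @ v) = g u @ sect g u v"
  by (metis TA_iff append_take_drop_id sect_def)

lemma TA_bij: "g \<in> TA \<Longrightarrow> bij g" by (simp add: TA_iff)

lemma id_TA [simp]: "id \<in> TA" by (simp add: TA_iff)

lemma comp_TA [simp]: assumes "g \<in> TA" "h \<in> TA" shows "g \<circ> h \<in> TA"
proof -
  have "take (length u) (g (h (u @ v))) = g (h u)" for u v
    using assms by (metis TA_append TA_iff append_eq_conv_conj)
  then show ?thesis using assms by (auto simp: TA_iff bij_comp)
qed

lemma inv_TA [simp]: assumes g: "g \<in> TA" shows "inv_into UNIV g \<in> TA"
proof -
  let ?i = "inv_into UNIV g"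
  have b: "bij g" using g TA_bij by blast
  have gi: "g (?i x) = x" "?i (g x) = x" for x
    using b by (simp_all add: bij_is_surj surj_f_inv_f bij_is_inj)
  have l: "length (?i v) = length v" for v
    by (metis TA_length g gi(1))
  have "take (length u) (?i (u @ v)) = ?i u" for u v
  proof -
    let ?w = "?i (u @ v)"
    have "g (take (length u) ?w) = take (length u) (g (take (length u) ?w @ drop (length u) ?w))"
      using TA_append[OF g, of "take (length u) ?w" "drop (length u) ?w"] l g
      by (simp add: TA_length)
    also have "\<dots> = u" by (simp add: gi)
    finally show ?thesis by (metis gi(2))
  qed
  then show ?thesis using b l by (simp add: TA_iff bij_imp_bij_inv)
qed

lemma TA_inv [simp]: assumes "g \<in> TA"
  shows "g \<circ> inv_into UNIV g = id" "inv_into UNIV g \<circ> g = id"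
    "g (inv_into UNIV g v) = v" "inv_into UNIV g (g v) = v"
  using TA_bij[OF assms]
  by (auto simp: fun_eq_iff bij_is_surj surj_f_inv_f bij_is_inj)

lemma inv_inv_TA [simp]: "g \<in> TA \<Longrightarrow> inv_into UNIV (inv_into UNIV g) = g"
  by (simp add: TA_bij inv_inv_eq)

lemma group_tree_aut: "group (tree_aut :: ('x list \<Rightarrow> 'x list) monoid)"
proof (rule groupI)
  fix g :: "'x list \<Rightarrow> 'x list" assume "g \<in> TA"
  then show "\<exists>h\<in>TA. h \<otimes>\<^bsub>tree_aut\<^esub> g = \<one>\<^bsub>tree_aut\<^esub>"
    by (intro bexI[of _ "inv_into UNIV g"]) simp_all
qed (auto simp: comp_assoc)

lemma m_inv_tree_aut: assumes g: "g \<in> TA" shows "m_inv tree_aut g = inv_into UNIV g"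
proof -
  interpret group "tree_aut :: ('a list \<Rightarrow> 'a list) monoid" by (rule group_tree_aut)
  show ?thesis by (rule inv_equality) (simp_all add: g)
qed

lemma sect_append: "g \<in> TA \<Longrightarrow> sect g (u @ v) = sect (sect g u) v"
  by (simp add: sect_def fun_eq_iff TA_length add.commute)

lemma sect_comp: assumes "g \<in> TA" "h \<in> TA" shows "sect (g \<circ> h) u = sect g (h u) \<circ> sect h u"
proof
  fix v
  have "g (h (u @ v)) = g (h u) @ sect g (h u) (sect h u v)"
    by (simp only: TA_append[OF assms(1)] TA_append[OF assms(2)])
  then show "sect (g \<circ> h) u v = (sect g (h u) \<circ> sect h u) v"
    using assms by (simp add: sect_def[of "g \<circ> h"] TA_length)
qed

lemma sect_id [simp]: "sect id u = id" by (simp add: sect_def fun_eq_iff)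

lemma sect_Nil [simp]: "sect g [] = g" by (simp add: sect_def fun_eq_iff)

lemma sect_TA: assumes g: "g \<in> TA" shows "sect g u \<in> TA"
proof -
  have gi: "g x = g y \<Longrightarrow> x = y" for x y
    using g by (metis TA_inv(4))
  have inj: "inj (sect g u)"
  proof (rule injI)
    fix v w assume "sect g u v = sect g u w"
    then have "g (u @ v) = g (u @ w)" by (simp only: TA_append[OF g])
    then show "v = w" using gi by blast
  qed
  have surj: "\<exists>v. w = sect g u v" for w
  proof -
    let ?v = "inv_into UNIV g (g u @ w)"
    have e: "g ?v = g u @ w" using g by simp
    have "take (length (g u)) (inv_into UNIV g (g u @ w)) = inv_into UNIV g (g u)"
      using inv_TA[OF g] unfolding TA_iff by blast
    then have "take (length u) ?v = u" using g by (simp add: TA_length)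
    then have "?v = u @ drop (length u) ?v" by (metis append_take_drop_id)
    then have "g u @ w = g u @ sect g u (drop (length u) ?v)"
      using e TA_append[OF g] by metis
    then show ?thesis by blast
  qed
  have l: "length (sect g u v) = length v" for v using g by (simp add: sect_def TA_length)
  have "take (length v) (sect g u (v @ w)) = sect g u v" for v w
  proof -
    have "g u @ sect g u (v @ w) = g ((u @ v) @ w)" by (simp only: TA_append[OF g] append_assoc)
    also have "\<dots> = g (u @ v) @ sect g (u @ v) w" by (simp only: TA_append[OF g])
    also have "\<dots> = g u @ sect g u v @ sect g (u @ v) w" by (simp only: TA_append[OF g] append_assoc)
    finally have "sect g u (v @ w) = sect g u v @ sect g (u @ v) w" by simp
    then show ?thesis using l[of v] by simp
  qed
  then show ?thesis unfolding TA_iff using inj surj l unfolding bij_def surj_def by blast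
qed

text \<open>Only products are closed off, without inverses. The generating sets in question consist
  of involutions, for which this monoid is the generated group, and inductions have a single
  multiplication case.\<close>

inductive_set gen :: "('a \<Rightarrow> 'a) set \<Rightarrow> ('a \<Rightarrow> 'a) set" for S where
  gen_id [simp]: "id \<in> gen S"
| gen_mult: "s \<in> S \<Longrightarrow> g \<in> gen S \<Longrightarrow> s \<circ> g \<in> gen S"

lemma gen_incl: "s \<in> S \<Longrightarrow> s \<in> gen S"
  using gen_mult[of s S id] by simp

lemma gen_comp: "g \<in> gen S \<Longrightarrow> h \<in> gen S \<Longrightarrow> g \<circ> h \<in> gen S"
  by (induction rule: gen.induct) (auto simp: comp_assoc intro: gen_mult)

lemma gen_mono: "S \<subseteq> gen T \<Longrightarrow> gen S \<subseteq> gen T"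
proof
  fix g assume "S \<subseteq> gen T" "g \<in> gen S"
  from this(2,1) show "g \<in> gen T" by (induction rule: gen.induct) (auto intro: gen_comp)
qed

lemma gen_TA: "g \<in> gen S \<Longrightarrow> S \<subseteq> TA \<Longrightarrow> g \<in> TA"
  by (induction rule: gen.induct) auto

lemma involution_inv: "s \<circ> s = id \<Longrightarrow> inv_into UNIV s = s"
  by (metis inv_unique_comp)

lemma gen_inv: assumes "g \<in> gen S" "\<And>s. s \<in> S \<Longrightarrow> s \<circ> s = id"
  shows "inv_into UNIV g \<in> gen S"
  using assms(1)
proof (induction rule: gen.induct)
  case gen_id
  then show ?case by (metis gen.gen_id inv_id)
next
  case (gen_mult s g)
  have bs: "bij s" if "s \<in> S" for s using assms(2)[OF that] o_bij by blast
  have "bij g" using gen_mult(2) by (induction rule: gen.induct) (auto intro: bij_comp[OF _ bs] simp: bij_id simp del: o_apply comp_apply id_apply)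
  then have "inv_into UNIV (s \<circ> g) = inv_into UNIV g \<circ> s"
    using bs[OF gen_mult(1)] involution_inv[OF assms(2)[OF gen_mult(1)]]
    by (simp add: o_inv_distrib)
  then show ?case using gen_comp[OF gen_mult(3) gen_incl[OF gen_mult(1)]] by (simp only:)
qed

lemma generate_eq_gen:
  assumes S: "S \<subseteq> TA" and inv: "\<And>s. s \<in> S \<Longrightarrow> s \<circ> s = id"
  shows "generate tree_aut S = gen S"
proof
  show "generate tree_aut S \<subseteq> gen S"
  proof
    fix g assume "g \<in> generate tree_aut S"
    then show "g \<in> gen S"
    proof (induction rule: generate.induct)
      case (inv h)
      then have "m_inv tree_aut h = h"
        using S by (metis m_inv_tree_aut involution_inv assms(2) subsetD)
      then show ?case using inv by (simp add: gen_incl)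
    next
      case (eng h1 h2)
      show ?case unfolding tree_aut_simps by (rule gen_comp[OF eng(3,4)])
    next
      case one
      show ?case unfolding tree_aut_simps by (rule gen_id)
    next
      case (incl h)
      then show ?case by (rule gen_incl)
    qed
  qed
  show "gen S \<subseteq> generate tree_aut S"
  proof
    fix g assume "g \<in> gen S"
    then show "g \<in> generate tree_aut S"
    proof (induction rule: gen.induct)
      case gen_id
      show ?case using generate.one[of "tree_aut" S] by (simp only: tree_aut_simps)
    next
      case (gen_mult s g)
      then show ?case by (metis generate.eng generate.incl tree_aut_simps(1))
    qed
  qed
qed

lemma TA_if_self_inverse:
  assumes "\<And>v. g (g v) = v" "\<And>v. length (g v) = length v"
    "\<And>u v. take (length u) (g (u @ v)) = g u"
  shows "g \<in> TA"
  using assms by (simp add: TA_iff involuntory_imp_bij)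

section \<open>Relations in \<open>\<Gamma>\<close>\<close>

lemma length_g_a [simp]: "length (g_a v) = length v"
  by (cases v rule: g_a.cases) auto

lemma length_g_bc [simp]: "length (g_b v) = length v" "length (g_c v) = length v"
  by (induction v and v rule: g_b_g_c.induct) auto

lemma al_al [simp]: "g_alpha (g_alpha v) = v" by (cases v rule: g_alpha.cases) auto
lemma a_a [simp]: "g_a (g_a v) = v" by (cases v rule: g_a.cases) auto
lemma al_a: "g_alpha (g_a v) = g_a (g_alpha v)" by (cases v rule: g_a.cases) auto

lemma be_be [simp]: "g_beta (g_beta v) = v" and ga_ga [simp]: "g_gamma (g_gamma v) = v"
  by (induction v and v rule: g_beta_g_gamma.induct) auto

lemma a_be: "g_a (g_beta v) = g_beta (g_a v)" by (cases v rule: g_a.cases) auto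
lemma ga_a: "g_gamma (g_a v) = g_a (g_alpha (g_gamma (g_alpha v)))" by (cases v rule: g_a.cases) auto

lemma al_b: "g_alpha (g_b v) = g_b (g_alpha v)" by (cases v rule: g_alpha.cases) auto
lemma al_c: "g_alpha (g_c v) = g_c (g_alpha v)" by (cases v rule: g_alpha.cases) auto

lemma letter_length_induct [case_names Nil L1 L2 L3 L4]:
  assumes "P []" "\<And>v. (\<And>u. length u = length v \<Longrightarrow> P u) \<Longrightarrow> P (L1 # v)"
    "\<And>v. (\<And>u. length u = length v \<Longrightarrow> P u) \<Longrightarrow> P (L2 # v)"
    "\<And>v. (\<And>u. length u = length v \<Longrightarrow> P u) \<Longrightarrow> P (L3 # v)"
    "\<And>v. (\<And>u. length u = length v \<Longrightarrow> P u) \<Longrightarrow> P (L4 # v)"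
  shows "P v"
proof (induction "length v" arbitrary: v)
  case (Suc n)
  then obtain x u where "v = x # u" "length u = n" by (metis length_Suc_conv)
  with Suc(1) show ?case using assms(2-5) by (cases x) auto
qed (simp add: assms(1))

text \<open>Passing to the sections at a letter turns each of these relations into the other one or
  into a relation already shown, so only the conjunction is inductive. The same coupling of b and c
  occurs in the next two pairs.\<close>

lemma be_b: "g_beta (g_b v) = g_b (g_beta v)" and ga_c: "g_gamma (g_c v) = g_c (g_gamma v)"
proof -
  have "g_beta (g_b v) = g_b (g_beta v) \<and> g_gamma (g_c v) = g_c (g_gamma v)"
    by (induction v rule: letter_length_induct) (auto simp: al_a al_c ga_a)
  then show "g_beta (g_b v) = g_b (g_beta v)" "g_gamma (g_c v) = g_c (g_gamma v)" by auto
qed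

lemma b_b [simp]: "g_b (g_b v) = v" and c_c [simp]: "g_c (g_c v) = v"
proof -
  have "g_b (g_b v) = v \<and> g_c (g_c v) = v"
    by (induction v rule: letter_length_induct) (auto simp: al_a be_b)
  then show "g_b (g_b v) = v" "g_c (g_c v) = v" by auto
qed

lemma ga_b: "g_gamma (g_b v) = g_b (g_beta (g_gamma (g_beta v)))"
  and be_c: "g_beta (g_c v) = g_c (g_gamma (g_beta (g_gamma v)))"
proof -
  have "g_gamma (g_b v) = g_b (g_beta (g_gamma (g_beta v))) \<and>
     g_beta (g_c v) = g_c (g_gamma (g_beta (g_gamma v)))"
    by (induction v rule: letter_length_induct) (auto simp: al_a a_be ga_a be_b al_b al_c)
  then show "g_gamma (g_b v) = g_b (g_beta (g_gamma (g_beta v)))"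
     "g_beta (g_c v) = g_c (g_gamma (g_beta (g_gamma v)))" by auto
qed

lemma c_a: "g_c (g_a v) = g_a (g_c (g_gamma (g_alpha (g_gamma (g_alpha v)))))"
  by (cases v rule: g_a.cases) (auto simp: be_b)

section \<open>Letters and sections\<close>

abbreviation "iv \<equiv> inv_into UNIV"

definition lt :: "('x list \<Rightarrow> 'x list) \<Rightarrow> 'x \<Rightarrow> 'x" where "lt g x = hd (g [x])"

lemma TA_Cons: assumes "g \<in> TA" shows "g (x # u) = lt g x # sect g [x] u"
proof -
  have "length (g [x]) = 1" using assms by (simp add: TA_length)
  then have "g [x] = [lt g x]" by (auto simp: lt_def length_Suc_conv)
  then show ?thesis using TA_append[OF assms, of "[x]" u] by simp
qed

lemma TA_single: "g \<in> TA \<Longrightarrow> g [x] = [lt g x]"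
  using TA_Cons[of g x "[]"] TA_length[OF sect_TA[of g "[x]"], of "[]"] by simp

lemma TA_NilD: "g \<in> TA \<Longrightarrow> g [] = []" using TA_length[of g "[]"] by simp

lemma lt_comp: "g \<in> TA \<Longrightarrow> h \<in> TA \<Longrightarrow> lt (g \<circ> h) x = lt g (lt h x)"
  by (simp add: lt_def[of "g \<circ> h"] TA_single)

lemma lt_id [simp]: "lt id x = x" by (simp add: lt_def)

lemma sect_comp1: "g \<in> TA \<Longrightarrow> h \<in> TA \<Longrightarrow> sect (g \<circ> h) [x] = sect g [lt h x] \<circ> sect h [x]"
  by (simp add: sect_comp TA_single)

lemma TA_eqI:
  assumes "g \<in> TA" "h \<in> TA" "\<And>x. lt g x = lt h x" "\<And>x. sect g [x] = sect h [x]"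
  shows "g = h"
proof
  fix v show "g v = h v"
    using assms by (cases v) (simp_all add: TA_Cons TA_NilD)
qed

lemma g_Nil [simp]: "g_alpha [] = []" "g_beta [] = []" "g_gamma [] = []" "g_a [] = []"
  "g_b [] = []" "g_c [] = []" by simp_all

lemma gens_prefix:
  "take (length u) (g_alpha (u @ v)) = g_alpha u" "take (length u) (g_a (u @ v)) = g_a u"
  "take (length u) (g_beta (u @ v)) = g_beta u" "take (length u) (g_gamma (u @ v)) = g_gamma u"
  "take (length u) (g_b (u @ v)) = g_b u" "take (length u) (g_c (u @ v)) = g_c u"
proof -
  have A: "take (length u) (g_alpha (u @ v)) = g_alpha u"
    and B: "take (length u) (g_a (u @ v)) = g_a u" for u v
    by (cases u rule: g_alpha.cases, simp_all) (cases u rule: g_alpha.cases, simp_all)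
  have C: "take (length u) (g_beta (u @ v)) = g_beta u \<and> take (length u) (g_gamma (u @ v)) = g_gamma u"
    for u v by (induction u rule: letter_length_induct) (simp_all add: A)
  have AA: "take (length u) (g_a (g_alpha (u @ v))) = g_a (g_alpha u)" for u v
    by (cases u rule: g_alpha.cases) simp_all
  have D: "\<forall>v. take (length u) (g_b (u @ v)) = g_b u \<and> take (length u) (g_c (u @ v)) = g_c u" for u
  proof (induction u rule: letter_length_induct)
    case (L1 w)
    have "take (length w) (g_b (g_beta (w @ v))) = g_b (g_beta w)" for v
    proof -
      have "g_beta (w @ v) = g_beta w @ drop (length w) (g_beta (w @ v))"
        using C[of w v] by (metis append_take_drop_id)
      then show ?thesis using L1[of "g_beta w"] by (metis length_g_beta)
    qed
    then show ?case by (simp add: AA)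
  next
    case (L2 w)
    have "take (length w) (g_b (g_beta (w @ v))) = g_b (g_beta w)" for v
    proof -
      have "g_beta (w @ v) = g_beta w @ drop (length w) (g_beta (w @ v))"
        using C[of w v] by (metis append_take_drop_id)
      then show ?thesis using L2[of "g_beta w"] by (metis length_g_beta)
    qed
    then show ?case by (simp add: AA)
  qed (simp_all)
  show "take (length u) (g_alpha (u @ v)) = g_alpha u" "take (length u) (g_a (u @ v)) = g_a u"
  "take (length u) (g_beta (u @ v)) = g_beta u" "take (length u) (g_gamma (u @ v)) = g_gamma u"
  "take (length u) (g_b (u @ v)) = g_b u" "take (length u) (g_c (u @ v)) = g_c u"
    using A B C D by blast+
qed

lemma gens_TA [simp]: "g_alpha \<in> TA" "g_beta \<in> TA" "g_gamma \<in> TA" "g_a \<in> TA" "g_b \<in> TA" "g_c \<in> TA"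
  by (rule TA_if_self_inverse; simp add: gens_prefix)+

lemma lt_gens [simp]:
  "lt g_alpha L1 = L2" "lt g_alpha L2 = L1" "lt g_alpha L3 = L4" "lt g_alpha L4 = L3"
  "lt g_a L1 = L3" "lt g_a L2 = L4" "lt g_a L3 = L1" "lt g_a L4 = L2"
  "lt g_beta x = x" "lt g_gamma x = x" "lt g_b x = x" "lt g_c x = x"
  by (simp_all add: lt_def) (cases x; simp)+

lemma sect_gens [simp]:
  "sect g_alpha [x] = id" "sect g_a [x] = id"
  "sect g_beta [L1] = g_alpha" "sect g_beta [L2] = g_gamma" "sect g_beta [L3] = g_alpha" "sect g_beta [L4] = g_gamma"
  "sect g_gamma [L1] = g_beta" "sect g_gamma [L2] = id" "sect g_gamma [L3] = id" "sect g_gamma [L4] = g_beta"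
  "sect g_b [L1] = g_a \<circ> g_alpha" "sect g_b [L2] = g_a \<circ> g_alpha" "sect g_b [L3] = g_c" "sect g_b [L4] = g_c"
  "sect g_c [L1] = g_b \<circ> g_beta" "sect g_c [L2] = g_b \<circ> g_beta" "sect g_c [L3] = g_b" "sect g_c [L4] = g_b"
  by (cases x; simp add: sect_def fun_eq_iff)+

definition Gset :: "aut set" where "Gset = {g_alpha, g_beta, g_gamma, g_a, g_b, g_c}"

lemma Gset_invol: "s \<in> Gset \<Longrightarrow> s \<circ> s = id"
  by (auto simp: Gset_def fun_eq_iff)

lemma Gset_TA: "Gset \<subseteq> TA" by (auto simp: Gset_def)

lemma Gam_gen: "Gam = gen Gset"
  unfolding Gam_def Gset_def[symmetric] by (rule generate_eq_gen[OF Gset_TA Gset_invol])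

lemma Gam_TA: "g \<in> Gam \<Longrightarrow> g \<in> TA" using gen_TA[OF _ Gset_TA] by (simp add: Gam_gen)

lemma Gam_comp: "g \<in> Gam \<Longrightarrow> h \<in> Gam \<Longrightarrow> g \<circ> h \<in> Gam" unfolding Gam_gen by (rule gen_comp)
lemma Gam_inv: "g \<in> Gam \<Longrightarrow> iv g \<in> Gam" unfolding Gam_gen by (rule gen_inv[OF _ Gset_invol])
lemma Gam_id: "id \<in> Gam" unfolding Gam_gen by (rule gen_id)

lemma Gam_gens: "g_alpha \<in> Gam" "g_beta \<in> Gam" "g_gamma \<in> Gam" "g_a \<in> Gam" "g_b \<in> Gam" "g_c \<in> Gam"
  by (auto simp: Gam_gen Gset_def intro: gen_incl)

lemma Gam_induct [consumes 1, case_names id alpha beta gamma a b c]: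
  assumes "g \<in> Gam" "P id"
    "\<And>g. g \<in> Gam \<Longrightarrow> P g \<Longrightarrow> P (g_alpha \<circ> g)" "\<And>g. g \<in> Gam \<Longrightarrow> P g \<Longrightarrow> P (g_beta \<circ> g)"
    "\<And>g. g \<in> Gam \<Longrightarrow> P g \<Longrightarrow> P (g_gamma \<circ> g)" "\<And>g. g \<in> Gam \<Longrightarrow> P g \<Longrightarrow> P (g_a \<circ> g)"
    "\<And>g. g \<in> Gam \<Longrightarrow> P g \<Longrightarrow> P (g_b \<circ> g)" "\<And>g. g \<in> Gam \<Longrightarrow> P g \<Longrightarrow> P (g_c \<circ> g)"
  shows "P g"
  using assms(1) unfolding Gam_gen
proof (induction rule: gen.induct)
  case (gen_mult s g)
  then have "g \<in> Gam" by (simp only: Gam_gen)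
  with gen_mult assms(3-8)[of g] show ?case unfolding Gset_def by blast
qed (rule assms(2))

lemma Gam_sect1: "g \<in> Gam \<Longrightarrow> sect g [x] \<in> Gam"
proof (induction arbitrary: x rule: Gam_induct)
  case id then show ?case by (simp only: sect_id Gam_id)
next
  case (alpha g) then show ?case by (simp only: sect_comp1 gens_TA Gam_TA sect_gens id_comp)
next
  case (a g) then show ?case by (simp only: sect_comp1 gens_TA Gam_TA sect_gens id_comp)
next
  case (beta g) then show ?case
    by (cases "lt g x") (simp_all only: sect_comp1 gens_TA Gam_TA sect_gens id_comp Gam_comp Gam_gens)
next
  case (gamma g) then show ?case
    by (cases "lt g x") (simp_all only: sect_comp1 gens_TA Gam_TA sect_gens id_comp Gam_comp Gam_gens)
next
  case (b g) then show ?case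
    by (cases "lt g x") (simp_all only: sect_comp1 gens_TA Gam_TA sect_gens id_comp Gam_comp Gam_gens)
next
  case (c g) then show ?case
    by (cases "lt g x") (simp_all only: sect_comp1 gens_TA Gam_TA sect_gens id_comp Gam_comp Gam_gens)
qed

lemma Gam_sect: "g \<in> Gam \<Longrightarrow> sect g u \<in> Gam"
proof (induction u arbitrary: g)
  case (Cons x u)
  then show ?case using sect_append[OF Gam_TA[OF Cons(2)], of "[x]" u] by (simp add: Gam_sect1)
qed simp

section \<open>Parity homomorphisms\<close>

fun bit :: "letter \<Rightarrow> bool" where "bit L1 = False" | "bit L2 = True" | "bit L3 = False" | "bit L4 = True"
fun par :: "letter \<Rightarrow> bool" where "par L1 = False" | "par L2 = False" | "par L3 = True" | "par L4 = True"

lemma letter_eqI: "bit x = bit y \<Longrightarrow> par x = par y \<Longrightarrow> x = y" by (cases x; cases y; simp)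

text \<open>The letters form an affine plane over the two-element field with coordinates
  \<open>bit\<close> and \<open>par\<close>, and \<Gamma> acts on them by translations, so the image
  of \<open>L1\<close> carries all the information. The other two parities use that, at the letters
  1 and 2, \<beta> has exactly one section \<alpha> and \<gamma> exactly one section \<beta>.
  Altogether \<open>e_al\<close>, \<open>e_be\<close>, \<open>e_ga\<close>, \<open>e_a\<close> count
  the factors \<alpha>, \<beta>, \<gamma>, a modulo 2.\<close>

definition e_al :: "aut \<Rightarrow> bool" where "e_al g = bit (lt g L1)"
definition e_a :: "aut \<Rightarrow> bool" where "e_a g = par (lt g L1)"
definition e_be :: "aut \<Rightarrow> bool" where "e_be g = (e_al (sect g [L1]) \<noteq> e_al (sect g [L2]))"
definition e_ga :: "aut \<Rightarrow> bool" where "e_ga g = (e_be (sect g [L1]) \<noteq> e_be (sect g [L2]))"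

lemma lt_V4: "g \<in> Gam \<Longrightarrow> bit (lt g x) = (bit x \<noteq> e_al g) \<and> par (lt g x) = (par x \<noteq> e_a g)"
proof (induction arbitrary: x rule: Gam_induct)
  case id then show ?case by (simp add: e_al_def e_a_def del: id_apply)
next
  case (alpha g) 
  have "lt (g_alpha \<circ> g) y = lt g_alpha (lt g y)" for y using alpha(1) by (simp add: lt_comp Gam_TA del: o_apply)
  moreover have "bit (lt g_alpha y) = (\<not> bit y)" "par (lt g_alpha y) = par y" for y by (cases y; simp)+
  ultimately show ?case using alpha(2)[of x] unfolding e_al_def[of "g_alpha \<circ> g"] e_a_def[of "g_alpha \<circ> g"]
      e_al_def[of g] e_a_def[of g] by (simp only:) blast
next
  case (a g) 
  have "lt (g_a \<circ> g) y = lt g_a (lt g y)" for y using a(1) by (simp add: lt_comp Gam_TA del: o_apply)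
  moreover have "bit (lt g_a y) = bit y" "par (lt g_a y) = (\<not> par y)" for y by (cases y; simp)+
  ultimately show ?case using a(2)[of x] unfolding e_al_def[of "g_a \<circ> g"] e_a_def[of "g_a \<circ> g"]
      e_al_def[of g] e_a_def[of g] by (simp only:) blast
qed (simp_all add: lt_comp Gam_TA e_al_def[of "_ \<circ> _"] e_a_def[of "_ \<circ> _"] del: o_apply)

lemma e_comp_al: "g \<in> Gam \<Longrightarrow> h \<in> Gam \<Longrightarrow> e_al (g \<circ> h) = (e_al g \<noteq> e_al h)"
  using lt_V4[of g "lt h L1"] lt_comp[OF Gam_TA Gam_TA, of g h L1]
  unfolding e_al_def[of h] e_al_def[of "g \<circ> h"] by (simp only:) blast
lemma e_comp_a: "g \<in> Gam \<Longrightarrow> h \<in> Gam \<Longrightarrow> e_a (g \<circ> h) = (e_a g \<noteq> e_a h)"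
  using lt_V4[of g "lt h L1"] lt_comp[OF Gam_TA Gam_TA, of g h L1]
  unfolding e_a_def[of h] e_a_def[of "g \<circ> h"] by (simp only:) blast

lemma e_id [simp]: "e_al id = False" "e_a id = False" "e_be id = False" "e_ga id = False"
  by (simp_all only: e_al_def e_a_def e_be_def e_ga_def sect_id lt_id) simp_all

lemma e_ala_gens [simp]: "e_al g_alpha = True" "e_al g_beta = False" "e_al g_gamma = False" "e_al g_a = False"
   "e_al g_b = False" "e_al g_c = False"
  "e_a g_alpha = False" "e_a g_beta = False" "e_a g_gamma = False" "e_a g_a = True"
   "e_a g_b = False" "e_a g_c = False"
  by (simp_all add: e_al_def e_a_def)

lemma sect_Gam_comp1: "g \<in> Gam \<Longrightarrow> h \<in> Gam \<Longrightarrow> sect (g \<circ> h) [x] = sect g [lt h x] \<circ> sect h [x]"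
  by (simp only: sect_comp1 Gam_TA)

text \<open>A homomorphism to the two-element group induces another one by adding up its values on the
  sections at letters 1 and 2, provided that letters 3 and 4 give the same sum.\<close>

lemma pair_sum_hom:
  assumes hom: "\<And>g h. g \<in> Gam \<Longrightarrow> h \<in> Gam \<Longrightarrow> e (g \<circ> h) = (e g \<noteq> e h)"
    and f: "\<And>g. f g = (e (sect g [L1]) \<noteq> e (sect g [L2]))"
    and s: "\<And>s. s \<in> Gset \<Longrightarrow> f s = (e (sect s [L3]) \<noteq> e (sect s [L4]))"
    and g: "g \<in> Gam"
  shows "f g = (e (sect g [L3]) \<noteq> e (sect g [L4]))"
    and "h \<in> Gam \<Longrightarrow> f (g \<circ> h) = (f g \<noteq> f h)"
proof -
  let ?P = "\<lambda>g. f g = (e (sect g [L3]) \<noteq> e (sect g [L4]))"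
  have *: "f (g \<circ> h) = (f g \<noteq> f h) \<and> ?P (g \<circ> h)" if "g \<in> Gam" "h \<in> Gam" "?P g" "?P h" for g h
  proof -
    have 1: "e (sect (g \<circ> h) [x]) = (e (sect g [lt h x]) \<noteq> e (sect h [x]))" for x
      using that(1,2) by (simp add: sect_Gam_comp1 hom Gam_sect1)
    have v: "bit (lt h y) = (bit y \<noteq> e_al h)" "par (lt h y) = (par y \<noteq> e_a h)" for y
      using lt_V4[OF that(2)] by blast+
    \<comment> \<open>A translation preserves the blocks {1,2} and {3,4} or exchanges them; hence a
      sum over one block is again a sum over a block.\<close>
    have "(lt h L1 = L1 \<and> lt h L2 = L2 \<and> lt h L3 = L3 \<and> lt h L4 = L4)
      \<or> (lt h L1 = L2 \<and> lt h L2 = L1 \<and> lt h L3 = L4 \<and> lt h L4 = L3)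
      \<or> (lt h L1 = L3 \<and> lt h L2 = L4 \<and> lt h L3 = L1 \<and> lt h L4 = L2)
      \<or> (lt h L1 = L4 \<and> lt h L2 = L3 \<and> lt h L3 = L2 \<and> lt h L4 = L1)"
      using letter_eqI[of "lt h L1"] letter_eqI[of "lt h L2"] letter_eqI[of "lt h L3"] letter_eqI[of "lt h L4"]
      by (cases "e_al h"; cases "e_a h"; simp add: v)
    then show ?thesis using that(3,4)
      f[of g] f[of h] f[of "g \<circ> h"] 1[of L1] 1[of L2] 1[of L3] 1[of L4]
      by (elim disjE conjE) (simp only:, blast)+
  qed
  have P: "?P g" if "g \<in> Gam" for g using that unfolding Gam_gen
  proof (induction rule: gen.induct)
    case gen_id
    then show ?case by (simp only: f sect_id)
  next
    case (gen_mult t g)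
    then have "t \<in> Gam" "g \<in> Gam" by (simp_all only: Gam_gen gen_incl)
    then show ?case using *[of t g] s[OF gen_mult(1)] gen_mult(3) by blast
  qed
  show "?P g" by (rule P[OF g])
  show "f (g \<circ> h) = (f g \<noteq> f h)" if "h \<in> Gam" using *[OF g that P[OF g] P[OF that]] by blast
qed

lemma e_comp_be: "g \<in> Gam \<Longrightarrow> h \<in> Gam \<Longrightarrow> e_be (g \<circ> h) = (e_be g \<noteq> e_be h)"
proof -
  have s: "e_be s = (e_al (sect s [L3]) \<noteq> e_al (sect s [L4]))" if "s \<in> Gset" for s
    using that unfolding Gset_def e_be_def by (auto simp del: o_apply)
  assume "g \<in> Gam" "h \<in> Gam"
  then show ?thesis
    using pair_sum_hom[of e_al e_be, OF e_comp_al e_be_def s] by blast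
qed

lemma e_be_gens [simp]: "e_be g_alpha = False" "e_be g_beta = True" "e_be g_gamma = False" "e_be g_a = False"
   "e_be g_b = False" "e_be g_c = False"
  by (simp_all add: e_be_def del: o_apply)

lemma e_comp_ga: "g \<in> Gam \<Longrightarrow> h \<in> Gam \<Longrightarrow> e_ga (g \<circ> h) = (e_ga g \<noteq> e_ga h)"
proof -
  have s: "e_ga s = (e_be (sect s [L3]) \<noteq> e_be (sect s [L4]))" if "s \<in> Gset" for s
    using that unfolding Gset_def e_ga_def by (auto simp del: o_apply simp: e_comp_be Gam_gens)
  assume "g \<in> Gam" "h \<in> Gam"
  then show ?thesis
    using pair_sum_hom[of e_be e_ga, OF e_comp_be e_ga_def s] by blast
qed

lemma e_ga_gens [simp]: "e_ga g_alpha = False" "e_ga g_beta = False" "e_ga g_gamma = True" "e_ga g_a = False"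
   "e_ga g_b = False" "e_ga g_c = False"
  by (simp_all add: e_ga_def del: o_apply)

lemmas e_comps = e_comp_al e_comp_a e_comp_be e_comp_ga

section \<open>The quotient of \<Gamma> acting on the plane as a triangle reflection group\<close>

section \<open>The group \<open>\<Gamma>\<close>-hat and the epimorphism \<open>\<nu>\<close>\<close>

lemma length_h_a [simp]: "length (h_a v) = length v" by (cases v rule: h_a.cases) auto

lemma bletter_length_induct [case_names Nil B1 B2]:
  assumes "P []" "\<And>v. (\<And>u. length u = length v \<Longrightarrow> P u) \<Longrightarrow> P (B1 # v)"
    "\<And>v. (\<And>u. length u = length v \<Longrightarrow> P u) \<Longrightarrow> P (B2 # v)"
  shows "P v"
proof (induction "length v" arbitrary: v)
  case (Suc n)
  then obtain x u where "v = x # u" "length u = n" by (metis length_Suc_conv)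
  with Suc(1) show ?case using assms(2,3) by (cases x) auto
qed (simp add: assms(1))

lemma length_h_bc [simp]: "length (h_b v) = length v" "length (h_c v) = length v"
proof -
  have "length (h_b v) = length v \<and> length (h_c v) = length v" 
    by (induction v rule: bletter_length_induct) auto
  then show "length (h_b v) = length v" "length (h_c v) = length v" by auto
qed

lemma ha_ha [simp]: "h_a (h_a v) = v" by (cases v rule: h_a.cases) auto

lemma hb_hb [simp]: "h_b (h_b v) = v" and hc_hc [simp]: "h_c (h_c v) = v"
proof -
  have "h_b (h_b v) = v \<and> h_c (h_c v) = v" 
    by (induction v rule: bletter_length_induct) auto
  then show "h_b (h_b v) = v" "h_c (h_c v) = v" by auto
qed

lemma h_TA [simp]: "h_a \<in> TA" "h_b \<in> TA" "h_c \<in> TA"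
proof -
  have A: "take (length u) (h_a (u @ v)) = h_a u" for u v by (cases u rule: h_a.cases) auto
  have B: "\<forall>v. take (length u) (h_b (u @ v)) = h_b u \<and> take (length u) (h_c (u @ v)) = h_c u" for u
    by (induction u rule: bletter_length_induct) (auto simp: A)
  show "h_a \<in> TA" "h_b \<in> TA" "h_c \<in> TA"
    by (rule TA_if_self_inverse; simp add: A B)+
qed

definition Hset :: "baut set" where "Hset = {h_a, h_b, h_c}"

lemma Hset_invol: "s \<in> Hset \<Longrightarrow> s \<circ> s = id" by (auto simp: Hset_def fun_eq_iff)
lemma Hset_TA: "Hset \<subseteq> TA" by (auto simp: Hset_def)
lemma Gamh_gen: "Gam_hat = gen Hset"
  unfolding Gam_hat_def Hset_def[symmetric] by (rule generate_eq_gen[OF Hset_TA Hset_invol])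
lemma Gamh_TA: "g \<in> Gam_hat \<Longrightarrow> g \<in> TA" using gen_TA[OF _ Hset_TA] by (simp add: Gamh_gen)
lemma Gamh_comp: "g \<in> Gam_hat \<Longrightarrow> h \<in> Gam_hat \<Longrightarrow> g \<circ> h \<in> Gam_hat" unfolding Gamh_gen by (rule gen_comp)
lemma Gamh_inv: "g \<in> Gam_hat \<Longrightarrow> iv g \<in> Gam_hat" unfolding Gamh_gen by (rule gen_inv[OF _ Hset_invol])
lemma Gamh_id: "id \<in> Gam_hat" unfolding Gamh_gen by (rule gen_id)
lemma Gamh_gens: "h_a \<in> Gam_hat" "h_b \<in> Gam_hat" "h_c \<in> Gam_hat"
  by (auto simp: Gamh_gen Hset_def intro: gen_incl)

lemma Gamh_induct [consumes 1, case_names id a b c]: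
  assumes "g \<in> Gam_hat" "P id"
    "\<And>g. g \<in> Gam_hat \<Longrightarrow> P g \<Longrightarrow> P (h_a \<circ> g)"
    "\<And>g. g \<in> Gam_hat \<Longrightarrow> P g \<Longrightarrow> P (h_b \<circ> g)" "\<And>g. g \<in> Gam_hat \<Longrightarrow> P g \<Longrightarrow> P (h_c \<circ> g)"
  shows "P g"
  using assms(1) unfolding Gamh_gen
proof (induction rule: gen.induct)
  case (gen_mult s g)
  then have "g \<in> Gam_hat" by (simp only: Gamh_gen)
  with gen_mult assms(3-5)[of g] show ?case unfolding Hset_def by blast
qed (rule assms(2))

lemma lt_hgens [simp]: "lt h_a B1 = B2" "lt h_a B2 = B1" "lt h_b x = x" "lt h_c x = x"
  by (simp_all add: lt_def) (cases x; simp)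

lemma sect_hgens [simp]: "sect h_a [x] = id" "sect h_b [B1] = h_a" "sect h_b [B2] = h_c" "sect h_c [x] = h_b"
  by (cases x; simp add: sect_def fun_eq_iff)+

lemma Gamh_sect1: "g \<in> Gam_hat \<Longrightarrow> sect g [x] \<in> Gam_hat"
proof (induction arbitrary: x rule: Gamh_induct)
  case id then show ?case by (simp only: sect_id Gamh_id)
next
  case (a g) then show ?case by (simp only: sect_comp1 h_TA Gamh_TA sect_hgens id_comp)
next
  case (b g) then show ?case
    by (cases "lt g x") (simp_all only: sect_comp1 h_TA Gamh_TA sect_hgens id_comp Gamh_comp Gamh_gens)
next
  case (c g) then show ?case
    by (simp_all only: sect_comp1 h_TA Gamh_TA sect_hgens id_comp Gamh_comp Gamh_gens)
qed

lemma Gamh_sect: "g \<in> Gam_hat \<Longrightarrow> sect g u \<in> Gam_hat"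
proof (induction u arbitrary: g)
  case (Cons x u)
  then show ?case using sect_append[OF Gamh_TA[OF Cons(2)], of "[x]" u] by (simp add: Gamh_sect1)
qed simp

abbreviation "mw \<equiv> map mu_letter"

lemma mw_gens1: "mw (g_alpha v) = mw v" "mw (g_a v) = h_a (mw v)"
  by (cases v rule: g_alpha.cases; simp)+

lemma mw_gens2: "mw (g_beta v) = mw v" "mw (g_gamma v) = mw v"
proof -
  have "mw (g_beta v) = mw v \<and> mw (g_gamma v) = mw v"
    by (induction v rule: letter_length_induct) (auto simp: mw_gens1)
  then show "mw (g_beta v) = mw v" "mw (g_gamma v) = mw v" by auto
qed

lemma mw_gens3: "mw (g_b v) = h_b (mw v)" "mw (g_c v) = h_c (mw v)"
proof -
  have "mw (g_b v) = h_b (mw v) \<and> mw (g_c v) = h_c (mw v)"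
    by (induction v rule: letter_length_induct) (auto simp: mw_gens1 mw_gens2)
  then show "mw (g_b v) = h_b (mw v)" "mw (g_c v) = h_c (mw v)" by auto
qed

lemmas mw_gens = mw_gens1 mw_gens2 mw_gens3

lemma mw_surj: "\<exists>v. mw v = w"
proof (induction w)
  case (Cons x w)
  then obtain v where "mw v = w" by blast
  then have "mw ((if x = B1 then L1 else L3) # v) = x # w" by (cases x) auto
  then show ?case by (rule exI)
qed simp

text \<open>A candidate for \<nu>: merging the letters 1, 2 and 3, 4 makes every element of \<Gamma>
  act on binary words, and \<open>mw_surj\<close> shows that this action is determined.\<close>

definition nu0 :: "aut \<Rightarrow> baut" where "nu0 g = (THE h. \<forall>v. mw (g v) = h (mw v))"

lemma nu0_eqI: assumes "\<And>v. mw (g v) = h (mw v)" shows "nu0 g = h"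
  unfolding nu0_def
proof (rule the_equality)
  fix h' assume h': "\<forall>v. mw (g v) = h' (mw v)"
  show "h' = h"
  proof
    fix w obtain v where "mw v = w" using mw_surj by blast
    then show "h' w = h w" using h' assms[of v] by auto
  qed
qed (simp add: assms)

lemma nu0_ex: "g \<in> Gam \<Longrightarrow> \<exists>h\<in>Gam_hat. \<forall>v. mw (g v) = h (mw v)"
proof (induction rule: Gam_induct)
  case id
  show ?case by (rule bexI[OF _ Gamh_id]) simp
next
  case (alpha g) then show ?case by (auto simp: mw_gens)
next
  case (beta g) then show ?case by (auto simp: mw_gens)
next
  case (gamma g) then show ?case by (auto simp: mw_gens)
next
  case (a g)
  then obtain h where "h \<in> Gam_hat" "\<And>v. mw (g v) = h (mw v)" by blast
  then show ?case using Gamh_comp[OF Gamh_gens(1), of h] by (intro bexI[of _ "h_a \<circ> h"]) (simp_all add: mw_gens)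
next
  case (b g)
  then obtain h where "h \<in> Gam_hat" "\<And>v. mw (g v) = h (mw v)" by blast
  then show ?case using Gamh_comp[OF Gamh_gens(2), of h] by (intro bexI[of _ "h_b \<circ> h"]) (simp_all add: mw_gens)
next
  case (c g)
  then obtain h where "h \<in> Gam_hat" "\<And>v. mw (g v) = h (mw v)" by blast
  then show ?case using Gamh_comp[OF Gamh_gens(3), of h] by (intro bexI[of _ "h_c \<circ> h"]) (simp_all add: mw_gens)
qed

lemma nu0: assumes "g \<in> Gam" shows "nu0 g \<in> Gam_hat" "mw (g v) = nu0 g (mw v)"
  using nu0_ex[OF assms] nu0_eqI[of g] by metis+

lemma nu0_comp: "g \<in> Gam \<Longrightarrow> h \<in> Gam \<Longrightarrow> nu0 (g \<circ> h) = nu0 g \<circ> nu0 h"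
  by (rule nu0_eqI) (simp add: nu0(2))

lemma nu0_gens: "nu0 id = id" "nu0 g_alpha = id" "nu0 g_beta = id" "nu0 g_gamma = id" 
  "nu0 g_a = h_a" "nu0 g_b = h_b" "nu0 g_c = h_c"
  by (rule nu0_eqI; simp add: mw_gens)+

text \<open>A homomorphism is determined by its values on the generators; its value at
  \<open>id\<close> comes from \<alpha> being an involution with trivial image.\<close>

lemma nu_eq: "nu = restrict nu0 Gam"
  unfolding nu_def
proof (rule the_equality)
  let ?G = "tree_aut\<lparr>carrier := Gam\<rparr>" and ?H = "tree_aut\<lparr>carrier := Gam_hat\<rparr>"
  have car: "carrier ?G = Gam" "carrier ?H = Gam_hat" and
    mul: "monoid.mult ?G = (\<circ>)" "monoid.mult ?H = (\<circ>)" by (simp_all add: tree_aut_def)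
  show "restrict nu0 Gam \<in> extensional Gam \<and> restrict nu0 Gam \<in> hom ?G ?H \<and>
    restrict nu0 Gam g_alpha = id \<and> restrict nu0 Gam g_beta = id \<and> restrict nu0 Gam g_gamma = id \<and>
    restrict nu0 Gam g_a = h_a \<and> restrict nu0 Gam g_b = h_b \<and> restrict nu0 Gam g_c = h_c"
    using nu0(1) nu0_comp Gam_comp unfolding hom_def car mul
    by (simp add: Gam_gens nu0_gens del: o_apply)
  fix f assume f: "f \<in> extensional Gam \<and> f \<in> hom ?G ?H \<and> f g_alpha = id \<and> f g_beta = id \<and> f g_gamma = id \<and>
    f g_a = h_a \<and> f g_b = h_b \<and> f g_c = h_c"
  then have m: "f (g \<circ> h) = f g \<circ> f h" if "g \<in> Gam" "h \<in> Gam" for g h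
    using that unfolding hom_def car mul by blast
  have "f (g_alpha \<circ> g_alpha) = id" using f m[OF Gam_gens(1) Gam_gens(1)] by simp
  moreover have "g_alpha \<circ> g_alpha = id" by (auto simp: fun_eq_iff)
  ultimately have fid: "f id = id" by simp
  have "f g = nu0 g" if "g \<in> Gam" for g
    using that
  proof (induction rule: Gam_induct)
    case id show ?case by (simp only: fid nu0_gens)
  qed (use f in \<open>simp_all only: m nu0_comp Gam_gens nu0_gens\<close>)
  then show "f = restrict nu0 Gam" using f by (auto simp: extensional_def fun_eq_iff restrict_def)
qed

lemma nu_mw: "g \<in> Gam \<Longrightarrow> mw (g v) = nu g (mw v)" by (simp add: nu_eq nu0)
lemma nu_eqI: "g \<in> Gam \<Longrightarrow> (\<And>v. mw (g v) = h (mw v)) \<Longrightarrow> nu g = h" by (simp add: nu_eq nu0_eqI)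
lemma nu_Gamh: "g \<in> Gam \<Longrightarrow> nu g \<in> Gam_hat" by (simp add: nu_eq nu0)
lemma nu_comp: "g \<in> Gam \<Longrightarrow> h \<in> Gam \<Longrightarrow> nu (g \<circ> h) = nu g \<circ> nu h"
  using Gam_comp by (simp add: nu_eq nu0_comp del: o_apply)
lemma nu_gens: "nu id = id" "nu g_alpha = id" "nu g_beta = id" "nu g_gamma = id" 
  "nu g_a = h_a" "nu g_b = h_b" "nu g_c = h_c"
  by (simp_all add: nu_eq nu0_gens Gam_gens Gam_id)

lemma nu_surj: "h \<in> Gam_hat \<Longrightarrow> \<exists>g\<in>Gam. nu g = h"
proof (induction rule: Gamh_induct)
  case id then show ?case using Gam_id nu_gens by blast
qed (metis nu_comp nu_gens Gam_gens Gam_comp)+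

lemma nu_lt: assumes "g \<in> Gam" shows "lt (nu g) (mu_letter x) = mu_letter (lt g x)"
  using nu_mw[OF assms, of "[x]"] by (simp add: TA_single Gam_TA nu_Gamh Gamh_TA assms)

lemma nu_sect: assumes g: "g \<in> Gam" shows "nu (sect g u) = sect (nu g) (mw u)"
proof (rule nu_eqI[OF Gam_sect[OF g]])
  fix v
  have "mw (g (u @ v)) = nu g (mw u @ mw v)" using nu_mw[OF g] by simp
  then have "mw (g u) @ mw (sect g u v) = nu g (mw u) @ sect (nu g) (mw u) (mw v)"
    using g by (simp only: TA_append Gam_TA nu_Gamh Gamh_TA map_append)
  then show "mw (sect g u v) = sect (nu g) (mw u) (mw v)" using nu_mw[OF g, of u] by simp
qed

section \<open>The action on the plane\<close>

definition rf_a :: "plane \<Rightarrow> plane" where "rf_a z = (- fst z, snd z)"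
definition rf_b :: "plane \<Rightarrow> plane" where "rf_b z = (1 - snd z, 1 - fst z)"
definition rf_c :: "plane \<Rightarrow> plane" where "rf_c z = (fst z, - snd z)"

lemma rf_rf [simp]: "rf_a \<circ> rf_a = id" "rf_b \<circ> rf_b = id" "rf_c \<circ> rf_c = id"
  by (auto simp: rf_a_def rf_b_def rf_c_def fun_eq_iff)

lemma dist_plane: "dist (z :: plane) w = sqrt ((fst z - fst w)\<^sup>2 + (snd z - snd w)\<^sup>2)"
  by (cases z; cases w) (simp add: dist_Pair_Pair dist_real_def)

lemma reflect_line_eq:
  assumes S: "affine hull {P, Q} = S" and x: "x \<in> S" and le: "\<And>w. w \<in> S \<Longrightarrow> dist z x \<le> dist z w"
  shows "reflect_line P Q z = 2 *\<^sub>R x - z"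
proof -
  have "x = closest_point S z"
    by (rule closest_point_unique) (use x le S in \<open>auto simp: affine_imp_convex affine_affine_hull\<close>)
  then show ?thesis unfolding reflect_line_def S by simp
qed

lemma affine_hull_lines:
  "affine hull {pB, pC} = {z. fst z = 0}" "affine hull {pA, pC} = {z. fst z + snd z = 1}"
  "affine hull {pA, pB} = {z. snd z = 0}"
proof -
  show "affine hull {pB, pC} = {z. fst z = 0}"
  proof
    show "affine hull {pB, pC} \<subseteq> {z. fst z = 0}" by (auto simp: affine_hull_2 pB_def pC_def)
    show "{z. fst z = 0} \<subseteq> affine hull {pB, pC}"
    proof
      fix z :: plane assume "z \<in> {z. fst z = 0}"
      then have "z = (1 - snd z) *\<^sub>R pB + snd z *\<^sub>R pC \<and> (1 - snd z) + snd z = 1"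
        by (cases z) (auto simp: pB_def pC_def)
      then show "z \<in> affine hull {pB, pC}" unfolding affine_hull_2 by blast
    qed
  qed
  show "affine hull {pA, pC} = {z. fst z + snd z = 1}"
  proof
    show "affine hull {pA, pC} \<subseteq> {z. fst z + snd z = 1}" by (auto simp: affine_hull_2 pA_def pC_def)
    show "{z. fst z + snd z = 1} \<subseteq> affine hull {pA, pC}"
    proof
      fix z :: plane assume "z \<in> {z. fst z + snd z = 1}"
      then have "z = fst z *\<^sub>R pA + snd z *\<^sub>R pC \<and> fst z + snd z = 1"
        by (cases z) (auto simp: pA_def pC_def)
      then show "z \<in> affine hull {pA, pC}" unfolding affine_hull_2 by blast
    qed
  qed
  show "affine hull {pA, pB} = {z. snd z = 0}"
  proof
    show "affine hull {pA, pB} \<subseteq> {z. snd z = 0}" by (auto simp: affine_hull_2 pA_def pB_def)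
    show "{z. snd z = 0} \<subseteq> affine hull {pA, pB}"
    proof
      fix z :: plane assume "z \<in> {z. snd z = 0}"
      then have "z = fst z *\<^sub>R pA + (1 - fst z) *\<^sub>R pB \<and> fst z + (1 - fst z) = 1"
        by (cases z) (auto simp: pA_def pB_def)
      then show "z \<in> affine hull {pA, pB}" unfolding affine_hull_2 by blast
    qed
  qed
qed

lemma reflect_lines:
  "reflect_line pB pC = rf_a" "reflect_line pA pC = rf_b" "reflect_line pA pB = rf_c"
proof -
  show "reflect_line pB pC = rf_a"
  proof
    fix z show "reflect_line pB pC z = rf_a z"
      by (subst reflect_line_eq[OF affine_hull_lines(1), of "(0, snd z)"])
         (auto simp: dist_plane rf_a_def prod_eq_iff)
  qed
  show "reflect_line pA pB = rf_c"
  proof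
    fix z show "reflect_line pA pB z = rf_c z"
      by (subst reflect_line_eq[OF affine_hull_lines(3), of "(fst z, 0)"])
         (auto simp: dist_plane rf_c_def prod_eq_iff)
  qed
  show "reflect_line pA pC = rf_b"
  proof
    fix z :: plane
    \<comment> \<open>The foot of the perpendicular from z to the line through A' and C'.\<close>
    let ?x = "((fst z - snd z + 1) / 2, (snd z - fst z + 1) / 2) :: plane"
    have "dist z ?x \<le> dist z w" if "fst w + snd w = 1" for w
    proof -
      have w: "snd w = 1 - fst w" using that by simp
      have "(fst z - fst ?x)\<^sup>2 + (snd z - snd ?x)\<^sup>2 \<le> (fst z - fst w)\<^sup>2 + (snd z - snd w)\<^sup>2"
      proof -
        have "(fst z - fst w)\<^sup>2 + (snd z - snd w)\<^sup>2 - ((fst z - fst ?x)\<^sup>2 + (snd z - snd ?x)\<^sup>2)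
           = (fst z - snd z + 1 - 2 * fst w)\<^sup>2 / 2" unfolding w by (simp add: power2_eq_square field_simps)
        then show ?thesis using zero_le_power2[of "fst z - snd z + 1 - 2 * fst w"] by linarith
      qed
      then show ?thesis unfolding dist_plane by (rule real_sqrt_le_mono)
    qed
    then show "reflect_line pA pC z = rf_b z"
      by (subst reflect_line_eq[OF affine_hull_lines(2), of ?x])
         (auto simp: rf_b_def prod_eq_iff field_simps)
  qed
qed

text \<open>This relation turns out to be the graph of \<open>plane_act\<close>, which shows that the description
  in the definition of the latter is satisfiable.\<close>

inductive wrel :: "baut \<Rightarrow> (plane \<Rightarrow> plane) \<Rightarrow> bool" where
  wrel_id: "wrel id id"
| wrel_a: "wrel g M \<Longrightarrow> wrel (h_a \<circ> g) (M \<circ> rf_a)"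
| wrel_b: "wrel g M \<Longrightarrow> wrel (h_b \<circ> g) (M \<circ> rf_b)"
| wrel_c: "wrel g M \<Longrightarrow> wrel (h_c \<circ> g) (M \<circ> rf_c)"

lemma wrel_Gamh: "wrel g M \<Longrightarrow> g \<in> Gam_hat"
  by (induction rule: wrel.induct) (simp_all only: Gamh_id Gamh_comp Gamh_gens)

lemma wrel_ex: "g \<in> Gam_hat \<Longrightarrow> \<exists>M. wrel g M"
  by (induction rule: Gamh_induct) (blast intro: wrel.intros)+

lemma wrel_comp: assumes "wrel g M" "wrel h N" shows "wrel (g \<circ> h) (N \<circ> M)"
  using assms(1)
proof (induction rule: wrel.induct)
  case wrel_id
  show ?case using assms(2) by (simp only: id_comp comp_id)
next
  case (wrel_a g M)
  show ?case using wrel.wrel_a[OF wrel_a(2)] by (simp only: comp_assoc)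
next
  case (wrel_b g M)
  show ?case using wrel.wrel_b[OF wrel_b(2)] by (simp only: comp_assoc)
next
  case (wrel_c g M)
  show ?case using wrel.wrel_c[OF wrel_c(2)] by (simp only: comp_assoc)
qed

lemma wrel_gens: "wrel h_a rf_a" "wrel h_b rf_b" "wrel h_c rf_c"
  using wrel_a[OF wrel_id] wrel_b[OF wrel_id] wrel_c[OF wrel_id] by simp_all

lemma wrel_inv: "wrel g M \<Longrightarrow> \<exists>N. wrel (iv g) N \<and> N \<circ> M = id \<and> M \<circ> N = id"
proof -
  have step: "\<exists>N. wrel (iv (s \<circ> g)) N \<and> N \<circ> (M \<circ> r) = id \<and> (M \<circ> r) \<circ> N = id"
    if h: "wrel s r" "s \<in> Hset" "r \<circ> r = id" "g \<in> Gam_hat" "\<exists>N. wrel (iv g) N \<and> N \<circ> M = id \<and> M \<circ> N = id" for s r g M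
  proof -
    obtain N where N: "wrel (iv g) N" "N \<circ> M = id" "M \<circ> N = id" using h(5) by (elim exE conjE)
    have "s \<in> TA" using h Hset_TA by auto
    then have "iv (s \<circ> g) = iv g \<circ> s"
      using o_inv_distrib[of s g] involution_inv[OF Hset_invol[OF h(2)]] TA_bij Gamh_TA h(4) by metis
    then have "wrel (iv (s \<circ> g)) (r \<circ> N)" using wrel_comp[OF N(1) h(1)] by simp
    moreover have "(r \<circ> N) \<circ> (M \<circ> r) = id" "(M \<circ> r) \<circ> (r \<circ> N) = id"
      using N h(3) by (metis comp_assoc comp_id id_comp)+
    ultimately show ?thesis by blast
  qed
  assume "wrel g M"
  then show ?thesis
  proof (induction rule: wrel.induct)
    case wrel_id
    show ?case using wrel.wrel_id inv_id by (metis comp_id)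
  next
    case (wrel_a g M) show ?case
      by (rule step[OF wrel_gens(1) _ _ wrel_Gamh[OF wrel_a(1)] wrel_a(2)]) (auto simp: Hset_def)
  next
    case (wrel_b g M) show ?case
      by (rule step[OF wrel_gens(2) _ _ wrel_Gamh[OF wrel_b(1)] wrel_b(2)]) (auto simp: Hset_def)
  next
    case (wrel_c g M) show ?case
      by (rule step[OF wrel_gens(3) _ _ wrel_Gamh[OF wrel_c(1)] wrel_c(2)]) (auto simp: Hset_def)
  qed
qed

text \<open>A signed permutation matrix followed by an integral translation; \<open>sw\<close> tells
  whether the coordinates are exchanged.\<close>

definition wform :: "bool \<Rightarrow> int \<Rightarrow> int \<Rightarrow> int \<Rightarrow> int \<Rightarrow> plane \<Rightarrow> plane" where
  "wform sw s1 s2 t1 t2 z = (of_int s1 * (if sw then snd z else fst z) + of_int t1,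
     of_int s2 * (if sw then fst z else snd z) + of_int t2)"

text \<open>Each factor \<open>rf_b\<close> exchanges the coordinates and changes both translation
  parts by an odd number, while the other two reflections do neither. This parity later rules out
  maps such as x to 1 - x.\<close>

definition wok :: "bool \<Rightarrow> int \<Rightarrow> int \<Rightarrow> int \<Rightarrow> int \<Rightarrow> bool" where
  "wok sw s1 s2 t1 t2 \<longleftrightarrow> (s1 = 1 \<or> s1 = -1) \<and> (s2 = 1 \<or> s2 = -1) \<and> odd t1 = sw \<and> odd t2 = sw"

lemma wform_rf:
  "wform sw s1 s2 t1 t2 \<circ> rf_a = (if sw then wform sw s1 (- s2) t1 t2 else wform sw (- s1) s2 t1 t2)"
  "wform sw s1 s2 t1 t2 \<circ> rf_c = (if sw then wform sw (- s1) s2 t1 t2 else wform sw s1 (- s2) t1 t2)"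
  "wform sw s1 s2 t1 t2 \<circ> rf_b = wform (\<not> sw) (- s1) (- s2) (t1 + s1) (t2 + s2)"
  by (auto simp: wform_def rf_a_def rf_b_def rf_c_def fun_eq_iff algebra_simps)

lemma wrel_form: "wrel g M \<Longrightarrow> \<exists>sw s1 s2 t1 t2. M = wform sw s1 s2 t1 t2 \<and> wok sw s1 s2 t1 t2"
proof (induction rule: wrel.induct)
  case wrel_id
  have "id = wform False 1 1 0 0" by (auto simp: wform_def fun_eq_iff)
  moreover have "wok False 1 1 0 0" by (simp add: wok_def)
  ultimately show ?case by blast
next
  case (wrel_a g M)
  then obtain sw s1 s2 t1 t2 where M: "M = wform sw s1 s2 t1 t2" "wok sw s1 s2 t1 t2" by blast
  show ?case
  proof (cases sw)
    case True
    then show ?thesis using M(2) unfolding M(1) wform_rf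
      by (intro exI[of _ "sw"] exI[of _ "s1"] exI[of _ "- s2"] exI[of _ "t1"] exI[of _ "t2"]) (auto simp: wok_def)
  next
    case False
    then show ?thesis using M(2) unfolding M(1) wform_rf
      by (intro exI[of _ "sw"] exI[of _ "- s1"] exI[of _ "s2"] exI[of _ "t1"] exI[of _ "t2"]) (auto simp: wok_def)
  qed
next
  case (wrel_c g M)
  then obtain sw s1 s2 t1 t2 where M: "M = wform sw s1 s2 t1 t2" "wok sw s1 s2 t1 t2" by blast
  show ?case
  proof (cases sw)
    case True
    then show ?thesis using M(2) unfolding M(1) wform_rf
      by (intro exI[of _ "sw"] exI[of _ "- s1"] exI[of _ "s2"] exI[of _ "t1"] exI[of _ "t2"]) (auto simp: wok_def)
  next
    case False
    then show ?thesis using M(2) unfolding M(1) wform_rf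
      by (intro exI[of _ "sw"] exI[of _ "s1"] exI[of _ "- s2"] exI[of _ "t1"] exI[of _ "t2"]) (auto simp: wok_def)
  qed
next
  case (wrel_b g M)
  then obtain sw s1 s2 t1 t2 where M: "M = wform sw s1 s2 t1 t2" "wok sw s1 s2 t1 t2" by blast
  have "wok (\<not> sw) (- s1) (- s2) (t1 + s1) (t2 + s2)"
    using M(2) unfolding wok_def by (elim conjE disjE) simp_all
  then show ?case unfolding M(1) wform_rf by blast
qed

text \<open>The contractions conjugating the action of an element of \<open>\<Gamma>\<close>-hat into the actions of its
  sections.\<close>

fun AA :: "bletter \<Rightarrow> plane \<Rightarrow> plane" where
  "AA B1 z = ((1 - fst z - snd z) / 2, (1 + fst z - snd z) / 2)"
| "AA B2 z = ((1 + fst z - snd z) / 2, (1 - fst z - snd z) / 2)"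

lemma AA_rf:
  "AA B1 \<circ> rf_a = AA B2" "AA B2 \<circ> rf_a = AA B1" "AA B1 \<circ> rf_b = rf_a \<circ> AA B1" "AA B2 \<circ> rf_b = rf_c \<circ> AA B2"
  "AA x \<circ> rf_c = rf_b \<circ> AA x"
  by (auto simp: rf_a_def rf_b_def rf_c_def fun_eq_iff field_simps) (cases x; simp add: field_simps)+

text \<open>By \<open>AA_rf\<close> a reflection passes through a contraction either by exchanging
  the two contractions or by becoming the reflection that belongs to the section, so the claim is
  carried through a word factor by factor.\<close>

lemma wrel_sect: "wrel g M \<Longrightarrow> \<exists>M'. wrel (sect g [x]) M' \<and> M' \<circ> AA (lt g x) = AA x \<circ> M"
proof (induction arbitrary: x rule: wrel.induct)
  case wrel_id
  show ?case by (rule exI[of _ id]) (simp only: lt_id sect_id id_comp comp_id wrel.wrel_id)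
next
  case (wrel_a g M)
  then obtain M' where M': "wrel (sect g [x]) M'" "M' \<circ> AA (lt g x) = AA x \<circ> M" by blast
  have g: "g \<in> TA" using wrel_Gamh wrel_a(1) Gamh_TA by blast
  have "AA x \<circ> (M \<circ> rf_a) = M' \<circ> (AA (lt g x) \<circ> rf_a)" using M'(2) by (metis comp_assoc)
  also have "AA (lt g x) \<circ> rf_a = AA (lt h_a (lt g x))" by (cases "lt g x") (simp_all add: AA_rf)
  finally show ?case using M'(1) g by (intro exI[of _ M']) (simp add: sect_comp1 lt_comp del: o_apply AA.simps)
next
  case (wrel_b g M)
  then obtain M' where M': "wrel (sect g [x]) M'" "M' \<circ> AA (lt g x) = AA x \<circ> M" by blast
  have g: "g \<in> TA" using wrel_Gamh wrel_b(1) Gamh_TA by blast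
  have 1: "AA x \<circ> (M \<circ> rf_b) = M' \<circ> (AA (lt g x) \<circ> rf_b)" using M'(2) by (metis comp_assoc)
  show ?case
  proof (cases "lt g x")
    case B1
    then have "AA x \<circ> (M \<circ> rf_b) = (M' \<circ> rf_a) \<circ> AA (lt g x)" using 1 by (simp add: AA_rf comp_assoc)
    then show ?thesis using wrel.wrel_a[OF M'(1)] g B1
      by (intro exI[of _ "M' \<circ> rf_a"]) (simp add: sect_comp1 lt_comp del: o_apply AA.simps)
  next
    case B2
    then have "AA x \<circ> (M \<circ> rf_b) = (M' \<circ> rf_c) \<circ> AA (lt g x)" using 1 by (simp add: AA_rf comp_assoc)
    then show ?thesis using wrel.wrel_c[OF M'(1)] g B2
      by (intro exI[of _ "M' \<circ> rf_c"]) (simp add: sect_comp1 lt_comp del: o_apply AA.simps)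
  qed
next
  case (wrel_c g M)
  then obtain M' where M': "wrel (sect g [x]) M'" "M' \<circ> AA (lt g x) = AA x \<circ> M" by blast
  have g: "g \<in> TA" using wrel_Gamh wrel_c(1) Gamh_TA by blast
  have 1: "AA x \<circ> (M \<circ> rf_c) = M' \<circ> (AA (lt g x) \<circ> rf_c)" using M'(2) by (metis comp_assoc)
  then have "AA x \<circ> (M \<circ> rf_c) = (M' \<circ> rf_b) \<circ> AA (lt g x)" by (simp add: AA_rf comp_assoc)
  then show ?case using wrel.wrel_b[OF M'(1)] g
    by (intro exI[of _ "M' \<circ> rf_b"]) (simp add: sect_comp1 lt_comp del: o_apply AA.simps)
qed

text \<open>The fixed point of \<open>AA B1\<close> has trivial stabilizer and lies in \<open>(1/5)\<int>\<^sup>2\<close>, so a displacement of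
  it cannot shrink indefinitely under the contraction \<open>AA B1\<close>.\<close>

lemma wrel_id_unique: assumes "wrel id M" shows "M = id"
proof -
  define p :: plane where "p = (1/5, 2/5)"
  define d where "d M = (fst (M p) - fst p)\<^sup>2 + (snd (M p) - snd p)\<^sup>2" for M :: "plane \<Rightarrow> plane"
  have fixp: "AA B1 p = p" by (simp add: p_def)
  have step: "\<exists>N. wrel id N \<and> d N = d M / 2" if M: "wrel id M" for M
  proof -
    obtain M' where M': "wrel id M'" "M' \<circ> AA B1 = AA B1 \<circ> M"
      using wrel_sect[OF M, of B1] by (auto simp del: AA.simps)
    have "M' p = AA B1 (M p)" using M'(2) fixp by (metis comp_apply)
    then have "d M' = d M / 2" unfolding d_def by (simp add: p_def power2_eq_square field_simps)
    with M'(1) show ?thesis by blast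
  qed
  have "\<exists>N. wrel id N \<and> d N * 2 ^ n = d M" for n
  proof (induction n)
    case (Suc n)
    then obtain N where N: "wrel id N" "d N * 2 ^ n = d M" by blast
    obtain N' where N': "wrel id N'" "d N' = d N / 2" using step[OF N(1)] by blast
    moreover have "d N' * 2 ^ Suc n = d M" unfolding N'(2) N(2)[symmetric] by simp
    ultimately show ?case by (rule_tac x = N' in exI) (rule conjI)
  next
    case 0
    show ?case by (rule exI[of _ M]) (simp only: assms power_0 mult_1_right simp_thms)
  qed
  moreover have "\<exists>m::nat. 25 * d N = real m" if "wrel id N" for N
  proof -
    obtain sw s1 s2 t1 t2 where N: "N = wform sw s1 s2 t1 t2" using wrel_form[OF \<open>wrel id N\<close>] by blast
    have "\<exists>i j :: int. 5 * (fst (N p) - fst p) = of_int i \<and> 5 * (snd (N p) - snd p) = of_int j"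
      by (cases sw, rule exI[of _ "2 * s1 + 5 * t1 - 1"], rule exI[of _ "s2 + 5 * t2 - 2"])
         (simp add: N wform_def p_def, rule exI[of _ "s1 + 5 * t1 - 1"], rule exI[of _ "2 * s2 + 5 * t2 - 2"],
         simp add: N wform_def p_def)
    then obtain i j :: int where ij: "5 * (fst (N p) - fst p) = of_int i" "5 * (snd (N p) - snd p) = of_int j" by blast
    have "25 * d N = (5 * (fst (N p) - fst p))\<^sup>2 + (5 * (snd (N p) - snd p))\<^sup>2"
      unfolding d_def by (simp add: power2_eq_square algebra_simps)
    also have "\<dots> = real (nat (i\<^sup>2 + j\<^sup>2))" unfolding ij by simp
    finally show ?thesis by blast
  qed
  ultimately have ex: "\<exists>m::nat. 25 * d M = real m * 2 ^ n" for n by (metis mult.assoc)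
  have d0: "d M = 0"
  proof (rule ccontr)
    assume "d M \<noteq> 0"
    obtain n where n: "25 * d M < 2 ^ n" using real_arch_pow[of 2 "25 * d M"] by auto
    obtain m :: nat where m: "25 * d M = real m * 2 ^ n" using ex by blast
    have "m \<noteq> 0" using m \<open>d M \<noteq> 0\<close> by (metis mult_eq_0_iff of_nat_0 zero_neq_numeral)
    then have "(2::real) ^ n \<le> real m * 2 ^ n" by (cases m) auto
    then show False using n m by simp
  qed
  then have Mp: "M p = p" unfolding d_def by (simp add: sum_power2_eq_zero_iff prod_eq_iff)
  obtain sw s1 s2 t1 t2 where M: "M = wform sw s1 s2 t1 t2" and ok: "wok sw s1 s2 t1 t2" using wrel_form[OF assms] by blast
  show ?thesis
  proof (cases sw)
    case True
    then have "of_int (2 * s1 + 5 * t1) = (of_int 1 :: real)" using Mp by (simp add: M wform_def p_def)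
    then have "2 * s1 + 5 * t1 = 1" by (simp only: of_int_eq_iff)
    moreover have "s1 = 1 \<or> s1 = -1" using ok unfolding wok_def by blast
    ultimately have False by presburger
    then show ?thesis ..
  next
    case False
    then have "of_int (s1 + 5 * t1) = (of_int 1 :: real)" "of_int (2 * s2 + 5 * t2) = (of_int 2 :: real)"
      using Mp by (simp_all add: M wform_def p_def)
    then have "s1 + 5 * t1 = 1" "2 * s2 + 5 * t2 = 2" by (simp_all only: of_int_eq_iff)
    moreover have "s1 = 1 \<or> s1 = -1" "s2 = 1 \<or> s2 = -1" using ok unfolding wok_def by blast+
    ultimately have "s1 = 1 \<and> t1 = 0 \<and> s2 = 1 \<and> t2 = 0" by presburger
    then show ?thesis using False by (simp add: M wform_def fun_eq_iff)
  qed
qed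

lemma wrel_unique: assumes "wrel g M" "wrel g N" shows "M = N"
proof -
  obtain K where K: "wrel (iv g) K" "K \<circ> M = id" "M \<circ> K = id" using wrel_inv[OF assms(1)] by blast
  have "wrel (iv g \<circ> g) (N \<circ> K)" by (rule wrel_comp[OF K(1) assms(2)])
  then have "wrel id (N \<circ> K)" using TA_inv(2)[OF Gamh_TA[OF wrel_Gamh[OF assms(1)]]] by simp
  then have "N \<circ> K = id" by (rule wrel_id_unique)
  then show ?thesis using K(2) by (metis comp_assoc comp_id id_comp)
qed

lemma plane_act_eq: "plane_act = restrict (\<lambda>g. THE M. wrel g M) Gam_hat"
  unfolding plane_act_def
proof (rule the_equality)
  let ?f = "restrict (\<lambda>g. THE M. wrel g M) Gam_hat"
  have f: "?f g = M" if "wrel g M" for g M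
    using that wrel_Gamh[OF that] wrel_unique by (auto intro!: the_equality)
  have "?f (g \<circ> h) = ?f h \<circ> ?f g" if gh: "g \<in> Gam_hat" "h \<in> Gam_hat" for g h
  proof -
    obtain M N where MN: "wrel g M" "wrel h N" using wrel_ex gh by blast
    show ?thesis by (simp only: f[OF wrel_comp[OF MN]] f[OF MN(1)] f[OF MN(2)])
  qed
  then show "?f \<in> extensional Gam_hat \<and> ?f id = id \<and> (\<forall>g\<in>Gam_hat. \<forall>h\<in>Gam_hat. ?f (g \<circ> h) = ?f h \<circ> ?f g) \<and>
    ?f h_a = reflect_line pB pC \<and> ?f h_b = reflect_line pA pC \<and> ?f h_c = reflect_line pA pB"
    unfolding reflect_lines f[OF wrel_gens(1)] f[OF wrel_gens(2)] f[OF wrel_gens(3)] f[OF wrel_id]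
    by blast
  fix \<phi> assume \<phi>: "\<phi> \<in> extensional Gam_hat \<and> \<phi> id = id \<and> (\<forall>g\<in>Gam_hat. \<forall>h\<in>Gam_hat. \<phi> (g \<circ> h) = \<phi> h \<circ> \<phi> g) \<and>
    \<phi> h_a = reflect_line pB pC \<and> \<phi> h_b = reflect_line pA pC \<and> \<phi> h_c = reflect_line pA pB"
  then have m: "\<phi> (g \<circ> h) = \<phi> h \<circ> \<phi> g" if "g \<in> Gam_hat" "h \<in> Gam_hat" for g h using that by blast
  have "\<phi> g = M" if "wrel g M" for g M
    using that by (induction rule: wrel.induct)
      (use \<phi> in \<open>simp_all only: m wrel_Gamh Gamh_gens reflect_lines\<close>)
  then have "\<phi> g = ?f g" if "g \<in> Gam_hat" for g using f wrel_ex[OF that] by metis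
  then show "\<phi> = ?f" using \<phi> by (auto simp: extensional_def fun_eq_iff)
qed

lemma plane_act_wrel: assumes "g \<in> Gam_hat" shows "wrel g (plane_act g)"
proof -
  obtain M where "wrel g M" using wrel_ex[OF assms] by blast
  then have "plane_act g = M" using assms wrel_unique by (auto simp: plane_act_eq intro!: the_equality)
  then show ?thesis using \<open>wrel g M\<close> by simp
qed

lemma plane_act_eqI: "wrel g M \<Longrightarrow> plane_act g = M"
  using plane_act_wrel wrel_unique wrel_Gamh by blast

lemma plane_act_comp: "g \<in> Gam_hat \<Longrightarrow> h \<in> Gam_hat \<Longrightarrow> plane_act (g \<circ> h) = plane_act h \<circ> plane_act g"
  by (intro plane_act_eqI wrel_comp plane_act_wrel)

lemma plane_act_gens: "plane_act id = id" "plane_act h_a = rf_a" "plane_act h_b = rf_b" "plane_act h_c = rf_c"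
  by (intro plane_act_eqI wrel_gens wrel_id)+

lemma plane_act_sect: assumes "g \<in> Gam_hat"
  shows "plane_act (sect g [x]) \<circ> AA (lt g x) = AA x \<circ> plane_act g"
  using wrel_sect[OF plane_act_wrel[OF assms], of x] plane_act_eqI by blast

section \<open>The fundamental triangle\<close>

definition Dt :: "plane set" where "Dt = {z. 0 \<le> fst z \<and> 0 \<le> snd z \<and> fst z + snd z \<le> 1}"

lemma Dt_hull: "convex hull {pA, pB, pC} = Dt"
proof
  show "convex hull {pA, pB, pC} \<subseteq> Dt"
    by (auto simp: convex_hull_3 Dt_def pA_def pB_def pC_def)
  show "Dt \<subseteq> convex hull {pA, pB, pC}"
  proof
    fix z assume z: "z \<in> Dt"
    then have "z = fst z *\<^sub>R pA + (1 - fst z - snd z) *\<^sub>R pB + snd z *\<^sub>R pC \<and> 0 \<le> fst z \<and> 0 \<le> (1 - fst z - snd z)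
       \<and> 0 \<le> snd z \<and> fst z + (1 - fst z - snd z) + snd z = 1"
      by (auto simp: Dt_def pA_def pB_def pC_def prod_eq_iff)
    then show "z \<in> convex hull {pA, pB, pC}" unfolding convex_hull_3 by blast
  qed
qed

text \<open>Invariance under the three reflections and injectivity on the triangle make the triangle a
  fundamental domain.\<close>

definition orbit_inv :: "plane \<Rightarrow> real \<times> real" where
  "orbit_inv z = (cos (pi * fst z) - cos (pi * snd z), cos (pi * fst z) * cos (pi * snd z))"

lemma orbit_inv_wrel: "wrel g M \<Longrightarrow> orbit_inv (M z) = orbit_inv z"
proof (induction arbitrary: z rule: wrel.induct)
  case (wrel_b g M)
  have "cos (pi * (1 - x)) = - cos (pi * x)" for x by (simp add: right_diff_distrib cos_diff)
  then have "orbit_inv (rf_b z) = orbit_inv z" by (simp add: orbit_inv_def rf_b_def)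
  then show ?case using wrel_b(2) by simp
qed (simp_all add: orbit_inv_def rf_a_def rf_c_def)

lemma Dt_unique: assumes "z \<in> Dt" "w \<in> Dt" "orbit_inv z = orbit_inv w" shows "z = w"
proof -
  \<comment> \<open>In the triangle the first coordinate is at most one minus the second, and the
    cosine decreases between 0 and pi.\<close>
  have mono: "- cos (pi * snd z) \<le> cos (pi * fst z)" if "z \<in> Dt" for z
  proof -
    have "pi * fst z \<le> pi - pi * snd z" using that mult_left_mono[of "fst z + snd z" 1 pi]
      by (simp add: Dt_def algebra_simps)
    then have "cos (pi - pi * snd z) \<le> cos (pi * fst z)"
      using that by (intro cos_monotone_0_pi_le) (auto simp: Dt_def)
    then show ?thesis by (simp add: cos_diff)
  qed
  define X Y X' Y' where "X = cos (pi * fst z)" "Y = - cos (pi * snd z)" "X' = cos (pi * fst w)" "Y' = - cos (pi * snd w)"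
  note d = this
  have e: "X + Y = X' + Y'" "X * Y = X' * Y'" using assms(3) by (auto simp: d orbit_inv_def)
  have le: "Y \<le> X" "Y' \<le> X'" using mono assms by (auto simp: d)
  \<comment> \<open>\<open>orbit_inv\<close> consists of the sum and, up to sign, the product of X
    and Y. So X and Y form the same pair as X' and Y', and \<open>le\<close> matches the larger with
    the larger.\<close>
  have "(X - X') * (X - Y') = 0"
  proof -
    have Y: "Y = X' + Y' - X" using e(1) by simp
    show ?thesis using e(2) unfolding Y by (simp add: algebra_simps)
  qed
  then have "X = X' \<and> Y = Y'" using le e(1) by auto
  then have "cos (pi * fst z) = cos (pi * fst w)" "cos (pi * snd z) = cos (pi * snd w)" by (auto simp: d)
  moreover have "0 \<le> pi * fst v" "pi * fst v \<le> pi" "0 \<le> pi * snd v" "pi * snd v \<le> pi" if "v \<in> Dt" for v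
    using that mult_left_le[of "fst v" pi] mult_left_le[of "snd v" pi] by (simp_all add: Dt_def)
  ultimately have "pi * fst z = pi * fst w" "pi * snd z = pi * snd w"
    using assms(1,2) cos_inj_pi by metis+
  then show ?thesis by (simp add: prod_eq_iff)
qed

lemma Dt_fundamental: assumes "g \<in> Gam_hat" "z \<in> Dt" "plane_act g z \<in> Dt" shows "plane_act g z = z"
  using Dt_unique[OF assms(3,2)] orbit_inv_wrel[OF plane_act_wrel[OF assms(1)]] by simp

lemma AA_Dt: "z \<in> Dt \<Longrightarrow> AA x z \<in> Dt" by (cases x) (auto simp: Dt_def field_simps)

lemma AA_surj: "\<exists>w. AA x w = z"
proof (cases x)
  case B1 then have "AA x (snd z - fst z, 1 - fst z - snd z) = z" by (cases z) (simp add: field_simps)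
  then show ?thesis by blast
next
  case B2 then have "AA x (fst z - snd z, 1 - fst z - snd z) = z" by (cases z) (simp add: field_simps)
  then show ?thesis by blast
qed

text \<open>If g acts trivially, its section at x carries the image of \<open>AA (lt g x)\<close> to
  that of \<open>AA x\<close> inside the fundamental triangle. The two contractions send A' to
  different points, so the letter is fixed; then the section acts trivially because
  \<open>AA x\<close> is onto, and the same argument applies to it.\<close>

lemma plane_act_faithful: assumes "g \<in> Gam_hat" "plane_act g = id" shows "g = id"
proof -
  have "g v = v" if "g \<in> Gam_hat" "plane_act g = id" for g v
    using that
  proof (induction v arbitrary: g)
    case Nil then show ?case by (simp add: TA_NilD Gamh_TA)
  next
    case (Cons x v)
    have s: "plane_act (sect g [x]) (AA (lt g x) z) = AA x z" for z
      using plane_act_sect[OF Cons(2), of x] Cons(3) by (metis comp_apply comp_id)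
    have "lt g x = x"
    proof (rule ccontr)
      assume n: "lt g x \<noteq> x"
      have pA: "pA \<in> Dt" by (simp add: Dt_def pA_def)
      have "plane_act (sect g [x]) (AA (lt g x) pA) \<in> Dt" using s AA_Dt[OF pA] by simp
      then have "AA x pA = AA (lt g x) pA"
        using Dt_fundamental[OF Gamh_sect1[OF Cons(2), of x] AA_Dt[OF pA, of "lt g x"]] s[of pA] by simp
      then show False using n by (cases x; cases "lt g x") (auto simp: pA_def)
    qed
    moreover have "plane_act (sect g [x]) = id"
    proof
      fix z obtain w where "AA x w = z" using AA_surj by blast
      then show "plane_act (sect g [x]) z = id z" using s[of w] \<open>lt g x = x\<close> by simp
    qed
    ultimately show ?case using Cons(1)[OF Gamh_sect1[OF Cons(2)]] Cons(2) by (simp add: TA_Cons Gamh_TA)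
  qed
  then show ?thesis using assms by (simp add: fun_eq_iff)
qed

section \<open>Orientation\<close>

text \<open>The determinant of the linear part, computed from the images of the origin and of the
  two unit vectors.\<close>

definition orient :: "(plane \<Rightarrow> plane) \<Rightarrow> real" where
  "orient M = (fst (M (1,0)) - fst (M (0,0))) * (snd (M (0,1)) - snd (M (0,0)))
    - (fst (M (0,1)) - fst (M (0,0))) * (snd (M (1,0)) - snd (M (0,0)))"

lemma orient_wform: "orient (wform sw s1 s2 t1 t2) = (if sw then - of_int (s1 * s2) else of_int (s1 * s2))"
  by (simp add: orient_def wform_def)

lemma orient_rf: assumes "wrel g M"
  shows "orient (M \<circ> rf_a) = - orient M" "orient (M \<circ> rf_b) = - orient M" "orient (M \<circ> rf_c) = - orient M"
    "orient M = 1 \<or> orient M = -1"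
proof -
  obtain sw s1 s2 t1 t2 where M: "M = wform sw s1 s2 t1 t2" and ok: "wok sw s1 s2 t1 t2" using wrel_form[OF assms] by blast
  show "orient (M \<circ> rf_a) = - orient M" "orient (M \<circ> rf_b) = - orient M" "orient (M \<circ> rf_c) = - orient M"
    unfolding M wform_rf by (simp_all add: orient_wform split: if_splits)
  show "orient M = 1 \<or> orient M = -1" using ok unfolding M orient_wform wok_def by auto
qed

definition sgh :: "baut \<Rightarrow> bool" where "sgh g \<longleftrightarrow> orient (plane_act g) = -1"

lemma sgh_id [simp]: "\<not> sgh id" by (simp add: sgh_def plane_act_gens orient_def)

lemma sgh_step: assumes "g \<in> Gam_hat"
  shows "sgh (h_a \<circ> g) = (\<not> sgh g)" "sgh (h_b \<circ> g) = (\<not> sgh g)" "sgh (h_c \<circ> g) = (\<not> sgh g)"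
  unfolding sgh_def
  by (simp_all only: plane_act_comp Gamh_gens assms plane_act_gens)
     (use orient_rf[OF plane_act_wrel[OF assms]] in auto)

lemma sgh_comp: "g \<in> Gam_hat \<Longrightarrow> h \<in> Gam_hat \<Longrightarrow> sgh (g \<circ> h) = (sgh g \<noteq> sgh h)"
  by (induction rule: Gamh_induct)
     (simp_all only: comp_assoc sgh_step Gamh_comp id_comp sgh_id, simp_all)

lemma sgh_gens [simp]: "sgh h_a" "sgh h_b" "sgh h_c"
  using sgh_step[OF Gamh_id] by simp_all

fun parh :: "bletter \<Rightarrow> bool" where "parh B1 = False" | "parh B2 = True"

text \<open>This is \<open>plane_act_sect\<close> on the level of determinants: \<open>AA B1\<close>
  preserves the orientation and \<open>AA B2\<close> reverses it. The identity is what makes the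
  letter 1 and the letter 2 twisted by a reflection span a bimodule over the orientation preserving
  subgroup.\<close>

lemma parity_hat: "g \<in> Gam_hat \<Longrightarrow> (parh (lt g x) \<noteq> sgh (sect g [x])) = (parh x \<noteq> sgh g)"
proof (induction arbitrary: x rule: Gamh_induct)
  case id then show ?case by (simp only: lt_id sect_id)
next
  case (a g)
  have "lt (h_a \<circ> g) x = lt h_a (lt g x)" "sect (h_a \<circ> g) [x] = sect g [x]"
    using a(1) by (simp_all only: lt_comp sect_comp1 h_TA Gamh_TA sect_hgens id_comp)
  then show ?case using a(2)[of x] sgh_step(1)[OF a(1)] by (cases "lt g x") (auto simp del: o_apply)
next
  case (b g)
  have "lt (h_b \<circ> g) x = lt g x" "sect (h_b \<circ> g) [x] = (if lt g x = B1 then h_a else h_c) \<circ> sect g [x]"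
    using b(1) by (simp_all only: lt_comp sect_comp1 h_TA Gamh_TA lt_hgens) (cases "lt g x"; simp)
  then show ?case using b(2)[of x] sgh_step[OF Gamh_sect1[OF b(1)]] sgh_step(2)[OF b(1)]
    by (cases "lt g x") (auto simp del: o_apply)
next
  case (c g)
  have "lt (h_c \<circ> g) x = lt g x" "sect (h_c \<circ> g) [x] = h_b \<circ> sect g [x]"
    using c(1) by (simp_all only: lt_comp sect_comp1 h_TA Gamh_TA lt_hgens sect_hgens)
  then show ?case using c(2)[of x] sgh_step[OF Gamh_sect1[OF c(1)]] sgh_step(3)[OF c(1)] by (auto simp del: o_apply)
qed

definition sgG :: "aut \<Rightarrow> bool" where "sgG g = sgh (nu g)"

lemma sgG_comp: "g \<in> Gam \<Longrightarrow> h \<in> Gam \<Longrightarrow> sgG (g \<circ> h) = (sgG g \<noteq> sgG h)"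
  by (simp add: sgG_def nu_comp sgh_comp nu_Gamh del: o_apply)

lemma sgG_gens [simp]: "\<not> sgG id" "\<not> sgG g_alpha" "\<not> sgG g_beta" "\<not> sgG g_gamma" "sgG g_a" "sgG g_b" "sgG g_c"
  by (simp_all add: sgG_def nu_gens)

lemma par_mu: "par x = parh (mu_letter x)" by (cases x) auto

lemma parity: assumes "g \<in> Gam" shows "(par (lt g x) \<noteq> sgG (sect g [x])) = (par x \<noteq> sgG g)"
  using parity_hat[OF nu_Gamh[OF assms], of "mu_letter x"] assms
  by (simp add: par_mu sgG_def nu_sect nu_lt)

text \<open>IMG(f) and its coset of a exhaust \<Gamma>, since each generator preserves or exchanges
  the two. As a reverses the orientation and IMG(f) does not, \<open>sgG\<close> tells them
  apart.\<close>

lemma IMGf_eq: "IMGf = {g \<in> Gam. \<not> sgG g}"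
proof
  have G: "{g_alpha, g_beta, g_gamma, g_a \<circ> g_b, g_b \<circ> g_c} \<subseteq> {g \<in> Gam. \<not> sgG g}"
    by (simp add: Gam_gens Gam_comp sgG_comp del: o_apply)
  show "IMGf \<subseteq> {g \<in> Gam. \<not> sgG g}"
  proof
    fix g assume "g \<in> IMGf"
    then show "g \<in> {g \<in> Gam. \<not> sgG g}" unfolding IMGf_def
    proof (induction rule: generate.induct)
      case one show ?case using Gam_id sgG_gens(1) by (simp only: tree_aut_simps mem_Collect_eq simp_thms)
    next
      case (incl h) then show ?case using G by blast
    next
      case (inv h)
      then have h: "h \<in> Gam" "\<not> sgG h" using G by blast+
      have "sgG (iv h \<circ> h) = (sgG (iv h) \<noteq> sgG h)" using h Gam_inv sgG_comp by blast
      then show ?case using h by (simp add: m_inv_tree_aut Gam_TA Gam_inv del: o_apply)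
    next
      case (eng h1 h2)
      then show ?case by (simp add: Gam_comp sgG_comp del: o_apply)
    qed
  qed
  have inc: "g \<in> IMGf" if "g \<in> {g_alpha, g_beta, g_gamma, g_a \<circ> g_b, g_b \<circ> g_c}" for g
    using that unfolding IMGf_def by (rule generate.incl)
  have cl: "g \<circ> h \<in> IMGf" if "g \<in> IMGf" "h \<in> IMGf" for g h
    using that generate.eng[of g tree_aut _ h] unfolding IMGf_def by simp
  have inv: "g_b \<circ> g_a \<in> IMGf" "g_c \<circ> g_b \<in> IMGf"
  proof -
    have "iv (g_a \<circ> g_b) = g_b \<circ> g_a" "iv (g_b \<circ> g_c) = g_c \<circ> g_b"
      by (rule inv_unique_comp; auto simp: fun_eq_iff)+
    moreover have "m_inv tree_aut (g_a \<circ> g_b) \<in> IMGf" "m_inv tree_aut (g_b \<circ> g_c) \<in> IMGf"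
      unfolding IMGf_def by (rule generate.inv; simp)+
    ultimately show "g_b \<circ> g_a \<in> IMGf" "g_c \<circ> g_b \<in> IMGf" by (simp_all add: m_inv_tree_aut)
  qed
  have "g \<in> IMGf \<or> g_a \<circ> g \<in> IMGf" if "g \<in> Gam" for g
    using that
  proof (induction rule: Gam_induct)
    case id
    have "id \<in> IMGf" unfolding IMGf_def using generate.one[of tree_aut] by (metis tree_aut_simps(2))
    then show ?case by blast
  next
    case (alpha g)
    have "g_a \<circ> (g_alpha \<circ> g) = g_alpha \<circ> (g_a \<circ> g)" by (auto simp: fun_eq_iff al_a)
    then show ?case using alpha(2) cl inc by (metis insertCI)
  next
    case (beta g)
    have "g_a \<circ> (g_beta \<circ> g) = g_beta \<circ> (g_a \<circ> g)" by (auto simp: fun_eq_iff a_be)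
    then show ?case using beta(2) cl inc by (metis insertCI)
  next
    case (gamma g)
    have "g_a \<circ> (g_gamma \<circ> g) = (g_alpha \<circ> (g_gamma \<circ> g_alpha)) \<circ> (g_a \<circ> g)" by (auto simp: fun_eq_iff al_a ga_a)
    then show ?case using gamma(2) cl inc by (metis insertCI)
  next
    case (a g)
    have "g_a \<circ> (g_a \<circ> g) = g" by (auto simp: fun_eq_iff)
    then show ?case using a(2) by metis
  next
    case (b g)
    have "g_a \<circ> (g_b \<circ> g) = (g_a \<circ> g_b) \<circ> g" "g_b \<circ> g = (g_b \<circ> g_a) \<circ> (g_a \<circ> g)" by (auto simp: fun_eq_iff)
    then show ?case using b(2) cl inc inv by (metis insertCI)
  next
    case (c g)
    have "g_a \<circ> (g_c \<circ> g) = (g_a \<circ> g_b) \<circ> ((g_b \<circ> g_c) \<circ> g)"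
      "g_c \<circ> g = (g_c \<circ> g_b) \<circ> ((g_b \<circ> g_a) \<circ> (g_a \<circ> g))" by (auto simp: fun_eq_iff)
    then show ?case using c(2) cl inc inv by (metis insertCI)
  qed
  moreover have "g_a \<circ> g \<notin> IMGf" if "g \<in> Gam" "\<not> sgG g" for g
    using \<open>IMGf \<subseteq> {g \<in> Gam. \<not> sgG g}\<close> that sgG_comp[OF Gam_gens(4) that(1)] sgG_gens by blast
  ultimately show "{g \<in> Gam. \<not> sgG g} \<subseteq> IMGf" by blast
qed

section \<open>The finite vertex groups of \<Gamma>\<close>

section \<open>Structure of the vertex groups\<close>

abbreviation "pl g \<equiv> plane_act (nu g)"

lemma pl_comp: "g \<in> Gam \<Longrightarrow> h \<in> Gam \<Longrightarrow> pl (g \<circ> h) = pl h \<circ> pl g"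
  by (simp add: nu_comp plane_act_comp nu_Gamh del: o_apply)

lemma pl_gens: "pl id = id" "pl g_alpha = id" "pl g_beta = id" "pl g_gamma = id" "pl g_a = rf_a" "pl g_b = rf_b" "pl g_c = rf_c"
  by (simp_all only: nu_gens plane_act_gens)

lemma plane_act_inj: assumes "g \<in> Gam_hat" "h \<in> Gam_hat" "plane_act g = plane_act h" shows "g = h"
proof -
  have "plane_act (g \<circ> iv h) = plane_act (iv h) \<circ> plane_act h"
    using plane_act_comp[OF assms(1) Gamh_inv[OF assms(2)]] assms(3) by simp
  also have "\<dots> = plane_act (h \<circ> iv h)" by (simp only: plane_act_comp[OF assms(2) Gamh_inv[OF assms(2)]])
  also have "\<dots> = id" using Gamh_TA[OF assms(2)] by (simp only: TA_inv plane_act_gens)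
  finally have "g \<circ> iv h = id" using plane_act_faithful Gamh_comp Gamh_inv assms by metis
  then have "g \<circ> (iv h \<circ> h) = h" by (metis comp_assoc id_comp)
  then show ?thesis using Gamh_TA[OF assms(2)] by (simp only: TA_inv comp_id)
qed

lemma al_ga: "g_gamma (g_alpha (g_gamma (g_alpha v))) = g_alpha (g_gamma (g_alpha (g_gamma v)))"
  by (cases v rule: g_a.cases) auto

text \<open>The eight words exhaust a group generated by two involutions whose product has order
  dividing 4.\<close>

definition dih :: "('a \<Rightarrow> 'a) \<Rightarrow> ('a \<Rightarrow> 'a) \<Rightarrow> ('a \<Rightarrow> 'a) set" where
  "dih r s = {id, r, s, r \<circ> s, s \<circ> r, r \<circ> (s \<circ> r), s \<circ> (r \<circ> s), r \<circ> (s \<circ> (r \<circ> s))}"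

lemma dih_closed:
  assumes r: "r \<circ> r = id" and s: "s \<circ> s = id" and rel: "s \<circ> (r \<circ> (s \<circ> r)) = r \<circ> (s \<circ> (r \<circ> s))"
    and d: "d \<in> dih r s"
  shows "r \<circ> d \<in> dih r s" "s \<circ> d \<in> dih r s"
proof -
  have 1: "r \<circ> (r \<circ> x) = x" "s \<circ> (s \<circ> x) = x" for x using r s by (metis comp_assoc id_comp)+
  have 2: "s \<circ> (r \<circ> (s \<circ> (r \<circ> s))) = r \<circ> (s \<circ> r)" using rel 1 by metis
  show "r \<circ> d \<in> dih r s" "s \<circ> d \<in> dih r s"
    using d unfolding dih_def
    by (elim insertE emptyE; simp only: comp_id r s 1 2 rel insert_iff simp_thms)+
qed

abbreviation "aal \<equiv> g_a \<circ> g_alpha"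
abbreviation "bbe \<equiv> g_b \<circ> g_beta"
abbreviation "cga \<equiv> g_c \<circ> g_gamma"

lemma rel_C: "bbe \<circ> (aal \<circ> (bbe \<circ> aal)) = aal \<circ> (bbe \<circ> (aal \<circ> bbe))"
proof
  fix v show "(bbe \<circ> (aal \<circ> (bbe \<circ> aal))) v = (aal \<circ> (bbe \<circ> (aal \<circ> bbe))) v"
    by (cases v rule: g_a.cases) (simp_all add: al_a al_c ga_a ga_c c_a al_ga)
qed

text \<open>At the letters 1 and 2 the relation becomes \<open>rel_C\<close>, at 3 and 4 it becomes
  itself with b and c exchanged.\<close>

lemma rel_A: "g_c \<circ> (g_b \<circ> (g_c \<circ> g_b)) = g_b \<circ> (g_c \<circ> (g_b \<circ> g_c))"
proof
  have C: "g_b (g_beta (g_a (g_alpha (g_b (g_beta (g_a (g_alpha v))))))) = g_a (g_alpha (g_b (g_beta (g_a (g_alpha (g_b (g_beta v)))))))" for v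
    using fun_cong[OF rel_C, of v] by simp
  fix v show "(g_c \<circ> (g_b \<circ> (g_c \<circ> g_b))) v = (g_b \<circ> (g_c \<circ> (g_b \<circ> g_c))) v"
  proof (induction v rule: letter_length_induct)
    case (L3 v) then show ?case by (metis comp_apply g_b.simps(4) g_c.simps(4))
  next
    case (L4 v) then show ?case by (metis comp_apply g_b.simps(5) g_c.simps(5))
  qed (simp_all add: C)
qed

text \<open>The group \<open>stab X\<close> is the product of the subgroup generated by \<open>JJ X\<close>, which is the kernel of
  \<open>\<nu>\<close> in it, and the dihedral group \<open>DD X\<close> generated by \<open>RR X\<close>.\<close>

fun JJ :: "vert \<Rightarrow> aut set" where
  "JJ vA = {g_beta, g_gamma}" | "JJ vB = {g_alpha, g_gamma}" | "JJ vC = {g_alpha, g_beta}"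
| "JJ vA1 = {g_alpha}" | "JJ vB1 = {g_beta}" | "JJ vC1 = {g_gamma}"

fun DD :: "vert \<Rightarrow> aut set" where
  "DD vA = dih g_b g_c" | "DD vA1 = dih g_b g_c"
| "DD vB = {id, g_a, cga, g_a \<circ> cga}" | "DD vB1 = {id, g_a, cga, g_a \<circ> cga}"
| "DD vC = dih aal bbe" | "DD vC1 = dih aal bbe"

fun RR :: "vert \<Rightarrow> aut set" where
  "RR vA = {g_b, g_c}" | "RR vA1 = {g_b, g_c}" | "RR vB = {g_a, cga}" | "RR vB1 = {g_a, cga}"
| "RR vC = {aal, bbe}" | "RR vC1 = {aal, bbe}"

lemma gens_Gam: "JJ X \<subseteq> Gam" "RR X \<subseteq> Gam"
  by (cases X; simp add: Gam_gens Gam_comp del: o_apply)+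

lemma gens_invol: "s \<in> JJ X \<union> RR X \<Longrightarrow> s \<circ> s = id"
  by (cases X) (auto simp: fun_eq_iff al_a be_b ga_c)

lemma gen_Gam: "S \<subseteq> Gam \<Longrightarrow> gen S \<subseteq> Gam"
proof
  fix g assume "S \<subseteq> Gam" "g \<in> gen S"
  from this(2,1) show "g \<in> Gam" by (induction rule: gen.induct) (simp only: Gam_id, blast intro: Gam_comp)
qed

text \<open>Some of the generators a, b, c are multiplied by \<alpha>, \<beta> or \<gamma> so that
  those outside the kernel of \<nu> satisfy dihedral relations among themselves and generate a
  complement of the kernel.\<close>

lemma stab_gen: "stab X = gen (JJ X \<union> RR X)"
proof -
  have TA: "S \<subseteq> TA" if "S \<subseteq> Gam" for S using that Gam_TA by blast
  have eq: "gen S = gen (JJ X \<union> RR X)" if "S \<subseteq> gen (JJ X \<union> RR X)" "JJ X \<union> RR X \<subseteq> gen S" for S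
    using gen_mono[OF that(1)] gen_mono[OF that(2)] by blast
  have i: "s \<in> gen (JJ X \<union> RR X)" if "s \<in> JJ X \<union> RR X" for s using that by (rule gen_incl)
  have cgg: "cga \<circ> g_gamma = g_c" "bbe \<circ> g_beta = g_b" "aal \<circ> g_alpha = g_a" by (auto simp: fun_eq_iff)
  show ?thesis
  proof (cases X)
    case vA
    have "stab X = gen {g_beta, g_gamma, g_b, g_c}" unfolding vA stab.simps
      by (rule generate_eq_gen) (auto simp: fun_eq_iff)
    then show ?thesis unfolding vA by (simp add: insert_commute)
  next
    case vB
    have 1: "stab X = gen {g_alpha, g_gamma, g_a, g_c}" unfolding vB stab.simps
      by (rule generate_eq_gen) (auto simp: fun_eq_iff)
    have "g_c \<in> gen (JJ X \<union> RR X)"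
      using gen_comp[OF i[of cga] i[of g_gamma]] by (simp add: vB cgg del: o_apply)
    then have 2: "{g_alpha, g_gamma, g_a, g_c} \<subseteq> gen (JJ X \<union> RR X)" using i by (simp add: vB)
    have "JJ X \<union> RR X \<subseteq> gen {g_alpha, g_gamma, g_a, g_c}"
      by (simp add: vB gen_incl gen_comp del: o_apply)
    with 1 eq[OF 2] show ?thesis by blast
  next
    case vC
    have 1: "stab X = gen {g_alpha, g_beta, g_a, g_b}" unfolding vC stab.simps
      by (rule generate_eq_gen) (auto simp: fun_eq_iff)
    have "g_b \<in> gen (JJ X \<union> RR X)" "g_a \<in> gen (JJ X \<union> RR X)"
      using gen_comp[OF i[of bbe] i[of g_beta]] gen_comp[OF i[of aal] i[of g_alpha]]
      by (simp_all add: vC cgg del: o_apply)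
    then have 2: "{g_alpha, g_beta, g_a, g_b} \<subseteq> gen (JJ X \<union> RR X)" using i by (simp add: vC)
    have "JJ X \<union> RR X \<subseteq> gen {g_alpha, g_beta, g_a, g_b}"
      by (simp add: vC gen_incl gen_comp del: o_apply)
    with 1 eq[OF 2] show ?thesis by blast
  next
    case vA1
    have "stab X = gen {g_alpha, g_b, g_c}" unfolding vA1 stab.simps
      by (rule generate_eq_gen) (auto simp: fun_eq_iff)
    then show ?thesis unfolding vA1 by (simp add: insert_commute)
  next
    case vB1
    have "stab X = gen {g_beta, g_a, cga}" unfolding vB1 stab.simps
      by (rule generate_eq_gen) (auto simp: fun_eq_iff ga_c)
    then show ?thesis unfolding vB1 by (simp add: insert_commute)
  next
    case vC1
    have "stab X = gen {g_gamma, aal, bbe}" unfolding vC1 stab.simps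
      by (rule generate_eq_gen) (auto simp: fun_eq_iff al_a be_b)
    then show ?thesis unfolding vC1 by (simp add: insert_commute)
  qed
qed

lemma stab_Gam: "stab X \<subseteq> Gam"
  unfolding stab_gen using gens_Gam by (intro gen_Gam) blast

lemma stab_group: "id \<in> stab X" "g \<in> stab X \<Longrightarrow> h \<in> stab X \<Longrightarrow> g \<circ> h \<in> stab X" "g \<in> stab X \<Longrightarrow> iv g \<in> stab X"
  unfolding stab_gen by (simp, erule (1) gen_comp, erule gen_inv, erule gens_invol)

text \<open>Elements of R normalize the group generated by J, so they can be collected on the right,
  where D absorbs them.\<close>

lemma gen_normal_form:
  assumes conj: "\<And>r j. r \<in> R \<Longrightarrow> j \<in> J \<Longrightarrow> \<exists>j'\<in>gen J. r \<circ> j = j' \<circ> r"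
    and D: "id \<in> D" "\<And>r d. r \<in> R \<Longrightarrow> d \<in> D \<Longrightarrow> r \<circ> d \<in> D" and k: "k \<in> gen (J \<union> R)"
  shows "\<exists>j\<in>gen J. \<exists>d\<in>D. k = j \<circ> d"
proof -
  have cj: "\<exists>j'\<in>gen J. r \<circ> j = j' \<circ> r" if r: "r \<in> R" and "j \<in> gen J" for r j
    using that(2)
  proof (induction rule: gen.induct)
    case gen_id show ?case by (rule bexI[of _ id]) simp_all
  next
    case (gen_mult s g)
    obtain s' g' where "s' \<in> gen J" "r \<circ> s = s' \<circ> r" "g' \<in> gen J" "r \<circ> g = g' \<circ> r"
      using gen_mult(3) conj[OF r gen_mult(1)] by blast
    then have "r \<circ> (s \<circ> g) = (s' \<circ> g') \<circ> r" "s' \<circ> g' \<in> gen J" by (metis comp_assoc, simp add: gen_comp)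
    then show ?case by blast
  qed
  show ?thesis using k
  proof (induction rule: gen.induct)
    case gen_id show ?case using D(1) by (intro bexI[of _ id]) simp_all
  next
    case (gen_mult s g)
    then obtain j d where jd: "j \<in> gen J" "d \<in> D" "g = j \<circ> d" by blast
    show ?case
    proof (cases "s \<in> J")
      case True
      then have "s \<circ> j \<in> gen J" "s \<circ> g = (s \<circ> j) \<circ> d" using jd by (auto simp: gen.gen_mult comp_assoc simp del: o_apply)
      then show ?thesis using jd(2) by blast
    next
      case False
      then have s: "s \<in> R" using gen_mult(1) by blast
      obtain j' where "j' \<in> gen J" "s \<circ> j = j' \<circ> s" using cj[OF s jd(1)] by blast
      then have "s \<circ> g = j' \<circ> (s \<circ> d)" using jd(3) by (metis comp_assoc)
      then show ?thesis using D(2)[OF s jd(2)] \<open>j' \<in> gen J\<close> by blast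
    qed
  qed
qed

lemma stab_normal_form: assumes "k \<in> stab X" shows "\<exists>j\<in>gen (JJ X). \<exists>d\<in>DD X. k = j \<circ> d"
proof (rule gen_normal_form[of "RR X"])
  show "k \<in> gen (JJ X \<union> RR X)" using assms by (simp only: stab_gen)
  show "id \<in> DD X" by (cases X) (simp_all add: dih_def)
  show "r \<circ> d \<in> DD X" if rd: "r \<in> RR X" "d \<in> DD X" for r d
  proof -
    have A: "x \<circ> d \<in> dih g_b g_c" if "d \<in> dih g_b g_c" "x \<in> {g_b, g_c}" for x d
    proof -
      have "g_b \<circ> g_b = id" "g_c \<circ> g_c = id" by (auto simp: fun_eq_iff)
      then show ?thesis using dih_closed[OF _ _ rel_A that(1)] that(2) by blast
    qed
    have C: "x \<circ> d \<in> dih aal bbe" if "d \<in> dih aal bbe" "x \<in> {aal, bbe}" for x d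
    proof -
      have "aal \<circ> aal = id" "bbe \<circ> bbe = id" by (auto simp: fun_eq_iff al_a be_b)
      then show ?thesis using dih_closed[OF _ _ rel_C that(1)] that(2) by blast
    qed
    have B: "x \<circ> d \<in> {id, g_a, cga, g_a \<circ> cga}" if "d \<in> {id, g_a, cga, g_a \<circ> cga}" "x \<in> {g_a, cga}" for x d
    proof -
      have 1: "g_a \<circ> g_a = id" "cga \<circ> cga = id" "cga \<circ> g_a = g_a \<circ> cga"
        by (auto simp: fun_eq_iff ga_c ga_a c_a al_ga)
      have 2: "g_a \<circ> (g_a \<circ> cga) = cga" "cga \<circ> (g_a \<circ> cga) = g_a" using 1 by (metis comp_assoc id_comp comp_id)+
      show ?thesis using that
        by (elim insertE emptyE; simp only: 1 2 comp_id insert_iff simp_thms)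
    qed
    show ?thesis using A[of d r] B[of d r] C[of d r] rd by (cases X; simp only: DD.simps RR.simps)
  qed
  show "\<exists>j'\<in>gen (JJ X). r \<circ> j = j' \<circ> r" if "r \<in> RR X" "j \<in> JJ X" for r j
  proof -
    have "g_b \<circ> g_beta = g_beta \<circ> g_b" "g_b \<circ> g_gamma = (g_beta \<circ> g_gamma \<circ> g_beta) \<circ> g_b"
      "g_c \<circ> g_beta = (g_gamma \<circ> g_beta \<circ> g_gamma) \<circ> g_c" "g_c \<circ> g_gamma = g_gamma \<circ> g_c"
      "g_b \<circ> g_alpha = g_alpha \<circ> g_b" "g_c \<circ> g_alpha = g_alpha \<circ> g_c"
      "g_a \<circ> g_alpha = g_alpha \<circ> g_a" "g_a \<circ> g_gamma = (g_alpha \<circ> g_gamma \<circ> g_alpha) \<circ> g_a"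
      "g_a \<circ> g_beta = g_beta \<circ> g_a"
      "cga \<circ> g_alpha = (g_gamma \<circ> g_alpha \<circ> g_gamma) \<circ> cga" "cga \<circ> g_gamma = g_gamma \<circ> cga" "cga \<circ> g_beta = g_beta \<circ> cga"
      "aal \<circ> g_alpha = g_alpha \<circ> aal" "aal \<circ> g_gamma = g_gamma \<circ> aal"
      "bbe \<circ> g_alpha = (g_beta \<circ> g_alpha \<circ> g_beta) \<circ> bbe" "bbe \<circ> g_beta = g_beta \<circ> bbe" "bbe \<circ> g_gamma = g_gamma \<circ> bbe"
      by (auto simp: fun_eq_iff be_b ga_b be_c ga_c al_b al_c al_a ga_a a_be)
    moreover have "aal \<circ> g_beta = (g_alpha \<circ> g_beta \<circ> g_alpha) \<circ> aal"
      by (simp add: fun_eq_iff a_be flip: al_a)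
    note rels = calculation this
    have cm: "\<exists>j'\<in>gen J. r \<circ> j = j' \<circ> r" if "r \<circ> j = j \<circ> r" "j \<in> J" for r j :: aut and J
      using that(1) gen_incl[OF that(2)] by (rule bexI)
    have cj: "\<exists>j'\<in>gen J. r \<circ> j = j' \<circ> r" if "r \<circ> j = (x \<circ> j \<circ> x) \<circ> r" "j \<in> J" "x \<in> J" for r j x :: aut and J
      using that(1) gen_comp[OF gen_comp[OF gen_incl gen_incl] gen_incl, OF that(3,2,3)] by (rule bexI)
    show ?thesis
    proof (cases X)
      case vA
      show ?thesis using that unfolding vA JJ.simps RR.simps
        by (elim insertE emptyE; hypsubst) (rule cm[OF rels(1)] cj[OF rels(2)] cj[OF rels(3)] cm[OF rels(4)]; simp)+
    next
      case vB
      show ?thesis using that unfolding vB JJ.simps RR.simps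
        by (elim insertE emptyE; hypsubst) (rule cm[OF rels(7)] cj[OF rels(8)] cj[OF rels(10)] cm[OF rels(11)]; simp)+
    next
      case vC
      show ?thesis using that unfolding vC JJ.simps RR.simps
        by (elim insertE emptyE; hypsubst) (rule cm[OF rels(13)] cj[OF rels(18)] cj[OF rels(15)] cm[OF rels(16)]; simp)+
    next
      case vA1
      show ?thesis using that unfolding vA1 JJ.simps RR.simps
        by (elim insertE emptyE; hypsubst) (rule cm[OF rels(5)] cm[OF rels(6)]; simp)+
    next
      case vB1
      show ?thesis using that unfolding vB1 JJ.simps RR.simps
        by (elim insertE emptyE; hypsubst) (rule cm[OF rels(9)] cm[OF rels(12)]; simp)+
    next
      case vC1
      show ?thesis using that unfolding vC1 JJ.simps RR.simps
        by (elim insertE emptyE; hypsubst) (rule cm[OF rels(14)] cm[OF rels(17)]; simp)+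
    qed
  qed
qed

subsection \<open>Constraints satisfied by the vertex groups\<close>

text \<open>Certificates of non-membership: all conditions are linear in homomorphisms to the
  two-element group, so they pass from the generators to the whole vertex group.\<close>

fun constr :: "vert \<Rightarrow> aut \<Rightarrow> bool" where
  "constr vA k = (\<not> e_al k \<and> \<not> e_a k)"
| "constr vB k = (\<not> e_be k)"
| "constr vC k = (\<not> e_ga k)"
| "constr vA1 k = (\<not> e_be k \<and> \<not> e_ga k \<and> \<not> e_a k)"
| "constr vB1 k = (\<not> e_al k \<and> sgG k = (e_a k \<noteq> e_ga k))"
| "constr vC1 k = (e_al k = e_a k \<and> sgG k = (e_al k \<noteq> e_be k))"

lemmas hom_comps = e_comps sgG_comp

lemma stab_constr: assumes "k \<in> stab X" shows "constr X k"
proof -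
  have "constr X k \<and> k \<in> Gam" using assms unfolding stab_gen
  proof (induction rule: gen.induct)
    case gen_id show ?case by (cases X) (simp_all only: constr.simps e_id sgG_gens Gam_id simp_thms)
  next
    case (gen_mult s g)
    then have s: "s \<in> Gam" using gens_Gam by blast
    have "constr X s" using gen_mult(1)
      by (cases X) (auto simp: hom_comps Gam_gens Gam_comp simp del: o_apply)
    then show ?case using gen_mult(3) s Gam_comp[of s g]
      by (cases X) (auto simp: hom_comps simp del: o_apply)
  qed
  then show ?thesis by blast
qed

lemma stab_fixes: assumes "k \<in> stab X" shows "pl k (vert_image X) = vert_image X"
proof -
  have "pl k (vert_image X) = vert_image X \<and> k \<in> Gam" using assms unfolding stab_gen
  proof (induction rule: gen.induct)
    case gen_id show ?case by (metis id_apply pl_gens(1) Gam_id)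
  next
    case (gen_mult s g)
    then have s: "s \<in> Gam" using gens_Gam by blast
    have "pl s (vert_image X) = vert_image X" using gen_mult(1)
      by (cases X) (auto simp: pl_comp pl_gens Gam_gens Gam_comp pA_def pB_def pC_def rf_a_def rf_b_def rf_c_def)
    moreover have "pl (s \<circ> g) (vert_image X) = pl g (pl s (vert_image X))"
      using pl_comp[OF s, of g] gen_mult(3) by (metis comp_apply)
    ultimately show ?case using gen_mult(3) Gam_comp[OF s, of g] by metis
  qed
  then show ?thesis by blast
qed

lemma gen_JJ_N: assumes "S \<subseteq> {g_alpha, g_beta, g_gamma}" "k \<in> gen S" shows "k \<in> Gam" "nu k = id" "\<not> sgG k" "mw (k w) = mw w"
proof -
  have *: "k \<in> Gam \<and> nu k = id" using assms(2)
  proof (induction rule: gen.induct)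
    case gen_id show ?case by (simp only: nu_gens Gam_id simp_thms)
  next
    case (gen_mult s g)
    then have "s \<in> Gam \<and> nu s = id" using assms(1) by (auto simp: Gam_gens nu_gens)
    then show ?case using gen_mult(3) Gam_comp[of s g] by (simp add: nu_comp del: o_apply)
  qed
  then show "k \<in> Gam" "nu k = id" by auto
  then show "\<not> sgG k" by (simp only: sgG_def sgh_id not_False_eq_True)
  show "mw (k w) = mw w" using nu_mw[of k w] * by simp
qed

lemma JJ_sub: "JJ X \<subseteq> {g_alpha, g_beta, g_gamma}" by (cases X) auto

lemma DD_sub: "DD X \<subseteq> Gam"
  by (cases X) (simp_all add: dih_def Gam_id Gam_gens Gam_comp del: o_apply)

lemma DD_trivial: assumes d: "d \<in> DD X" and "pl d = id" shows "d = id"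
proof -
  \<comment> \<open>A point inside the triangle, moved by every nontrivial word in the
    lists.\<close>
  have "pl d (1/5, 2/5) = (1/5, 2/5)" using assms(2) by simp
  then show ?thesis using d
    by (cases X; simp only: DD.simps dih_def; elim insertE emptyE)
       (simp_all add: pl_comp pl_gens Gam_gens Gam_comp rf_a_def rf_b_def rf_c_def)
qed

lemma stab_kernel: assumes k: "k \<in> stab X" "pl k = id" shows "k \<in> gen (JJ X)"
proof -
  obtain j d where jd: "j \<in> gen (JJ X)" "d \<in> DD X" "k = j \<circ> d" using stab_normal_form[OF k(1)] by blast
  have "pl k = pl d \<circ> pl j" using pl_comp gen_JJ_N(1)[OF JJ_sub jd(1)] DD_sub jd by blast
  then have "pl d = id" using k(2) gen_JJ_N(2)[OF JJ_sub jd(1)] by (simp only: plane_act_gens comp_id)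
  then have "d = id" using DD_trivial jd(2) by blast
  then show ?thesis using jd by (simp only: comp_id)
qed

subsection \<open>Rotations\<close>

lemma e_a_moves: assumes "g \<in> Gam" "e_a g" "mw (g v) = mw v" shows "v = []"
proof (cases v)
  case (Cons x u)
  then have "mu_letter (lt g x) = mu_letter x" using assms by (simp add: TA_Cons Gam_TA)
  then have "par (lt g x) = par x" by (simp add: par_mu)
  then show ?thesis using lt_V4[OF assms(1), of x] assms(2) by auto
qed

text \<open>The sections exchange the two binary letters, so no word of length two or more keeps its
  binary image, and words of length at most one are fixed.\<close>

lemma rot2: assumes g: "g \<in> Gam" and "\<And>x. lt g x = x" "\<And>x. e_a (sect g [x])" "mw (g v) = mw v" shows "g v = v"
proof (cases v)
  case Nil then show ?thesis using g by (simp add: TA_NilD Gam_TA)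
next
  case (Cons x u)
  have gv: "g v = x # sect g [x] u" using Cons assms(2) g by (simp add: TA_Cons Gam_TA)
  then have "mw (sect g [x] u) = mw u" using assms(4) Cons by simp
  then have "u = []" using e_a_moves[OF Gam_sect1[OF g] assms(3)] by blast
  then show ?thesis using gv Cons TA_length[OF Gam_TA[OF g], of v] by simp
qed

lemma rot_C2: assumes "mw ((aal \<circ> (bbe \<circ> (aal \<circ> bbe))) v) = mw v" shows "(aal \<circ> (bbe \<circ> (aal \<circ> bbe))) v = v"
proof (rule rot2)
  show "aal \<circ> (bbe \<circ> (aal \<circ> bbe)) \<in> Gam" by (simp add: Gam_gens Gam_comp del: o_apply)
  show "lt (aal \<circ> (bbe \<circ> (aal \<circ> bbe))) x = x" for x
    by (cases x) (simp_all add: lt_comp del: o_apply)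
  show "e_a (sect (aal \<circ> (bbe \<circ> (aal \<circ> bbe))) [x])" for x
    by (cases x) (simp_all add: lt_comp sect_comp1 e_comp_a Gam_gens Gam_comp Gam_id del: o_apply)
qed (rule assms)

text \<open>At the letters 1 and 2 the sections of these rotations exchange the binary letters; at 3
  and 4 they are the same two rotations interchanged. The half turn in \<open>rot_A2\<close> reduces
  to \<open>rot_C2\<close> in the same manner.\<close>

lemma rot_A: "mw ((g_b \<circ> g_c) v) = mw v \<Longrightarrow> (g_b \<circ> g_c) v = v" "mw ((g_c \<circ> g_b) v) = mw v \<Longrightarrow> (g_c \<circ> g_b) v = v"
proof -
  have a: "mw (g_a (g_alpha (g_b (g_beta u)))) = mw u \<Longrightarrow> u = []" "mw (g_b (g_beta (g_a (g_alpha u)))) = mw u \<Longrightarrow> u = []" for u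
  proof -
    have "aal \<circ> bbe \<in> Gam" "bbe \<circ> aal \<in> Gam" "e_a (aal \<circ> bbe)" "e_a (bbe \<circ> aal)"
      by (simp_all add: Gam_gens Gam_comp e_comp_a del: o_apply)
    then show "mw (g_a (g_alpha (g_b (g_beta u)))) = mw u \<Longrightarrow> u = []" "mw (g_b (g_beta (g_a (g_alpha u)))) = mw u \<Longrightarrow> u = []"
      using e_a_moves[of "aal \<circ> bbe" u] e_a_moves[of "bbe \<circ> aal" u] by auto
  qed
  have "(mw (g_b (g_c v)) = mw v \<longrightarrow> g_b (g_c v) = v) \<and> (mw (g_c (g_b v)) = mw v \<longrightarrow> g_c (g_b v) = v)"
    by (induction v rule: letter_length_induct) (auto dest: a)
  then show "mw ((g_b \<circ> g_c) v) = mw v \<Longrightarrow> (g_b \<circ> g_c) v = v" "mw ((g_c \<circ> g_b) v) = mw v \<Longrightarrow> (g_c \<circ> g_b) v = v" by auto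
qed

lemma rot_A2: "mw ((g_b \<circ> (g_c \<circ> (g_b \<circ> g_c))) v) = mw v \<Longrightarrow> (g_b \<circ> (g_c \<circ> (g_b \<circ> g_c))) v = v"
proof -
  have c: "g_a (g_alpha (g_b (g_beta (g_a (g_alpha (g_b (g_beta u))))))) = u"
    if "mw (g_a (g_alpha (g_b (g_beta (g_a (g_alpha (g_b (g_beta u)))))))) = mw u" for u
    using rot_C2[of u] that by simp
  have d: "g_b (g_beta (g_a (g_alpha (g_b (g_beta (g_a (g_alpha u))))))) = u"
    if "mw (g_b (g_beta (g_a (g_alpha (g_b (g_beta (g_a (g_alpha u)))))))) = mw u" for u
    using rot_C2[of u] that fun_cong[OF rel_C, of u] by simp
  have "(mw (g_b (g_c (g_b (g_c v)))) = mw v \<longrightarrow> g_b (g_c (g_b (g_c v))) = v) \<and>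
    (mw (g_c (g_b (g_c (g_b v)))) = mw v \<longrightarrow> g_c (g_b (g_c (g_b v))) = v)"
    by (induction v rule: letter_length_induct) (auto dest: c d)
  then show "mw ((g_b \<circ> (g_c \<circ> (g_b \<circ> g_c))) v) = mw v \<Longrightarrow> (g_b \<circ> (g_c \<circ> (g_b \<circ> g_c))) v = v" by auto
qed

lemma DD_rotation: assumes d: "d \<in> DD X" and s: "\<not> sgG d" and m: "mw (d v) = mw v" shows "d v = v"
proof -
  note G = Gam_gens Gam_comp
  have ea: "u = []" if "g \<in> Gam" "e_a g" "mw (g u) = mw u" for g u using e_a_moves that by blast
  have Nil: "g [] = []" if "g \<in> Gam" for g using that by (simp add: TA_NilD Gam_TA)
  have A: "d v = v" if "d \<in> dih g_b g_c"
    using that s m rot_A[of v] rot_A2[of v] unfolding dih_def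
    by (elim insertE emptyE) (simp_all add: sgG_comp G)
  have B: "d v = v" if "d \<in> {id, g_a, cga, g_a \<circ> cga}"
  proof -
    have "d = id \<or> d = g_a \<circ> cga" using that s by (elim insertE emptyE) (simp_all add: sgG_comp G del: o_apply)
    moreover have "g_a \<circ> cga \<in> Gam" "e_a (g_a \<circ> cga)" by (simp_all add: G e_comp_a del: o_apply)
    ultimately show ?thesis using ea[of "g_a \<circ> cga" v] Nil[of "g_a \<circ> cga"] m by auto
  qed
  have C: "d v = v" if "d \<in> dih aal bbe"
  proof -
    have "d = id \<or> d = aal \<circ> bbe \<or> d = bbe \<circ> aal \<or> d = aal \<circ> (bbe \<circ> (aal \<circ> bbe))"
      using that s unfolding dih_def by (elim insertE emptyE) (simp_all add: sgG_comp G del: o_apply)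
    moreover have "aal \<circ> bbe \<in> Gam" "bbe \<circ> aal \<in> Gam" "e_a (aal \<circ> bbe)" "e_a (bbe \<circ> aal)"
      by (simp_all add: G e_comp_a del: o_apply)
    ultimately show ?thesis
      using ea[of "aal \<circ> bbe" v] ea[of "bbe \<circ> aal" v] Nil[of "aal \<circ> bbe"] Nil[of "bbe \<circ> aal"] m rot_C2[of v] by auto
  qed
  show ?thesis using A B C d by (cases X) simp_all
qed

subsection \<open>Intersections\<close>

text \<open>At the letters 2 and 3 the generator \<gamma> has trivial sections, so only the parity
  of the number of factors \<beta> matters there.\<close>

lemma gen_letter_fix: assumes "k \<in> gen {g_beta, g_gamma}"
  shows "k \<in> Gam \<and> lt k x = x \<and> (sect k [L2] = (if e_be k then g_gamma else id)) \<and> sect k [L3] = (if e_be k then g_alpha else id)"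
  using assms
proof (induction rule: gen.induct)
  case gen_id show ?case by (simp only: e_id lt_id sect_id if_False Gam_id simp_thms)
next
  case (gen_mult s g)
  then have s: "s = g_beta \<or> s = g_gamma" by blast
  have "g_gamma \<circ> g_gamma = id" "g_alpha \<circ> g_alpha = id" by (auto simp: fun_eq_iff)
  moreover have "lt g L2 = L2" "lt g L3 = L3" 
  proof -
    have "lt g y = y" for y
    proof -
      have "\<not> e_al g \<and> \<not> e_a g \<and> g \<in> Gam" using gen_mult(2)
      proof (induction rule: gen.induct)
        case gen_id show ?case by (simp only: e_id Gam_id simp_thms)
      next
        case (gen_mult s g) then show ?case by (auto simp: e_comps Gam_gens Gam_comp simp del: o_apply)
      qed
      then show ?thesis using lt_V4[of g y] letter_eqI[of "lt g y" y] by auto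
    qed
    then show "lt g L2 = L2" "lt g L3 = L3" by auto
  qed
  ultimately show ?case using s gen_mult(3)
    by (elim disjE) (auto simp: lt_comp sect_comp1 Gam_TA e_comp_be Gam_gens Gam_comp simp del: o_apply)
qed

lemma pow_id: "g_alpha \<circ> g_alpha = id" "g_beta \<circ> g_beta = id" "g_gamma \<circ> g_gamma = id"
  by (auto simp: fun_eq_iff)

lemma gen_single: assumes "s \<circ> s = id" "k \<in> gen {s}" shows "k = id \<or> k = s"
  using assms(2)
proof (induction rule: gen.induct)
  case gen_id show ?case by simp
next
  case (gen_mult t g)
  then show ?case using assms(1) by (metis comp_id singletonD)
qed

lemma gen_al_ga: assumes "k \<in> gen {g_alpha, g_gamma}"
  shows "k \<in> Gam \<and> \<not> e_a k \<and> \<not> e_be k \<and> (\<exists>i j. sect k [L1] = (if i then g_beta else id) \<and> sect k [L4] = (if i then g_beta else id)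
    \<and> sect k [L2] = (if j then g_beta else id) \<and> sect k [L3] = (if j then g_beta else id))"
  using assms
proof (induction rule: gen.induct)
  case gen_id show ?case by (intro conjI exI[of _ False]) (simp_all only: e_id sect_id if_False Gam_id not_False_eq_True)
next
  case (gen_mult s g)
  then obtain i j where g: "g \<in> Gam" "\<not> e_a g" "\<not> e_be g" "sect g [L1] = (if i then g_beta else id)" "sect g [L4] = (if i then g_beta else id)"
    "sect g [L2] = (if j then g_beta else id)" "sect g [L3] = (if j then g_beta else id)" by blast
  have lt: "lt g x = (if e_al g then lt g_alpha x else x)" for x
    using lt_V4[OF g(1), of x] g(2) letter_eqI[of "lt g x" "lt g_alpha x"] letter_eqI[of "lt g x" x]
    by (cases x; cases "e_al g"; simp)
  have "s = g_alpha \<or> s = g_gamma" using gen_mult(1) by blast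
  then show ?case
  proof
    assume s: "s = g_alpha"
    show ?thesis using g unfolding s
      by (intro conjI exI[of _ i] exI[of _ j]) (simp_all add: sect_comp1 Gam_TA e_comps Gam_gens Gam_comp del: o_apply)
  next
    assume s: "s = g_gamma"
    show ?thesis
    proof (cases "e_al g")
      case True
      show ?thesis using g lt True unfolding s
        by (intro conjI exI[of _ i] exI[of _ "\<not> j"])
          (simp_all add: sect_comp1 Gam_TA e_comps Gam_gens Gam_comp pow_id del: o_apply)
    next
      case False
      show ?thesis using g lt False unfolding s
        by (intro conjI exI[of _ "\<not> i"] exI[of _ j])
          (simp_all add: sect_comp1 Gam_TA e_comps Gam_gens Gam_comp pow_id del: o_apply)
    qed
  qed
qed

lemma gen_al_be: assumes "k \<in> gen {g_alpha, g_beta}"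
  shows "k \<in> Gam \<and> \<not> e_a k \<and> \<not> e_ga k \<and> sect k [L1] = sect k [L3] \<and> sect k [L2] = sect k [L4]
    \<and> (\<forall>x. sect k [x] \<in> gen {g_alpha, g_gamma})"
  using assms
proof (induction rule: gen.induct)
  case gen_id show ?case by (simp only: e_id sect_id Gam_id gen.gen_id simp_thms)
next
  case (gen_mult s g)
  then have g: "g \<in> Gam" "\<not> e_a g" by blast+
  have lt: "lt g x = (if e_al g then lt g_alpha x else x)" for x
    using lt_V4[OF g(1), of x] g(2) letter_eqI[of "lt g x" "lt g_alpha x"] letter_eqI[of "lt g x" x]
    by (cases x; cases "e_al g"; simp)
  have "s = g_alpha \<or> s = g_beta" using gen_mult(1) by blast
  then show ?case
  proof
    assume s: "s = g_alpha"
    show ?thesis using gen_mult(3) unfolding s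
      by (simp add: sect_comp1 Gam_TA e_comps Gam_gens Gam_comp del: o_apply)
  next
    assume s: "s = g_beta"
    have "sect g_beta [y] \<in> gen {g_alpha, g_gamma}" for y by (cases y) (simp_all add: gen_incl)
    then show ?thesis using gen_mult(3) lt unfolding s
      by (cases "e_al g") (simp_all add: sect_comp1 Gam_TA e_comps Gam_gens Gam_comp gen_comp del: o_apply)
  qed
qed

lemma sect_id_imp: assumes "k \<in> Gam" "\<not> e_al k" "\<not> e_a k" "\<And>x. sect k [x] = sect l [x]" "l \<in> Gam" "\<not> e_al l" "\<not> e_a l"
  shows "k = l"
proof (rule TA_eqI)
  show "lt k x = lt l x" for x using lt_V4[OF assms(1), of x] lt_V4[OF assms(5), of x] assms by (intro letter_eqI) auto
qed (use assms Gam_TA in auto)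

text \<open>The parity \<open>e_be\<close> vanishes on the group of \<alpha> and \<gamma>, which by
  membership in the other group makes the sections at 2 and 3 trivial; those at 1 and 4 coincide and
  equal \<open>id\<close> or \<beta>.\<close>

lemma gen_inter_AB: assumes "k \<in> gen {g_beta, g_gamma}" "k \<in> gen {g_alpha, g_gamma}" shows "k = id \<or> k = g_gamma"
proof -
  note 1 = gen_letter_fix[OF assms(1)]
  have al: "\<not> e_al k" using 1[of L1] by (simp add: e_al_def)
  obtain i j where k: "k \<in> Gam" "\<not> e_a k" "\<not> e_be k" "sect k [L1] = (if i then g_beta else id)" "sect k [L4] = (if i then g_beta else id)"
    "sect k [L2] = (if j then g_beta else id)" "sect k [L3] = (if j then g_beta else id)" using gen_al_ga[OF assms(2)] by blast
  have 2: "sect k [L2] = id" "sect k [L3] = id" using 1 k(3) by simp_all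
  show ?thesis
  proof (cases i)
    case True
    have "sect k [x] = sect g_gamma [x]" for x using k(4,5) 2 True by (cases x) simp_all
    then show ?thesis using sect_id_imp[of k g_gamma] k al Gam_gens by simp
  next
    case False
    have "sect k [x] = sect id [x]" for x using k(4,5) 2 False by (cases x) (simp_all only: sect_id if_False)
    then have "k = id" using sect_id_imp[of k id] k al Gam_id e_id by blast
    then show ?thesis by blast
  qed
qed

text \<open>One group makes the sections at 1 and 3 and those at 2 and 4 agree, the other expresses
  those at 2 and 3 by \<open>e_be\<close>; so \<open>e_be\<close> alone decides.\<close>

lemma gen_inter_AC: assumes "k \<in> gen {g_beta, g_gamma}" "k \<in> gen {g_alpha, g_beta}" shows "k = id \<or> k = g_beta"
proof -
  note 1 = gen_letter_fix[OF assms(1)]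
  have al: "\<not> e_al k" using 1[of L1] by (simp add: e_al_def)
  note k = gen_al_be[OF assms(2)]
  show ?thesis
  proof (cases "e_be k")
    case True
    have "sect k [x] = sect g_beta [x]" for x using k 1[of L1] True by (cases x) simp_all
    then show ?thesis using sect_id_imp[of k g_beta] k al Gam_gens by simp
  next
    case False
    have "sect k [x] = sect id [x]" for x using k 1[of L1] False by (cases x) (simp_all only: sect_id if_False)
    then have "k = id" using sect_id_imp[of k id] k al Gam_id e_id by blast
    then show ?thesis by blast
  qed
qed

text \<open>Up to a factor \<alpha> the element fixes the letters. Its sections lie in the group of
  \<alpha> and \<gamma> and are \<open>id\<close> or \<beta>, while \<open>e_be\<close> excludes
  \<beta> from that group.\<close>

lemma gen_inter_BC: assumes "k \<in> gen {g_alpha, g_gamma}" "k \<in> gen {g_alpha, g_beta}" shows "k = id \<or> k = g_alpha"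
proof -
  have *: "k = id" if kk: "k \<in> gen {g_alpha, g_gamma}" "k \<in> gen {g_alpha, g_beta}" "\<not> e_al k" for k
  proof -
    obtain i j where k: "k \<in> Gam" "\<not> e_a k" "\<not> e_be k" "sect k [L1] = (if i then g_beta else id)" "sect k [L4] = (if i then g_beta else id)"
      "sect k [L2] = (if j then g_beta else id)" "sect k [L3] = (if j then g_beta else id)" using gen_al_ga[OF kk(1)] by blast
    note c = gen_al_be[OF kk(2)]
    have "g_beta \<notin> gen {g_alpha, g_gamma}" using gen_al_ga[of g_beta] by auto
    then have "\<not> i" "\<not> j" using c k by (metis (full_types))+
    then have "sect k [x] = sect id [x]" for x using k by (cases x) (simp_all only: sect_id if_False)
    then show "k = id" using sect_id_imp[of k id] k kk(3) Gam_id e_id by blast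
  qed
  show ?thesis
  proof (cases "e_al k")
    case False then show ?thesis using * assms by blast
  next
    case True
    have "\<not> e_al (g_alpha \<circ> k)" using True e_comp_al[of g_alpha k] gen_al_be[OF assms(2)] Gam_gens by simp
    moreover have "g_alpha \<circ> k \<in> gen {g_alpha, g_gamma}" "g_alpha \<circ> k \<in> gen {g_alpha, g_beta}" using assms by (simp_all add: gen.gen_mult)
    ultimately have "g_alpha \<circ> k = id" using * by blast
    then have "g_alpha \<circ> (g_alpha \<circ> k) = g_alpha" by simp
    then show ?thesis using pow_id by (metis comp_assoc id_comp)
  qed
qed

section \<open>Topology of finite complexes, trees and two-sheeted maps\<close>

section \<open>Quotient topologies and realizations\<close>

lemma istopology_quotient:
  "istopology (\<lambda>U. U \<subseteq> f ` topspace X \<and> openin X {x \<in> topspace X. f x \<in> U})"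
  unfolding istopology_def
proof (intro conjI allI impI)
  fix S T assume "S \<subseteq> f ` topspace X \<and> openin X {x \<in> topspace X. f x \<in> S}"
    "T \<subseteq> f ` topspace X \<and> openin X {x \<in> topspace X. f x \<in> T}"
  moreover have "{x \<in> topspace X. f x \<in> S \<inter> T} = {x \<in> topspace X. f x \<in> S} \<inter> {x \<in> topspace X. f x \<in> T}"
    by auto
  ultimately show "S \<inter> T \<subseteq> f ` topspace X" "openin X {x \<in> topspace X. f x \<in> S \<inter> T}"
    by auto
next
  fix K assume K: "\<forall>U\<in>K. U \<subseteq> f ` topspace X \<and> openin X {x \<in> topspace X. f x \<in> U}"
  have "{x \<in> topspace X. f x \<in> \<Union>K} = \<Union>((\<lambda>U. {x \<in> topspace X. f x \<in> U}) ` K)" by auto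
  then show "openin X {x \<in> topspace X. f x \<in> \<Union>K}" using K by auto
  show "\<Union>K \<subseteq> f ` topspace X" using K by auto
qed

lemma openin_quotient_topology:
  "openin (quotient_topology X f) U \<longleftrightarrow> U \<subseteq> f ` topspace X \<and> openin X {x \<in> topspace X. f x \<in> U}"
  unfolding quotient_topology_def by (simp add: istopology_quotient)

lemma topspace_quotient_topology [simp]: "topspace (quotient_topology X f) = f ` topspace X"
proof
  show "topspace (quotient_topology X f) \<subseteq> f ` topspace X"
    using openin_quotient_topology[of X f "topspace (quotient_topology X f)"] by simp
  have "{x \<in> topspace X. f x \<in> f ` topspace X} = topspace X" by auto
  then show "f ` topspace X \<subseteq> topspace (quotient_topology X f)"
    by (intro openin_subset) (simp add: openin_quotient_topology)
qed

lemma quotient_map_quotient_topology: "quotient_map X (quotient_topology X f) f"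
  unfolding quotient_map_def by (auto simp: openin_quotient_topology)

abbreviation cell :: "'v set \<Rightarrow> ('v \<Rightarrow> real) set" where
  "cell s \<equiv> realization (Pow s - {{}})"

lemma cell_eq:
  assumes "finite s"
  shows "cell s = {f. (\<forall>v. 0 \<le> f v) \<and> (\<forall>v. v \<notin> s \<longrightarrow> f v = 0) \<and> sum f s = 1}"
proof -
  have eq: "(\<Sum>v | f v \<noteq> 0. f v) = sum f s" if "\<forall>v. v \<notin> s \<longrightarrow> f v = 0" for f :: "'a \<Rightarrow> real"
    using that assms by (intro sum.mono_neutral_left) auto
  show ?thesis
  proof (intro Set.set_eqI iffI)
    fix f :: "'a \<Rightarrow> real" assume "f \<in> cell s"
    then have f: "\<forall>v. 0 \<le> f v" "{v. f v \<noteq> 0} \<subseteq> s" "(\<Sum>v | f v \<noteq> 0. f v) = 1"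
      by (auto simp: realization_def)
    then have "\<forall>v. v \<notin> s \<longrightarrow> f v = 0" by auto
    with eq f show "f \<in> {f. (\<forall>v. 0 \<le> f v) \<and> (\<forall>v. v \<notin> s \<longrightarrow> f v = 0) \<and> sum f s = 1}" by auto
  next
    fix f :: "'a \<Rightarrow> real" assume "f \<in> {f. (\<forall>v. 0 \<le> f v) \<and> (\<forall>v. v \<notin> s \<longrightarrow> f v = 0) \<and> sum f s = 1}"
    then have f: "\<forall>v. 0 \<le> f v" "\<forall>v. v \<notin> s \<longrightarrow> f v = 0" "sum f s = 1" by auto
    have "{v. f v \<noteq> 0} \<noteq> {}" using f(2,3) eq[of f] by fastforce
    moreover have "{v. f v \<noteq> 0} \<subseteq> s" using f(2) by auto
    ultimately show "f \<in> cell s" using f eq[of f] by (auto simp: realization_def)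
  qed
qed

lemma Hausdorff_fun: "Hausdorff_space (euclidean :: ('v \<Rightarrow> real) topology)"
proof -
  have "Hausdorff_space (product_topology (\<lambda>_. euclidean) UNIV :: ('v \<Rightarrow> real) topology)"
    unfolding Hausdorff_space_product_topology by (simp add: Hausdorff_space_euclidean)
  then show ?thesis by (simp add: euclidean_product_topology)
qed

lemma compact_cell:
  assumes "finite s"
  shows "compact (cell s)"
proof -
  let ?B = "PiE UNIV (\<lambda>v. if v \<in> s then {0..1} else {0}) :: ('a \<Rightarrow> real) set"
  have "compactin (product_topology (\<lambda>_. euclidean) UNIV) ?B"
    unfolding compactin_PiE by auto
  then have B: "compact ?B" by (simp add: euclidean_product_topology)
  have cl: "closed {f. (\<forall>v. 0 \<le> f v) \<and> (\<forall>v. v \<notin> s \<longrightarrow> f v = 0) \<and> sum f s = (1::real)}"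
    by (intro closed_Collect_conj closed_Collect_all closed_Collect_le closed_Collect_eq
        closed_Collect_imp continuous_on_sum continuous_on_product_coordinates continuous_on_const) simp
  have "cell s \<subseteq> ?B"
  proof
    fix f assume "f \<in> cell s"
    then have f: "\<forall>v. 0 \<le> f v" "\<forall>v. v \<notin> s \<longrightarrow> f v = 0" "sum f s = 1" by (auto simp: cell_eq[OF assms])
    have "f v \<le> 1" if "v \<in> s" for v using member_le_sum[OF that, of f] f assms by auto
    then show "f \<in> ?B" using f by auto
  qed
  then have "cell s = ?B \<inter> cell s" by blast
  also have "compact \<dots>" unfolding cell_eq[OF assms] by (rule compact_Int_closed[OF B cl])
  finally show ?thesis .
qed

lemma compact_imp_closed_fun: "compact (S :: ('v \<Rightarrow> real) set) \<Longrightarrow> closed S"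
  using compactin_imp_closedin[OF Hausdorff_fun, of S] by simp

lemma closed_cell: "finite s \<Longrightarrow> closed (cell s)"
  by (intro compact_imp_closed_fun compact_cell)

definition simplicial :: "'v set set \<Rightarrow> bool" where
  "simplicial K \<longleftrightarrow> (\<forall>s\<in>K. finite s \<and> s \<noteq> {} \<and> (\<forall>t. t \<subseteq> s \<and> t \<noteq> {} \<longrightarrow> t \<in> K))"

lemma cell_subset_realization: "simplicial K \<Longrightarrow> s \<in> K \<Longrightarrow> cell s \<subseteq> realization K"
proof
  fix f assume K: "simplicial K" "s \<in> K" and f: "f \<in> cell s"
  then have "{v. f v \<noteq> 0} \<subseteq> s" "{v. f v \<noteq> 0} \<noteq> {}" by (auto simp: realization_def)
  with K have "{v. f v \<noteq> 0} \<in> K" unfolding simplicial_def by blast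
  with f show "f \<in> realization K" by (simp add: realization_def)
qed

lemma realization_eq_Union: assumes "simplicial K" shows "realization K = (\<Union>s\<in>K. cell s)"
proof -
  have "f \<in> cell {v. f v \<noteq> 0}" if "f \<in> realization K" for f
    using that assms by (auto simp: realization_def simplicial_def)
  moreover have "{v. f v \<noteq> 0} \<in> K" if "f \<in> realization K" for f using that by (simp add: realization_def)
  ultimately show ?thesis using cell_subset_realization[OF assms] by blast
qed

lemma istopology_realization: "istopology (\<lambda>U. U \<subseteq> realization K \<and>
    (\<forall>s\<in>K. openin (top_of_set (cell s)) (U \<inter> cell s)))"
  unfolding istopology_def
proof (intro conjI allI impI ballI)
  fix S T s assume *: "S \<subseteq> realization K \<and> (\<forall>s\<in>K. openin (top_of_set (cell s)) (S \<inter> cell s))"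
    "T \<subseteq> realization K \<and> (\<forall>s\<in>K. openin (top_of_set (cell s)) (T \<inter> cell s))" 
  then show "S \<inter> T \<subseteq> realization K" by auto
  assume "s \<in> K"
  then have "openin (top_of_set (cell s)) ((S \<inter> cell s) \<inter> (T \<inter> cell s))" using * by blast
  moreover have "(S \<inter> cell s) \<inter> (T \<inter> cell s) = S \<inter> T \<inter> cell s" by auto
  ultimately show "openin (top_of_set (cell s)) (S \<inter> T \<inter> cell s)" by simp
next
  fix \<K> s assume *: "\<forall>S\<in>\<K>. S \<subseteq> realization K \<and> (\<forall>s\<in>K. openin (top_of_set (cell s)) (S \<inter> cell s))"
  then show "\<Union>\<K> \<subseteq> realization K" by auto
  assume "s \<in> K"
  then have "openin (top_of_set (cell s)) (\<Union>S\<in>\<K>. S \<inter> cell s)" using * by blast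
  moreover have "(\<Union>S\<in>\<K>. S \<inter> cell s) = \<Union>\<K> \<inter> cell s" by auto
  ultimately show "openin (top_of_set (cell s)) (\<Union>\<K> \<inter> cell s)" by simp
qed

lemma openin_realization: "openin (realization_topology K) U \<longleftrightarrow> U \<subseteq> realization K \<and>
    (\<forall>s\<in>K. openin (top_of_set (cell s)) (U \<inter> cell s))"
  unfolding realization_topology_def using istopology_realization[of K] by simp

lemma topspace_realization [simp]:
  assumes "simplicial K" shows "topspace (realization_topology K) = realization K"
proof
  show "topspace (realization_topology K) \<subseteq> realization K"
    using openin_realization[of K "topspace (realization_topology K)"] by simp
  have "realization K \<inter> cell s = cell s" if "s \<in> K" for s
    using cell_subset_realization[OF assms that] by blast
  then show "realization K \<subseteq> topspace (realization_topology K)"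
    by (intro openin_subset) (simp add: openin_realization)
qed

lemma closedin_realization:
  assumes K: "simplicial K"
  shows "closedin (realization_topology K) C \<longleftrightarrow> C \<subseteq> realization K \<and> (\<forall>s\<in>K. closed (C \<inter> cell s))"
proof -
  have "openin (top_of_set (cell s)) ((realization K - C) \<inter> cell s) \<longleftrightarrow> closed (C \<inter> cell s)"
    if "s \<in> K" for s
  proof -
    have "(realization K - C) \<inter> cell s = cell s - (C \<inter> cell s)"
      using cell_subset_realization[OF K that] by blast
    then have "openin (top_of_set (cell s)) ((realization K - C) \<inter> cell s)
        \<longleftrightarrow> closedin (top_of_set (cell s)) (C \<inter> cell s)"
      by (simp add: closedin_def)
    also have "\<dots> \<longleftrightarrow> closed (C \<inter> cell s)"
      using closed_cell[of s] K that unfolding simplicial_def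
      by (metis Int_lower2 closed_subset closedin_closed_trans)
    finally show ?thesis .
  qed
  then show ?thesis by (auto simp: closedin_def openin_realization K)
qed

lemma compact_realization:
  assumes "simplicial K" "finite K" shows "compact (realization K)"
proof -
  have "compact (cell s)" if "s \<in> K" for s
    using that assms(1) by (auto simp: simplicial_def intro: compact_cell)
  then show ?thesis unfolding realization_eq_Union[OF assms(1)] using assms(2) by (intro compact_UN) auto
qed

text \<open>A set closed in every cell is a finite union of closed pieces, and cells are closed in
  the whole function space because they are compact.\<close>

lemma realization_topology_finite:
  assumes K: "simplicial K" "finite K"
  shows "realization_topology K = top_of_set (realization K)"
proof -
  have cR: "closed (realization K)" by (rule compact_imp_closed_fun[OF compact_realization[OF K]])
  have "closedin (realization_topology K) C \<longleftrightarrow> closedin (top_of_set (realization K)) C" for C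
  proof
    assume "closedin (realization_topology K) C"
    then have C: "C \<subseteq> realization K" "\<And>s. s \<in> K \<Longrightarrow> closed (C \<inter> cell s)"
      by (auto simp: closedin_realization K)
    then have "C = (\<Union>s\<in>K. C \<inter> cell s)" using realization_eq_Union[OF K(1)] by blast
    moreover have "closed \<dots>" using C(2) K(2) by (intro closed_UN) auto
    ultimately show "closedin (top_of_set (realization K)) C" using C(1) by (metis closed_subset)
  next
    assume C: "closedin (top_of_set (realization K)) C"
    have "closed C" using closedin_closed_trans[OF C cR] .
    have "C \<subseteq> realization K" using closedin_subset[OF C] by simp
    moreover have "closed (C \<inter> cell s)" if "s \<in> K" for s
      using that K(1) closed_Int[OF \<open>closed C\<close> closed_cell] unfolding simplicial_def by blast
    ultimately show "closedin (realization_topology K) C"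
      unfolding closedin_realization[OF K(1)] by blast
  qed
  then show ?thesis unfolding topology_eq openin_closedin_eq by (simp add: K(1))
qed

section \<open>Trees\<close>

definition graph_complex :: "'v set \<Rightarrow> 'v set set \<Rightarrow> 'v set set" where
  "graph_complex V E = (\<lambda>v. {v}) ` V \<union> E"

definition dirac :: "'v \<Rightarrow> 'v \<Rightarrow> real" where "dirac v = (\<lambda>u. if u = v then 1 else 0)"

text \<open>Acyclicity is expressed by requiring every edge to be a bridge, which is easy to check for
  wedges of graphs.\<close>

definition tree_graph :: "'v set \<Rightarrow> 'v set set \<Rightarrow> bool" where
  "tree_graph V E \<longleftrightarrow> finite V \<and> V \<noteq> {} \<and> E \<subseteq> {{u, v} | u v. u \<in> V \<and> v \<in> V \<and> u \<noteq> v} \<and>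
    graph_connected V E \<and>
    (\<forall>e\<in>E. \<exists>S. \<forall>u v. {u, v} \<in> E \<longrightarrow> ((u \<in> S) \<noteq> (v \<in> S) \<longleftrightarrow> {u, v} = e))"

lemma tree_graph_bridge:
  "tree_graph V E \<Longrightarrow> e \<in> E \<Longrightarrow> \<exists>S. \<forall>u v. {u, v} \<in> E \<longrightarrow> ((u \<in> S) \<noteq> (v \<in> S) \<longleftrightarrow> {u, v} = e)"
  by (simp only: tree_graph_def)

lemma tree_graph_edge: "tree_graph V E \<Longrightarrow> {u, v} \<in> E \<Longrightarrow> u \<in> V \<and> v \<in> V \<and> u \<noteq> v"
  unfolding tree_graph_def by (blast dest: doubleton_eq_iff[THEN iffD1])

lemma finite_edges: "tree_graph V E \<Longrightarrow> finite E"
  unfolding tree_graph_def by (rule finite_subset[of _ "Pow V"]) auto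

lemma simplicial_graph: assumes "tree_graph V E" shows "simplicial (graph_complex V E)" "finite (graph_complex V E)"
proof -
  show "finite (graph_complex V E)"
    using assms finite_edges[OF assms] by (simp add: graph_complex_def tree_graph_def)
  have "finite e \<and> e \<noteq> {} \<and> (\<forall>t. t \<subseteq> e \<and> t \<noteq> {} \<longrightarrow> t \<in> graph_complex V E)" if eE: "e \<in> E" for e
  proof -
    obtain u v where e: "e = {u, v}" "u \<in> V" "v \<in> V"
    proof -
      have "e \<in> {{u, v} | u v. u \<in> V \<and> v \<in> V \<and> u \<noteq> v}" using eE assms unfolding tree_graph_def by blast
      then show thesis using that by blast
    qed
    then have "t = {u} \<or> t = {v} \<or> t = e" if "t \<subseteq> e" "t \<noteq> {}" for t using that by blast
    then show ?thesis using e eE by (auto simp: graph_complex_def)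
  qed
  moreover have "finite {v} \<and> {v} \<noteq> {} \<and> (\<forall>t. t \<subseteq> {v} \<and> t \<noteq> {} \<longrightarrow> t \<in> graph_complex V E)" if "v \<in> V" for v
  proof -
    have "t = {v}" if "t \<subseteq> {v}" "t \<noteq> {}" for t using that by blast
    then show ?thesis using that by (auto simp: graph_complex_def)
  qed
  ultimately show "simplicial (graph_complex V E)" unfolding simplicial_def graph_complex_def[of V E]
    by (auto simp: graph_complex_def)
qed

text \<open>Removing the last edge of a cycle leaves a path between its ends that never crosses the
  cut belonging to this edge, so both ends would lie on the same side.\<close>

lemma bridges_no_cycle: assumes "tree_graph V E" shows "\<not> graph_cycle E vs"
proof
  assume c: "graph_cycle E vs"
  define n where "n = length vs"
  have n: "3 \<le> n" and d: "distinct vs" and e: "\<And>i. Suc i < n \<Longrightarrow> {vs ! i, vs ! Suc i} \<in> E"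
    and l: "{last vs, hd vs} \<in> E" using c by (auto simp: graph_cycle_def n_def)
  have lh: "last vs = vs ! (n - 1)" "hd vs = vs ! 0" using n unfolding n_def
    by (metis last_conv_nth list.size(3) not_numeral_le_zero, metis hd_conv_nth list.size(3) not_numeral_le_zero)
  obtain S where "\<forall>u v. {u, v} \<in> E \<longrightarrow> (((u \<in> S) \<noteq> (v \<in> S)) \<longleftrightarrow> {u, v} = {last vs, hd vs})"
    using tree_graph_bridge[OF assms l] by (elim exE)
  then have S: "\<And>u v. {u, v} \<in> E \<Longrightarrow> ((u \<in> S) \<noteq> (v \<in> S)) \<longleftrightarrow> {u, v} = {last vs, hd vs}" by blast
  have const: "vs ! i \<in> S \<longleftrightarrow> vs ! 0 \<in> S" if "i < n" for i
    using that
  proof (induction i)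
    case (Suc i)
    have "{vs ! i, vs ! Suc i} \<noteq> {vs ! (n - 1), vs ! 0}"
    proof
      assume "{vs ! i, vs ! Suc i} = {vs ! (n - 1), vs ! 0}"
      then have "(vs ! i = vs ! (n - 1) \<and> vs ! Suc i = vs ! 0) \<or> (vs ! i = vs ! 0 \<and> vs ! Suc i = vs ! (n - 1))"
        by (simp only: doubleton_eq_iff)
      moreover have "vs ! k = vs ! l \<longleftrightarrow> k = l" if "k < n" "l < n" for k l
        using that d by (simp add: n_def nth_eq_iff_index_eq)
      ultimately show False using Suc(2) n by auto
    qed
    then have "vs ! Suc i \<in> S \<longleftrightarrow> vs ! i \<in> S" using S[OF e[OF Suc(2)]] unfolding lh by simp
    then show ?case using Suc by simp
  qed simp
  have "vs ! (n - 1) \<in> S \<longleftrightarrow> vs ! 0 \<in> S" using const[of "n - 1"] n by simp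
  moreover have "(last vs \<in> S) \<noteq> (hd vs \<in> S)" using S[OF l] by simp
  ultimately show False unfolding lh by simp
qed

text \<open>Serves two purposes: \<open>finite_tree\<close> asks for natural numbers as vertices,
  and transporting a \<open>marked_tree\<close> turns the vertices into points of another
  space.\<close>

lemma rename_tree_graph:
  assumes T: "tree_graph V E" and g: "inj_on g V"
  shows "tree_graph (g ` V) ((`) g ` E)" (is ?A)
    and "\<exists>r. homeomorphic_map (top_of_set (realization (graph_complex V E)))
      (top_of_set (realization (graph_complex (g ` V) ((`) g ` E)))) r \<and> (\<forall>v\<in>V. r (dirac v) = dirac (g v))" (is ?B)
proof -
  have E: "E \<subseteq> {{u, v} | u v. u \<in> V \<and> v \<in> V \<and> u \<noteq> v}" using T by (simp add: tree_graph_def)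
  have inE: "{g u, g v} \<in> (`) g ` E \<longleftrightarrow> {u, v} \<in> E" if "u \<in> V" "v \<in> V" for u v
  proof
    assume "{g u, g v} \<in> (`) g ` E"
    then obtain e where e: "e \<in> E" "g ` {u, v} = g ` e" by auto
    then have "e \<subseteq> V" using E by auto
    then have "e = {u, v}" using e(2) that inj_on_image_eq_iff[OF g, of "{u, v}" e] by auto
    then show "{u, v} \<in> E" using e by simp
  next
    assume "{u, v} \<in> E" then show "{g u, g v} \<in> (`) g ` E" by (intro image_eqI[of _ _ "{u, v}"]) auto
  qed
  show ?A unfolding tree_graph_def
  proof (intro conjI ballI)
    show "finite (g ` V)" "g ` V \<noteq> {}" using T by (auto simp: tree_graph_def)
    show "(`) g ` E \<subseteq> {{u, v} |u v. u \<in> g ` V \<and> v \<in> g ` V \<and> u \<noteq> v}"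
    proof
      fix e' assume "e' \<in> (`) g ` E"
      then obtain u v where "e' = {g u, g v}" "u \<in> V" "v \<in> V" "u \<noteq> v" using E by force
      then show "e' \<in> {{u, v} |u v. u \<in> g ` V \<and> v \<in> g ` V \<and> u \<noteq> v}" using g by (auto simp: inj_on_def)
    qed
    have "(g u, g v) \<in> {(x, y). {x, y} \<in> (`) g ` E}\<^sup>*" if "(u, v) \<in> {(x, y). {x, y} \<in> E}\<^sup>*" for u v
      using that
    proof (induction rule: rtrancl_induct)
      case (step y z)
      then have "{g y, g z} \<in> (`) g ` E" by (auto intro!: image_eqI[of _ _ "{y, z}"])
      then show ?case using step(3) by (auto intro: rtrancl_into_rtrancl)
    qed simp
    then show "graph_connected (g ` V) ((`) g ` E)" using T by (auto simp: tree_graph_def graph_connected_def)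
    fix e' assume "e' \<in> (`) g ` E"
    then obtain e where e: "e \<in> E" "e' = g ` e" by auto
    obtain S where "\<forall>u v. {u, v} \<in> E \<longrightarrow> (((u \<in> S) \<noteq> (v \<in> S)) \<longleftrightarrow> {u, v} = e)"
      using tree_graph_bridge[OF T e(1)] by (elim exE)
    then have S: "\<And>u v. {u, v} \<in> E \<Longrightarrow> ((u \<in> S) \<noteq> (v \<in> S)) \<longleftrightarrow> {u, v} = e" by blast
    show "\<exists>S. \<forall>u v. {u, v} \<in> (`) g ` E \<longrightarrow> ((u \<in> S) \<noteq> (v \<in> S) \<longleftrightarrow> {u, v} = e')"
    proof (intro exI[of _ "g ` (S \<inter> V)"] allI impI)
      fix u' v' assume uv: "{u', v'} \<in> (`) g ` E"
      then obtain d where d: "d \<in> E" "{u', v'} = g ` d" by auto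
      then have "d \<subseteq> V" using E by auto
      then obtain u v where u: "u \<in> V" "v \<in> V" "u' = g u" "v' = g v" 
        using d(2) by (metis imageE insertI1 insert_subset subsetD insert_commute)
      then have uvE: "{u, v} \<in> E" using uv inE by blast
      have m: "g x \<in> g ` (S \<inter> V) \<longleftrightarrow> x \<in> S" if "x \<in> V" for x using that g by (auto simp: inj_on_def)
      have "e \<subseteq> V" using E e by auto
      then have "{u', v'} = e' \<longleftrightarrow> {u, v} = e"
        using inj_on_image_eq_iff[OF g, of "{u, v}" e] u e(2) by auto
      then show "(u' \<in> g ` (S \<inter> V)) \<noteq> (v' \<in> g ` (S \<inter> V)) \<longleftrightarrow> {u', v'} = e'"
        using S[OF uvE] m u by auto
    qed
  qed
  let ?K = "graph_complex V E" and ?K' = "graph_complex (g ` V) ((`) g ` E)"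
  have KK: "s \<in> ?K \<longleftrightarrow> g ` s \<in> ?K'" if "s \<subseteq> V" for s
  proof
    assume "s \<in> ?K" then show "g ` s \<in> ?K'" by (auto simp: graph_complex_def)
  next
    assume "g ` s \<in> ?K'"
    moreover have "?K' = (`) g ` ?K" by (simp add: graph_complex_def image_Un image_image)
    ultimately obtain t where t: "t \<in> ?K" "g ` s = g ` t" by (auto simp del: image_Un)
    have "t \<subseteq> V" using t(1) E by (auto simp: graph_complex_def)
    then show "s \<in> ?K" using t inj_on_image_eq_iff[OF g that] by auto
  qed
  have KV: "s \<subseteq> V" if "s \<in> ?K" for s using that E by (auto simp: graph_complex_def)
  have KV': "s \<subseteq> g ` V" if "s \<in> ?K'" for s using that KV by (auto simp: graph_complex_def)
  define r where "r = (\<lambda>(f :: 'a \<Rightarrow> real) k. if k \<in> g ` V then f (inv_into V g k) else 0)"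
  define r' where "r' = (\<lambda>(f :: 'b \<Rightarrow> real) v. if v \<in> V then f (g v) else 0)"
  have rr: "r' (r f) = f" if "f \<in> realization ?K" for f
    using that KV[of "{v. f v \<noteq> 0}"] g by (auto simp: r_def r'_def realization_def fun_eq_iff)
  have rr': "r (r' f) = f" if "f \<in> realization ?K'" for f
    using that KV'[of "{v. f v \<noteq> 0}"] g by (auto simp: r_def r'_def realization_def fun_eq_iff inv_into_into f_inv_into_f)
  have r: "r f \<in> realization ?K'" if "f \<in> realization ?K" for f
  proof -
    have f: "\<And>v. 0 \<le> f v" "{v. f v \<noteq> 0} \<in> ?K" "(\<Sum>v | f v \<noteq> 0. f v) = 1" using that by (auto simp: realization_def)
    have V: "{v. f v \<noteq> 0} \<subseteq> V" using KV f(2) by blast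
    have rg: "r f (g v) = f v" if "v \<in> V" for v using that g by (simp add: r_def)
    have s: "{k. r f k \<noteq> 0} = g ` {v. f v \<noteq> 0}"
    proof (intro equalityI subsetI)
      fix k assume k: "k \<in> {k. r f k \<noteq> 0}"
      then have "k \<in> g ` V" by (auto simp: r_def split: if_splits)
      then obtain v where "v \<in> V" "k = g v" by blast
      then show "k \<in> g ` {v. f v \<noteq> 0}" using k rg by auto
    qed (use rg V in auto)
    have "(\<Sum>k \<in> g ` {v. f v \<noteq> 0}. r f k) = (\<Sum>v | f v \<noteq> 0. r f (g v))"
      using g V by (subst sum.reindex) (auto intro: inj_on_subset)
    also have "\<dots> = 1" unfolding f(3)[symmetric] using V rg by (intro sum.cong) auto
    finally show ?thesis using f KK[OF V] by (auto simp: realization_def s) (auto simp: r_def)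
  qed
  have r': "r' f \<in> realization ?K" if "f \<in> realization ?K'" for f
  proof -
    have f: "\<And>v. 0 \<le> f v" "{v. f v \<noteq> 0} \<in> ?K'" "(\<Sum>v | f v \<noteq> 0. f v) = 1" using that by (auto simp: realization_def)
    have V: "{v. f v \<noteq> 0} \<subseteq> g ` V" using KV' f(2) by blast
    have s: "g ` {k. r' f k \<noteq> 0} = {v. f v \<noteq> 0}" using V by (auto simp: r'_def)
    have sV: "{k. r' f k \<noteq> 0} \<subseteq> V" by (auto simp: r'_def)
    have "(\<Sum>k | r' f k \<noteq> 0. r' f k) = (\<Sum>k | r' f k \<noteq> 0. f (g k))"
      by (intro sum.cong) (auto simp: r'_def split: if_splits)
    also have "\<dots> = (\<Sum>v \<in> g ` {k. r' f k \<noteq> 0}. f v)"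
      using inj_on_subset[OF g sV] by (subst sum.reindex) auto
    finally show ?thesis using f KK[OF sV] by (auto simp: realization_def s) (auto simp: r'_def)
  qed
  have "continuous_on UNIV (\<lambda>f. r f i)" for i unfolding r_def by (cases "i \<in> g ` V") simp_all
  moreover have "continuous_on UNIV (\<lambda>f. r' f i)" for i unfolding r'_def by (cases "i \<in> V") simp_all
  ultimately have c: "continuous_on UNIV r" "continuous_on UNIV r'"
    by (blast intro: continuous_on_coordinatewise_then_product)+
  have "homeomorphic_maps (top_of_set (realization ?K)) (top_of_set (realization ?K')) r r'"
    unfolding homeomorphic_maps_def using rr rr' r r' continuous_on_subset[OF c(1)] continuous_on_subset[OF c(2)]
    by (auto simp: continuous_map_in_subtopology)
  moreover have "r (dirac v) = dirac (g v)" if "v \<in> V" for v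
    using that g by (auto simp: r_def dirac_def fun_eq_iff)
  ultimately show ?B using homeomorphic_maps_map by blast
qed

text \<open>The vertices are points of the space itself, and the chart sends each of them to its own
  Dirac function. Two charts therefore agree at a common vertex and paste without renaming or
  subdividing.\<close>

definition marked_tree :: "'a topology \<Rightarrow> 'a set \<Rightarrow> bool" where
  "marked_tree X V \<longleftrightarrow> V \<subseteq> topspace X \<and> (\<exists>E f. tree_graph V E \<and>
    homeomorphic_map X (top_of_set (realization (graph_complex V E))) f \<and> (\<forall>v\<in>V. f v = dirac v))"

lemma marked_tree_imp_finite_tree: assumes "marked_tree X V" shows "finite_tree X"
proof -
  obtain E f where E: "tree_graph V E" and f: "homeomorphic_map X (top_of_set (realization (graph_complex V E))) f"
    using assms by (auto simp: marked_tree_def)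
  obtain g :: "'a \<Rightarrow> nat" where g: "inj_on g V"
    using E finite_imp_inj_to_nat_seg[of V] by (auto simp: tree_graph_def)
  note R = rename_tree_graph[OF E g]
  obtain r where r: "homeomorphic_map (top_of_set (realization (graph_complex V E)))
      (top_of_set (realization (graph_complex (g ` V) ((`) g ` E)))) r" using R(2) by blast
  have "X homeomorphic_space realization_topology (graph_complex (g ` V) ((`) g ` E))"
    unfolding realization_topology_finite[OF simplicial_graph[OF R(1)]]
    using homeomorphic_map_compose[OF f r] homeomorphic_map_imp_homeomorphic_space by blast
  moreover have "finite_graph_tree (g ` V) ((`) g ` E)"
    using R(1) bridges_no_cycle[OF R(1)] by (auto simp: finite_graph_tree_def tree_graph_def)
  ultimately show ?thesis unfolding finite_tree_def graph_complex_def by blast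
qed

lemma marked_tree_space: assumes "marked_tree X V" shows "compact_space X" "Hausdorff_space X"
proof -
  obtain E f where E: "tree_graph V E" and f: "homeomorphic_map X (top_of_set (realization (graph_complex V E))) f"
    using assms by (auto simp: marked_tree_def)
  have h: "X homeomorphic_space top_of_set (realization (graph_complex V E))"
    using f homeomorphic_map_imp_homeomorphic_space by blast
  show "compact_space X" using homeomorphic_compact_space[OF h] compact_realization[OF simplicial_graph[OF E]]
    by (simp add: compact_space_subtopology)
  show "Hausdorff_space X" using homeomorphic_Hausdorff_space[OF h] Hausdorff_space_subtopology[OF Hausdorff_fun] by simp
qed

lemma marked_tree_transfer:
  assumes h: "homeomorphic_map Y X h" and T: "marked_tree X V"
  shows "marked_tree Y {y \<in> topspace Y. h y \<in> V}"
proof -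
  obtain E f where E: "tree_graph V E" and f: "homeomorphic_map X (top_of_set (realization (graph_complex V E))) f"
    and fv: "\<And>v. v \<in> V \<Longrightarrow> f v = dirac v" and VX: "V \<subseteq> topspace X" using T by (auto simp: marked_tree_def)
  obtain k where k: "homeomorphic_maps Y X h k" using h homeomorphic_map_maps by blast
  then have hk: "\<And>x. x \<in> topspace X \<Longrightarrow> h (k x) = x \<and> k x \<in> topspace Y" "\<And>y. y \<in> topspace Y \<Longrightarrow> k (h y) = y"
    by (auto simp: homeomorphic_maps_def continuous_map_def)
  have kV: "k ` V = {y \<in> topspace Y. h y \<in> V}"
    using hk VX by (auto simp: image_iff) metis
  have ki: "inj_on k V" using hk VX by (metis inj_on_def subsetD)
  note R = rename_tree_graph[OF E ki]
  obtain r where r: "homeomorphic_map (top_of_set (realization (graph_complex V E)))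
      (top_of_set (realization (graph_complex (k ` V) ((`) k ` E)))) r"
    and rd: "\<And>v. v \<in> V \<Longrightarrow> r (dirac v) = dirac (k v)" using R(2) by blast
  have "homeomorphic_map Y (top_of_set (realization (graph_complex (k ` V) ((`) k ` E)))) (r \<circ> (f \<circ> h))"
    by (intro homeomorphic_map_compose[OF _ r] homeomorphic_map_compose[OF h f])
  moreover have "(r \<circ> (f \<circ> h)) y = dirac y" if "y \<in> k ` V" for y
    using that hk VX fv rd by (auto simp: subset_eq)
  ultimately show ?thesis unfolding marked_tree_def kV[symmetric] using R(1) kV
    by (intro conjI exI[of _ "(`) k ` E"] exI[of _ "r \<circ> (f \<circ> h)"]) auto
qed

lemma graph_connected_glue:
  assumes "graph_connected V1 E1" "graph_connected V2 E2" "p \<in> V1" "p \<in> V2"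
  shows "graph_connected (V1 \<union> V2) (E1 \<union> E2)"
proof -
  let ?R = "{(x, y). {x, y} \<in> E1 \<union> E2}\<^sup>*"
  have 1: "{(x, y). {x, y} \<in> E1}\<^sup>* \<subseteq> ?R" "{(x, y). {x, y} \<in> E2}\<^sup>* \<subseteq> ?R" by (rule rtrancl_mono; auto)+
  have "(u, p) \<in> ?R \<and> (p, u) \<in> ?R" if "u \<in> V1 \<union> V2" for u
    using assms 1 that unfolding graph_connected_def by blast
  then show ?thesis unfolding graph_connected_def by (meson rtrancl_trans)
qed

text \<open>A cut for an edge of one graph extends by placing the whole second graph on the side of
  the common vertex.\<close>

lemma tree_graph_glue:
  assumes T: "tree_graph V1 E1" "tree_graph V2 E2" and p: "V1 \<inter> V2 = {p}"
  shows "tree_graph (V1 \<union> V2) (E1 \<union> E2)"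
  unfolding tree_graph_def
proof (intro conjI ballI)
  have bridge: "\<exists>S. \<forall>u v. {u, v} \<in> E1 \<union> E2 \<longrightarrow> ((u \<in> S) \<noteq> (v \<in> S) \<longleftrightarrow> {u, v} = e)"
    if T: "tree_graph V1 E1" "tree_graph V2 E2" and p: "V1 \<inter> V2 = {p}" and e: "e \<in> E1"
    for V1 V2 E1 E2 e
  proof -
    obtain S1 where "\<forall>u v. {u, v} \<in> E1 \<longrightarrow> (((u \<in> S1) \<noteq> (v \<in> S1)) \<longleftrightarrow> {u, v} = e)"
      using tree_graph_bridge[OF T(1) e] by (elim exE)
    then have S1: "\<And>u v. {u, v} \<in> E1 \<Longrightarrow> ((u \<in> S1) \<noteq> (v \<in> S1)) \<longleftrightarrow> {u, v} = e" by blast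
    define S where "S = (if p \<in> S1 then (S1 \<inter> V1) \<union> V2 else S1 \<inter> V1)"
    have "(u \<in> S) \<noteq> (v \<in> S) \<longleftrightarrow> {u, v} = e" if "{u, v} \<in> E1 \<union> E2" for u v
    proof (cases "{u, v} \<in> E1")
      case True
      then have "u \<in> V1" "v \<in> V1" using tree_graph_edge[OF T(1)] by auto
      then have "u \<in> S \<longleftrightarrow> u \<in> S1" "v \<in> S \<longleftrightarrow> v \<in> S1" using p unfolding S_def by auto
      then show ?thesis using S1[OF True] by simp
    next
      case False
      then have "{u, v} \<in> E2" using that by blast
      then have uv: "u \<in> V2" "v \<in> V2" "u \<noteq> v" using tree_graph_edge[OF T(2), of u v] by blast+
      have "u \<in> S \<longleftrightarrow> u \<in> V2 \<and> p \<in> S1" if "u \<in> V2" for u using p that unfolding S_def by auto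
      then show ?thesis using False e uv by metis
    qed
    then show ?thesis by blast
  qed
  fix e assume "e \<in> E1 \<union> E2"
  then show "\<exists>S. \<forall>u v. {u, v} \<in> E1 \<union> E2 \<longrightarrow> ((u \<in> S) \<noteq> (v \<in> S) \<longleftrightarrow> {u, v} = e)"
  proof
    assume "e \<in> E1" then show ?thesis by (rule bridge[OF T p])
  next
    assume e: "e \<in> E2"
    have "V2 \<inter> V1 = {p}" using p by blast
    from bridge[OF T(2,1) this e] show ?thesis by (simp only: Un_commute[of E2 E1])
  qed
next
  show "graph_connected (V1 \<union> V2) (E1 \<union> E2)"
    using T p by (intro graph_connected_glue[of _ _ _ _ p]) (auto simp: tree_graph_def)
  show "E1 \<union> E2 \<subseteq> {{u, v} |u v. u \<in> V1 \<union> V2 \<and> v \<in> V1 \<union> V2 \<and> u \<noteq> v}"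
  proof -
    have "E1 \<subseteq> {{u, v} |u v. u \<in> V1 \<and> v \<in> V1 \<and> u \<noteq> v}" "E2 \<subseteq> {{u, v} |u v. u \<in> V2 \<and> v \<in> V2 \<and> u \<noteq> v}"
      using T by (simp_all add: tree_graph_def)
    moreover have "{{u, v} |u v. u \<in> V \<and> v \<in> V \<and> u \<noteq> v} \<subseteq> {{u, v} |u v. u \<in> V' \<and> v \<in> V' \<and> u \<noteq> v}"
      if "V \<subseteq> V'" for V V' :: "'a set" using that by auto
    ultimately show ?thesis by (meson Un_least Un_upper1 Un_upper2 order_trans)
  qed
qed (use T in \<open>auto simp: tree_graph_def\<close>)

text \<open>Both charts send c to \<open>dirac c\<close>, the only common point of the two
  realizations, so they paste to a continuous bijection from a compact space to a Hausdorff
  space.\<close>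

lemma marked_tree_glue:
  assumes cl: "closedin X S" "closedin X T" and un: "S \<union> T = topspace X" and int: "S \<inter> T = {c}"
    and trees: "marked_tree (subtopology X S) V" "marked_tree (subtopology X T) W" and c: "c \<in> V" "c \<in> W"
  shows "marked_tree X (V \<union> W)"
proof -
  have ST: "S \<subseteq> topspace X" "T \<subseteq> topspace X" using un by auto
  obtain E f where E: "tree_graph V E" and f: "homeomorphic_map (subtopology X S) (top_of_set (realization (graph_complex V E))) f"
    and fv: "\<And>v. v \<in> V \<Longrightarrow> f v = dirac v" and VS: "V \<subseteq> S"
    using trees(1) ST by (auto simp: marked_tree_def)
  obtain F g where F: "tree_graph W F" and g: "homeomorphic_map (subtopology X T) (top_of_set (realization (graph_complex W F))) g"
    and gv: "\<And>v. v \<in> W \<Longrightarrow> g v = dirac v" and WT: "W \<subseteq> T"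
    using trees(2) ST by (auto simp: marked_tree_def)
  have VW: "V \<inter> W = {c}" using VS WT c int by blast
  note G = tree_graph_glue[OF E F VW]
  let ?A = "realization (graph_complex V E)" and ?B = "realization (graph_complex W F)"
    and ?C = "realization (graph_complex (V \<union> W) (E \<union> F))"
  have Cu: "?C = ?A \<union> ?B" by (auto simp: realization_def graph_complex_def)
  have AB: "?A \<inter> ?B = {dirac c}"
  proof
    show "?A \<inter> ?B \<subseteq> {dirac c}"
    proof
      fix h assume h: "h \<in> ?A \<inter> ?B"
      have sub: "s \<subseteq> V" if "s \<in> graph_complex V E" for s
        using that E unfolding tree_graph_def graph_complex_def by auto
      have sub': "s \<subseteq> W" if "s \<in> graph_complex W F" for s
        using that F unfolding tree_graph_def graph_complex_def by auto
      have 1: "{v. h v \<noteq> 0} \<subseteq> {c}" using h sub[of "{v. h v \<noteq> 0}"] sub'[of "{v. h v \<noteq> 0}"] VW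
        unfolding realization_def by blast
      have "{v. h v \<noteq> 0} \<noteq> {}"
      proof
        assume e: "{v. h v \<noteq> 0} = {}"
        have "sum h {v. h v \<noteq> 0} = 1" using h by (simp add: realization_def)
        then show False unfolding e by simp
      qed
      with 1 have s: "{v. h v \<noteq> 0} = {c}" by blast
      then have "h c = 1" using h by (simp add: realization_def)
      then show "h \<in> {dirac c}" using s by (auto simp: dirac_def fun_eq_iff)
    qed
    have "f ` S = ?A" "g ` T = ?B"
      using f g ST by (auto simp: homeomorphic_eq_everything_map Int_absorb1)
    then have "f c \<in> ?A" "g c \<in> ?B" using c VS WT by blast+
    then show "{dirac c} \<subseteq> ?A \<inter> ?B" using fv gv c by auto
  qed
  define h where "h = (\<lambda>x. if x \<in> S then f x else g x)"
  have hS: "h x = f x" if "x \<in> S" for x using that by (simp add: h_def)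
  have hT: "h x = g x" if "x \<in> T" for x
  proof (cases "x \<in> S")
    case True
    then have "x = c" using that int by blast
    then show ?thesis using fv gv c by (simp add: h_def)
  qed (simp add: h_def)
  have fA: "f ` S = ?A" "inj_on f S" and gB: "g ` T = ?B" "inj_on g T"
    using f g ST by (auto simp: homeomorphic_eq_everything_map Int_absorb1)
  have cont: "continuous_map X (top_of_set ?C) h"
    unfolding continuous_map_closedin
  proof (intro conjI Pi_I allI impI)
    fix x assume "x \<in> topspace X"
    then have "x \<in> S \<or> x \<in> T" using un by blast
    then show "h x \<in> topspace (top_of_set ?C)"
      using fA(1) gB(1) hS hT Cu by auto
  next
    fix D assume D: "closedin (top_of_set ?C) D"
    have "closedin (top_of_set ?A) (D \<inter> ?A)" "closedin (top_of_set ?B) (D \<inter> ?B)"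
    proof -
      obtain D' where D': "closed D'" "D = ?C \<inter> D'" using D closedin_closed by blast
      have "D \<inter> ?A = ?A \<inter> D'" "D \<inter> ?B = ?B \<inter> D'" unfolding D'(2) Cu by blast+
      then show "closedin (top_of_set ?A) (D \<inter> ?A)" "closedin (top_of_set ?B) (D \<inter> ?B)"
        using closedin_closed_Int[OF D'(1)] by simp_all
    qed
    then have "closedin (subtopology X S) {x \<in> S. f x \<in> D \<inter> ?A}" "closedin (subtopology X T) {x \<in> T. g x \<in> D \<inter> ?B}"
      using f g ST unfolding homeomorphic_eq_everything_map continuous_map_closedin
      by (auto simp: Int_absorb1)
    then have "closedin X {x \<in> S. f x \<in> D \<inter> ?A}" "closedin X {x \<in> T. g x \<in> D \<inter> ?B}"
      using cl closedin_trans_full by blast+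
    moreover have "{x \<in> topspace X. h x \<in> D} = {x \<in> S. f x \<in> D \<inter> ?A} \<union> {x \<in> T. g x \<in> D \<inter> ?B}"
      unfolding un[symmetric] using fA(1) gB(1) hS hT by auto
    ultimately show "closedin X {x \<in> topspace X. h x \<in> D}" by (simp add: closedin_Un)
  qed
  have "compactin X S" "compactin X T"
    using marked_tree_space(1)[OF trees(1)] marked_tree_space(1)[OF trees(2)] ST
    by (auto simp: compactin_subspace)
  then have "compactin X (topspace X)" using un compactin_Un by metis
  then have comp: "compact_space X" by (simp add: compact_space_def)
  have clm: "closed_map X (top_of_set ?C) h"
    using continuous_imp_closed_map_gen[OF comp Hausdorff_imp_kc_space[OF Hausdorff_space_subtopology[OF Hausdorff_fun]] cont] .
  have im: "h ` topspace X = ?C" unfolding un[symmetric] Cu image_Un using hS hT fA gB by auto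
  have inj: "inj_on h (topspace X)"
  proof (rule inj_onI)
    have *: "x = y" if "x \<in> S" "y \<in> T" "h x = h y" for x y
    proof -
      have "f x = g y" using that hS hT by simp
      moreover have "f x \<in> ?A" "g y \<in> ?B" using that fA(1) gB(1) by blast+
      ultimately have "f x = dirac c" "g y = dirac c" using AB by auto
      then show "x = y" using fv gv c fA(2) gB(2) that VS WT by (metis inj_onD subsetD)
    qed
    fix x y assume "x \<in> topspace X" "y \<in> topspace X" "h x = h y"
    then show "x = y" using * un hS hT fA(2) gB(2) unfolding inj_on_def by (metis UnE)
  qed
  have "homeomorphic_map X (top_of_set ?C) h"
    using bijective_closed_imp_homeomorphic_map[OF cont clm _ inj] im by simp
  moreover have "h v = dirac v" if "v \<in> V \<union> W" for v using that hS hT fv gv VS WT by auto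
  ultimately show ?thesis unfolding marked_tree_def using G VS WT ST by blast
qed

lemma marked_tree_singleton: assumes "topspace X = {c}" shows "marked_tree X {c}"
proof -
  have T: "tree_graph {c} {}" by (auto simp: tree_graph_def graph_connected_def)
  have R: "realization (graph_complex {c} {}) = {dirac c}"
  proof (intro Set.set_eqI iffI)
    fix h assume h: "h \<in> realization (graph_complex {c} {})"
    then have s: "{v. h v \<noteq> 0} = {c}" by (auto simp: realization_def graph_complex_def)
    then have "h c = 1" using h by (simp add: realization_def)
    then show "h \<in> {dirac c}" using s by (auto simp: dirac_def fun_eq_iff)
  next
    fix h assume "h \<in> {dirac c}"
    then show "h \<in> realization (graph_complex {c} {})"
      by (auto simp: realization_def graph_complex_def dirac_def)
  qed
  have "homeomorphic_map X (top_of_set (realization (graph_complex {c} {}))) (\<lambda>x. dirac c)"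
    unfolding R
  proof (rule bijective_closed_imp_homeomorphic_map)
    show "continuous_map X (top_of_set {dirac c}) (\<lambda>x. dirac c)" by simp
    show "closed_map X (top_of_set {dirac c}) (\<lambda>x. dirac c)"
    proof (unfold closed_map_def, intro allI impI)
      fix U assume "closedin X U"
      then have "U = {} \<or> U = {c}" using closedin_subset[of X U] assms by auto
      then show "closedin (top_of_set {dirac c}) ((\<lambda>x. dirac c) ` U)"
        using closedin_topspace[of "top_of_set {dirac c}"] by (elim disjE) simp_all
    qed
  qed (auto simp: assms)
  then show ?thesis unfolding marked_tree_def using T assms by auto
qed

lemma marked_tree_segment:
  fixes l :: real
  assumes h: "homeomorphic_map X (top_of_set {0..l}) h" and l: "0 < l"
    and uv: "u \<in> topspace X" "v \<in> topspace X" "h u = 0" "h v = l"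
  shows "marked_tree X {u, v}"
proof -
  have ne: "u \<noteq> v" using uv l by auto
  have T: "tree_graph {u, v} {{u, v}}"
    unfolding tree_graph_def
  proof (intro conjI)
    show "graph_connected {u, v} {{u, v}}" unfolding graph_connected_def by (auto simp: insert_commute)
    show "\<forall>e\<in>{{u, v}}. \<exists>S. \<forall>x y. {x, y} \<in> {{u, v}} \<longrightarrow> ((x \<in> S) \<noteq> (y \<in> S) \<longleftrightarrow> {x, y} = e)"
      using ne by (auto intro!: exI[of _ "{u}"] simp: doubleton_eq_iff)
  qed (use ne in auto)
  let ?K = "graph_complex {u, v} {{u, v}}"
  define k where "k = (\<lambda>t x. if x = u then 1 - t / l else if x = v then t / l else 0)"
  have R: "realization ?K = cell {u, v}"
  proof -
    have "?K = Pow {u, v} - {{}}" by (auto simp: graph_complex_def)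
    then show ?thesis by simp
  qed
  have eq: "realization ?K = {f. (\<forall>x. 0 \<le> f x) \<and> (\<forall>x. x \<notin> {u, v} \<longrightarrow> f x = 0) \<and> f u + f v = 1}"
    unfolding R using cell_eq[of "{u, v}"] ne by simp
  have "continuous_on {0..l} (\<lambda>t. k t i)" for i unfolding k_def
    using l by (cases "i = u"; cases "i = v"; simp; intro continuous_intros; simp)
  then have c: "continuous_on {0..l} k" by (rule continuous_on_coordinatewise_then_product)
  have im: "k ` {0..l} = realization ?K"
  proof
    show "k ` {0..l} \<subseteq> realization ?K" unfolding eq using l ne by (auto simp: k_def field_simps)
    show "realization ?K \<subseteq> k ` {0..l}"
    proof
      fix f assume "f \<in> realization ?K"
      then have f: "\<And>x. 0 \<le> f x" "\<And>x. x \<notin> {u, v} \<Longrightarrow> f x = 0" "f u + f v = 1" unfolding eq by auto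
      have "f = k (l * f v)" using f(2,3) l ne by (auto simp: k_def fun_eq_iff)
      moreover have "l * f v \<in> {0..l}" using f(1)[of u] f(1)[of v] f(3) l
        by (auto simp: mult_le_cancel_left1)
      ultimately show "f \<in> k ` {0..l}" by blast
    qed
  qed
  have inj: "inj_on k {0..l}"
  proof (rule inj_onI)
    fix s t assume "k s = k t" 
    then have "k s v = k t v" by simp
    then show "s = t" using l ne by (simp add: k_def)
  qed
  have km: "continuous_map (top_of_set {0..l}) (top_of_set (realization ?K)) k"
    using c im by (auto simp: continuous_map_in_subtopology)
  have cs: "compact_space (top_of_set {0..l})" by (simp add: compact_space_subtopology)
  have "homeomorphic_map (top_of_set {0..l}) (top_of_set (realization ?K)) k"
    by (rule bijective_closed_imp_homeomorphic_map[OF km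
       continuous_imp_closed_map_gen[OF cs Hausdorff_imp_kc_space[OF Hausdorff_space_subtopology[OF Hausdorff_fun]] km]])
       (use im inj in auto)
  from homeomorphic_map_compose[OF h this]
  have "homeomorphic_map X (top_of_set (realization ?K)) (k \<circ> h)" .
  moreover have "(k \<circ> h) x = dirac x" if "x \<in> {u, v}" for x
    using that uv l ne by (auto simp: k_def dirac_def fun_eq_iff)
  ultimately show ?thesis unfolding marked_tree_def using T uv by blast
qed

section \<open>Two sheets glued at a point\<close>

text \<open>Off c the two sheets are disjoint open sets, which gives the covering and the local
  homeomorphisms. The map is open on each sheet; if it were injective near c, the images of the two
  halves of a neighbourhood would meet in an isolated point of the connected space Y, which
  \<open>big\<close> excludes.\<close>

lemma two_sheets:
  assumes cl: "closedin X S" "closedin X T" and un: "S \<union> T = topspace X" and int: "S \<inter> T = {c}"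
    and hS: "homeomorphic_map (subtopology X S) Y p" and hT: "homeomorphic_map (subtopology X T) Y p"
    and Y: "Hausdorff_space Y" "connected_space Y" and big: "\<exists>y\<in>topspace Y. y \<noteq> p c"
  shows "branched_covering_of_degree 2 X Y p" "critical_points X Y p = {c}"
proof -
  have ST: "S \<subseteq> topspace X" "T \<subseteq> topspace X" using un by auto
  have cS: "c \<in> S" "c \<in> T" using int by auto
  have pS: "p ` S = topspace Y" "inj_on p S" and pT: "p ` T = topspace Y" "inj_on p T"
    using hS hT ST by (auto simp: homeomorphic_eq_everything_map Int_absorb1)
  have oS: "open_map (subtopology X S) Y p" "closed_map (subtopology X S) Y p"
    and oT: "open_map (subtopology X T) Y p" "closed_map (subtopology X T) Y p"
    using hS hT by (auto simp: homeomorphic_eq_everything_map)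
  have pc: "p x = p c \<Longrightarrow> x = c" if "x \<in> topspace X" for x
    using that un cS pS(2) pT(2) unfolding inj_on_def by blast
  have cont: "continuous_map X Y p"
    unfolding continuous_map_closedin
  proof (intro conjI Pi_I allI impI)
    fix x assume "x \<in> topspace X" then show "p x \<in> topspace Y" using un pS pT by blast
  next
    fix D assume D: "closedin Y D"
    have "closedin (subtopology X S) {x \<in> S. p x \<in> D}" "closedin (subtopology X T) {x \<in> T. p x \<in> D}"
      using hS hT D ST unfolding homeomorphic_eq_everything_map continuous_map_closedin
      by (auto simp: Int_absorb1)
    then have "closedin X {x \<in> S. p x \<in> D}" "closedin X {x \<in> T. p x \<in> D}"
      using cl closedin_trans_full by blast+
    moreover have "{x \<in> topspace X. p x \<in> D} = {x \<in> S. p x \<in> D} \<union> {x \<in> T. p x \<in> D}"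
      using un by auto
    ultimately show "closedin X {x \<in> topspace X. p x \<in> D}" by (simp add: closedin_Un)
  qed
  have op: "open_map X Y p" unfolding open_map_def
  proof (intro allI impI)
    fix U assume U: "openin X U"
    have "openin Y (p ` (S \<inter> U))" "openin Y (p ` (T \<inter> U))"
      using oS oT U unfolding open_map_def by (auto simp: openin_subtopology_Int2)
    moreover have "p ` U = p ` (S \<inter> U) \<union> p ` (T \<inter> U)" using un openin_subset[OF U] by blast
    ultimately show "openin Y (p ` U)" by auto
  qed
  have clm: "closed_map X Y p" unfolding closed_map_def
  proof (intro allI impI)
    fix U assume U: "closedin X U"
    have "closedin Y (p ` (S \<inter> U))" "closedin Y (p ` (T \<inter> U))"
      using oS oT U unfolding closed_map_def by (auto simp: closedin_subtopology_Int_closed)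
    moreover have "p ` U = p ` (S \<inter> U) \<union> p ` (T \<inter> U)" using un closedin_subset[OF U] by blast
    ultimately show "closedin Y (p ` U)" by auto
  qed
  have fin: "finite {x \<in> topspace X. p x = y}" for y
  proof -
    have "p -` {y} \<inter> S = {x \<in> S. p x = y}" "p -` {y} \<inter> T = {x \<in> T. p x = y}" by auto
    then have "finite {x \<in> S. p x = y}" "finite {x \<in> T. p x = y}"
      using finite_vimage_IntI[OF _ pS(2), of "{y}"] finite_vimage_IntI[OF _ pT(2), of "{y}"] by simp_all
    moreover have "{x \<in> topspace X. p x = y} = {x \<in> S. p x = y} \<union> {x \<in> T. p x = y}" using un by auto
    ultimately show ?thesis by simp
  qed
  have pm: "proper_map X Y p" unfolding proper_map_def using clm fin by (simp add: finite_imp_compactin)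
  have pcY: "p c \<in> topspace Y" using pS cS by auto
  have cY: "closedin Y {p c}" using Y(1) pcY closedin_Hausdorff_sing_eq by metis
  then have oY: "openin Y (topspace Y - {p c})" by blast
  have oA: "openin X (S - {c})" "openin X (T - {c})"
  proof -
    have "S - {c} = topspace X - T" "T - {c} = topspace X - S" using un int by auto
    then show "openin X (S - {c})" "openin X (T - {c})" using cl by auto
  qed
  have imS: "p ` (S - {c}) = topspace Y - {p c}" "p ` (T - {c}) = topspace Y - {p c}"
    using inj_on_image_set_diff[OF pS(2), of S "{c}"] inj_on_image_set_diff[OF pT(2), of T "{c}"] cS pS(1) pT(1) by auto
  have topS: "topspace (subtopology X S) \<inter> (S - {c}) = S - {c}" "topspace (subtopology X T) \<inter> (T - {c}) = T - {c}"
    using ST by auto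
  have locS: "homeomorphic_map (subtopology X (S - {c})) (subtopology Y (topspace Y - {p c})) p"
  proof -
    have "homeomorphic_map (subtopology (subtopology X S) (S - {c})) (subtopology Y (topspace Y - {p c})) p"
    proof (rule homeomorphic_map_subtopologies[OF hS])
      show "p ` (topspace (subtopology X S) \<inter> (S - {c})) = topspace Y \<inter> (topspace Y - {p c})"
        unfolding topS imS by blast
    qed
    then show ?thesis by (simp add: subtopology_subtopology Int_absorb1 Diff_subset Int_Diff)
  qed
  have locT: "homeomorphic_map (subtopology X (T - {c})) (subtopology Y (topspace Y - {p c})) p"
  proof -
    have "homeomorphic_map (subtopology (subtopology X T) (T - {c})) (subtopology Y (topspace Y - {p c})) p"
    proof (rule homeomorphic_map_subtopologies[OF hT])
      show "p ` (topspace (subtopology X T) \<inter> (T - {c})) = topspace Y \<inter> (topspace Y - {p c})"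
        unfolding topS imS by blast
    qed
    then show ?thesis by (simp add: subtopology_subtopology Int_absorb1 Diff_subset Int_Diff)
  qed
  let ?X' = "{x \<in> topspace X. p x \<notin> {p c}}" and ?Y' = "topspace Y - {p c}"
  have X'eq: "?X' = (S - {c}) \<union> (T - {c})" using un pc by auto
  have Y': "subtopology Y (- {p c}) = subtopology Y ?Y'"
    by (metis Compl_eq_Diff_UNIV Int_Diff inf_top.right_neutral subtopology_restrict)
  have cov: "covering_of_degree 2 (subtopology X ?X') (subtopology Y (- {p c})) p"
    unfolding covering_of_degree_def
  proof (intro conjI ballI)
    show "continuous_map (subtopology X ?X') (subtopology Y (- {p c})) p"
      using cont by (auto simp: continuous_map_in_subtopology continuous_map_from_subtopology)
    fix y assume y: "y \<in> topspace (subtopology Y (- {p c}))"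
    then have y': "y \<in> topspace Y" "y \<noteq> p c" by auto
    have ne: "S - {c} \<noteq> T - {c}" using y' pS int by blast
    have sub: "subtopology (subtopology X ?X') (S - {c}) = subtopology X (S - {c})"
      "subtopology (subtopology X ?X') (T - {c}) = subtopology X (T - {c})"
      "subtopology (subtopology Y (- {p c})) ?Y' = subtopology Y ?Y'"
      unfolding X'eq subtopology_subtopology by (rule arg_cong[of _ _ "subtopology _"], blast)+
    show "\<exists>U. openin (subtopology Y (- {p c})) U \<and> y \<in> U \<and>
      (\<exists>\<V>. finite \<V> \<and> card \<V> = 2 \<and> pairwise disjnt \<V> \<and>
        \<Union>\<V> = {x \<in> topspace (subtopology X ?X'). p x \<in> U} \<and>
        (\<forall>V\<in>\<V>. openin (subtopology X ?X') V \<and>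
          homeomorphic_map (subtopology (subtopology X ?X') V) (subtopology (subtopology Y (- {p c})) U) p))"
    proof (intro exI[of _ ?Y'] conjI exI[of _ "{S - {c}, T - {c}}"])
      show "openin (subtopology Y (- {p c})) ?Y'" using Y' by (metis openin_topspace topspace_subtopology_subset Diff_subset)
      show "card {S - {c}, T - {c}} = 2" using ne by simp
      show "pairwise disjnt {S - {c}, T - {c}}" using int by (auto simp: pairwise_def disjnt_def)
      show "\<Union>{S - {c}, T - {c}} = {x \<in> topspace (subtopology X ?X'). p x \<in> ?Y'}"
        using X'eq ST pS pT by auto
      show "\<forall>V\<in>{S - {c}, T - {c}}. openin (subtopology X ?X') V \<and>
          homeomorphic_map (subtopology (subtopology X ?X') V) (subtopology (subtopology Y (- {p c})) ?Y') p"
      proof -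
        have "?X' \<inter> (S - {c}) = S - {c}" "?X' \<inter> (T - {c}) = T - {c}" unfolding X'eq by blast+
        then have "openin (subtopology X ?X') (S - {c})" "openin (subtopology X ?X') (T - {c})"
          using openin_subtopology_Int2[OF oA(1), of ?X'] openin_subtopology_Int2[OF oA(2), of ?X'] by simp_all
        then show ?thesis using locS locT by (intro ballI, elim insertE emptyE) (simp_all only: sub simp_thms)
      qed
    qed (use y' in auto)
  qed
  have im: "p ` topspace X = topspace Y" unfolding un[symmetric] image_Un pS(1) pT(1) by blast
  show "branched_covering_of_degree 2 X Y p"
    unfolding branched_covering_of_degree_def
    using cont op pm fin cov pcY im
    by (intro conjI exI[of _ "{p c}"]) auto
  have critc: "\<not> (\<exists>U. openin X U \<and> c \<in> U \<and> openin Y (p ` U) \<and>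
    homeomorphic_map (subtopology X U) (subtopology Y (p ` U)) p)"
  proof
    assume "\<exists>U. openin X U \<and> c \<in> U \<and> openin Y (p ` U) \<and>
      homeomorphic_map (subtopology X U) (subtopology Y (p ` U)) p"
    then obtain U where U: "openin X U" "c \<in> U" "homeomorphic_map (subtopology X U) (subtopology Y (p ` U)) p" by blast
    then have inj: "inj_on p U" using openin_subset[OF U(1)] by (auto simp: homeomorphic_eq_everything_map Int_absorb1)
    have "openin Y (p ` (S \<inter> U) \<inter> p ` (T \<inter> U))"
      using oS oT U unfolding open_map_def by (auto simp: openin_subtopology_Int2)
    moreover have "p ` (S \<inter> U) \<inter> p ` (T \<inter> U) = {p c}"
    proof
      show "{p c} \<subseteq> p ` (S \<inter> U) \<inter> p ` (T \<inter> U)" using cS U by auto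
      show "p ` (S \<inter> U) \<inter> p ` (T \<inter> U) \<subseteq> {p c}"
      proof
        fix y assume "y \<in> p ` (S \<inter> U) \<inter> p ` (T \<inter> U)"
        then obtain x x' where "x \<in> S" "x \<in> U" "x' \<in> T" "x' \<in> U" "y = p x" "y = p x'" by blast
        moreover then have "x = x'" using inj unfolding inj_on_def by metis
        ultimately show "y \<in> {p c}" using int by auto
      qed
    qed
    ultimately have "openin Y {p c}" by simp
    then have "{p c} = topspace Y" using Y(2) cY unfolding connected_space_clopen_in by blast
    then show False using big by blast
  qed
  show "critical_points X Y p = {c}"
  proof
    show "{c} \<subseteq> critical_points X Y p" using critc cS ST by (auto simp: critical_points_def)
    show "critical_points X Y p \<subseteq> {c}"
    proof
      fix x assume x: "x \<in> critical_points X Y p"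
      show "x \<in> {c}"
      proof (rule ccontr)
        assume "x \<notin> {c}"
        then have "x \<in> S - {c} \<or> x \<in> T - {c}" using x un by (auto simp: critical_points_def)
        moreover have "p ` (S - {c}) = ?Y'" "p ` (T - {c}) = ?Y'"
          using pS pT cS by (auto simp: inj_on_def)
        ultimately show False using x locS locT oA oY unfolding critical_points_def by (auto, metis+)
      qed
    qed
  qed
qed

section \<open>Intersections of vertex groups and the order on faces\<close>

section \<open>Intersections of vertex groups\<close>

lemma orient_two_fixed:
  assumes g: "g \<in> Gam_hat" "\<not> sgh g" and fix2: "plane_act g P = P" "plane_act g Q = Q" "P \<noteq> Q"
  shows "plane_act g = id"
proof -
  obtain sw s1 s2 t1 t2 where M: "plane_act g = wform sw s1 s2 t1 t2" and ok: "wok sw s1 s2 t1 t2"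
    using wrel_form[OF plane_act_wrel[OF g(1)]] by blast
  have s: "s1 = 1 \<or> s1 = -1" "s2 = 1 \<or> s2 = -1" using ok by (auto simp: wok_def)
  have o: "orient (plane_act g) = 1" using g orient_rf(4)[OF plane_act_wrel[OF g(1)]] by (auto simp: sgh_def)
  obtain p1 p2 q1 q2 where PQ: "P = (p1, p2)" "Q = (q1, q2)" by (cases P; cases Q)
  have ne: "p1 \<noteq> q1 \<or> p2 \<noteq> q2" using fix2(3) PQ by auto
  show ?thesis
  proof (cases sw)
    case True
    then have "s2 = - s1" using o s unfolding M orient_wform by auto
    then have "p1 = of_int s1 * p2 + of_int t1" "p2 = - of_int s1 * p1 + of_int t2"
       "q1 = of_int s1 * q2 + of_int t1" "q2 = - of_int s1 * q1 + of_int t2"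
      using fix2 True unfolding M PQ wform_def by auto
    then have False using ne s(1) by (cases "s1 = 1") auto
    then show ?thesis ..
  next
    case False
    then have s12: "s2 = s1" using o s unfolding M orient_wform by auto
    then have e: "p1 = of_int s1 * p1 + of_int t1" "p2 = of_int s1 * p2 + of_int t2"
       "q1 = of_int s1 * q1 + of_int t1" "q2 = of_int s1 * q2 + of_int t2"
      using fix2 False unfolding M PQ wform_def by auto
    have "s1 \<noteq> -1" using e ne by auto
    then have "s1 = 1" using s by blast
    then have "t1 = 0" "t2 = 0" using e by auto
    then show ?thesis using False \<open>s1 = 1\<close> s12 unfolding M by (auto simp: wform_def fun_eq_iff)
  qed
qed

lemma vert_image_neq: "pA \<noteq> pB" "pA \<noteq> pC" "pB \<noteq> pC" by (simp_all add: pA_def pB_def pC_def)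

definition ggens :: "aut set" where "ggens = {g_alpha, g_beta, g_gamma}"

lemma gens_distinct: "g_alpha \<noteq> g_beta" "g_alpha \<noteq> g_gamma" "g_beta \<noteq> g_gamma" "g_alpha \<noteq> id" "g_beta \<noteq> id" "g_gamma \<noteq> id"
  using e_ala_gens e_be_gens e_ga_gens e_id by metis+

lemma gen_e: assumes "S \<subseteq> ggens" "k \<in> gen S"
  shows "e_al k \<Longrightarrow> g_alpha \<in> S" "e_be k \<Longrightarrow> g_beta \<in> S" "e_ga k \<Longrightarrow> g_gamma \<in> S"
proof -
  have "k \<in> Gam \<and> (e_al k \<longrightarrow> g_alpha \<in> S) \<and> (e_be k \<longrightarrow> g_beta \<in> S) \<and> (e_ga k \<longrightarrow> g_gamma \<in> S)"
    using assms(2)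
  proof (induction rule: gen.induct)
    case gen_id show ?case by (simp only: e_id Gam_id simp_thms)
  next
    case (gen_mult s g)
    then have "s = g_alpha \<or> s = g_beta \<or> s = g_gamma" using assms(1) by (auto simp: ggens_def)
    then show ?case using gen_mult by (elim disjE) (simp_all add: e_comps Gam_gens Gam_comp del: o_apply)
  qed
  then show "e_al k \<Longrightarrow> g_alpha \<in> S" "e_be k \<Longrightarrow> g_beta \<in> S" "e_ga k \<Longrightarrow> g_gamma \<in> S" by auto
qed

lemma gen_ggens_mem: assumes "S \<subseteq> ggens" "s \<in> ggens" "s \<in> gen S" shows "s \<in> S"
  using assms gen_e[OF assms(1,3)] by (auto simp: ggens_def)

text \<open>By \<open>inter_kernel\<close> these generate the kernel of \<nu> on the intersection of
  the vertex groups of F.\<close>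

definition JF :: "vert set \<Rightarrow> aut set" where "JF F = {s \<in> ggens. \<forall>X\<in>F. s \<in> JJ X}"

lemma JF_sub: "JF F \<subseteq> ggens" by (auto simp: JF_def)

lemma JJ_stab: "JJ X \<subseteq> stab X" unfolding stab_gen using gen_incl by blast

lemma JF_iff: "F \<noteq> {} \<Longrightarrow> s \<in> ggens \<Longrightarrow> s \<in> JF F \<longleftrightarrow> (\<forall>X\<in>F. s \<in> stab X)"
proof -
  have "s \<in> JJ X" if "s \<in> ggens" "s \<in> stab X" for X
  proof -
    have "pl s = id" using that(1) by (auto simp: ggens_def pl_gens)
    then have "s \<in> gen (JJ X)" using stab_kernel that by blast
    then show ?thesis using gen_ggens_mem JJ_sub that(1) by (simp add: ggens_def)
  qed
  moreover assume "F \<noteq> {}" "s \<in> ggens"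
  ultimately show ?thesis using JJ_stab by (auto simp: JF_def)
qed

lemma gen_JJ_pair: assumes "X \<noteq> Y" "k \<in> gen (JJ X)" "k \<in> gen (JJ Y)" shows "k = id \<or> k \<in> ggens"
proof -
  have 1: "k = id \<or> k \<in> ggens" if "k \<in> gen {s}" "s \<in> ggens" for s
    using gen_single[OF _ that(1)] that(2) pow_id by (auto simp: ggens_def)
  show ?thesis
  proof (cases "X \<in> {vA1, vB1, vC1} \<or> Y \<in> {vA1, vB1, vC1}")
    case True
    then show ?thesis using assms 1[of g_alpha] 1[of g_beta] 1[of g_gamma] by (auto simp: ggens_def)
  next
    case False
    then show ?thesis using assms gen_inter_AB[of k] gen_inter_AC[of k] gen_inter_BC[of k]
      by (cases X; cases Y) (auto simp: ggens_def)
  qed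
qed

text \<open>Elements common to two of the kernels are trivial or single generators by
  \<open>gen_JJ_pair\<close>, and for a single generator membership in \<open>stab X\<close> and in
  \<open>JJ X\<close> coincide.\<close>

lemma inter_kernel: assumes "F \<noteq> {}" "\<forall>X\<in>F. k \<in> stab X" "pl k = id" shows "k \<in> gen (JF F)"
proof -
  have k: "k \<in> gen (JJ X)" if "X \<in> F" for X using stab_kernel assms(2,3) that by blast
  obtain X where X: "X \<in> F" using assms(1) by blast
  show ?thesis
  proof (cases "F = {X}")
    case True
    have "JF F = JJ X" using True JJ_sub[of X] by (auto simp: JF_def ggens_def)
    then show ?thesis using k X by simp
  next
    case False
    then obtain Y where "Y \<in> F" "Y \<noteq> X" using X by blast
    then have "k = id \<or> k \<in> ggens" using gen_JJ_pair k X by metis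
    then show ?thesis
    proof
      assume "k \<in> ggens"
      then have "k \<in> JF F" using assms JF_iff by blast
      then show ?thesis by (rule gen_incl)
    qed (simp only: gen_id)
  qed
qed

lemma stab_DD_e: assumes d: "d \<in> DD X"
  shows "X = vA1 \<Longrightarrow> \<not> e_al d" "X = vB1 \<Longrightarrow> \<not> e_be d" "X = vC1 \<Longrightarrow> \<not> e_ga d"
  using d by (auto simp: dih_def e_comps Gam_gens Gam_comp simp del: o_apply)

lemma stab_one: assumes k: "k \<in> stab X" "k \<in> stab Y" and XY: "(X, Y) \<in> {(vA1, vA), (vB1, vB), (vC1, vC)}"
  shows "k \<in> DD X"
proof -
  obtain j d where jd: "j \<in> gen (JJ X)" "d \<in> DD X" "k = j \<circ> d" using stab_normal_form[OF k(1)] by blast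
  note c = stab_constr[OF k(2)]
  have G: "d \<in> Gam" "j \<in> Gam" using DD_sub jd(2) gen_JJ_N(1)[OF JJ_sub jd(1)] by blast+
  have "j = id"
    using XY
  proof (elim insertE emptyE)
    assume X: "(X, Y) = (vA1, vA)"
    then have "j = id \<or> j = g_alpha" using gen_single[of g_alpha j] jd(1) pow_id by simp
    moreover have "\<not> e_al j" using c X jd(3) e_comp_al[OF G(2,1)] stab_DD_e(1)[OF jd(2)] by simp
    ultimately show ?thesis by auto
  next
    assume X: "(X, Y) = (vB1, vB)"
    then have "j = id \<or> j = g_beta" using gen_single[of g_beta j] jd(1) pow_id by simp
    moreover have "\<not> e_be j" using c X jd(3) e_comp_be[OF G(2,1)] stab_DD_e(2)[OF jd(2)] by simp
    ultimately show ?thesis by auto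
  next
    assume X: "(X, Y) = (vC1, vC)"
    then have "j = id \<or> j = g_gamma" using gen_single[of g_gamma j] jd(1) pow_id by simp
    moreover have "\<not> e_ga j" using c X jd(3) e_comp_ga[OF G(2,1)] stab_DD_e(3)[OF jd(2)] by simp
    ultimately show ?thesis by auto
  qed
  then show ?thesis using jd by (simp only: id_comp)
qed

text \<open>Orientation preserving elements of the stabilizers act on the words over a fixed binary word
  in the same way as the elements of the kernel of \<open>\<nu>\<close>: the rotations act trivially there.\<close>

lemma rotation_orbit:
  assumes F: "F \<noteq> {}" and k: "\<forall>X\<in>F. k \<in> stab X" and s: "\<not> sgG k" and m: "mw (k w) = mw w"
  shows "\<exists>j\<in>gen (JF F). k w = j w"
proof (cases "\<exists>X\<in>F. \<exists>Y\<in>F. vert_image X \<noteq> vert_image Y")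
  case True
  then obtain X Y where XY: "X \<in> F" "Y \<in> F" "vert_image X \<noteq> vert_image Y" by blast
  then have "k \<in> Gam" using k stab_Gam by blast
  \<comment> \<open>An orientation preserving isometry with two fixed points is the
    identity.\<close>
  then have "pl k = id"
    using orient_two_fixed[OF nu_Gamh, of k "vert_image X" "vert_image Y"] s stab_fixes k XY
    by (simp add: sgG_def)
  then show ?thesis using inter_kernel[OF F k] by blast
next
  case same: False
  obtain X where X: "X \<in> F" using F by blast
  show ?thesis
  proof (cases "F = {X}")
    case True
    obtain j d where jd: "j \<in> gen (JJ X)" "d \<in> DD X" "k = j \<circ> d" using stab_normal_form k X by blast
    have G: "d \<in> Gam" "j \<in> Gam" "\<not> sgG j" using DD_sub jd(2) gen_JJ_N[OF JJ_sub jd(1)] by blast+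
    have "\<not> sgG d" using s jd(3) sgG_comp[OF G(2,1)] G(3) by simp
    moreover have "mw (d w) = mw w" using m gen_JJ_N(4)[OF JJ_sub jd(1)] jd(3) by simp
    ultimately have "d w = w" using DD_rotation[OF jd(2)] by blast
    moreover have "JF F = JJ X" using True JJ_sub[of X] by (auto simp: JF_def ggens_def)
    ultimately show ?thesis using jd by (intro bexI[of _ j]) simp_all
  next
    case False
    then obtain Y where Y: "Y \<in> F" "Y \<noteq> X" using X by blast
    have vi: "vert_image X = vert_image Y" using same X Y by blast
    \<comment> \<open>Two different vertices over the same point of the plane are of the form X1 and
      X.\<close>
    have "(X, Y) \<in> {(vA1, vA), (vB1, vB), (vC1, vC)} \<or> (Y, X) \<in> {(vA1, vA), (vB1, vB), (vC1, vC)}"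
      using vi Y(2) vert_image_neq by (cases X; cases Y) auto
    then obtain Z where "k \<in> DD Z" using stab_one k X Y by blast
    then have "k w = w" using DD_rotation s m by blast
    then show ?thesis by (intro bexI[of _ id]) (simp_all only: id_apply gen_id)
  qed
qed

text \<open>Three fixed points that are not collinear make the action on the plane trivial, and no
  kernel generator belongs to all three vertices.\<close>

lemma inter_trivial_ABC: assumes "k \<in> stab vA" "k \<in> stab vB" "k \<in> stab vC" shows "k = id"
proof -
  have G: "k \<in> Gam" using assms stab_Gam by blast
  have f: "pl k pA = pA" "pl k pB = pB" "pl k pC = pC" 
    using stab_fixes[OF assms(1)] stab_fixes[OF assms(2)] stab_fixes[OF assms(3)] by simp_all
  obtain sw s1 s2 t1 t2 where M: "pl k = wform sw s1 s2 t1 t2"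
    using wrel_form[OF plane_act_wrel[OF nu_Gamh[OF G]]] by blast
  have "pl k = id"
  proof (cases sw)
    case True then show ?thesis using f unfolding M by (auto simp: wform_def pA_def pB_def pC_def)
  next
    case False
    then have "of_int s1 = (1::real)" "of_int s2 = (1::real)" "of_int t1 = (0::real)" "of_int t2 = (0::real)"
      using f unfolding M by (auto simp: wform_def pA_def pB_def pC_def)
    then show ?thesis using False unfolding M by (auto simp: wform_def fun_eq_iff)
  qed
  then have k: "k \<in> gen (JJ vA)" "k \<in> gen (JJ vB)" "k \<in> gen (JJ vC)" using stab_kernel assms by blast+
  then have "k = id \<or> k \<in> ggens" using gen_JJ_pair[of vA vB] by blast
  moreover have "k \<in> JJ vA \<inter> JJ vB \<inter> JJ vC" if "k \<in> ggens"
    using gen_ggens_mem[OF _ that] JJ_sub k unfolding ggens_def by (metis IntI)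
  moreover have "JJ vA \<inter> JJ vB \<inter> JJ vC = {}" using gens_distinct by auto
  ultimately show ?thesis by blast
qed

text \<open>Once the element is known to preserve the orientation, its two fixed points in the plane
  put it into both kernels, which have no generator in common.\<close>

lemma inter_trivial_pair:
  assumes k: "k \<in> stab X" "k \<in> stab Y" and XY: "X \<noteq> Y" "X \<in> {vA1, vB1, vC1}" "Y \<in> {vA1, vB1, vC1}" shows "k = id"
proof -
  have G: "k \<in> Gam" using k stab_Gam by blast
  note f = stab_fixes[OF k(1)] stab_fixes[OF k(2)]
  note c = stab_constr[OF k(1)] stab_constr[OF k(2)]
  have ne: "vert_image X \<noteq> vert_image Y" using XY vert_image_neq by auto
  have s: "\<not> sgG k"
  \<comment> \<open>For B1 and C1 the constraints exclude a reversal only together with geometry: if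
    k reversed the orientation, a k would fix two points and act trivially, so \<open>e_a k\<close>
    would hold, whereas the constraints force it to fail. For the other pairs the constraints
    suffice.\<close>
  proof (cases "{X, Y} = {vB1, vC1}")
    case True
    then have XY': "X = vB1 \<and> Y = vC1 \<or> X = vC1 \<and> Y = vB1" by (simp add: doubleton_eq_iff)
    show ?thesis
    proof
      assume sk: "sgG k"
      have fB: "pl k pB = pB" "pl k pC = pC" using f XY' by auto
      have "plane_act (nu (g_a \<circ> k)) = id"
      proof (rule orient_two_fixed[of _ pB pC])
        show "nu (g_a \<circ> k) \<in> Gam_hat" using nu_Gamh Gam_comp Gam_gens G by blast
        show "\<not> sgh (nu (g_a \<circ> k))" using sgG_comp[OF Gam_gens(4) G] sk by (simp add: sgG_def nu_gens)
        show "pl (g_a \<circ> k) pB = pB" "pl (g_a \<circ> k) pC = pC"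
          using fB by (simp_all only: pl_comp[OF Gam_gens(4) G] pl_gens) (simp_all add: rf_a_def pB_def pC_def)
        show "pB \<noteq> pC" using vert_image_neq by blast
      qed
      then have "nu (g_a \<circ> k) = id" using plane_act_faithful nu_Gamh Gam_comp Gam_gens G by blast
      then have "mu_letter (lt (g_a \<circ> k) L1) = mu_letter L1" 
        using nu_lt[OF Gam_comp[OF Gam_gens(4) G], of L1] by (metis lt_id)
      then have "\<not> par (lt (g_a \<circ> k) L1)" by (simp add: par_mu)
      then have "\<not> e_a (g_a \<circ> k)" by (simp only: e_a_def not_False_eq_True)
      then have "e_a k" using e_comp_a[OF Gam_gens(4) G] by simp
      then show False using c XY' by auto
    qed
  next
    case False
    then show ?thesis using c XY by auto
  qed
  then have "pl k = id" using orient_two_fixed[OF nu_Gamh[OF G] _ f ne] by (simp add: sgG_def)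
  then have k: "k \<in> gen (JJ X)" "k \<in> gen (JJ Y)" using stab_kernel k by blast+
  then have "k = id \<or> k \<in> ggens" using gen_JJ_pair XY by blast
  moreover have "k \<in> JJ X \<inter> JJ Y" if "k \<in> ggens"
    using gen_ggens_mem[OF _ that] JJ_sub k unfolding ggens_def by (metis IntI)
  moreover have "JJ X \<inter> JJ Y = {}"
    using XY gens_distinct by (cases X; cases Y; simp)
  ultimately show ?thesis by blast
qed

definition face :: "vert set \<Rightarrow> bool" where
  "face F \<longleftrightarrow> F \<noteq> {} \<and> (\<exists>D\<in>tetrahedra. F \<subset> D)"

definition grp :: "vert set \<Rightarrow> aut set" where "grp F = \<Inter>(stab ` F)"

lemma finite_vert [simp]: "finite (F :: vert set)"
proof -
  have "(UNIV :: vert set) = {vA, vB, vC, vA1, vB1, vC1}" using vert.exhaust by auto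
  then show ?thesis by (metis finite.emptyI finite.insertI finite_subset subset_UNIV)
qed

lemma face_card: "face F \<longleftrightarrow> F \<noteq> {} \<and> card F \<le> 3 \<and> (\<exists>D\<in>tetrahedra. F \<subseteq> D)"
proof -
  have c: "card D = 4" if "D \<in> tetrahedra" for D using that by (auto simp: tetrahedra_def)
  have "F \<subset> D \<longleftrightarrow> F \<subseteq> D \<and> card F \<le> 3" if "D \<in> tetrahedra" for D
  proof
    assume "F \<subset> D" then show "F \<subseteq> D \<and> card F \<le> 3" using c[OF that] psubset_card_mono[of D F] by auto
  next
    assume F: "F \<subseteq> D \<and> card F \<le> 3"
    then have "F \<noteq> D" using c[OF that] by auto
    then show "F \<subset> D" using F by blast
  qed
  then show ?thesis unfolding face_def by blast
qed

lemma id_grp: "id \<in> grp F" using stab_group by (auto simp: grp_def)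

lemma grp_ABC: "grp {vA, vB, vC} = {id}"
  using inter_trivial_ABC id_grp[of "{vA, vB, vC}"] by (auto simp: grp_def)

text \<open>An intersection over a set with two of the vertices A1, B1, C1 is trivial and thus
  coincides with the one for the face ABC.\<close>

lemma subgroups_eq: "subgroups = grp ` {F. face F}"
proof
  show "grp ` {F. face F} \<subseteq> subgroups" by (auto simp: subgroups_def grp_def face_card)
  show "subgroups \<subseteq> grp ` {F. face F}"
  proof
    fix G assume "G \<in> subgroups"
    then obtain F where F: "G = grp F" "F \<noteq> {}" "card F \<le> 3" by (auto simp: subgroups_def grp_def)
    show "G \<in> grp ` {F. face F}"
    proof (cases "\<exists>X Y. X \<in> F \<and> Y \<in> F \<and> X \<noteq> Y \<and> X \<in> {vA1, vB1, vC1} \<and> Y \<in> {vA1, vB1, vC1}")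
      case True
      then have "G = {id}" using inter_trivial_pair id_grp[of F] unfolding F(1) grp_def by blast
      moreover have "face {vA, vB, vC}" by (auto simp: face_def tetrahedra_def)
      ultimately show ?thesis using grp_ABC by force
    next
      case False
      have v: "X \<in> {vA, vB, vC} \<or> X \<in> {vA1, vB1, vC1}" for X by (cases X) auto
      have "\<exists>Z\<in>{vA1, vB1, vC1}. F \<subseteq> {Z, vA, vB, vC}"
      proof (cases "F \<inter> {vA1, vB1, vC1} = {}")
        case True then show ?thesis using v by (intro bexI[of _ vA1]) auto
      next
        case ne: False
        then obtain Z where "Z \<in> F" "Z \<in> {vA1, vB1, vC1}" by blast
        then show ?thesis using False v by (intro bexI[of _ Z]) blast+
      qed
      then have "face F" using F by (auto simp: face_card tetrahedra_def)
      then show ?thesis using F by blast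
    qed
  qed
qed

text \<open>One element for each triangle containing A1, B1 or C1. It is a product of generators of
  the three vertex groups, and it is kept out of the others by a parity constraint or because it
  moves the image of the vertex. These elements separate the subgroups of different faces.\<close>

lemma triangle_witness:
  "\<exists>t. \<forall>X. t \<in> stab X \<longleftrightarrow> X \<in> {vA1, vA, vB}" "\<exists>t. \<forall>X. t \<in> stab X \<longleftrightarrow> X \<in> {vA1, vA, vC}"
  "\<exists>t. \<forall>X. t \<in> stab X \<longleftrightarrow> X \<in> {vA1, vB, vC}" "\<exists>t. \<forall>X. t \<in> stab X \<longleftrightarrow> X \<in> {vB1, vA, vB}"
  "\<exists>t. \<forall>X. t \<in> stab X \<longleftrightarrow> X \<in> {vB1, vA, vC}" "\<exists>t. \<forall>X. t \<in> stab X \<longleftrightarrow> X \<in> {vB1, vB, vC}"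
  "\<exists>t. \<forall>X. t \<in> stab X \<longleftrightarrow> X \<in> {vC1, vA, vB}" "\<exists>t. \<forall>X. t \<in> stab X \<longleftrightarrow> X \<in> {vC1, vA, vC}"
  "\<exists>t. \<forall>X. t \<in> stab X \<longleftrightarrow> X \<in> {vC1, vB, vC}"
proof -
  have w: "\<exists>t. \<forall>X. t \<in> stab X \<longleftrightarrow> X \<in> T"
    if "\<And>X. X \<in> T \<Longrightarrow> t \<in> gen (JJ X \<union> RR X)"
      "\<And>X. X \<notin> T \<Longrightarrow> \<not> constr X t \<or> pl t (vert_image X) \<noteq> vert_image X" for T t
    using that stab_constr stab_fixes unfolding stab_gen by (intro exI[of _ t]) blast
  note c = pl_comp pl_gens rf_a_def rf_b_def rf_c_def pA_def pB_def pC_def hom_comps Gam_gens Gam_comp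
  have cgg: "cga \<circ> g_gamma = g_c" "bbe \<circ> g_beta = g_b" "aal \<circ> g_alpha = g_a" by (auto simp: fun_eq_iff)
  have "cga \<circ> g_gamma \<in> gen (JJ vB \<union> RR vB)" "bbe \<circ> g_beta \<in> gen (JJ vC \<union> RR vC)" "aal \<circ> g_alpha \<in> gen (JJ vC \<union> RR vC)"
    by (intro gen_comp gen_incl; simp)+
  note gc = this[unfolded cgg]
  show "\<exists>t. \<forall>X. t \<in> stab X \<longleftrightarrow> X \<in> {vA1, vA, vB}"
  proof (rule w[of _ g_c])
    fix X show "X \<in> {vA1, vA, vB} \<Longrightarrow> g_c \<in> gen (JJ X \<union> RR X)"
      by (elim insertE emptyE; hypsubst; (rule gc | (rule gen_incl, simp; fail) | (rule gen_comp; rule gen_incl, simp)))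
    show "X \<notin> {vA1, vA, vB} \<Longrightarrow> \<not> constr X g_c \<or> pl g_c (vert_image X) \<noteq> vert_image X"
      by (cases X) (simp_all add: c del: o_apply)
  qed
  show "\<exists>t. \<forall>X. t \<in> stab X \<longleftrightarrow> X \<in> {vA1, vA, vC}"
  proof (rule w[of _ g_b])
    fix X show "X \<in> {vA1, vA, vC} \<Longrightarrow> g_b \<in> gen (JJ X \<union> RR X)"
      by (elim insertE emptyE; hypsubst; (rule gc | (rule gen_incl, simp; fail) | (rule gen_comp; rule gen_incl, simp)))
    show "X \<notin> {vA1, vA, vC} \<Longrightarrow> \<not> constr X g_b \<or> pl g_b (vert_image X) \<noteq> vert_image X"
      by (cases X) (simp_all add: c del: o_apply)
  qed
  show "\<exists>t. \<forall>X. t \<in> stab X \<longleftrightarrow> X \<in> {vA1, vB, vC}"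
  proof (rule w[of _ g_alpha])
    fix X show "X \<in> {vA1, vB, vC} \<Longrightarrow> g_alpha \<in> gen (JJ X \<union> RR X)"
      by (elim insertE emptyE; hypsubst; (rule gc | (rule gen_incl, simp; fail) | (rule gen_comp; rule gen_incl, simp)))
    show "X \<notin> {vA1, vB, vC} \<Longrightarrow> \<not> constr X g_alpha \<or> pl g_alpha (vert_image X) \<noteq> vert_image X"
      by (cases X) (simp_all add: c del: o_apply)
  qed
  show "\<exists>t. \<forall>X. t \<in> stab X \<longleftrightarrow> X \<in> {vB1, vA, vB}"
  proof (rule w[of _ cga])
    fix X show "X \<in> {vB1, vA, vB} \<Longrightarrow> cga \<in> gen (JJ X \<union> RR X)"
      by (elim insertE emptyE; hypsubst; (rule gc | (rule gen_incl, simp; fail) | (rule gen_comp; rule gen_incl, simp)))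
    show "X \<notin> {vB1, vA, vB} \<Longrightarrow> \<not> constr X cga \<or> pl cga (vert_image X) \<noteq> vert_image X"
      by (cases X) (simp_all add: c)
  qed
  show "\<exists>t. \<forall>X. t \<in> stab X \<longleftrightarrow> X \<in> {vB1, vA, vC}"
  proof (rule w[of _ g_beta])
    fix X show "X \<in> {vB1, vA, vC} \<Longrightarrow> g_beta \<in> gen (JJ X \<union> RR X)"
      by (elim insertE emptyE; hypsubst; (rule gc | (rule gen_incl, simp; fail) | (rule gen_comp; rule gen_incl, simp)))
    show "X \<notin> {vB1, vA, vC} \<Longrightarrow> \<not> constr X g_beta \<or> pl g_beta (vert_image X) \<noteq> vert_image X"
      by (cases X) (simp_all add: c del: o_apply)
  qed
  show "\<exists>t. \<forall>X. t \<in> stab X \<longleftrightarrow> X \<in> {vB1, vB, vC}"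
  proof (rule w[of _ g_a])
    fix X show "X \<in> {vB1, vB, vC} \<Longrightarrow> g_a \<in> gen (JJ X \<union> RR X)"
      by (elim insertE emptyE; hypsubst; (rule gc | (rule gen_incl, simp; fail) | (rule gen_comp; rule gen_incl, simp)))
    show "X \<notin> {vB1, vB, vC} \<Longrightarrow> \<not> constr X g_a \<or> pl g_a (vert_image X) \<noteq> vert_image X"
      by (cases X) (simp_all add: c del: o_apply)
  qed
  show "\<exists>t. \<forall>X. t \<in> stab X \<longleftrightarrow> X \<in> {vC1, vA, vB}"
  proof (rule w[of _ g_gamma])
    fix X show "X \<in> {vC1, vA, vB} \<Longrightarrow> g_gamma \<in> gen (JJ X \<union> RR X)"
      by (elim insertE emptyE; hypsubst; (rule gc | (rule gen_incl, simp; fail) | (rule gen_comp; rule gen_incl, simp)))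
    show "X \<notin> {vC1, vA, vB} \<Longrightarrow> \<not> constr X g_gamma \<or> pl g_gamma (vert_image X) \<noteq> vert_image X"
      by (cases X) (simp_all add: c del: o_apply)
  qed
  show "\<exists>t. \<forall>X. t \<in> stab X \<longleftrightarrow> X \<in> {vC1, vA, vC}"
  proof (rule w[of _ bbe])
    fix X show "X \<in> {vC1, vA, vC} \<Longrightarrow> bbe \<in> gen (JJ X \<union> RR X)"
      by (elim insertE emptyE; hypsubst; (rule gc | (rule gen_incl, simp; fail) | (rule gen_comp; rule gen_incl, simp)))
    show "X \<notin> {vC1, vA, vC} \<Longrightarrow> \<not> constr X bbe \<or> pl bbe (vert_image X) \<noteq> vert_image X"
      by (cases X) (simp_all add: c)
  qed
  show "\<exists>t. \<forall>X. t \<in> stab X \<longleftrightarrow> X \<in> {vC1, vB, vC}"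
  proof (rule w[of _ aal])
    fix X show "X \<in> {vC1, vB, vC} \<Longrightarrow> aal \<in> gen (JJ X \<union> RR X)"
      by (elim insertE emptyE; hypsubst; (rule gc | (rule gen_incl, simp; fail) | (rule gen_comp; rule gen_incl, simp)))
    show "X \<notin> {vC1, vB, vC} \<Longrightarrow> \<not> constr X aal \<or> pl aal (vert_image X) \<noteq> vert_image X"
      by (cases X) (simp_all add: c)
  qed
qed

text \<open>If X were not in F, some triangle with a vertex among A1, B1, C1 would contain F but not
  X, and its witness would lie in \<open>grp F\<close> outside \<open>stab X\<close>.\<close>

lemma grp_subset_stab: assumes F: "face F" "F \<noteq> {vA, vB, vC}" and sub: "grp F \<subseteq> stab X" shows "X \<in> F"
proof (rule ccontr)
  assume X: "X \<notin> F"
  obtain Z0 where Z0: "Z0 \<in> {vA1, vB1, vC1}" "F \<subset> {Z0, vA, vB, vC}" using F(1) by (auto simp: face_def tetrahedra_def)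
  have "\<exists>Y\<in>{vA, vB, vC}. Y \<notin> F" using Z0 F(2) by blast
  then obtain Y where Y: "Y \<in> {vA, vB, vC}" "Y \<notin> F" "X \<in> {vA, vB, vC} \<longrightarrow> Y = X" using X by blast
  obtain Z where Z: "Z \<in> {vA1, vB1, vC1}" "F \<subseteq> {Z, vA, vB, vC}" "X \<noteq> Z"
  proof (cases "Z0 \<in> F")
    case True then show thesis using that[of Z0] Z0 X by blast
  next
    case False
    then have "F \<subseteq> {vA, vB, vC}" using Z0 by blast
    then show thesis using that[of vA1] that[of vB1] by blast
  qed
  have T: "F \<subseteq> {Z} \<union> ({vA, vB, vC} - {Y})" "X \<notin> {Z} \<union> ({vA, vB, vC} - {Y})" using Z Y by blast+
  have "\<exists>t. \<forall>X. t \<in> stab X \<longleftrightarrow> X \<in> {Z} \<union> ({vA, vB, vC} - {Y})"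
  proof -
    have s: "{Z} \<union> ({vA, vB, vC} - {vA}) = {Z, vB, vC}" "{Z} \<union> ({vA, vB, vC} - {vB}) = {Z, vA, vC}"
      "{Z} \<union> ({vA, vB, vC} - {vC}) = {Z, vA, vB}"
      if "Z \<in> {vA1, vB1, vC1}" for Z using that by auto
    show ?thesis using Z(1) Y(1)
      by (elim insertE emptyE; hypsubst) (subst s, simp, rule triangle_witness)+
  qed
  then obtain t where "\<forall>X. t \<in> stab X \<longleftrightarrow> X \<in> {Z} \<union> ({vA, vB, vC} - {Y})" by blast
  then have t: "t \<in> stab W \<longleftrightarrow> W \<in> {Z} \<union> ({vA, vB, vC} - {Y})" for W by blast
  have "t \<in> grp F" unfolding grp_def using T(1) t by blast
  then have "t \<in> stab X" using sub by blast
  then show False using T(2) t by blast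
qed

text \<open>The face ABC is exceptional because its group is trivial. In the order complex its
  barycenter is joined to all other vertices, so each tetrahedron appears as the cone from this
  barycenter over its other three faces, barycentrically subdivided.\<close>

lemma grp_subset_iff: assumes "face F" "face F'"
  shows "grp F \<subseteq> grp F' \<longleftrightarrow> F' \<subseteq> F \<or> F = {vA, vB, vC}"
proof
  assume s: "grp F \<subseteq> grp F'"
  show "F' \<subseteq> F \<or> F = {vA, vB, vC}"
  proof (rule disjCI)
    assume n: "F \<noteq> {vA, vB, vC}"
    show "F' \<subseteq> F"
    proof
      fix X assume "X \<in> F'"
      then have "grp F \<subseteq> stab X" using s by (auto simp: grp_def)
      then show "X \<in> F" using grp_subset_stab assms n by blast
    qed
  qed
next
  assume "F' \<subseteq> F \<or> F = {vA, vB, vC}"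
  then show "grp F \<subseteq> grp F'" using grp_ABC id_grp by (auto simp: grp_def)
qed

lemma grp_inj: assumes "face F" "face F'" "grp F = grp F'" shows "F = F'"
proof -
  have "F' \<subseteq> F \<or> F = {vA, vB, vC}" "F \<subseteq> F' \<or> F' = {vA, vB, vC}"
    using grp_subset_iff assms by blast+
  moreover have "\<not> {vA, vB, vC} \<subset> F" if "face F" for F
    using that by (auto simp: face_def tetrahedra_def)
  ultimately show ?thesis
  proof (elim disjE)
    assume "F = {vA, vB, vC}" "F \<subseteq> F'" 
    then show ?thesis using \<open>\<And>F. face F \<Longrightarrow> \<not> {vA, vB, vC} \<subset> F\<close>[OF assms(2)] by blast
  next
    assume "F' = {vA, vB, vC}" "F' \<subseteq> F" 
    then show ?thesis using \<open>\<And>F. face F \<Longrightarrow> \<not> {vA, vB, vC} \<subset> F\<close>[OF assms(1)] by blast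
  qed auto
qed

section \<open>Stabilizers of points of the plane and of words\<close>

section \<open>Stabilizers in the plane\<close>

text \<open>Fixing a point of the triangle leaves only few signs and translation parts, since the
  latter are integers with parity given by \<open>sw\<close>. Each remaining form is realized by a
  word in the reflections fixing z, and faithfulness identifies g with that word.\<close>

lemma plane_stabilizer:
  assumes z: "z \<in> Dt" and g: "g \<in> Gam_hat" and fix_z: "plane_act g z = z"
  shows "g \<in> gen {s \<in> Hset. plane_act s z = z}" (is "g \<in> gen ?S")
proof -
  have S: "gen ?S \<subseteq> Gam_hat" unfolding Gamh_gen by (rule gen_mono) (auto intro: gen_incl)
  have inS: "g \<in> gen ?S" if "d \<in> gen ?S" "plane_act g = plane_act d" for d
    using plane_act_inj[OF g _ that(2)] that(1) S by auto
  obtain sw s1 s2 t1 t2 where M: "plane_act g = wform sw s1 s2 t1 t2" and ok: "wok sw s1 s2 t1 t2"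
    using wrel_form[OF plane_act_wrel[OF g]] by blast
  obtain x y where xy: "z = (x, y)" by (cases z)
  have D: "0 \<le> x" "0 \<le> y" "x + y \<le> 1" using z by (auto simp: Dt_def xy)
  have a: "h_a \<in> ?S" if "x = 0" using that by (simp add: xy Hset_def plane_act_gens rf_a_def)
  have b: "h_b \<in> ?S" if "x + y = 1" using that by (simp add: xy Hset_def plane_act_gens rf_b_def)
  have c: "h_c \<in> ?S" if "y = 0" using that by (simp add: xy Hset_def plane_act_gens rf_c_def)
  note P = plane_act_comp Gamh_gens Gamh_comp plane_act_gens
  have s: "s1 = 1 \<or> s1 = -1" "s2 = 1 \<or> s2 = -1" "odd t1 = sw" "odd t2 = sw" using ok by (auto simp: wok_def)
  show ?thesis
  proof (cases sw)
    case False
    then have e: "of_int s1 * x + of_int t1 = x" "of_int s2 * y + of_int t2 = y"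
      using fix_z unfolding M xy by (auto simp: wform_def)
    have X: "s1 = 1 \<and> t1 = 0 \<or> s1 = -1 \<and> x = 0 \<and> t1 = 0 \<or> s1 = -1 \<and> x = 1 \<and> y = 0 \<and> t1 = 2"
    proof (cases "s1 = 1")
      case True then show ?thesis using e by auto
    next
      case n: False
      then have "s1 = -1" using s by blast
      then have "of_int t1 = 2 * x" using e by auto
      then have "0 \<le> real_of_int t1" "real_of_int t1 \<le> 2" using D by auto
      then have "t1 = 0 \<or> t1 = 1 \<or> t1 = 2" by linarith
      then have "t1 = 0 \<or> t1 = 2" using s(3) False by auto
      then show ?thesis using \<open>of_int t1 = 2 * x\<close> \<open>s1 = -1\<close> D by auto
    qed
    have Y: "s2 = 1 \<and> t2 = 0 \<or> s2 = -1 \<and> y = 0 \<and> t2 = 0 \<or> s2 = -1 \<and> y = 1 \<and> x = 0 \<and> t2 = 2"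
    proof (cases "s2 = 1")
      case True then show ?thesis using e by auto
    next
      case n: False
      then have "s2 = -1" using s by blast
      then have "of_int t2 = 2 * y" using e by auto
      then have "0 \<le> real_of_int t2" "real_of_int t2 \<le> 2" using D by auto
      then have "t2 = 0 \<or> t2 = 1 \<or> t2 = 2" by linarith
      then have "t2 = 0 \<or> t2 = 2" using s(4) False by auto
      then show ?thesis using \<open>of_int t2 = 2 * y\<close> \<open>s2 = -1\<close> D by auto
    qed
    \<comment> \<open>The two coordinates are treated separately. At an acute corner the reflection
      in the line x = 1 is b c b, and that in y = 1 is b a b.\<close>
    define dx where "dx = (if s1 = 1 then id else if t1 = 0 then h_a else h_b \<circ> (h_c \<circ> h_b))"
    define dy where "dy = (if s2 = 1 then id else if t2 = 0 then h_c else h_b \<circ> (h_a \<circ> h_b))"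
    have dxS: "dx \<in> gen ?S"
    proof -
      have "h_b \<circ> (h_c \<circ> h_b) \<in> gen ?S" if "x = 1" "y = 0" by (intro gen_comp gen_incl b c) (use that in auto)
      moreover have "h_a \<in> gen ?S" if "x = 0" by (intro gen_incl a that)
      ultimately show ?thesis using X unfolding dx_def by (auto simp del: o_apply)
    qed
    have dyS: "dy \<in> gen ?S"
    proof -
      have "h_b \<circ> (h_a \<circ> h_b) \<in> gen ?S" if "y = 1" "x = 0" by (intro gen_comp gen_incl a b) (use that in auto)
      moreover have "h_c \<in> gen ?S" if "y = 0" by (intro gen_incl c that)
      ultimately show ?thesis using Y unfolding dy_def by (auto simp del: o_apply)
    qed
    have dG: "dx \<in> Gam_hat" "dy \<in> Gam_hat" using dxS dyS S by blast+
    have px: "plane_act dx (u, v) = (of_int s1 * u + of_int t1, v)" for u v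
      using X unfolding dx_def by (auto simp: P rf_a_def rf_b_def rf_c_def)
    have py: "plane_act dy (u, v) = (u, of_int s2 * v + of_int t2)" for u v
      using Y unfolding dy_def by (auto simp: P rf_a_def rf_b_def rf_c_def)
    have "plane_act (dx \<circ> dy) = plane_act g"
    proof
      fix w show "plane_act (dx \<circ> dy) w = plane_act g w"
        using plane_act_comp[OF dG] px py False unfolding M by (cases w) (auto simp: wform_def)
    qed
    then show ?thesis using inS[OF gen_comp[OF dxS dyS]] by simp
  next
    case True
    then have e: "of_int s1 * y + of_int t1 = x" "of_int s2 * x + of_int t2 = y"
      using fix_z unfolding M xy by (auto simp: wform_def)
    have o: "odd t1" "odd t2" using s True by auto
    have bnd: "\<bar>real_of_int t1\<bar> \<le> 1" "\<bar>real_of_int t2\<bar> \<le> 1"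
      using e D s(1,2) by auto
    then have t: "t1 = 1 \<or> t1 = -1" "t2 = 1 \<or> t2 = -1" using o
    proof -
      have "\<bar>t1\<bar> \<le> 1" "\<bar>t2\<bar> \<le> 1" using bnd by linarith+
      moreover have "t1 \<noteq> 0" "t2 \<noteq> 0" using o by auto
      ultimately show "t1 = 1 \<or> t1 = -1" "t2 = 1 \<or> t2 = -1" by arith+
    qed
    \<comment> \<open>Either the map is \<open>rf_b\<close>, or z is one of the two acute
      corners.\<close>
    have cases: "s1 = -1 \<and> s2 = -1 \<and> t1 = 1 \<and> t2 = 1 \<and> x + y = 1 \<or>
       (x = 1 \<and> y = 0 \<and> t1 = 1 \<and> t2 = - s2) \<or> (x = 0 \<and> y = 1 \<and> t2 = 1 \<and> t1 = - s1)"
      using e D s(1,2) t by (elim disjE) auto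
    have bg: "h_b \<in> gen ?S" by (intro gen_incl b) (use cases in auto)
    show ?thesis
    proof (cases "s1 = -1 \<and> s2 = -1 \<and> t1 = 1 \<and> t2 = 1")
      case True
      then have "plane_act g = plane_act h_b" using \<open>sw\<close> unfolding M by (auto simp: P wform_def rf_b_def fun_eq_iff)
      then show ?thesis using inS[OF bg] by blast
    next
      case n: False
      then consider "x = 1" "y = 0" "t1 = 1" "t2 = - s2" | "x = 0" "y = 1" "t2 = 1" "t1 = - s1" using cases by blast
      then show ?thesis
      proof cases
        case 1
        have cg: "h_c \<in> gen ?S" by (intro gen_incl c 1)
        define d where "d = (if s2 = 1 then h_b \<circ> (h_c \<circ> h_b) else id) \<circ> ((if s1 = 1 then h_c else id) \<circ> h_b)"
        have dS: "d \<in> gen ?S" unfolding d_def using bg cg by (auto intro!: gen_comp simp del: o_apply)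
        have "plane_act g = plane_act d" using 1 s \<open>sw\<close> unfolding M d_def
          by (elim disjE) (auto simp: P wform_def rf_b_def rf_c_def fun_eq_iff Gamh_id)
        then show ?thesis using inS[OF dS] by blast
      next
        case 2
        have ag: "h_a \<in> gen ?S" by (intro gen_incl a 2)
        define d where "d = (if s1 = 1 then h_b \<circ> (h_a \<circ> h_b) else id) \<circ> ((if s2 = 1 then h_a else id) \<circ> h_b)"
        have dS: "d \<in> gen ?S" unfolding d_def using bg ag by (auto intro!: gen_comp simp del: o_apply)
        have "plane_act g = plane_act d" using 2 s \<open>sw\<close> unfolding M d_def
          by (elim disjE) (auto simp: P wform_def rf_b_def rf_a_def fun_eq_iff Gamh_id)
        then show ?thesis using inS[OF dS] by blast
      qed
    qed
  qed
qed

text \<open>When the binary letters are preserved, \<open>plane_act_sect\<close> relates the action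
  of k to that of its section by one and the same injective contraction.\<close>

lemma pl_sect_trivial: assumes "k \<in> Gam" "mw (k w) = mw w" "pl (sect k w) = id" shows "pl k = id"
  using assms
proof (induction w arbitrary: k)
  case (Cons x w)
  have k: "k \<in> TA" using Cons(2) Gam_TA by blast
  have m: "mu_letter (lt k x) = mu_letter x" "mw (sect k [x] w) = mw w"
    using Cons(3) k by (simp_all add: TA_Cons)
  have "sect k (x # w) = sect (sect k [x]) w" using sect_append[OF k, of "[x]" w] by simp
  then have "pl (sect (sect k [x]) w) = id" using Cons(4) by (simp only:)
  then have "pl (sect k [x]) = id" using Cons(1)[OF Gam_sect1[OF Cons(2)] m(2)] by blast
  then have "AA (mu_letter x) = AA (mu_letter x) \<circ> pl k"
    using plane_act_sect[OF nu_Gamh[OF Cons(2)], of "mu_letter x"] nu_lt[OF Cons(2), of x] nu_sect[OF Cons(2), of "[x]"] m(1)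
    by simp
  then have e: "AA (mu_letter x) (pl k z) = AA (mu_letter x) z" for z by (metis comp_apply)
  have inj: "u = v" if "AA y u = AA y v" for y u v
    using that by (cases y; cases u; cases v) (auto simp: field_simps)
  show ?case using inj[OF e] by (auto simp: fun_eq_iff)
qed simp

section \<open>Stabilizers of words in the groups generated by \<open>\<alpha>\<close>, \<open>\<beta>\<close>, \<open>\<gamma>\<close>\<close>

text \<open>For a set \<open>J\<close> of generators among \<open>\<alpha>\<close>, \<open>\<beta>\<close>, \<open>\<gamma>\<close>, the sections at \<open>x\<close> of the elements of the group
  generated by \<open>J\<close> which fix \<open>x\<close> form the group generated by \<open>Jx J x\<close>.\<close>

definition Jx :: "aut set \<Rightarrow> letter \<Rightarrow> aut set" where
  "Jx J x = {s. s = g_alpha \<and> g_beta \<in> J \<and> (x \<in> {L1, L3} \<or> g_alpha \<in> J) \<or>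
    s = g_gamma \<and> g_beta \<in> J \<and> (x \<in> {L2, L4} \<or> g_alpha \<in> J) \<or>
    s = g_beta \<and> g_gamma \<in> J \<and> (x \<in> {L1, L4} \<or> g_alpha \<in> J)}"

lemma Jx_sub: "Jx J x \<subseteq> ggens" by (auto simp: Jx_def ggens_def)

lemma Jx_mem:
  "g_alpha \<in> Jx J x \<longleftrightarrow> g_beta \<in> J \<and> (x \<in> {L1, L3} \<or> g_alpha \<in> J)"
  "g_gamma \<in> Jx J x \<longleftrightarrow> g_beta \<in> J \<and> (x \<in> {L2, L4} \<or> g_alpha \<in> J)"
  "g_beta \<in> Jx J x \<longleftrightarrow> g_gamma \<in> J \<and> (x \<in> {L1, L4} \<or> g_alpha \<in> J)"
  using gens_distinct by (auto simp: Jx_def)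

lemma ggens_Gam: "S \<subseteq> ggens \<Longrightarrow> k \<in> gen S \<Longrightarrow> k \<in> Gam"
  using gen_Gam[of S] Gam_gens by (auto simp: ggens_def)

lemma Jx_sect: assumes J: "J \<subseteq> ggens" "k \<in> gen J"
  shows "sect k [x] \<in> gen (Jx J x) \<and> (lt k x = x \<or> g_alpha \<in> J \<and> lt k x = lt g_alpha x)"
  using J(2)
proof (induction rule: gen.induct)
  case gen_id show ?case by (simp only: sect_id lt_id gen.gen_id simp_thms)
next
  case (gen_mult s g)
  have g: "g \<in> TA" using gen_mult ggens_Gam[OF J(1)] Gam_TA by blast
  have "s = g_alpha \<or> s = g_beta \<or> s = g_gamma" using gen_mult(1) J(1) by (auto simp: ggens_def)
  then show ?case
  proof (elim disjE)
    assume s: "s = g_alpha"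
    have "lt g_alpha (lt g_alpha x) = x" by (cases x) simp_all
    then show ?thesis using gen_mult g s by (auto simp: sect_comp1 lt_comp simp del: o_apply)
  next
    assume s: "s = g_beta"
    have "sect g_beta [lt g x] \<in> gen (Jx J x)"
      using gen_mult(3) gen_mult(1) s by (cases x) (auto intro!: gen_incl simp: Jx_mem)
    then show ?thesis using gen_mult g s by (auto simp: sect_comp1 lt_comp gen_comp simp del: o_apply)
  next
    assume s: "s = g_gamma"
    have "sect g_gamma [lt g x] \<in> gen (Jx J x)"
    proof (cases "lt g x \<in> {L1, L4}")
      case True
      then have "sect g_gamma [lt g x] = g_beta" by auto
      moreover have "g_beta \<in> Jx J x" using gen_mult(3) gen_mult(1) s True by (cases x) (auto simp: Jx_mem)
      ultimately show ?thesis by (simp only: gen_incl)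
    next
      case False
      then have "sect g_gamma [lt g x] = id" by (cases "lt g x") auto
      then show ?thesis by (simp only: gen.gen_id)
    qed
    then show ?thesis using gen_mult g s by (auto simp: sect_comp1 lt_comp gen_comp simp del: o_apply)
  qed
qed

text \<open>A section occurring at the other letter over the same binary letter is brought to x by
  conjugation with \<alpha>, whose sections are trivial.\<close>

lemma Jx_lift: assumes J: "J \<subseteq> ggens" "l \<in> gen (Jx J x)" shows "\<exists>k\<in>gen J. lt k x = x \<and> sect k [x] = l"
  using J(2)
proof (induction rule: gen.induct)
  case gen_id show ?case by (rule bexI[of _ id]) (simp_all only: sect_id lt_id gen.gen_id simp_thms)
next
  case (gen_mult s g)
  have one: "\<exists>k\<in>gen J. lt k x = x \<and> sect k [x] = sect t [y]"
    if t: "t \<in> {g_beta, g_gamma}" "t \<in> J" "y = x \<or> g_alpha \<in> J \<and> y = lt g_alpha x" for t y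
  proof (cases "y = x")
    case True then show ?thesis using t by (intro bexI[of _ t]) (auto intro: gen_incl)
  next
    case False
    have tt: "t \<in> TA" using t(1) by auto
    have aa: "lt g_alpha (lt g_alpha x) = x" by (cases x) simp_all
    have "lt (g_alpha \<circ> (t \<circ> g_alpha)) x = x" using t(1) aa by (auto simp: lt_comp simp del: o_apply)
    moreover have "sect (g_alpha \<circ> (t \<circ> g_alpha)) [x] = sect t [y]" using tt t False by (auto simp: sect_comp1 lt_comp simp del: o_apply)
    moreover have "g_alpha \<circ> (t \<circ> g_alpha) \<in> gen J" using t False by (intro gen_comp gen_incl) auto
    ultimately show ?thesis by blast
  qed
  have 0: "\<exists>t y. t \<in> {g_beta, g_gamma} \<and> t \<in> J \<and> (y = x \<or> g_alpha \<in> J \<and> y = lt g_alpha x) \<and> sect t [y] = s"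
  proof -
    have "s = g_alpha \<or> s = g_beta \<or> s = g_gamma" using gen_mult(1) Jx_sub by (auto simp: ggens_def)
    then show ?thesis
    proof (elim disjE)
      assume s: "s = g_alpha"
      then have "g_beta \<in> J \<and> (x \<in> {L1, L3} \<or> g_alpha \<in> J)" using gen_mult(1) by (simp only: Jx_mem)
      then show ?thesis unfolding s
        by (intro exI[of _ g_beta] exI[of _ "if x \<in> {L1, L3} then x else lt g_alpha x"]) (cases x; auto)
    next
      assume s: "s = g_beta"
      then have "g_gamma \<in> J \<and> (x \<in> {L1, L4} \<or> g_alpha \<in> J)" using gen_mult(1) by (simp only: Jx_mem)
      then show ?thesis unfolding s
        by (intro exI[of _ g_gamma] exI[of _ "if x \<in> {L1, L4} then x else lt g_alpha x"]) (cases x; auto)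
    next
      assume s: "s = g_gamma"
      then have "g_beta \<in> J \<and> (x \<in> {L2, L4} \<or> g_alpha \<in> J)" using gen_mult(1) by (simp only: Jx_mem)
      then show ?thesis unfolding s
        by (intro exI[of _ g_beta] exI[of _ "if x \<in> {L2, L4} then x else lt g_alpha x"]) (cases x; auto)
    qed
  qed
  then obtain t y where ty: "t \<in> {g_beta, g_gamma}" "t \<in> J" "y = x \<or> g_alpha \<in> J \<and> y = lt g_alpha x" "sect t [y] = s" by blast
  obtain k where k: "k \<in> gen J" "lt k x = x" "sect k [x] = s" using one[OF ty(1-3)] ty(4) by blast
  obtain h where h: "h \<in> gen J" "lt h x = x" "sect h [x] = g" using gen_mult(3) by blast
  have "k \<in> TA" "h \<in> TA" using k h ggens_Gam[OF J(1)] Gam_TA by blast+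
  then show ?case using k h by (intro bexI[of _ "k \<circ> h"]) (simp_all add: lt_comp sect_comp1 gen_comp del: o_apply)
qed

fun Jw :: "aut set \<Rightarrow> letter list \<Rightarrow> aut set" where
  "Jw J [] = J" | "Jw J (x # u) = Jw (Jx J x) u"

lemma Jw_append: "Jw J (u @ v) = Jw (Jw J u) v" by (induction u arbitrary: J) auto

lemma Jw_snoc: "Jw J (w @ [x]) = Jx (Jw J w) x" by (simp add: Jw_append)

lemma Jw_sub: "J \<subseteq> ggens \<Longrightarrow> Jw J w \<subseteq> ggens" by (induction w arbitrary: J) (use Jx_sub in auto)

lemma sect_Cons: "g \<in> TA \<Longrightarrow> sect g (x # u) = sect (sect g [x]) u"
  using sect_append[of g "[x]" u] by simp

lemma Jw_sect: assumes "J \<subseteq> ggens" "k \<in> gen J" "k w = w" shows "sect k w \<in> gen (Jw J w)"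
  using assms
proof (induction w arbitrary: k J)
  case (Cons x w)
  have k: "k \<in> TA" using Cons ggens_Gam Gam_TA by blast
  have "sect k [x] w = w" using Cons(4) k by (simp add: TA_Cons)
  then have "sect (sect k [x]) w \<in> gen (Jw (Jx J x) w)"
    using Cons(1)[OF Jx_sub] Jx_sect[OF Cons(2,3), of x] by blast
  then show ?case by (simp only: sect_Cons[OF k, of x w] Jw.simps)
qed simp

lemma Jw_lift: assumes "J \<subseteq> ggens" "l \<in> gen (Jw J w)" shows "\<exists>k\<in>gen J. k w = w \<and> sect k w = l"
  using assms
proof (induction w arbitrary: l J)
  case Nil
  then have "l \<in> gen J" by simp
  then have "l \<in> TA" using ggens_Gam[OF Nil(1)] Gam_TA by blast
  then have "l [] = [] \<and> sect l [] = l" using TA_NilD by (simp only: sect_Nil simp_thms)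
  then show ?case using \<open>l \<in> gen J\<close> by (rule bexI)
next
  case (Cons x w)
  have "l \<in> gen (Jw (Jx J x) w)" using Cons(3) by simp
  then obtain h where h: "h \<in> gen (Jx J x)" "h w = w" "sect h w = l" using Cons(1)[OF Jx_sub] by blast
  obtain k where k: "k \<in> gen J" "lt k x = x" "sect k [x] = h" using Jx_lift[OF Cons(2) h(1)] by blast
  have T: "k \<in> TA" using k(1) ggens_Gam[OF Cons(2)] Gam_TA by blast
  have "k (x # w) = x # w" using k h by (simp add: TA_Cons[OF T])
  moreover have "sect k (x # w) = l" using k h by (simp only: sect_Cons[OF T, of x w])
  ultimately show ?case using k(1) by blast
qed

text \<open>The first letter is moved by \<alpha> only, whose sections are trivial. Once it is
  fixed, the section there is replaced by an element with the same effect and trivial section, which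
  exists by induction and lifts by \<open>Jx_lift\<close>.\<close>

lemma orbit_trivial_section: assumes "J \<subseteq> ggens" "k \<in> gen J" shows "\<exists>h\<in>gen J. h w = k w \<and> sect h w = id"
  using assms
proof (induction w arbitrary: k J)
  case Nil
  have "k \<in> TA" using Nil ggens_Gam Gam_TA by blast
  then have "id [] = k []" by (simp add: TA_NilD)
  then show ?case using sect_id gen.gen_id by blast
next
  case (Cons x w)
  have kT: "k \<in> TA" if "k \<in> gen J" for k using that ggens_Gam[OF Cons(2)] Gam_TA by blast
  have fixed: "\<exists>h\<in>gen J. h (x # w) = k (x # w) \<and> sect h (x # w) = id" if k: "k \<in> gen J" "lt k x = x" for k
  proof -
    obtain l where l: "l \<in> gen (Jx J x)" "l w = sect k [x] w" "sect l w = id"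
      using Cons(1)[OF Jx_sub] Jx_sect[OF Cons(2) k(1), of x] by blast
    obtain h where h: "h \<in> gen J" "lt h x = x" "sect h [x] = l" using Jx_lift[OF Cons(2) l(1)] by blast
    have "h (x # w) = k (x # w)" using h l k by (simp add: TA_Cons kT)
    moreover have "sect h (x # w) = id" using h l by (simp only: sect_Cons[OF kT[OF h(1)], of x w])
    ultimately show ?thesis using h(1) by blast
  qed
  show ?case
  proof (cases "lt k x = x")
    case True then show ?thesis using fixed Cons(3) by blast
  next
    case False
    then have a: "g_alpha \<in> J" "lt k x = lt g_alpha x" using Jx_sect[OF Cons(2,3), of x] by auto
    have aa: "lt g_alpha (lt g_alpha x) = x" by (cases x) simp_all
    have "g_alpha \<circ> k \<in> gen J" using a Cons(3) by (simp add: gen.gen_mult)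
    moreover have "lt (g_alpha \<circ> k) x = x" using a kT[OF Cons(3)] aa by (simp add: lt_comp del: o_apply)
    ultimately obtain h where h: "h \<in> gen J" "h (x # w) = (g_alpha \<circ> k) (x # w)" "sect h (x # w) = id"
      using fixed by blast
    have hT: "h \<in> TA" by (rule kT[OF h(1)])
    have "sect (g_alpha \<circ> h) (x # w) = sect g_alpha (h (x # w)) \<circ> sect h (x # w)"
      by (rule sect_comp[OF _ hT]) simp
    moreover have "sect g_alpha (y # u) = id" for y u
      using sect_Cons[OF gens_TA(1), of y u] by (simp only: sect_gens sect_id)
    moreover have "h (x # w) = lt h x # sect h [x] w" by (rule TA_Cons[OF hT])
    ultimately have "sect (g_alpha \<circ> h) (x # w) = id" using h(3) by (simp only: id_comp)
    moreover have "(g_alpha \<circ> h) (x # w) = k (x # w)" using h(2) by simp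
    moreover have "g_alpha \<circ> h \<in> gen J" using h(1) a(1) by (rule gen.gen_mult[rotated])
    ultimately show ?thesis by blast
  qed
qed

section \<open>Tensor products with bimodules and orbits of the index two subgroup\<close>

section \<open>Tensor products with powers of a bimodule\<close>

lemma bimod_left_simp: "bimod_left g (v, h) = (g v, sect g v \<circ> h)" by (simp add: bimod_left_def)
lemma bimod_right_simp: "bimod_right (v, h) g = (v, h \<circ> g)" by (simp add: bimod_right_def)
lemma bimod_mult_simp: "bimod_mult (v, h) (w, k) = (v @ h w, sect h w \<circ> k)"
  by (simp add: bimod_mult_def bimod_left_def)

text \<open>Instantiated by \<Gamma> acting on \<open>Xi\<close> and by \<Gamma>-hat acting on the
  plane, with \<open>sg\<close> the orientation character and \<open>pr\<close> the parity of
  letters. The identity \<open>sg_parity\<close> makes \<open>Bf\<close> a bimodule over the kernel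
  \<open>H\<close> of \<open>sg\<close>.\<close>

locale bimod_action =
  fixes S :: "'p set" and act :: "'p \<Rightarrow> ('x list \<Rightarrow> 'x list) \<Rightarrow> 'p" and G :: "('x list \<Rightarrow> 'x list) set"
    and sg :: "('x list \<Rightarrow> 'x list) \<Rightarrow> bool" and pr :: "'x \<Rightarrow> bool"
  assumes G_TA: "g \<in> G \<Longrightarrow> g \<in> TA" and G_id: "id \<in> G"
    and G_comp: "g \<in> G \<Longrightarrow> h \<in> G \<Longrightarrow> g \<circ> h \<in> G" and G_inv: "g \<in> G \<Longrightarrow> iv g \<in> G"
    and G_sect: "g \<in> G \<Longrightarrow> sect g u \<in> G"
    and act_S: "\<xi> \<in> S \<Longrightarrow> g \<in> G \<Longrightarrow> act \<xi> g \<in> S" and act_id: "\<xi> \<in> S \<Longrightarrow> act \<xi> id = \<xi>"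
    and act_comp: "\<xi> \<in> S \<Longrightarrow> g \<in> G \<Longrightarrow> h \<in> G \<Longrightarrow> act \<xi> (g \<circ> h) = act (act \<xi> g) h"
    and sg_comp: "g \<in> G \<Longrightarrow> h \<in> G \<Longrightarrow> sg (g \<circ> h) = (sg g \<noteq> sg h)"
    and sg_parity: "g \<in> G \<Longrightarrow> (pr (lt g x) \<noteq> sg (sect g [x])) = (pr x \<noteq> sg g)"
begin

definition H where "H = {g \<in> G. \<not> sg g}"
definition Bf where "Bf = {([x], k) | x k. k \<in> G \<and> pr x = sg k}"

abbreviation "tn \<equiv> tensor S act G"

lemma act_inv: "\<xi> \<in> S \<Longrightarrow> g \<in> G \<Longrightarrow> act (act \<xi> g) (iv g) = \<xi>" "\<xi> \<in> S \<Longrightarrow> g \<in> G \<Longrightarrow> act (act \<xi> (iv g)) g = \<xi>"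
  using act_comp[of \<xi> g "iv g"] act_comp[of \<xi> "iv g" g] TA_inv(1,2)[OF G_TA] G_inv[of g] act_id by auto

lemma sg_id: "\<not> sg id" using sg_comp[OF G_id G_id] by simp

lemma sg_inv: "g \<in> G \<Longrightarrow> sg (iv g) = sg g"
  using sg_comp[of g "iv g"] G_inv TA_inv(1)[OF G_TA] sg_id by auto

lemma bl_comp: "g \<in> G \<Longrightarrow> h \<in> G \<Longrightarrow> bimod_left (g \<circ> h) m = bimod_left g (bimod_left h m)"
  by (cases m) (simp add: bimod_left_simp sect_comp G_TA comp_assoc)

lemma bl_id: "bimod_left id m = m" by (cases m) (simp only: bimod_left_simp sect_id id_apply id_comp)

lemma bl_G: "g \<in> G \<Longrightarrow> snd m \<in> G \<Longrightarrow> snd (bimod_left g m) \<in> G"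
  by (cases m) (simp add: bimod_left_simp G_comp G_sect del: o_apply)

lemma bl_inv: "g \<in> G \<Longrightarrow> bimod_left (iv g) (bimod_left g m) = m" "g \<in> G \<Longrightarrow> bimod_left g (bimod_left (iv g) m) = m"
  using bl_comp[of "iv g" g m] bl_comp[of g "iv g" m] G_inv[of g] TA_inv(1,2)[OF G_TA, of g] bl_id[of m] by metis+

text \<open>The relation \<open>tensor_rel\<close> is a single step by a group element, which for a
  group action is already an equivalence, so the classes are orbits.\<close>

lemma tensor_eq: assumes "\<xi> \<in> S" "snd m \<in> G"
  shows "tn \<xi> m = (\<lambda>g. (act \<xi> (iv g), bimod_left g m)) ` G"
proof
  show "tn \<xi> m \<subseteq> (\<lambda>g. (act \<xi> (iv g), bimod_left g m)) ` G"
  proof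
    fix y assume "y \<in> tn \<xi> m"
    then have "((\<xi>, m), y) \<in> tensor_rel S act G" by (simp add: tensor_def)
    then obtain \<eta> g where "\<eta> \<in> S" "g \<in> G" "\<xi> = act \<eta> g" "y = (\<eta>, bimod_left g m)"
      unfolding tensor_rel_def by blast
    then show "y \<in> (\<lambda>g. (act \<xi> (iv g), bimod_left g m)) ` G" using act_inv(1)[of \<eta> g]
      by (intro image_eqI[of _ _ g]) simp_all
  qed
  show "(\<lambda>g. (act \<xi> (iv g), bimod_left g m)) ` G \<subseteq> tn \<xi> m"
  proof (rule image_subsetI)
    fix g assume g: "g \<in> G"
    have "((act (act \<xi> (iv g)) g, m), (act \<xi> (iv g), bimod_left g m)) \<in> tensor_rel S act G"
      unfolding tensor_rel_def using g assms act_S[OF assms(1) G_inv[OF g]] by blast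
    then show "(act \<xi> (iv g), bimod_left g m) \<in> tn \<xi> m" 
      unfolding tensor_def using act_inv(2)[OF assms(1) g] by simp
  qed
qed

lemma tensor_eq_iff: assumes "\<xi> \<in> S" "snd m \<in> G" "\<xi>' \<in> S" "snd m' \<in> G"
  shows "tn \<xi> m = tn \<xi>' m' \<longleftrightarrow> (\<exists>g\<in>G. \<xi> = act \<xi>' g \<and> m' = bimod_left g m)"
proof
  assume eq: "tn \<xi> m = tn \<xi>' m'"
  have "(\<xi>', m') \<in> tn \<xi>' m'" unfolding tensor_eq[OF assms(3,4)]
    by (rule image_eqI[of _ _ id]) (simp_all only: inv_id act_id[OF assms(3)] bl_id G_id)
  then obtain g where "g \<in> G" "\<xi>' = act \<xi> (iv g)" "m' = bimod_left g m"
    unfolding eq[symmetric] tensor_eq[OF assms(1,2)] by auto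
  then show "\<exists>g\<in>G. \<xi> = act \<xi>' g \<and> m' = bimod_left g m" using act_inv(2)[OF assms(1)] by metis
next
  assume "\<exists>g\<in>G. \<xi> = act \<xi>' g \<and> m' = bimod_left g m"
  then obtain g where g: "g \<in> G" "\<xi> = act \<xi>' g" "m' = bimod_left g m" by blast
  show "tn \<xi> m = tn \<xi>' m'" unfolding tensor_eq[OF assms(1,2)] tensor_eq[OF assms(3,4)]
  proof (intro equalityI subsetI)
    fix y assume "y \<in> (\<lambda>g. (act \<xi> (iv g), bimod_left g m)) ` G"
    then obtain h where h: "h \<in> G" "y = (act \<xi> (iv h), bimod_left h m)" by blast
    have hg: "h \<circ> iv g \<in> G" using h g G_comp G_inv by blast
    have "iv (h \<circ> iv g) = g \<circ> iv h"
      using o_inv_distrib[of h "iv g"] TA_bij G_TA h(1) G_inv[OF g(1)] inv_inv_TA[OF G_TA[OF g(1)]] by metis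
    then have "act \<xi>' (iv (h \<circ> iv g)) = act \<xi> (iv h)" using act_comp[OF assms(3) g(1) G_inv[OF h(1)]] g(2) by simp
    moreover have "bimod_left (h \<circ> iv g) m' = bimod_left h m"
      using bl_comp[OF h(1) G_inv[OF g(1)]] g(3) bl_inv(1)[OF g(1)] by simp
    ultimately show "y \<in> (\<lambda>g. (act \<xi>' (iv g), bimod_left g m')) ` G" using hg h(2) by (intro image_eqI[of _ _ "h \<circ> iv g"]) auto
  next
    fix y assume "y \<in> (\<lambda>g. (act \<xi>' (iv g), bimod_left g m')) ` G"
    then obtain h where h: "h \<in> G" "y = (act \<xi>' (iv h), bimod_left h m')" by blast
    have hg: "h \<circ> g \<in> G" using h g G_comp by blast
    have "iv (h \<circ> g) = iv g \<circ> iv h"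
      using o_inv_distrib[of h g] TA_bij G_TA h(1) g(1) by metis
    then have "act \<xi> (iv (h \<circ> g)) = act \<xi>' (iv h)"
      using act_comp[OF assms(1) G_inv[OF g(1)] G_inv[OF h(1)]] g(2) act_inv(1)[OF assms(3) g(1)] by simp
    moreover have "bimod_left (h \<circ> g) m = bimod_left h m'" using bl_comp[OF h(1) g(1)] g(3) by simp
    ultimately show "y \<in> (\<lambda>g. (act \<xi> (iv g), bimod_left g m)) ` G" using hg h(2) by (intro image_eqI[of _ _ "h \<circ> g"]) auto
  qed
qed

lemma tensor_right_eq: assumes "\<xi> \<in> S" "snd m \<in> G" "g \<in> G"
  shows "tensor_right (tn \<xi> m) g = tn \<xi> (bimod_right m g)"
proof -
  have m': "snd (bimod_right m g) \<in> G" using assms G_comp by (simp add: bimod_right_def)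
  have "bimod_right (bimod_left h m) g = bimod_left h (bimod_right m g)" for h
    by (cases m) (simp add: bimod_left_simp bimod_right_simp comp_assoc)
  then show ?thesis unfolding tensor_eq[OF assms(1,2)] tensor_eq[OF assms(1) m'] tensor_right_def
    by (auto simp: image_image)
qed

definition orb :: "'p \<Rightarrow> 'x list \<Rightarrow> ('x list \<Rightarrow> 'x list) \<Rightarrow> ('p \<times> 'x bimod) set set" where
  "orb \<xi> v h = tensor_orbit H (tn \<xi> (v, h))"

lemma orb_alt: assumes "\<xi> \<in> S" "h \<in> G" shows "orb \<xi> v h = (\<lambda>u. tn \<xi> (v, h \<circ> u)) ` H"
  unfolding orb_def tensor_orbit_def
  by (rule image_cong[OF refl], subst tensor_right_eq) (use assms in \<open>auto simp: H_def bimod_right_simp\<close>)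

text \<open>Right multiplication by \<open>H\<close> can change h to any element with the same sign,
  so the orbit retains only \<open>sg h\<close>.\<close>

lemma orb_eq_iff: assumes S: "\<xi> \<in> S" "\<xi>' \<in> S" and h: "h \<in> G" "h' \<in> G"
  shows "orb \<xi> v h = orb \<xi>' v' h' \<longleftrightarrow> (\<exists>g\<in>G. \<xi> = act \<xi>' g \<and> v' = g v \<and> sg (sect g v \<circ> h) = sg h')"
proof
  assume eq: "orb \<xi> v h = orb \<xi>' v' h'"
  have "tn \<xi>' (v', h' \<circ> id) \<in> orb \<xi>' v' h'" unfolding orb_alt[OF S(2) h(2)]
    by (rule imageI) (simp only: H_def G_id sg_id mem_Collect_eq simp_thms)
  then obtain u where u: "u \<in> H" "tn \<xi>' (v', h') = tn \<xi> (v, h \<circ> u)"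
    unfolding eq[symmetric] orb_alt[OF S(1) h(1)] by auto
  have uG: "u \<in> G" "\<not> sg u" using u by (auto simp: H_def)
  obtain g where g: "g \<in> G" "\<xi> = act \<xi>' g" "(v', h') = bimod_left g (v, h \<circ> u)"
    using tensor_eq_iff[of \<xi> "(v, h \<circ> u)" \<xi>' "(v', h')"] S h u(2) G_comp[OF h(1) uG(1)] by auto
  have "h' = (sect g v \<circ> h) \<circ> u" using g(3) by (simp add: bimod_left_simp comp_assoc)
  then have "sg h' = sg (sect g v \<circ> h)" using sg_comp[of "sect g v \<circ> h" u] G_comp[OF G_sect[OF g(1)] h(1)] uG by simp
  then show "\<exists>g\<in>G. \<xi> = act \<xi>' g \<and> v' = g v \<and> sg (sect g v \<circ> h) = sg h'" using g by (auto simp: bimod_left_simp)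
next
  have sub: "orb \<xi> v h \<subseteq> orb \<xi>' v' h'"
    if g: "g \<in> G" "\<xi> = act \<xi>' g" "v' = g v" "sg (sect g v \<circ> h) = sg h'"
      and S: "\<xi> \<in> S" "\<xi>' \<in> S" and h: "h \<in> G" "h' \<in> G" for \<xi> \<xi>' v v' h h' g
  proof
    fix y assume "y \<in> orb \<xi> v h"
    then obtain u where u: "u \<in> G" "\<not> sg u" "y = tn \<xi> (v, h \<circ> u)" unfolding orb_alt[OF S(1) h(1)] by (auto simp: H_def)
    define w where "w = iv h' \<circ> (sect g v \<circ> (h \<circ> u))"
    have G1: "sect g v \<circ> h \<in> G" "sect g v \<circ> (h \<circ> u) \<in> G" using G_comp G_sect g(1) h u by blast+
    have "sg (sect g v \<circ> (h \<circ> u)) = sg h'" using sg_comp[OF G1(1) u(1)] g(4) u(2) by (simp add: comp_assoc)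
    then have w: "w \<in> H" unfolding H_def w_def using sg_comp[OF G_inv[OF h(2)] G1(2)] sg_inv[OF h(2)] G_comp[OF G_inv[OF h(2)] G1(2)] by simp
    have "h' \<circ> w = sect g v \<circ> (h \<circ> u)" unfolding w_def using TA_inv(1)[OF G_TA[OF h(2)]] by (metis comp_assoc id_comp)
    then have eq: "(v', h' \<circ> w) = bimod_left g (v, h \<circ> u)" using g(3) by (simp add: bimod_left_simp)
    have a: "snd (v, h \<circ> u) \<in> G" "snd (v', h' \<circ> w) \<in> G"
      using G_comp[OF h(1) u(1)] G_comp[OF h(2), of w] w by (simp_all add: H_def)
    have "y = tn \<xi>' (v', h' \<circ> w)" unfolding u(3) tensor_eq_iff[OF S(1) a(1) S(2) a(2)] using g(1,2) eq by blast
    then show "y \<in> orb \<xi>' v' h'" unfolding orb_alt[OF S(2) h(2)] using w by blast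
  qed
  assume "\<exists>g\<in>G. \<xi> = act \<xi>' g \<and> v' = g v \<and> sg (sect g v \<circ> h) = sg h'"
  then obtain g where g: "g \<in> G" "\<xi> = act \<xi>' g" "v' = g v" "sg (sect g v \<circ> h) = sg h'" by blast
  have "sect (iv g \<circ> g) v = sect (iv g) v' \<circ> sect g v" using sect_comp[OF G_TA[OF G_inv[OF g(1)]] G_TA[OF g(1)]] g(3) by simp
  then have e: "sect (iv g) v' \<circ> sect g v = id" using TA_inv(2)[OF G_TA[OF g(1)]] by simp
  have "sg (sect (iv g) v' \<circ> (sect g v \<circ> h)) = (sg (sect (iv g) v') \<noteq> sg h')"
    using sg_comp[OF G_sect[OF G_inv[OF g(1)], of v'] G_comp[OF G_sect[OF g(1), of v] h(1)]] g(4) by simp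
  then have "sg (sect (iv g) v' \<circ> h') = sg h"
    using sg_comp[OF G_sect[OF G_inv[OF g(1)], of v'] h(2)] e by (simp add: comp_assoc[symmetric])
  moreover have "\<xi>' = act \<xi> (iv g)" using act_inv(1)[OF S(2) g(1)] g(2) by simp
  moreover have "v = iv g v'" using g(3) TA_inv(4)[OF G_TA[OF g(1)]] by simp
  ultimately show "orb \<xi> v h = orb \<xi>' v' h'" using sub[OF g S h] sub[OF G_inv[OF g(1)] _ _ _ S(2,1) h(2,1)] by blast
qed

lemma orb_sg: assumes "\<xi> \<in> S" "h \<in> G" "h' \<in> G" "sg h = sg h'" shows "orb \<xi> v h = orb \<xi> v h'"
  unfolding orb_eq_iff[OF assms(1,1,2,3)]
  by (rule bexI[OF _ G_id]) (simp only: act_id assms sect_id id_apply id_comp simp_thms)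

lemma orb_right: assumes "\<xi> \<in> S" "h \<in> G" "g \<in> G"
  shows "tensor_orbit H (tensor_right (tn \<xi> (v, h)) g) = orb \<xi> v (h \<circ> g)"
  using tensor_right_eq[of \<xi> "(v, h)" g] assms by (simp add: orb_def bimod_right_simp)

lemma space_eq: "tensor_space S act G n = {tn \<xi> (v, h) | \<xi> v h. \<xi> \<in> S \<and> length v = n \<and> h \<in> G}"
  unfolding tensor_space_def quotient_def bimod_power_def tensor_def by auto

lemma append_eq: assumes "\<xi> \<in> S" "snd m \<in> G" "snd x \<in> G"
  shows "tensor_append S act G (tn \<xi> m) x = tn \<xi> (bimod_mult m x)"
proof -
  obtain v h where m: "m = (v, h)" "h \<in> G" using assms by (cases m) auto
  obtain w k where x: "x = (w, k)" "k \<in> G" using assms by (cases x) auto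
  have mG: "snd (bimod_mult m x) \<in> G" using m x G_comp G_sect by (simp add: bimod_mult_simp del: o_apply)
  have "tn (act \<xi> (iv g)) (bimod_mult (bimod_left g m) x) = tn \<xi> (bimod_mult m x)" if g: "g \<in> G" for g
  proof -
    have "bimod_mult (bimod_left g m) x = bimod_left g (bimod_mult m x)"
      using g m x by (simp add: bimod_left_simp bimod_mult_simp TA_append G_TA sect_comp sect_append G_sect comp_assoc)
    moreover have "snd (bimod_left g (bimod_mult m x)) \<in> G" by (rule bl_G[OF g mG])
    ultimately show ?thesis
      using tensor_eq_iff[OF assms(1) mG act_S[OF assms(1) G_inv[OF g]], of "bimod_left g (bimod_mult m x)"]
        act_inv(2)[OF assms(1) g] g by metis
  qed
  then have "(\<lambda>(\<xi>, m). tn \<xi> (bimod_mult m x)) ` tn \<xi> m = {tn \<xi> (bimod_mult m x)}"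
    unfolding tensor_eq[OF assms(1,2)] using G_id by (auto simp: image_iff image_image)
  then show ?thesis unfolding tensor_append_def by simp
qed

text \<open>This is independence of all choices in the definition of the projection: the sign of k
  is forced by \<open>sg_parity\<close> and the condition defining \<open>Bf\<close>, and the orbit
  depends on k only through its sign.\<close>

lemma projection_eq:
  assumes \<xi>: "\<xi> \<in> S" and h: "h \<in> G" and k: "k \<in> G" "sg k = (pr x \<noteq> sg h)" and v: "length v = n"
  shows "the_elem {tensor_orbit H y | y b. y \<in> tensor_space S act G n \<and> b \<in> Bf \<and>
    orb \<xi> (v @ [x]) h = tensor_orbit H (tensor_append S act G y b)} = orb \<xi> v k"
proof -
  have "{tensor_orbit H y | y b. y \<in> tensor_space S act G n \<and> b \<in> Bf \<and>
    orb \<xi> (v @ [x]) h = tensor_orbit H (tensor_append S act G y b)} = {orb \<xi> v k}" (is "?A = _")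
  proof
    show "?A \<subseteq> {orb \<xi> v k}"
    proof
      fix o' assume "o' \<in> ?A"
      then obtain y b where y: "o' = tensor_orbit H y" "y \<in> tensor_space S act G n" "b \<in> Bf"
        "orb \<xi> (v @ [x]) h = tensor_orbit H (tensor_append S act G y b)" by blast
      obtain \<xi>' v' h' where y': "y = tn \<xi>' (v', h')" "\<xi>' \<in> S" "length v' = n" "h' \<in> G" using y(2) unfolding space_eq by blast
      obtain l j where b: "b = ([l], j)" "j \<in> G" "pr l = sg j" using y(3) unfolding Bf_def by blast
      have hl: "h' [l] = [lt h' l]" using TA_single[OF G_TA[OF y'(4)]] by simp
      have "tensor_append S act G y b = tn \<xi>' (v' @ [lt h' l], sect h' [l] \<circ> j)"
        unfolding y'(1) b(1) using append_eq[of \<xi>' "(v', h')" "([l], j)"] y' b by (simp add: bimod_mult_simp hl)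
      then have "orb \<xi> (v @ [x]) h = orb \<xi>' (v' @ [lt h' l]) (sect h' [l] \<circ> j)" using y(4) by (simp add: orb_def)
      then obtain g where g: "g \<in> G" "\<xi> = act \<xi>' g" "v' @ [lt h' l] = g (v @ [x])"
        "sg (sect g (v @ [x]) \<circ> h) = sg (sect h' [l] \<circ> j)"
        using orb_eq_iff[OF \<xi> y'(2) h G_comp[OF G_sect[OF y'(4)] b(2)]] by blast
      let ?s = "sect g v"
      have s: "?s \<in> G" by (rule G_sect[OF g(1)])
      have "g (v @ [x]) = g v @ [lt ?s x]" using TA_append[OF G_TA[OF g(1)]] TA_single[OF G_TA[OF s]] by simp
      then have gv: "v' = g v" "lt h' l = lt ?s x" using g(3) by simp_all
      have "sect g (v @ [x]) = sect ?s [x]" using sect_append[OF G_TA[OF g(1)]] by simp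
      then have "(sg (sect ?s [x]) \<noteq> sg h) = (sg (sect h' [l]) \<noteq> sg j)"
        using g(4) sg_comp[OF G_sect[OF s] h] sg_comp[OF G_sect[OF y'(4)] b(2)] by simp
      moreover have "(pr (lt ?s x) \<noteq> sg (sect ?s [x])) = (pr x \<noteq> sg ?s)" by (rule sg_parity[OF s])
      moreover have "(pr (lt h' l) \<noteq> sg (sect h' [l])) = (pr l \<noteq> sg h')" by (rule sg_parity[OF y'(4)])
      ultimately have "(sg ?s \<noteq> sg k) = sg h'" using k(2) b(3) gv(2) by (smt (verit))
      then have "orb \<xi> v k = orb \<xi>' v' h'"
        using orb_eq_iff[OF \<xi> y'(2) k(1) y'(4), of v v'] g(1,2) gv(1) sg_comp[OF s k(1)] by blast
      then show "o' \<in> {orb \<xi> v k}" using y(1) y'(1) by (simp add: orb_def)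
    qed
    show "{orb \<xi> v k} \<subseteq> ?A"
    proof
      fix o' assume o': "o' \<in> {orb \<xi> v k}"
      \<comment> \<open>The pair ([l], j) solves the equation that its product with (v, k) is (v x,
        h).\<close>
      define l where "l = lt (iv k) x"
      define j where "j = iv (sect k [l]) \<circ> h"
      have kl: "lt k l = x" using lt_comp[OF G_TA[OF k(1)] G_TA[OF G_inv[OF k(1)]], of x] TA_inv(1)[OF G_TA[OF k(1)]]
        by (simp add: l_def)
      have s: "sect k [l] \<in> G" by (rule G_sect[OF k(1)])
      have j: "j \<in> G" "sg j = (sg (sect k [l]) \<noteq> sg h)"
        unfolding j_def using G_comp[OF G_inv[OF s] h] sg_comp[OF G_inv[OF s] h] sg_inv[OF s] by auto
      have "(pr (lt k l) \<noteq> sg (sect k [l])) = (pr l \<noteq> sg k)" by (rule sg_parity[OF k(1)])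
      then have "pr l = sg j" using kl k(2) j(2) by (smt (verit))
      then have "([l], j) \<in> Bf" using j(1) by (auto simp: Bf_def)
      moreover have "tn \<xi> (v, k) \<in> tensor_space S act G n" unfolding space_eq using \<xi> k(1) v by blast
      moreover have app: "tensor_append S act G (tn \<xi> (v, k)) ([l], j) = tn \<xi> (v @ [x], h)"
      proof -
        have "sect k [l] \<circ> j = h" unfolding j_def using TA_inv(1)[OF G_TA[OF s]] by (metis comp_assoc id_comp)
        then show ?thesis using append_eq[of \<xi> "(v, k)" "([l], j)"] \<xi> k(1) j(1) kl TA_single[OF G_TA[OF k(1)], of l]
          by (simp add: bimod_mult_simp)
      qed
      moreover have "orb \<xi> (v @ [x]) h = tensor_orbit H (tensor_append S act G (tn \<xi> (v, k)) ([l], j))"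
        by (simp only: orb_def app)
      moreover have "o' = tensor_orbit H (tn \<xi> (v, k))" using o' by (simp add: orb_def)
      ultimately show "o' \<in> ?A" by blast
    qed
  qed
  then show ?thesis by simp
qed

end

section \<open>The complex \<open>Xi\<close>, its fundamental domain \<open>T0\<close> and the map
  to the plane\<close>

section \<open>The complex \<open>\<Xi>\<close>\<close>

definition rc :: "aut set \<Rightarrow> aut \<Rightarrow> aut set" where "rc V g = (\<lambda>h. h \<circ> g) ` V"

lemma rc_comp: "rc (rc V g) h = rc V (g \<circ> h)" by (simp add: rc_def image_image comp_assoc)
lemma rc_id [simp]: "rc V id = V" by (simp add: rc_def)

lemma rc_inv: "g \<in> Gam \<Longrightarrow> rc (rc V g) (iv g) = V" "g \<in> Gam \<Longrightarrow> rc (rc V (iv g)) g = V"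
  by (simp_all only: rc_comp TA_inv Gam_TA rc_id)

lemma rc_mono: "U \<subseteq> V \<Longrightarrow> rc U g \<subseteq> rc V g" by (auto simp: rc_def)

lemma rc_mono_iff: "g \<in> Gam \<Longrightarrow> rc U g \<subseteq> rc V g \<longleftrightarrow> U \<subseteq> V"
  using rc_mono rc_inv(1) by metis

lemma rc_inj: "g \<in> Gam \<Longrightarrow> rc U g = rc V g \<longleftrightarrow> U = V" using rc_inv(1) by metis

lemma coset_poset_eq: "coset_poset = {rc G g | G g. G \<in> subgroups \<and> g \<in> Gam}"
  by (simp add: coset_poset_def rc_def)

lemma Xi_right_eq: "Xi_right \<xi> g V = \<xi> (rc V (iv g))" by (simp add: Xi_right_def rc_def)

lemma grp_Gam: "F \<noteq> {} \<Longrightarrow> grp F \<subseteq> Gam" using stab_Gam by (auto simp: grp_def)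

lemma subgroups_facts: assumes "G \<in> subgroups"
  shows "id \<in> G" "G \<subseteq> Gam" "g \<in> G \<Longrightarrow> h \<in> G \<Longrightarrow> g \<circ> h \<in> G" "g \<in> G \<Longrightarrow> iv g \<in> G"
proof -
  obtain F where F: "G = grp F" "face F" using assms by (auto simp: subgroups_eq)
  show "id \<in> G" using id_grp F by blast
  show "G \<subseteq> Gam" using grp_Gam F by (auto simp: face_def)
  show "g \<in> G \<Longrightarrow> h \<in> G \<Longrightarrow> g \<circ> h \<in> G" "g \<in> G \<Longrightarrow> iv g \<in> G"
    unfolding F(1) grp_def using stab_group(2,3) by blast+
qed

lemma rc_absorb: assumes "G \<in> subgroups" "k \<in> G" shows "rc G k = G"
proof
  show "rc G k \<subseteq> G" using subgroups_facts(3)[OF assms(1)] assms(2) by (auto simp: rc_def)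
  show "G \<subseteq> rc G k"
  proof
    fix g assume "g \<in> G"
    then have "g \<circ> iv k \<in> G" using subgroups_facts(3,4)[OF assms(1)] assms(2) by blast
    moreover have "(g \<circ> iv k) \<circ> k = g"
      using TA_inv(2)[OF Gam_TA] subgroups_facts(2)[OF assms(1)] assms(2) by (metis comp_assoc comp_id subsetD)
    ultimately show "g \<in> rc G k" unfolding rc_def by (metis image_eqI)
  qed
qed

lemma rc_mem: assumes "G \<in> subgroups" "g \<in> rc G h" "h \<in> Gam" shows "rc G h = rc G g"
proof -
  obtain k where k: "k \<in> G" "g = k \<circ> h" using assms by (auto simp: rc_def)
  then show ?thesis using rc_comp[of G k h] rc_absorb[OF assms(1) k(1)] by simp
qed

lemma rc_eq_subgroup: assumes "G \<in> subgroups" "G' \<in> subgroups" "g \<in> Gam" "rc G g = G'" shows "G = G'" "g \<in> G"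
proof -
  have "id \<circ> g \<in> rc G g" unfolding rc_def using subgroups_facts(1)[OF assms(1)] by (rule imageI)
  then have "g \<in> G'" using assms(4) by simp
  then have "rc G' (iv g) = G'" using rc_absorb assms(2) subgroups_facts(4) by blast
  then show "G = G'" using assms(4) rc_inv(1)[OF assms(3)] by metis
  with \<open>g \<in> G'\<close> show "g \<in> G" by simp
qed

lemma finite_vset [simp]: "finite (A :: vert set set)"
  by (rule finite_subset[of _ UNIV]) (simp_all add: Finite_Set.finite_set)

lemma finite_subgroups: "finite subgroups"
  unfolding subgroups_eq by simp

lemma simplicial_order_complex: "simplicial (order_complex Q)"
  unfolding simplicial_def order_complex_def by (auto intro: finite_subset simp: chain_subset_def)

text \<open>An element g of the smallest coset in the chain lies in all of them, and a coset
  containing g is the translate of its subgroup by g.\<close>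

lemma translate_simplex: assumes "C \<in> order_complex coset_poset"
  shows "\<exists>C0\<in>order_complex subgroups. \<exists>g\<in>Gam. C = (\<lambda>V. rc V g) ` C0"
proof -
  have C: "finite C" "C \<noteq> {}" "C \<subseteq> coset_poset" "\<And>U V. U \<in> C \<Longrightarrow> V \<in> C \<Longrightarrow> U \<subseteq> V \<or> V \<subseteq> U"
    using assms by (auto simp: order_complex_def chain_subset_def)
  obtain V1 where V1: "V1 \<in> C" "\<And>V. V \<in> C \<Longrightarrow> V \<subseteq> V1 \<Longrightarrow> V = V1"
    using finite_has_minimal[OF C(1,2)] by blast
  obtain G1 g where G1: "V1 = rc G1 g" "G1 \<in> subgroups" "g \<in> Gam" using V1(1) C(3) unfolding coset_poset_eq by blast
  have gV1: "g \<in> V1" unfolding G1(1) rc_def using subgroups_facts(1)[OF G1(2)] by (force intro: image_eqI[of _ _ id])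
  define C0 where "C0 = {G \<in> subgroups. rc G g \<in> C}"
  have ex: "\<exists>G\<in>C0. V = rc G g" if V: "V \<in> C" for V
  proof -
    have "g \<in> V" using gV1 V1 C(4)[OF V V1(1)] V by blast
    moreover obtain G h where G: "V = rc G h" "G \<in> subgroups" "h \<in> Gam" using V C(3) unfolding coset_poset_eq by blast
    ultimately have "V = rc G g" using rc_mem by blast
    then show ?thesis using G V by (auto simp: C0_def)
  qed
  have "C = (\<lambda>V. rc V g) ` C0" using ex by (auto simp: C0_def)
  moreover have "C0 \<in> order_complex subgroups"
    unfolding order_complex_def chain_subset_def
  proof (intro CollectI conjI ballI)
    show "finite C0" using finite_subgroups by (simp add: C0_def)
    show "C0 \<noteq> {}" using ex C(2) by blast
    show "C0 \<subseteq> subgroups" by (auto simp: C0_def)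
    fix U V assume "U \<in> C0" "V \<in> C0"
    then have "rc U g \<subseteq> rc V g \<or> rc V g \<subseteq> rc U g" using C(4) by (auto simp: C0_def)
    then show "U \<subseteq> V \<or> V \<subseteq> U" using rc_mono_iff[OF G1(3)] by blast
  qed
  ultimately show ?thesis using G1(3) by blast
qed

lemma Xi_right_id: "Xi_right \<xi> id = \<xi>" by (rule ext) (simp only: Xi_right_eq inv_id rc_id)

lemma Xi_right_comp: assumes "g \<in> Gam" "h \<in> Gam" shows "Xi_right \<xi> (g \<circ> h) = Xi_right (Xi_right \<xi> g) h"
proof
  fix V
  have "iv (g \<circ> h) = iv h \<circ> iv g" using o_inv_distrib[of g h] TA_bij Gam_TA assms by metis
  then show "Xi_right \<xi> (g \<circ> h) V = Xi_right (Xi_right \<xi> g) h V" by (simp only: Xi_right_eq rc_comp)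
qed

lemma supp_Xi_right: assumes "g \<in> Gam" shows "{V. Xi_right \<xi> g V \<noteq> 0} = (\<lambda>V. rc V g) ` {V. \<xi> V \<noteq> 0}"
proof (intro equalityI subsetI)
  fix V assume "V \<in> {V. Xi_right \<xi> g V \<noteq> 0}"
  then have "rc V (iv g) \<in> {V. \<xi> V \<noteq> 0}" by (simp add: Xi_right_eq)
  then show "V \<in> (\<lambda>V. rc V g) ` {V. \<xi> V \<noteq> 0}" using rc_inv(2)[OF assms, of V] by (metis image_eqI)
next
  fix V assume "V \<in> (\<lambda>V. rc V g) ` {V. \<xi> V \<noteq> 0}"
  then show "V \<in> {V. Xi_right \<xi> g V \<noteq> 0}" using rc_inv(1)[OF assms] by (auto simp: Xi_right_eq)
qed

lemma rc_coset_poset: "V \<in> coset_poset \<Longrightarrow> g \<in> Gam \<Longrightarrow> rc V g \<in> coset_poset"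
proof -
  assume "V \<in> coset_poset" "g \<in> Gam"
  then obtain G h where "V = rc G h" "G \<in> subgroups" "h \<in> Gam" unfolding coset_poset_eq by blast
  then have "rc V g = rc G (h \<circ> g)" "h \<circ> g \<in> Gam" using Gam_comp \<open>g \<in> Gam\<close> by (simp_all only: rc_comp)
  then show ?thesis using \<open>G \<in> subgroups\<close> unfolding coset_poset_eq by blast
qed

lemma rc_order_complex: assumes "C \<in> order_complex coset_poset" "g \<in> Gam"
  shows "(\<lambda>V. rc V g) ` C \<in> order_complex coset_poset"
  using assms rc_coset_poset unfolding order_complex_def chain_subset_def by (auto simp: rc_mono_iff)

lemma sum_supp_Xi_right: assumes "g \<in> Gam"
  shows "(\<Sum>V | Xi_right \<xi> g V \<noteq> 0. f V (Xi_right \<xi> g V)) = (\<Sum>V | \<xi> V \<noteq> 0. f (rc V g) (\<xi> V))"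
proof -
  have "inj_on (\<lambda>V. rc V g) {V. \<xi> V \<noteq> 0}" using rc_inj[OF assms] by (auto simp: inj_on_def)
  then show ?thesis unfolding supp_Xi_right[OF assms]
    by (subst sum.reindex) (simp_all add: Xi_right_eq rc_inv(1)[OF assms])
qed

lemma Xi_right_Xi: assumes "\<xi> \<in> Xi" "g \<in> Gam" shows "Xi_right \<xi> g \<in> Xi"
proof -
  have \<xi>: "\<And>V. 0 \<le> \<xi> V" "{V. \<xi> V \<noteq> 0} \<in> order_complex coset_poset" "(\<Sum>V | \<xi> V \<noteq> 0. \<xi> V) = 1"
    using assms(1) by (auto simp: Xi_def realization_def)
  have "{V. Xi_right \<xi> g V \<noteq> 0} \<in> order_complex coset_poset"
    unfolding supp_Xi_right[OF assms(2)] by (rule rc_order_complex[OF \<xi>(2) assms(2)])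
  moreover have "(\<Sum>V | Xi_right \<xi> g V \<noteq> 0. Xi_right \<xi> g V) = 1"
    using sum_supp_Xi_right[OF assms(2), of "\<lambda>V x. x" \<xi>] \<xi>(3) by simp
  ultimately show ?thesis using \<xi>(1) by (simp add: Xi_def realization_def Xi_right_eq)
qed

lemma subgroups_coset_poset: "subgroups \<subseteq> coset_poset"
  unfolding coset_poset_eq using Gam_id rc_id by blast

lemma order_complex_mono: "P \<subseteq> Q \<Longrightarrow> order_complex P \<subseteq> order_complex Q" by (auto simp: order_complex_def)

lemma T0_Xi: "T0 \<subseteq> Xi"
  using order_complex_mono[OF subgroups_coset_poset] by (auto simp: T0_def Xi_def realization_def)

lemma T0_facts: assumes "\<xi> \<in> T0"
  shows "\<And>V. 0 \<le> \<xi> V" "\<And>V. \<xi> V \<noteq> 0 \<Longrightarrow> V \<in> subgroups" "(\<Sum>V | \<xi> V \<noteq> 0. \<xi> V) = 1" "finite {V. \<xi> V \<noteq> 0}"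
    "\<And>U V. \<xi> U \<noteq> 0 \<Longrightarrow> \<xi> V \<noteq> 0 \<Longrightarrow> U \<subseteq> V \<or> V \<subseteq> U" "\<exists>V. \<xi> V \<noteq> 0"
  using assms by (auto simp: T0_def realization_def order_complex_def chain_subset_def)

lemma Xi_ex_T0: assumes "\<xi> \<in> Xi" shows "\<exists>\<xi>0\<in>T0. \<exists>g\<in>Gam. \<xi> = Xi_right \<xi>0 g"
proof -
  have \<xi>: "\<And>V. 0 \<le> \<xi> V" "{V. \<xi> V \<noteq> 0} \<in> order_complex coset_poset" "(\<Sum>V | \<xi> V \<noteq> 0. \<xi> V) = 1"
    using assms by (auto simp: Xi_def realization_def)
  obtain C0 g where C0: "C0 \<in> order_complex subgroups" "g \<in> Gam" "{V. \<xi> V \<noteq> 0} = (\<lambda>V. rc V g) ` C0"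
    using translate_simplex[OF \<xi>(2)] by blast
  let ?x = "Xi_right \<xi> (iv g)"
  have ig: "iv g \<in> Gam" using Gam_inv C0 by blast
  have "{V. ?x V \<noteq> 0} = C0" unfolding supp_Xi_right[OF ig] C0(3) by (simp add: image_image rc_inv[OF C0(2)])
  moreover have "(\<Sum>V | ?x V \<noteq> 0. ?x V) = 1" using sum_supp_Xi_right[OF ig, of "\<lambda>V x. x" \<xi>] \<xi>(3) by simp
  ultimately have "?x \<in> T0" using \<xi>(1) C0(1) by (simp add: T0_def realization_def Xi_right_eq)
  moreover have "\<xi> = Xi_right ?x g"
    using Xi_right_comp[OF ig C0(2), of \<xi>] by (simp only: TA_inv Gam_TA C0 Xi_right_id)
  ultimately show ?thesis using C0(2) by blast
qed

lemma T0_fixed: assumes "\<xi> \<in> T0" "k \<in> Gam" "\<And>G. \<xi> G \<noteq> 0 \<Longrightarrow> k \<in> G" shows "Xi_right \<xi> k = \<xi>"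
proof
  fix V
  have *: "rc G k = G" "rc G (iv k) = G" if "\<xi> G \<noteq> 0" for G
    using rc_absorb subgroups_facts(4) T0_facts(2)[OF assms(1) that] assms(3)[OF that] by blast+
  show "Xi_right \<xi> k V = \<xi> V"
  proof (cases "\<xi> V = 0")
    case False then show ?thesis using *(2) by (simp add: Xi_right_eq)
  next
    case True
    have "\<xi> (rc V (iv k)) = 0"
    proof (rule ccontr)
      assume n: "\<xi> (rc V (iv k)) \<noteq> 0"
      then have "rc V (iv k) = V" using *(1)[OF n] rc_inv(2)[OF assms(2)] by metis
      then show False using n True by simp
    qed
    then show ?thesis using True by (simp add: Xi_right_eq)
  qed
qed

text \<open>If a translate of one of the subgroups is again one of them, it is the same subgroup,
  translated by one of its own elements. So \<open>T0\<close> meets no orbit twice, and stabilizers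
  are read off from supports.\<close>

lemma T0_strict: assumes "\<xi> \<in> T0" "\<xi>' \<in> T0" "k \<in> Gam" "\<xi>' = Xi_right \<xi> k"
  shows "\<xi>' = \<xi>" "\<And>G. \<xi> G \<noteq> 0 \<Longrightarrow> k \<in> G"
proof -
  show k: "k \<in> G" if "\<xi> G \<noteq> 0" for G
  proof -
    have "rc G k \<in> {V. \<xi>' V \<noteq> 0}" unfolding assms(4) supp_Xi_right[OF assms(3)] using that by blast
    then have "rc G k \<in> subgroups" using T0_facts(2)[OF assms(2)] by blast
    then show ?thesis using rc_eq_subgroup(2)[OF T0_facts(2)[OF assms(1) that] _ assms(3)] by blast
  qed
  show "\<xi>' = \<xi>" using T0_fixed[OF assms(1,3) k] assms(4) by simp
qed

text \<open>The vertices of the smallest face of the three tetrahedra carrying the point, possibly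
  those of a whole tetrahedron, because the barycenter of ABC is joined to the other faces.\<close>

definition Fs :: "pt \<Rightarrow> vert set" where "Fs \<xi> = \<Union>{F. face F \<and> \<xi> (grp F) \<noteq> 0}"

lemma supp_subgroup: assumes "\<xi> \<in> T0" "\<xi> G \<noteq> 0" shows "\<exists>F. face F \<and> G = grp F"
  using T0_facts(2)[OF assms] by (auto simp: subgroups_eq)

lemma Fs_ne: assumes "\<xi> \<in> T0" shows "Fs \<xi> \<noteq> {}"
proof -
  obtain V where V: "\<xi> V \<noteq> 0" using T0_facts(6)[OF assms] by blast
  then obtain F where F: "face F" "V = grp F" using supp_subgroup[OF assms] by blast
  then have "F \<subseteq> Fs \<xi>" using V by (auto simp: Fs_def)
  then show ?thesis using F by (auto simp: face_def)
qed

lemma grp_Fs: assumes "\<xi> \<in> T0" shows "k \<in> grp (Fs \<xi>) \<longleftrightarrow> (\<forall>G. \<xi> G \<noteq> 0 \<longrightarrow> k \<in> G)"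
proof
  assume k: "k \<in> grp (Fs \<xi>)"
  show "\<forall>G. \<xi> G \<noteq> 0 \<longrightarrow> k \<in> G"
  proof (intro allI impI)
    fix G assume G: "\<xi> G \<noteq> 0"
    then obtain F where "face F" "G = grp F" using supp_subgroup[OF assms] by blast
    then show "k \<in> G" using k G by (auto simp: grp_def Fs_def)
  qed
next
  assume k: "\<forall>G. \<xi> G \<noteq> 0 \<longrightarrow> k \<in> G"
  show "k \<in> grp (Fs \<xi>)" unfolding grp_def Fs_def using k by (auto simp: grp_def)
qed

lemma T0_stab: assumes "\<xi> \<in> T0" "\<xi>' \<in> T0" "k \<in> Gam"
  shows "\<xi>' = Xi_right \<xi> k \<longleftrightarrow> \<xi>' = \<xi> \<and> k \<in> grp (Fs \<xi>)"
proof
  assume eq: "\<xi>' = Xi_right \<xi> k"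
  have "\<forall>G. \<xi> G \<noteq> 0 \<longrightarrow> k \<in> G" using T0_strict(2)[OF assms eq] by blast
  then show "\<xi>' = \<xi> \<and> k \<in> grp (Fs \<xi>)" using T0_strict(1)[OF assms eq] grp_Fs[OF assms(1)] by blast
next
  assume a: "\<xi>' = \<xi> \<and> k \<in> grp (Fs \<xi>)"
  then have "Xi_right \<xi> k = \<xi>" using grp_Fs[OF assms(1)] by (intro T0_fixed[OF assms(1,3)]) blast
  then show "\<xi>' = Xi_right \<xi> k" using a by simp
qed

section \<open>The map \<open>P\<close>\<close>

definition bary :: "vert set \<Rightarrow> plane" where "bary F = (1 / real (card F)) *\<^sub>R (\<Sum>X\<in>F. vert_image X)"

lemma plane_act_affine: assumes "g \<in> Gam_hat" "finite I" "sum c I = 1"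
  shows "plane_act g (\<Sum>i\<in>I. c i *\<^sub>R z i) = (\<Sum>i\<in>I. c i *\<^sub>R plane_act g (z i))"
proof -
  obtain sw s1 s2 t1 t2 where M: "plane_act g = wform sw s1 s2 t1 t2" using wrel_form[OF plane_act_wrel[OF assms(1)]] by blast
  have f: "fst (\<Sum>i\<in>I. c i *\<^sub>R z i) = (\<Sum>i\<in>I. c i * fst (z i))" "snd (\<Sum>i\<in>I. c i *\<^sub>R z i) = (\<Sum>i\<in>I. c i * snd (z i))"
    for z :: "'a \<Rightarrow> plane" by (simp_all add: fst_sum snd_sum)
  have t: "(\<Sum>i\<in>I. c i * (a * u i + b)) = a * (\<Sum>i\<in>I. c i * u i) + b" for a b u
    using assms(3) by (simp add: algebra_simps sum.distrib flip: sum_distrib_left sum_distrib_right)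
  show ?thesis unfolding M prod_eq_iff f by (cases sw) (simp_all add: wform_def f t)
qed

lemma pl_bary: assumes "F \<noteq> {}" "k \<in> grp F" shows "pl k (bary F) = bary F"
proof -
  have k: "k \<in> Gam" using assms grp_Gam by blast
  have "sum (\<lambda>_. 1 / real (card F)) F = 1" using assms(1) by simp
  from plane_act_affine[OF nu_Gamh[OF k] _ this, of vert_image]
  have "pl k (bary F) = (\<Sum>X\<in>F. (1 / real (card F)) *\<^sub>R pl k (vert_image X))" by (simp add: bary_def scaleR_sum_right)
  also have "\<dots> = bary F" unfolding bary_def scaleR_sum_right
    using assms(2) stab_fixes by (intro sum.cong) (auto simp: grp_def)
  finally show ?thesis .
qed

text \<open>The coset determines the face by \<open>grp_inj\<close>, and it determines g up to a
  left factor from \<open>grp F\<close>, which fixes the barycenter of the projected face.\<close>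

lemma P_vertex_eq: assumes F: "face F" and g: "g \<in> Gam" shows "P_vertex (rc (grp F) g) = pl g (bary F)"
  unfolding P_vertex_def
proof (rule the_equality)
  show "\<exists>F' g'. F' \<noteq> {} \<and> card F' \<le> 3 \<and> (\<exists>\<Delta>\<in>tetrahedra. F' \<subseteq> \<Delta>) \<and> g' \<in> Gam \<and> rc (grp F) g = (\<lambda>h. h \<circ> g') ` \<Inter> (stab ` F') \<and>
     pl g (bary F) = plane_right ((1 / real (card F')) *\<^sub>R sum vert_image F') (nu g')"
    using F g by (intro exI[of _ F] exI[of _ g]) (auto simp: face_card rc_def grp_def plane_right_def bary_def)
  fix z assume "\<exists>F' g'. F' \<noteq> {} \<and> card F' \<le> 3 \<and> (\<exists>\<Delta>\<in>tetrahedra. F' \<subseteq> \<Delta>) \<and> g' \<in> Gam \<and> rc (grp F) g = (\<lambda>h. h \<circ> g') ` \<Inter> (stab ` F') \<and>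
     z = plane_right ((1 / real (card F')) *\<^sub>R sum vert_image F') (nu g')"
  then obtain F' g' where F': "face F'" "g' \<in> Gam" "rc (grp F) g = rc (grp F') g'" "z = pl g' (bary F')"
    by (auto simp: face_card rc_def grp_def plane_right_def bary_def)
  have sub: "grp F \<in> subgroups" "grp F' \<in> subgroups" using F F'(1) by (auto simp: subgroups_eq)
  have ig: "iv g \<in> Gam" "g' \<circ> iv g \<in> Gam" using Gam_inv[OF g] Gam_comp F'(2) by blast+
  have "rc (grp F') (g' \<circ> iv g) = grp F" using F'(3) rc_inv(1)[OF g] by (metis rc_comp)
  from rc_eq_subgroup[OF sub(2,1) ig(2) this] have eq: "F' = F" "g' \<circ> iv g \<in> grp F'"
    using grp_inj[OF F'(1) F] by blast+
  have "pl ((g' \<circ> iv g) \<circ> g) = pl g \<circ> pl (g' \<circ> iv g)" by (rule pl_comp[OF ig(2) g])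
  moreover have "(g' \<circ> iv g) \<circ> g = g'" using TA_inv(2)[OF Gam_TA[OF g]] by (metis comp_assoc comp_id)
  ultimately have "pl g' (bary F) = pl g (pl (g' \<circ> iv g) (bary F))" by simp
  also have "pl (g' \<circ> iv g) (bary F) = bary F" using pl_bary[of F "g' \<circ> iv g"] eq F by (simp add: face_def)
  finally show "z = pl g (bary F)" using F'(4) eq by simp
qed

lemma P_vertex_grp: "face F \<Longrightarrow> P_vertex (grp F) = bary F"
  using P_vertex_eq[OF _ Gam_id, of F] by (simp only: rc_id pl_gens id_apply)

lemma P_vertex_rc: assumes "V \<in> coset_poset" "g \<in> Gam" shows "P_vertex (rc V g) = pl g (P_vertex V)"
proof -
  obtain F h where V: "V = rc (grp F) h" "face F" "h \<in> Gam" using assms(1) by (auto simp: coset_poset_eq subgroups_eq)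
  have "P_vertex (rc V g) = pl (h \<circ> g) (bary F)"
    unfolding V(1) rc_comp by (rule P_vertex_eq[OF V(2) Gam_comp[OF V(3) assms(2)]])
  then show ?thesis using P_vertex_eq[OF V(2,3)] pl_comp[OF V(3) assms(2)] V(1) by simp
qed

lemma P_map_right: assumes "\<xi> \<in> Xi" "g \<in> Gam" shows "P_map (Xi_right \<xi> g) = pl g (P_map \<xi>)"
proof -
  have \<xi>: "{V. \<xi> V \<noteq> 0} \<in> order_complex coset_poset" "(\<Sum>V | \<xi> V \<noteq> 0. \<xi> V) = 1"
    using assms(1) by (auto simp: Xi_def realization_def)
  then have f: "finite {V. \<xi> V \<noteq> 0}" and cp: "\<And>V. \<xi> V \<noteq> 0 \<Longrightarrow> V \<in> coset_poset" by (auto simp: order_complex_def)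
  have "P_map (Xi_right \<xi> g) = (\<Sum>V | \<xi> V \<noteq> 0. \<xi> V *\<^sub>R P_vertex (rc V g))"
    unfolding P_map_def using sum_supp_Xi_right[OF assms(2), of "\<lambda>V x. x *\<^sub>R P_vertex V" \<xi>] by simp
  also have "\<dots> = (\<Sum>V | \<xi> V \<noteq> 0. \<xi> V *\<^sub>R pl g (P_vertex V))"
    using P_vertex_rc[OF cp assms(2)] by (intro sum.cong) auto
  also have "\<dots> = pl g (P_map \<xi>)" unfolding P_map_def
    using plane_act_affine[OF nu_Gamh[OF assms(2)] f \<xi>(2), of P_vertex] by simp
  finally show ?thesis .
qed

section \<open>Barycentric coordinates on \<open>\<T>\<^sub>0\<close>\<close>

text \<open>Barycentric coordinates in the tetrahedra before subdivision: the weight at the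
  barycenter of F is shared equally by the vertices of F.\<close>

definition tau :: "pt \<Rightarrow> vert \<Rightarrow> real" where
  "tau \<xi> X = (\<Sum>F | face F \<and> X \<in> F. \<xi> (grp F) / real (card F))"

lemma card_face: "face F \<Longrightarrow> 0 < card F" by (auto simp: face_def card_gt_0_iff)

lemma tau_nonneg: "\<xi> \<in> T0 \<Longrightarrow> 0 \<le> tau \<xi> X"
  unfolding tau_def by (intro sum_nonneg) (simp add: T0_facts(1))

lemma tau_pos: assumes "\<xi> \<in> T0" shows "0 < tau \<xi> X \<longleftrightarrow> X \<in> Fs \<xi>"
proof -
  have "tau \<xi> X = 0 \<longleftrightarrow> (\<forall>F\<in>{F. face F \<and> X \<in> F}. \<xi> (grp F) / real (card F) = 0)"
    unfolding tau_def by (rule sum_nonneg_eq_0_iff) (simp_all add: T0_facts(1)[OF assms])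
  also have "\<dots> \<longleftrightarrow> X \<notin> Fs \<xi>" using card_face by (auto simp: Fs_def)
  finally show ?thesis using tau_nonneg[OF assms, of X] by auto
qed

lemma sum_T0: fixes f :: "aut set \<Rightarrow> real \<Rightarrow> 'b::comm_monoid_add" assumes "\<xi> \<in> T0" "\<And>V. f V 0 = 0"
  shows "(\<Sum>V | \<xi> V \<noteq> 0. f V (\<xi> V)) = (\<Sum>F | face F. f (grp F) (\<xi> (grp F)))"
proof -
  have inj: "inj_on grp {F. face F}" using grp_inj by (auto simp: inj_on_def)
  have "(\<Sum>F | face F. f (grp F) (\<xi> (grp F))) = (\<Sum>V\<in>subgroups. f V (\<xi> V))"
    unfolding subgroups_eq using inj by (subst sum.reindex) simp_all
  also have "\<dots> = (\<Sum>V | \<xi> V \<noteq> 0. f V (\<xi> V))"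
    by (rule sum.mono_neutral_right) (use T0_facts(2)[OF assms(1)] assms(2) finite_subgroups in auto)
  finally show ?thesis by simp
qed

lemma tau_sum: fixes z :: "vert \<Rightarrow> 'b::real_vector" assumes "\<xi> \<in> T0" shows "(\<Sum>X\<in>UNIV. tau \<xi> X *\<^sub>R z X) = (\<Sum>F | face F. \<xi> (grp F) *\<^sub>R ((1 / real (card F)) *\<^sub>R (\<Sum>X\<in>F. z X)))"
proof -
  have "(\<Sum>X\<in>UNIV. tau \<xi> X *\<^sub>R z X) = (\<Sum>X\<in>UNIV. \<Sum>F | face F. if X \<in> F then (\<xi> (grp F) / real (card F)) *\<^sub>R z X else 0)"
  proof (intro sum.cong refl)
    fix X
    have "tau \<xi> X *\<^sub>R z X = (\<Sum>F | face F \<and> X \<in> F. (\<xi> (grp F) / real (card F)) *\<^sub>R z X)"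
      unfolding tau_def by (rule scaleR_sum_left)
    then show "tau \<xi> X *\<^sub>R z X = (\<Sum>F | face F. if X \<in> F then (\<xi> (grp F) / real (card F)) *\<^sub>R z X else 0)"
      using sum.inter_filter[of "{F. face F}" "\<lambda>F. (\<xi> (grp F) / real (card F)) *\<^sub>R z X" "\<lambda>F. X \<in> F"] by simp
  qed
  also have "\<dots> = (\<Sum>F | face F. \<Sum>X\<in>UNIV. if X \<in> F then (\<xi> (grp F) / real (card F)) *\<^sub>R z X else 0)"
    by (rule sum.swap)
  also have "\<dots> = (\<Sum>F | face F. \<xi> (grp F) *\<^sub>R ((1 / real (card F)) *\<^sub>R (\<Sum>X\<in>F. z X)))"
    by (intro sum.cong refl) (simp add: sum.inter_restrict[symmetric] scaleR_sum_right)
  finally show ?thesis .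
qed

lemma P_map_tau: assumes "\<xi> \<in> T0" shows "P_map \<xi> = (\<Sum>X\<in>UNIV. tau \<xi> X *\<^sub>R vert_image X)"
proof -
  have "P_map \<xi> = (\<Sum>F | face F. \<xi> (grp F) *\<^sub>R P_vertex (grp F))"
    unfolding P_map_def using sum_T0[OF assms, of "\<lambda>V x. x *\<^sub>R P_vertex V"] by simp
  also have "\<dots> = (\<Sum>X\<in>UNIV. tau \<xi> X *\<^sub>R vert_image X)"
    unfolding tau_sum[OF assms] by (intro sum.cong refl) (simp only: mem_Collect_eq P_vertex_grp bary_def)
  finally show ?thesis .
qed

lemma UNIV_vert: "(UNIV :: vert set) = {vA, vB, vC, vA1, vB1, vC1}" using vert.exhaust by auto

lemma tau_total: assumes "\<xi> \<in> T0" shows "tau \<xi> vA + tau \<xi> vB + tau \<xi> vC + tau \<xi> vA1 + tau \<xi> vB1 + tau \<xi> vC1 = 1"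
proof -
  have "(\<Sum>X\<in>UNIV. tau \<xi> X *\<^sub>R (1::real)) = (\<Sum>F | face F. \<xi> (grp F))"
    unfolding tau_sum[OF assms]
  proof (intro sum.cong refl)
    fix F assume "F \<in> {F. face F}"
    then have "0 < card F" using card_face by blast
    moreover from this have "F \<noteq> {}" by auto
    ultimately show "\<xi> (grp F) *\<^sub>R ((1 / real (card F)) *\<^sub>R (\<Sum>X\<in>F. (1::real))) = \<xi> (grp F)" by simp
  qed
  also have "\<dots> = 1" using sum_T0[OF assms, of "\<lambda>V x. x"] T0_facts(3)[OF assms] by simp
  finally show ?thesis by (simp add: UNIV_vert)
qed

lemma P_map_coords: assumes "\<xi> \<in> T0"
  shows "P_map \<xi> = (tau \<xi> vA + tau \<xi> vA1, tau \<xi> vC + tau \<xi> vC1)"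
  unfolding P_map_tau[OF assms] by (simp add: UNIV_vert pA_def pB_def pC_def)

lemma P_map_Dt: assumes "\<xi> \<in> T0" shows "P_map \<xi> \<in> Dt"
  using tau_nonneg[OF assms] tau_total[OF assms] unfolding P_map_coords[OF assms] Dt_def
  by (simp add: algebra_simps) (smt (verit))

text \<open>The faces in the support other than ABC form a chain under inclusion, so two of A1, B1,
  C1 would have to occur in a common face.\<close>

lemma Fs_tetra: assumes "\<xi> \<in> T0" shows "\<exists>Z\<in>{vA1, vB1, vC1}. Fs \<xi> \<subseteq> {Z, vA, vB, vC}"
proof -
  have one: "Z = Z'" if Z: "Z \<in> Fs \<xi>" "Z' \<in> Fs \<xi>" "Z \<in> {vA1, vB1, vC1}" "Z' \<in> {vA1, vB1, vC1}" for Z Z'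
  proof -
    obtain F F' where F: "face F" "\<xi> (grp F) \<noteq> 0" "Z \<in> F" "face F'" "\<xi> (grp F') \<noteq> 0" "Z' \<in> F'" using Z unfolding Fs_def by blast
    have "F \<noteq> {vA, vB, vC}" "F' \<noteq> {vA, vB, vC}" using F Z by auto
    then have "F \<subseteq> F' \<or> F' \<subseteq> F" using T0_facts(5)[OF assms F(2,5)] grp_subset_iff[OF F(1,4)] grp_subset_iff[OF F(4,1)] by blast
    then obtain F2 where F2: "face F2" "Z \<in> F2" "Z' \<in> F2" using F by blast
    then show ?thesis using Z unfolding face_def tetrahedra_def by auto
  qed
  have v: "X \<in> {vA, vB, vC} \<or> X \<in> {vA1, vB1, vC1}" for X by (cases X) auto
  show ?thesis
  proof (cases "Fs \<xi> \<inter> {vA1, vB1, vC1} = {}")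
    case True then show ?thesis using v by (intro bexI[of _ vA1]) auto
  next
    case False
    then obtain Z where "Z \<in> Fs \<xi>" "Z \<in> {vA1, vB1, vC1}" by blast
    then show ?thesis using one v by (intro bexI[of _ Z]) blast+
  qed
qed

text \<open>It suffices to lift the reflections fixing the projected point. Such a reflection puts
  the point on a side of the triangle, so the weights over the opposite corner vanish; which of the
  lifts a or a \<alpha> and the like fixes the point depends on the tetrahedron containing
  it.\<close>

lemma stabilizer_lift: assumes \<xi>: "\<xi> \<in> T0" and h: "h \<in> Gam_hat" "plane_act h (P_map \<xi>) = P_map \<xi>"
  shows "\<exists>k\<in>grp (Fs \<xi>). nu k = h"
proof -
  let ?z = "P_map \<xi>"
  have F: "X \<in> Fs \<xi> \<longleftrightarrow> tau \<xi> X \<noteq> 0" for X using tau_pos[OF \<xi>, of X] tau_nonneg[OF \<xi>, of X] by auto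
  obtain Z where Z: "Z \<in> {vA1, vB1, vC1}" "Fs \<xi> \<subseteq> {Z, vA, vB, vC}" using Fs_tetra[OF \<xi>] by blast
  have st: "k \<in> grp (Fs \<xi>)" if "\<And>X. X \<in> Fs \<xi> \<Longrightarrow> k \<in> gen (JJ X \<union> RR X)" for k
    using that by (auto simp: grp_def stab_gen)
  have cgg: "cga \<circ> g_gamma = g_c" "bbe \<circ> g_beta = g_b" "aal \<circ> g_alpha = g_a" by (auto simp: fun_eq_iff)
  have "cga \<circ> g_gamma \<in> gen (JJ vB \<union> RR vB)" "bbe \<circ> g_beta \<in> gen (JJ vC \<union> RR vC)" "aal \<circ> g_alpha \<in> gen (JJ vC \<union> RR vC)"
    by (intro gen_comp gen_incl; simp)+
  note gc = this[unfolded cgg]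
  have ex: "aal \<in> gen (JJ vB \<union> RR vB)" "bbe \<in> gen (JJ vA \<union> RR vA)" "cga \<in> gen (JJ vA \<union> RR vA)"
    by (rule gen_comp; rule gen_incl; simp)+
  have i: "s \<in> gen (JJ X \<union> RR X)" if "s \<in> RR X" for s X using that by (simp add: gen_incl)
  have lift1: "\<exists>k\<in>grp (Fs \<xi>). nu k = s" if s: "s \<in> Hset" "plane_act s ?z = ?z" for s
  proof -
    have "s = h_a \<or> s = h_b \<or> s = h_c" using s(1) by (auto simp: Hset_def)
    then show ?thesis
    proof (elim disjE)
      assume sa: "s = h_a"
      then have "fst ?z = 0" using s(2) by (simp add: plane_act_gens rf_a_def prod_eq_iff)
      then have "tau \<xi> vA = 0" "tau \<xi> vA1 = 0" using tau_nonneg[OF \<xi>] unfolding P_map_coords[OF \<xi>] by (smt (verit) fst_conv)+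
      then have n: "vA \<notin> Fs \<xi>" "vA1 \<notin> Fs \<xi>" using F by auto
      show ?thesis
      proof (cases "vC1 \<in> Fs \<xi>")
        case True
        then have "Fs \<xi> \<subseteq> {vC1, vB, vC}" using Z n by auto
        then have "aal \<in> grp (Fs \<xi>)" using i[of aal vC] i[of aal vC1] ex by (intro st) auto
        moreover have "nu aal = s" using sa by (simp add: nu_comp Gam_gens nu_gens)
        ultimately show ?thesis by blast
      next
        case False
        then have "Fs \<xi> \<subseteq> {vB1, vB, vC}" using Z n by auto
        then have "g_a \<in> grp (Fs \<xi>)" using i[of g_a vB] i[of g_a vB1] gc by (intro st) auto
        then show ?thesis using sa nu_gens by blast
      qed
    next
      assume sb: "s = h_b"
      then have "fst ?z + snd ?z = 1" using s(2) by (simp add: plane_act_gens rf_b_def prod_eq_iff)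
      then have "tau \<xi> vB = 0" "tau \<xi> vB1 = 0" using tau_nonneg[OF \<xi>] tau_total[OF \<xi>] unfolding P_map_coords[OF \<xi>]
        by (smt (verit) fst_conv snd_conv)+
      then have n: "vB \<notin> Fs \<xi>" "vB1 \<notin> Fs \<xi>" using F by auto
      show ?thesis
      proof (cases "vC1 \<in> Fs \<xi>")
        case True
        then have "Fs \<xi> \<subseteq> {vC1, vA, vC}" using Z n by auto
        then have "bbe \<in> grp (Fs \<xi>)" using i[of bbe vC] i[of bbe vC1] ex by (intro st) auto
        moreover have "nu bbe = s" using sb by (simp add: nu_comp Gam_gens nu_gens)
        ultimately show ?thesis by blast
      next
        case False
        then have "Fs \<xi> \<subseteq> {vA1, vA, vC}" using Z n by auto
        then have "g_b \<in> grp (Fs \<xi>)" using i[of g_b vA] i[of g_b vA1] gc by (intro st) auto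
        then show ?thesis using sb nu_gens by blast
      qed
    next
      assume sc: "s = h_c"
      then have "snd ?z = 0" using s(2) by (simp add: plane_act_gens rf_c_def prod_eq_iff)
      then have "tau \<xi> vC = 0" "tau \<xi> vC1 = 0" using tau_nonneg[OF \<xi>] unfolding P_map_coords[OF \<xi>] by (smt (verit) snd_conv)+
      then have n: "vC \<notin> Fs \<xi>" "vC1 \<notin> Fs \<xi>" using F by auto
      show ?thesis
      proof (cases "vB1 \<in> Fs \<xi>")
        case True
        then have "Fs \<xi> \<subseteq> {vB1, vA, vB}" using Z n by auto
        then have "cga \<in> grp (Fs \<xi>)" using i[of cga vB] i[of cga vB1] ex by (intro st) auto
        moreover have "nu cga = s" using sc by (simp add: nu_comp Gam_gens nu_gens)
        ultimately show ?thesis by blast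
      next
        case False
        then have "Fs \<xi> \<subseteq> {vA1, vA, vB}" using Z n by auto
        then have "g_c \<in> grp (Fs \<xi>)" using i[of g_c vA] i[of g_c vA1] gc by (intro st) auto
        then show ?thesis using sc nu_gens by blast
      qed
    qed
  qed
  have Fne: "Fs \<xi> \<noteq> {}" by (rule Fs_ne[OF \<xi>])
  have "h \<in> gen {s \<in> Hset. plane_act s ?z = ?z}" by (rule plane_stabilizer[OF P_map_Dt[OF \<xi>] h])
  then show ?thesis
  proof (induction rule: gen.induct)
    case gen_id show ?case using nu_gens(1) id_grp by blast
  next
    case (gen_mult s g)
    obtain k k' where k: "k \<in> grp (Fs \<xi>)" "nu k = s" "k' \<in> grp (Fs \<xi>)" "nu k' = g" using gen_mult(3) lift1 gen_mult(1) by blast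
    then have "k \<circ> k' \<in> grp (Fs \<xi>)" unfolding grp_def using stab_group(2) by blast
    moreover have "nu (k \<circ> k') = s \<circ> g" using nu_comp[of k k'] k grp_Gam[OF Fne] by auto
    ultimately show ?case by blast
  qed
qed

section \<open>From the subdivision to coordinates in the tetrahedra; the tripods\<close>

section \<open>The fibres of \<open>P\<close> on \<open>\<T>\<^sub>0\<close>\<close>

text \<open>A nonnegative function as a combination of indicators of sets in a chain: barycentric
  coordinates on a simplex expressed in its barycentric subdivision, up to the factors
  \<open>card F\<close>.\<close>

definition layering :: "'a set \<Rightarrow> ('a set \<Rightarrow> real) \<Rightarrow> ('a \<Rightarrow> real) \<Rightarrow> bool" where
  "layering S c r \<longleftrightarrow> (\<forall>F. 0 \<le> c F) \<and> (\<forall>F. c F \<noteq> 0 \<longrightarrow> F \<noteq> {} \<and> F \<subseteq> S) \<and>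
    (\<forall>F G. c F \<noteq> 0 \<longrightarrow> c G \<noteq> 0 \<longrightarrow> F \<subseteq> G \<or> G \<subseteq> F) \<and> (\<forall>x. r x = (\<Sum>F | F \<subseteq> S \<and> x \<in> F. c F))"

lemma layeringD: assumes "layering S c r"
  shows "\<And>F. 0 \<le> c F" "\<And>F. c F \<noteq> 0 \<Longrightarrow> F \<noteq> {} \<and> F \<subseteq> S"
    "\<And>F G. c F \<noteq> 0 \<Longrightarrow> c G \<noteq> 0 \<Longrightarrow> F \<subseteq> G \<or> G \<subseteq> F" "\<And>x. r x = (\<Sum>F | F \<subseteq> S \<and> x \<in> F. c F)"
  using assms unfolding layering_def by simp_all

text \<open>Subtract the minimum on S as the coefficient of S itself and continue without a point
  where it is attained.\<close>

lemma layers_exist: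
  fixes r :: "'a \<Rightarrow> real" assumes "finite S" "\<And>x. 0 \<le> r x" "{x. r x \<noteq> 0} \<subseteq> S"
  shows "\<exists>c. layering S c r"
  using assms
proof (induction "card S" arbitrary: S r rule: less_induct)
  case less
  show ?case
  proof (cases "S = {}")
    case True
    then have "r x = 0" for x using less.prems by blast
    moreover have "(\<Sum>F | F \<subseteq> S \<and> x \<in> F. (0::real)) = 0" for x by simp
    ultimately show ?thesis unfolding layering_def by (intro exI[of _ "\<lambda>_. 0"]) simp
  next
    case False
    define m where "m = Min (r ` S)"
    have fS: "finite (r ` S)" "r ` S \<noteq> {}" using less.prems False by auto
    then obtain x0 where x0: "x0 \<in> S" "r x0 = m" using Min_in[OF fS] unfolding m_def by (metis imageE)
    have m: "0 \<le> m" "\<And>x. x \<in> S \<Longrightarrow> m \<le> r x" using x0 less.prems fS by (auto simp: m_def)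
    let ?S = "S - {x0}"
    let ?r = "\<lambda>x. if x \<in> S then r x - m else 0"
    have "card ?S < card S" using x0 less.prems by (intro card_Diff1_less) auto
    moreover have "\<And>x. 0 \<le> ?r x" "{x. ?r x \<noteq> 0} \<subseteq> ?S" "finite ?S" using less.prems m x0 by auto
    ultimately have "\<exists>c. layering ?S c ?r" by (intro less.hyps)
    then obtain c where "layering ?S c ?r" ..
    note c = layeringD[OF this]
    let ?c = "c(S := m)"
    have cS: "c S = 0" using c(2)[of S] x0 by blast
    have sum: "r x = (\<Sum>F | F \<subseteq> S \<and> x \<in> F. ?c F)" for x
    proof (cases "x \<in> S")
      case True
      have "(\<Sum>F | F \<subseteq> S \<and> x \<in> F. ?c F) = m + (\<Sum>F\<in>{F. F \<subseteq> S \<and> x \<in> F} - {S}. ?c F)"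
        using True less.prems(1) by (subst sum.remove[of _ S]) auto
      also have "(\<Sum>F\<in>{F. F \<subseteq> S \<and> x \<in> F} - {S}. ?c F) = (\<Sum>F\<in>{F. F \<subseteq> S \<and> x \<in> F} - {S}. c F)"
        by (intro sum.cong) auto
      also have "\<dots> = (\<Sum>F | F \<subseteq> ?S \<and> x \<in> F. c F)"
        using less.prems(1) c(2) x0(1) by (intro sum.mono_neutral_right) auto
      also have "\<dots> = ?r x" using c(4) by simp
      finally show ?thesis using True by simp
    next
      case F: False
      then have none: "{F. F \<subseteq> S \<and> x \<in> F} = {}" by auto
      have "r x = 0" using less.prems F by auto
      then show ?thesis unfolding none by simp
    qed
    show ?thesis unfolding layering_def
    proof (intro exI[of _ ?c] conjI allI impI)
      show "0 \<le> ?c F" for F using c(1) m by simp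
      show "F \<noteq> {}" "F \<subseteq> S" if "?c F \<noteq> 0" for F using c(2)[of F] that False by (auto split: if_splits)
      show "F \<subseteq> G \<or> G \<subseteq> F" if "?c F \<noteq> 0" "?c G \<noteq> 0" for F G
        using c(2)[of F] c(2)[of G] c(3)[of F G] that by (auto split: if_splits)
      show "r x = (\<Sum>F | F \<subseteq> S \<and> x \<in> F. ?c F)" for x by (rule sum)
    qed
  qed
qed

lemma layer_superlevel:
  fixes c :: "'a set \<Rightarrow> real"
  assumes fin: "finite \<F>" and nn: "\<And>F. 0 \<le> c F" and ch: "\<And>F G. c F \<noteq> 0 \<Longrightarrow> c G \<noteq> 0 \<Longrightarrow> F \<subseteq> G \<or> G \<subseteq> F"
    and G: "G \<in> \<F>" "c G \<noteq> 0"
  shows "\<exists>s. G = {x. s \<le> (\<Sum>F | F \<in> \<F> \<and> x \<in> F. c F)}"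
proof (intro exI Set.set_eqI iffI)
  let ?s = "\<Sum>F | F \<in> \<F> \<and> G \<subseteq> F. c F"
  show "x \<in> {x. ?s \<le> (\<Sum>F | F \<in> \<F> \<and> x \<in> F. c F)}" if "x \<in> G" for x
    using that fin nn by (auto intro!: sum_mono2)
  show "x \<in> G" if x: "x \<in> {x. ?s \<le> (\<Sum>F | F \<in> \<F> \<and> x \<in> F. c F)}" for x
  proof (rule ccontr)
    assume n: "x \<notin> G"
    have "(\<Sum>F | F \<in> \<F> \<and> x \<in> F. c F) = (\<Sum>F | F \<in> \<F> \<and> x \<in> F \<and> c F \<noteq> 0. c F)"
      using fin by (intro sum.mono_neutral_right) auto
    also have "\<dots> \<le> (\<Sum>F\<in>{F. F \<in> \<F> \<and> G \<subseteq> F} - {G}. c F)"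
    proof (rule sum_mono2)
      show "{F. F \<in> \<F> \<and> x \<in> F \<and> c F \<noteq> 0} \<subseteq> {F. F \<in> \<F> \<and> G \<subseteq> F} - {G}" using ch[OF G(2)] n by blast
    qed (use fin nn in auto)
    also have "\<dots> < ?s" using fin nn[of G] G by (subst sum.remove[of _ G]) auto
    finally show False using x by simp
  qed
qed

text \<open>By \<open>layer_superlevel\<close> every set with a nonzero coefficient, in either
  family, is a superlevel set of the common sum. Hence the sets with different coefficients form one
  chain, and a point of the largest of them outside all the others sees a single difference.\<close>

lemma layers_unique:
  fixes c c' :: "'a set \<Rightarrow> real"
  assumes fin: "finite \<F>" "{} \<notin> \<F>" "\<And>F. F \<in> \<F> \<Longrightarrow> finite F"
    and c: "\<And>F. 0 \<le> c F" "\<And>F G. c F \<noteq> 0 \<Longrightarrow> c G \<noteq> 0 \<Longrightarrow> F \<subseteq> G \<or> G \<subseteq> F"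
    and c': "\<And>F. 0 \<le> c' F" "\<And>F G. c' F \<noteq> 0 \<Longrightarrow> c' G \<noteq> 0 \<Longrightarrow> F \<subseteq> G \<or> G \<subseteq> F"
    and eq: "\<And>x. (\<Sum>F | F \<in> \<F> \<and> x \<in> F. c F) = (\<Sum>F | F \<in> \<F> \<and> x \<in> F. c' F)" and F: "F \<in> \<F>"
  shows "c F = c' F"
proof (rule ccontr)
  assume ne: "c F \<noteq> c' F"
  let ?r = "\<lambda>x. \<Sum>F | F \<in> \<F> \<and> x \<in> F. c F"
  define D where "D = {F\<in>\<F>. c F \<noteq> c' F}"
  have lev: "\<exists>s. G = {x. s \<le> ?r x}" if "G \<in> D" for G
  proof (cases "c G = 0")
    case True
    then have "G \<in> \<F>" "c' G \<noteq> 0" using that by (auto simp: D_def)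
    from layer_superlevel[of \<F> c', OF fin(1) c' this] show ?thesis unfolding eq[symmetric] by simp
  next
    case False
    have "G \<in> \<F>" using that by (auto simp: D_def)
    from layer_superlevel[of \<F> c, OF fin(1) c this False] show ?thesis .
  qed
  have chain: "G \<subseteq> H \<or> H \<subseteq> G" if "G \<in> D" "H \<in> D" for G H
  proof -
    from lev[OF that(1)] obtain s where s: "G = {x. s \<le> ?r x}" ..
    from lev[OF that(2)] obtain t where t: "H = {x. t \<le> ?r x}" ..
    show ?thesis unfolding s t by (cases "s \<le> t") auto
  qed
  have fD: "finite D" "F \<in> D" using fin F ne by (auto simp: D_def)
  obtain M where M: "M \<in> D" "\<And>G. G \<in> D \<Longrightarrow> M \<subseteq> G \<Longrightarrow> M = G"
    using finite_has_maximal[OF fD(1)] fD(2) by blast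
  then have sub: "G \<subseteq> M" if "G \<in> D" for G using chain that by blast
  have "\<exists>x\<in>M. \<forall>G\<in>D. x \<in> G \<longrightarrow> G = M"
  proof (cases "D = {M}")
    case True
    moreover have "M \<noteq> {}" using M(1) fin(2) by (auto simp: D_def)
    ultimately show ?thesis by blast
  next
    case False
    then have "D - {M} \<noteq> {}" "finite (D - {M})" using M fD by auto
    from finite_has_maximal[OF this(2,1)] obtain N where
      N: "N \<in> D - {M}" "\<And>G. G \<in> D - {M} \<Longrightarrow> N \<subseteq> G \<Longrightarrow> N = G" by blast
    then have "N \<subset> M" "\<And>G. G \<in> D - {M} \<Longrightarrow> G \<subseteq> N" using chain sub by blast+
    then show ?thesis by blast
  qed
  then obtain x where x: "x \<in> M" "\<And>G. G \<in> D \<Longrightarrow> x \<in> G \<Longrightarrow> G = M" by blast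
  have "0 = (\<Sum>F | F \<in> \<F> \<and> x \<in> F. c F - c' F)" using eq[of x] by (simp add: sum_subtractf)
  also have "\<dots> = (\<Sum>F\<in>{M}. c F - c' F)"
  proof (rule sum.mono_neutral_right)
    show "\<forall>i\<in>{F \<in> \<F>. x \<in> F} - {M}. c i - c' i = 0"
    proof
      fix i assume i: "i \<in> {F \<in> \<F>. x \<in> F} - {M}"
      then have "i \<notin> D" using x(2) by blast
      then show "c i - c' i = 0" using i by (simp add: D_def)
    qed
  qed (use fin(1) M(1) x(1) in \<open>simp_all add: D_def\<close>)
  finally show False using M(1) by (simp add: D_def)
qed

text \<open>The face ABC may occur in the support next to faces with which it is not comparable as a
  set. Its weight is recovered first, from the smallest coordinate among A, B, C; the remaining
  faces do form a chain of sets.\<close>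

lemma tau_inj: assumes "\<xi> \<in> T0" "\<xi>' \<in> T0" "\<And>X. tau \<xi> X = tau \<xi>' X" shows "\<xi> = \<xi>'"
proof -
  let ?A = "{vA, vB, vC}" and ?FF = "{F. face F} - {{vA, vB, vC}}"
  define d where "d \<xi> F = (if face F \<and> F \<noteq> {vA, vB, vC} then \<xi> (grp F) / real (card F) else 0)" for \<xi> :: pt and F
  have fA: "face ?A" unfolding face_def tetrahedra_def by auto
  have split: "tau \<xi> X = (if X \<in> ?A then \<xi> (grp ?A) / 3 else 0) + (\<Sum>F | F \<in> ?FF \<and> X \<in> F. d \<xi> F)" for \<xi> X
  proof -
    have "(\<Sum>F | F \<in> ?FF \<and> X \<in> F. d \<xi> F) = (\<Sum>F\<in>{F. face F \<and> X \<in> F} - {?A}. \<xi> (grp F) / real (card F))"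
      by (intro sum.cong) (auto simp: d_def)
    then show ?thesis unfolding tau_def using fA sum.remove[of "{F. face F \<and> X \<in> F}" ?A "\<lambda>F. \<xi> (grp F) / real (card F)"]
      by (cases "X \<in> ?A") auto
  qed
  have dc: "0 \<le> d \<xi> F" "d \<xi> F \<noteq> 0 \<Longrightarrow> d \<xi> G \<noteq> 0 \<Longrightarrow> F \<subseteq> G \<or> G \<subseteq> F" if "\<xi> \<in> T0" for \<xi> F G
  proof -
    show "0 \<le> d \<xi> F" by (simp add: d_def T0_facts(1)[OF that])
    assume "d \<xi> F \<noteq> 0" "d \<xi> G \<noteq> 0"
    then have f: "face F" "F \<noteq> ?A" "\<xi> (grp F) \<noteq> 0" "face G" "G \<noteq> ?A" "\<xi> (grp G) \<noteq> 0" by (auto simp: d_def split: if_splits)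
    then show "F \<subseteq> G \<or> G \<subseteq> F"
      using T0_facts(5)[OF that f(3,6)] grp_subset_iff[OF f(1,4)] grp_subset_iff[OF f(4,1)] by blast
  qed
  \<comment> \<open>The largest of the other faces in the support does not contain ABC, so one of A,
    B, C gets its whole coordinate from ABC.\<close>
  have low: "\<exists>X\<in>?A. tau \<xi> X = \<xi> (grp ?A) / 3" "\<And>X. X \<in> ?A \<Longrightarrow> \<xi> (grp ?A) / 3 \<le> tau \<xi> X" if \<xi>: "\<xi> \<in> T0" for \<xi>
  proof -
    define D where "D = {F. d \<xi> F \<noteq> 0}"
    have "\<exists>X\<in>?A. \<forall>F\<in>D. X \<notin> F"
    proof (cases "D = {}")
      case False
      have "finite D" by simp
      from finite_has_maximal[OF this False] obtain M where
        M: "M \<in> D" "\<And>G. G \<in> D \<Longrightarrow> M \<subseteq> G \<Longrightarrow> M = G" by blast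
      then have "F \<subseteq> M" if "F \<in> D" for F using dc(2)[OF \<xi>, of F M] that by (auto simp: D_def)
      moreover have "face M" "M \<noteq> ?A" using M by (auto simp: D_def d_def split: if_splits)
      then have "\<not> ?A \<subseteq> M" unfolding face_def tetrahedra_def by auto
      ultimately show ?thesis by blast
    qed auto
    then obtain X where X: "X \<in> ?A" "\<forall>F\<in>D. X \<notin> F" by (rule bexE)
    then have "(\<Sum>F | F \<in> ?FF \<and> X \<in> F. d \<xi> F) = 0" unfolding D_def by (intro sum.neutral ballI) blast
    moreover have "(if X \<in> ?A then \<xi> (grp ?A) / 3 else 0) = \<xi> (grp ?A) / 3" using X(1) by (rule if_P)
    ultimately have "tau \<xi> X = \<xi> (grp ?A) / 3" unfolding split[of \<xi> X] by (simp only: add_0_right)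
    then show "\<exists>X\<in>?A. tau \<xi> X = \<xi> (grp ?A) / 3" using X(1) by blast
    fix Y assume "Y \<in> ?A"
    then have "(if Y \<in> ?A then \<xi> (grp ?A) / 3 else 0) = \<xi> (grp ?A) / 3" by (rule if_P)
    moreover have "0 \<le> (\<Sum>F | F \<in> ?FF \<and> Y \<in> F. d \<xi> F)" using dc(1)[OF \<xi>] by (intro sum_nonneg) auto
    ultimately show "\<xi> (grp ?A) / 3 \<le> tau \<xi> Y" unfolding split[of \<xi> Y] by linarith
  qed
  have A: "\<xi> (grp ?A) = \<xi>' (grp ?A)"
  proof -
    obtain X where X: "X \<in> ?A" "tau \<xi> X = \<xi> (grp ?A) / 3" using low(1)[OF assms(1)] by blast
    obtain Y where Y: "Y \<in> ?A" "tau \<xi>' Y = \<xi>' (grp ?A) / 3" using low(1)[OF assms(2)] by blast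
    show ?thesis using low(2)[OF assms(1) Y(1)] low(2)[OF assms(2) X(1)] X(2) Y(2) assms(3)[of X] assms(3)[of Y] by simp
  qed
  have eq: "(\<Sum>F | F \<in> ?FF \<and> X \<in> F. d \<xi> F) = (\<Sum>F | F \<in> ?FF \<and> X \<in> F. d \<xi>' F)" for X
    using assms(3)[of X] unfolding split[of \<xi> X] split[of \<xi>' X] A by (simp only: add_left_cancel)
  have dd: "d \<xi> F = d \<xi>' F" if "F \<in> ?FF" for F
  proof (rule layers_unique[of ?FF "d \<xi>" "d \<xi>'"])
    show "finite ?FF" "{} \<notin> ?FF" "\<And>F. F \<in> ?FF \<Longrightarrow> finite F" by (auto simp: face_def)
    show "0 \<le> d \<xi> F" "0 \<le> d \<xi>' F" for F by (rule dc(1)[OF assms(1)], rule dc(1)[OF assms(2)])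
    show "F \<subseteq> G \<or> G \<subseteq> F" if "d \<xi> F \<noteq> 0" "d \<xi> G \<noteq> 0" for F G by (rule dc(2)[OF assms(1) that])
    show "F \<subseteq> G \<or> G \<subseteq> F" if "d \<xi>' F \<noteq> 0" "d \<xi>' G \<noteq> 0" for F G by (rule dc(2)[OF assms(2) that])
  qed (fact eq that)+
  have F: "\<xi> (grp F) = \<xi>' (grp F)" if "face F" for F
    using dd[of F] A that card_face[OF that] by (cases "F = ?A") (auto simp: d_def)
  show ?thesis
  proof
    fix V show "\<xi> V = \<xi>' V"
      using F supp_subgroup[OF assms(1), of V] supp_subgroup[OF assms(2), of V] by metis
  qed
qed

text \<open>The minimum over A, B, C goes to the face ABC. The rest vanishes at some vertex Y of ABC
  and is layered on the other three vertices of the tetrahedron, so that all layers are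
  faces.\<close>

lemma tau_surj:
  assumes t: "\<And>X. 0 \<le> t X" "(\<Sum>X\<in>UNIV. t X) = 1" and D: "D \<in> tetrahedra" "\<And>X. t X \<noteq> 0 \<Longrightarrow> X \<in> D"
  shows "\<exists>\<xi>\<in>T0. tau \<xi> = t"
proof -
  let ?A = "{vA, vB, vC}"
  have fA: "face ?A" unfolding face_def tetrahedra_def by auto
  have AD: "?A \<subseteq> D" using D(1) by (auto simp: tetrahedra_def)
  define m where "m = Min (t ` ?A)"
  have m: "0 \<le> m" "\<And>X. X \<in> ?A \<Longrightarrow> m \<le> t X" unfolding m_def using t(1) by auto
  have "m \<in> t ` ?A" unfolding m_def by (rule Min_in) auto
  then obtain Y where Y: "Y \<in> ?A" "t Y = m" by auto
  define r where "r X = t X - (if X \<in> ?A then m else 0)" for X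
  let ?S = "D - {Y}"
  have r: "\<And>X. 0 \<le> r X" "{X. r X \<noteq> 0} \<subseteq> ?S" using m t(1) D(2) Y AD by (auto simp: r_def)
  obtain c where "layering ?S c r" using layers_exist[of ?S r, OF finite_vert r] ..
  note c = layeringD[OF this]
  have cf: "face F" "F \<noteq> ?A" if "c F \<noteq> 0" for F
  proof -
    have "Y \<notin> F" "F \<subseteq> D" "F \<noteq> {}" using c(2)[OF that] by auto
    then show "face F" "F \<noteq> ?A" using D(1) Y(1) AD by (auto simp: face_def)
  qed
  define x where "x F = real (card F) * (c F + (if F = ?A then m else 0))" for F
  define \<xi> where "\<xi> V = (\<Sum>F | face F \<and> grp F = V. x F)" for V
  have xF: "\<xi> (grp F) = x F" if "face F" for F
  proof -
    have "{F'. face F' \<and> grp F' = grp F} = {F}" using grp_inj that by blast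
    then show ?thesis by (simp add: \<xi>_def)
  qed
  have nn: "0 \<le> x F" for F using c(1) m(1) by (simp add: x_def)
  have supp: "\<exists>F. face F \<and> V = grp F \<and> x F \<noteq> 0" if "\<xi> V \<noteq> 0" for V
    using sum.not_neutral_contains_not_neutral[OF that[unfolded \<xi>_def]] by blast
  have sumx: "(\<Sum>F | face F \<and> X \<in> F. x F / real (card F)) = t X" for X
  proof -
    have "(\<Sum>F | face F \<and> X \<in> F. x F / real (card F)) = (\<Sum>F | face F \<and> X \<in> F. c F + (if F = ?A then m else 0))"
    proof (intro sum.cong refl)
      fix F assume "F \<in> {F. face F \<and> X \<in> F}"
      then have "real (card F) \<noteq> 0" using card_face[of F] by auto
      then show "x F / real (card F) = c F + (if F = ?A then m else 0)" by (simp add: x_def)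
    qed
    also have "\<dots> = (\<Sum>F | face F \<and> X \<in> F. c F) + (\<Sum>F | face F \<and> X \<in> F. if F = ?A then m else 0)"
      by (rule sum.distrib)
    also have "(\<Sum>F | face F \<and> X \<in> F. c F) = r X" unfolding c(4)
      by (rule sum.mono_neutral_cong) (use cf c(2) in auto)
    also have "(\<Sum>F | face F \<and> X \<in> F. if F = ?A then m else 0) = (if X \<in> ?A then m else 0)"
      using fA by (subst sum.delta) auto
    finally show ?thesis by (simp add: r_def)
  qed
  have tau: "tau \<xi> = t" unfolding tau_def fun_eq_iff using sumx xF by (auto intro!: sum.cong)
  have fin: "finite {V. \<xi> V \<noteq> 0}"
    by (rule finite_subset[of _ "grp ` UNIV"]) (use supp in auto)
  have total: "(\<Sum>V | \<xi> V \<noteq> 0. \<xi> V) = 1"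
  proof -
    have "(\<Sum>V | \<xi> V \<noteq> 0. \<xi> V) = (\<Sum>V\<in>grp ` {F. face F}. \<xi> V)"
      by (rule sum.mono_neutral_left) (use supp in auto)
    also have "\<dots> = (\<Sum>F | face F. x F)"
      using grp_inj xF by (subst sum.reindex) (auto simp: inj_on_def)
    also have "\<dots> = (\<Sum>F | face F. \<Sum>X\<in>F. x F / real (card F))"
      by (intro sum.cong refl) (auto simp: face_def)
    also have "\<dots> = (\<Sum>F | face F. \<Sum>X | X \<in> UNIV \<and> X \<in> F. x F / real (card F))" by simp
    also have "\<dots> = (\<Sum>X\<in>UNIV. \<Sum>F | F \<in> {F. face F} \<and> X \<in> F. x F / real (card F))"
      by (rule sum.swap_restrict) simp_all
    also have "\<dots> = 1" using sumx t(2) by simp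
    finally show ?thesis .
  qed
  have ch: "U \<subseteq> V \<or> V \<subseteq> U" if UV: "\<xi> U \<noteq> 0" "\<xi> V \<noteq> 0" for U V
  proof -
    obtain F where F: "face F" "U = grp F" "x F \<noteq> 0" using supp[OF UV(1)] by blast
    obtain G where G: "face G" "V = grp G" "x G \<noteq> 0" using supp[OF UV(2)] by blast
    note FG = F G
    then have "F = ?A \<or> c F \<noteq> 0" "G = ?A \<or> c G \<noteq> 0" by (auto simp: x_def split: if_splits)
    then consider "F = ?A" | "G = ?A" | "F \<subseteq> G \<or> G \<subseteq> F" using c(3) by blast
    then show ?thesis
      using FG id_grp grp_ABC by cases (auto simp: grp_def)
  qed
  have "{V. \<xi> V \<noteq> 0} \<noteq> {}"
  proof
    assume "{V. \<xi> V \<noteq> 0} = {}" then show False using total by simp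
  qed
  then have "{V. \<xi> V \<noteq> 0} \<in> order_complex subgroups"
    using fin supp ch by (auto simp: order_complex_def chain_subset_def subgroups_eq)
  moreover have "0 \<le> \<xi> V" for V unfolding \<xi>_def using nn by (intro sum_nonneg) auto
  ultimately have "\<xi> \<in> T0" using total by (simp add: T0_def realization_def)
  then show ?thesis using tau by blast
qed


lemma T0_compact: "compact T0"
  unfolding T0_def using finite_subgroups
  by (intro compact_realization simplicial_order_complex) (auto simp: order_complex_def intro: finite_subset[of _ "Pow subgroups"])

lemma T0_closed: "closed T0" by (rule compact_imp_closed_fun[OF T0_compact])

lemma tau_continuous: "continuous_on S (\<lambda>\<xi>. tau \<xi> X)"
  unfolding tau_def by (intro continuous_intros continuous_on_subset[OF continuous_on_product_coordinates]) (auto simp: face_def)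

text \<open>The fibre over a point \<open>z\<close> of the triangle is a tripod.  Its three legs lie in the three tetrahedra,
  the coordinate along the leg in \<open>Z A B C\<close> being the weight of the apex \<open>Z\<close>, and they meet
  in the point of the triangle \<open>ABC\<close> over \<open>z\<close>.\<close>

abbreviation apex :: "vert set" where "apex \<equiv> {vA1, vB1, vC1}"

fun base :: "vert \<Rightarrow> vert" where
  "base vA1 = vA" | "base vB1 = vB" | "base vC1 = vC" | "base vA = vA" | "base vB = vB" | "base vC = vC"

fun zco :: "plane \<Rightarrow> vert \<Rightarrow> real" where
  "zco z vA1 = fst z" | "zco z vC1 = snd z" | "zco z vB1 = 1 - fst z - snd z"
| "zco z vA = fst z" | "zco z vC = snd z" | "zco z vB = 1 - fst z - snd z"

text \<open>For an apex Z, the generator that lies in the vertex groups of exactly one face of Z A B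
  C, the one opposite to \<open>base Z\<close>, where the leg ends; it lies in neither of the other
  two apex groups.\<close>

fun apex_gen :: "vert \<Rightarrow> aut" where
  "apex_gen vA1 = g_alpha" | "apex_gen vB1 = g_beta" | "apex_gen vC1 = g_gamma"
| "apex_gen vA = g_alpha" | "apex_gen vB = g_beta" | "apex_gen vC = g_gamma"

definition Tz :: "plane \<Rightarrow> pt set" where "Tz z = {\<xi> \<in> T0. P_map \<xi> = z}"

definition leg :: "plane \<Rightarrow> vert \<Rightarrow> pt set" where
  "leg z Z = {\<xi> \<in> Tz z. \<forall>Y\<in>apex. Y \<noteq> Z \<longrightarrow> tau \<xi> Y = 0}"

lemma Tz_iff: assumes "\<xi> \<in> T0" shows "\<xi> \<in> Tz z \<longleftrightarrow> (\<forall>Z\<in>apex. tau \<xi> (base Z) + tau \<xi> Z = zco z Z)"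
  using tau_total[OF assms] by (auto simp: Tz_def P_map_coords[OF assms] assms prod_eq_iff)

lemma zco_nonneg: "z \<in> Dt \<Longrightarrow> 0 \<le> zco z X" by (cases X) (auto simp: Dt_def)

lemma Tz_closed: "closed (Tz z)"
proof -
  have "Tz z = T0 \<inter> {\<xi>. tau \<xi> vA + tau \<xi> vA1 = fst z} \<inter> {\<xi>. tau \<xi> vC + tau \<xi> vC1 = snd z}"
    by (auto simp: Tz_def P_map_coords prod_eq_iff)
  then show ?thesis
    by (simp only:) (intro closed_Int T0_closed closed_Collect_eq continuous_intros tau_continuous)
qed

lemma leg_closed: "closed (leg z Z)"
proof -
  have "leg z Z = Tz z \<inter> (\<Inter>Y\<in>apex - {Z}. {\<xi>. tau \<xi> Y = 0})" by (auto simp: leg_def)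
  then show ?thesis
    by (simp only:) (intro closed_Int Tz_closed closed_INT ballI closed_Collect_eq continuous_intros tau_continuous)
qed

lemma Tz_compact: "compact (Tz z)"
  using compact_Int_closed[OF T0_compact Tz_closed[of z]] by (simp add: Tz_def Int_def)

lemma leg_compact: "compact (leg z Z)"
  using compact_Int_closed[OF Tz_compact[of z] leg_closed[of z Z]] by (simp add: leg_def Int_def)

lemma Tz_legs: assumes "\<xi> \<in> Tz z" shows "\<exists>Z\<in>apex. \<xi> \<in> leg z Z"
proof -
  have T: "\<xi> \<in> T0" using assms by (simp add: Tz_def)
  obtain Z where Z: "Z \<in> apex" "Fs \<xi> \<subseteq> {Z, vA, vB, vC}" using Fs_tetra[OF T] by blast
  have "tau \<xi> Y = 0" if "Y \<in> apex" "Y \<noteq> Z" for Y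
  proof -
    have "Y \<notin> Fs \<xi>" using Z(2) that by auto
    then show ?thesis using tau_pos[OF T, of Y] tau_nonneg[OF T, of Y] by simp
  qed
  then show ?thesis using Z assms by (auto simp: leg_def)
qed

lemma leg_inj: assumes "Z \<in> apex" "\<xi> \<in> leg z Z" "\<xi>' \<in> leg z Z" "tau \<xi> Z = tau \<xi>' Z" shows "\<xi> = \<xi>'"
proof (rule tau_inj)
  show T: "\<xi> \<in> T0" "\<xi>' \<in> T0" using assms by (auto simp: leg_def Tz_def)
  have m: "\<xi> \<in> Tz z" "\<xi>' \<in> Tz z" using assms by (auto simp: leg_def)
  have a: "tau \<xi> Y = tau \<xi>' Y" if "Y \<in> apex" for Y
  proof (cases "Y = Z")
    case False
    then have "tau \<xi> Y = 0" "tau \<xi>' Y = 0" using assms(2,3) that unfolding leg_def by blast+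
    then show ?thesis by simp
  qed (use assms in simp)
  have b: "tau \<xi> (base Y) = tau \<xi>' (base Y)" if "Y \<in> apex" for Y
    using m[unfolded Tz_iff[OF T(1)] Tz_iff[OF T(2)]] a[OF that] that by (metis add_right_cancel)
  show "tau \<xi> X = tau \<xi>' X" for X
    using a[of vA1] a[of vB1] a[of vC1] b[of vA1] b[of vB1] b[of vC1] by (cases X) simp_all
qed

lemma leg_point: assumes z: "z \<in> Dt" and Z: "Z \<in> apex" and t: "0 \<le> t" "t \<le> zco z Z"
  shows "\<exists>\<xi>\<in>leg z Z. tau \<xi> Z = t"
proof -
  \<comment> \<open>The weight t is moved from the base vertex to the apex.\<close>
  define f where "f X = (if X \<in> apex then if X = Z then t else 0 else zco z X - (if X = base Z then t else 0))" for X
  have "0 \<le> f X" for X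
    using Z t zco_nonneg[OF z, of X] by (cases X) (auto simp: f_def)
  moreover have "sum f UNIV = 1" using Z by (auto simp: f_def UNIV_vert)
  moreover have "{Z, vA, vB, vC} \<in> tetrahedra" using Z by (auto simp: tetrahedra_def)
  moreover have "X \<in> {Z, vA, vB, vC}" if "f X \<noteq> 0" for X using that by (cases X) (auto simp: f_def split: if_splits)
  ultimately obtain \<xi> where \<xi>: "\<xi> \<in> T0" "tau \<xi> = f" using tau_surj[of f "{Z, vA, vB, vC}"] by blast
  have "\<xi> \<in> Tz z" unfolding Tz_iff[OF \<xi>(1)] \<xi>(2) using Z by (auto simp: f_def)
  then have "\<xi> \<in> leg z Z" using Z by (auto simp: leg_def \<xi>(2) f_def)
  moreover have "tau \<xi> Z = t" using Z by (auto simp: \<xi>(2) f_def)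
  ultimately show ?thesis by blast
qed

lemma leg_bounds: assumes "\<xi> \<in> leg z Z" "Z \<in> apex" shows "0 \<le> tau \<xi> Z" "tau \<xi> Z \<le> zco z Z"
proof -
  have T: "\<xi> \<in> T0" "\<xi> \<in> Tz z" using assms by (auto simp: leg_def Tz_def)
  show "0 \<le> tau \<xi> Z" by (rule tau_nonneg[OF T(1)])
  have "tau \<xi> (base Z) + tau \<xi> Z = zco z Z" using T(2) assms(2) unfolding Tz_iff[OF T(1)] by blast
  then show "tau \<xi> Z \<le> zco z Z" using tau_nonneg[OF T(1), of "base Z"] by linarith
qed

lemma leg_homeo: assumes z: "z \<in> Dt" and Z: "Z \<in> apex"
  shows "homeomorphic_map (top_of_set (leg z Z)) (top_of_set {0..zco z Z}) (\<lambda>\<xi>. tau \<xi> Z)"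
proof (rule continuous_imp_homeomorphic_map)
  show "compact_space (top_of_set (leg z Z))" using leg_compact by (simp add: compact_space_subtopology)
  show "Hausdorff_space (top_of_set {0..zco z Z})" by (simp add: Hausdorff_space_subtopology)
  show im: "(\<lambda>\<xi>. tau \<xi> Z) ` topspace (top_of_set (leg z Z)) = topspace (top_of_set {0..zco z Z})"
  proof
    show "(\<lambda>\<xi>. tau \<xi> Z) ` topspace (top_of_set (leg z Z)) \<subseteq> topspace (top_of_set {0..zco z Z})"
      using leg_bounds[OF _ Z, of _ z] by (simp add: image_subset_iff)
    show "topspace (top_of_set {0..zco z Z}) \<subseteq> (\<lambda>\<xi>. tau \<xi> Z) ` topspace (top_of_set (leg z Z))"
      using leg_point[OF z Z] by (auto simp: image_iff) metis
  qed
  show "continuous_map (top_of_set (leg z Z)) (top_of_set {0..zco z Z}) (\<lambda>\<xi>. tau \<xi> Z)"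
    using tau_continuous leg_bounds[OF _ Z] by (auto simp: continuous_map_in_subtopology)
  show "inj_on (\<lambda>\<xi>. tau \<xi> Z) (topspace (top_of_set (leg z Z)))"
    using leg_inj[OF Z] by (auto simp: inj_on_def)
qed

lemma apex_gen_JF: assumes \<xi>: "\<xi> \<in> T0" and Z: "Z \<in> apex"
  shows "apex_gen Z \<in> JF (Fs \<xi>) \<longleftrightarrow> tau \<xi> (base Z) = 0 \<and> (\<forall>Y\<in>apex. Y \<noteq> Z \<longrightarrow> tau \<xi> Y = 0)"
proof -
  have F: "tau \<xi> X = 0 \<longleftrightarrow> X \<notin> Fs \<xi>" for X using tau_pos[OF \<xi>, of X] tau_nonneg[OF \<xi>, of X] by auto
  have J: "apex_gen Z \<in> JJ X \<longleftrightarrow> X \<noteq> base Z \<and> (X \<in> apex \<longrightarrow> X = Z)" for X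
    using Z gens_distinct gens_distinct(1-3)[symmetric] by (cases X) auto
  have "apex_gen Z \<in> ggens" using Z by (auto simp: ggens_def)
  then show ?thesis unfolding JF_def F using J by auto
qed

lemma leg_end: assumes z: "z \<in> Dt" and Z: "Z \<in> apex"
  shows "\<xi> \<in> Tz z \<and> apex_gen Z \<in> JF (Fs \<xi>) \<longleftrightarrow> \<xi> \<in> leg z Z \<and> tau \<xi> Z = zco z Z"
proof -
  have "tau \<xi> (base Z) = 0 \<longleftrightarrow> tau \<xi> Z = zco z Z" if "\<xi> \<in> Tz z"
  proof -
    have T: "\<xi> \<in> T0" using that by (simp add: Tz_def)
    have "tau \<xi> (base Z) + tau \<xi> Z = zco z Z" using that Z unfolding Tz_iff[OF T] by blast
    then show ?thesis by linarith
  qed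
  then show ?thesis using apex_gen_JF[OF _ Z, of \<xi>] by (auto simp: leg_def Tz_def)
qed

lemma ggens_apex: "g \<in> ggens \<Longrightarrow> \<exists>Z\<in>apex. g = apex_gen Z" by (auto simp: ggens_def)

lemma tripod_end_unique: assumes z: "z \<in> Dt" and g: "g \<in> ggens"
  shows "\<exists>!\<xi>. \<xi> \<in> Tz z \<and> g \<in> JF (Fs \<xi>)"
proof -
  obtain Z where Z: "Z \<in> apex" "g = apex_gen Z" using ggens_apex[OF g] by blast
  obtain \<xi> where \<xi>: "\<xi> \<in> leg z Z" "tau \<xi> Z = zco z Z" using leg_point[OF z Z(1) zco_nonneg[OF z]] by blast
  show ?thesis unfolding Z(2) leg_end[OF z Z(1)]
  proof (rule ex1I[of _ \<xi>])
    show "y = \<xi>" if "y \<in> leg z Z \<and> tau y Z = zco z Z" for y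
      using leg_inj[OF Z(1) _ \<xi>(1), of y] that \<xi>(2) by presburger
  qed (use \<xi> in blast)
qed

lemma tripod_centre: assumes z: "z \<in> Dt"
  shows "\<exists>x. \<forall>Z\<in>apex. x \<in> leg z Z \<and> tau x Z = 0 \<and> (\<forall>Y\<in>apex. Y \<noteq> Z \<longrightarrow> leg z Z \<inter> leg z Y = {x})"
proof -
  obtain x where x: "x \<in> leg z vA1" "tau x vA1 = 0" using leg_point[OF z, of vA1 0] zco_nonneg[OF z, of vA1] by auto
  have xz: "x \<in> leg z Z" "tau x Z = 0" if "Z \<in> apex" for Z using x that by (auto simp: leg_def)
  have i: "leg z Z \<inter> leg z Y = {x}" if ZY: "Z \<in> apex" "Y \<in> apex" "Y \<noteq> Z" for Z Y
  proof (intro equalityI subsetI)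
    fix y assume y: "y \<in> leg z Z \<inter> leg z Y"
    then have "tau y Z = 0" using ZY by (auto simp: leg_def)
    then have "y = x" using leg_inj[OF ZY(1) _ xz(1)[OF ZY(1)], of y] xz(2)[OF ZY(1)] y by auto
    then show "y \<in> {x}" by simp
  qed (use xz(1)[OF ZY(1)] xz(1)[OF ZY(2)] in blast)
  show ?thesis by (intro exI[of _ x] ballI conjI impI xz i)
qed

lemma leg_marked: assumes z: "z \<in> Dt" and Z: "Z \<in> apex" and x: "x \<in> leg z Z" "tau x Z = 0"
  and y: "y \<in> leg z Z" "tau y Z = zco z Z"
  shows "marked_tree (top_of_set (leg z Z)) {x, y}"
proof (cases "zco z Z = 0")
  case True
  have "leg z Z = {x}"
  proof (intro equalityI subsetI)
    fix u assume u: "u \<in> leg z Z"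
    then have "tau u Z = 0" using leg_bounds[OF u Z] True by linarith
    then show "u \<in> {x}" using leg_inj[OF Z u x(1)] x(2) by simp
  qed (use x in simp)
  moreover from this have "y = x" using y by blast
  ultimately show ?thesis using marked_tree_singleton[of "top_of_set (leg z Z)" x] by simp
next
  case False
  then have "0 < zco z Z" using zco_nonneg[OF z, of Z] by linarith
  from marked_tree_segment[OF leg_homeo[OF z Z] this] x y show ?thesis by simp
qed

lemma tripod_marked: assumes z: "z \<in> Dt"
  shows "\<exists>V. marked_tree (top_of_set (Tz z)) V \<and> {\<xi> \<in> Tz z. JF (Fs \<xi>) \<noteq> {}} \<subseteq> V"
proof -
  obtain x where x: "\<And>Z. Z \<in> apex \<Longrightarrow> x \<in> leg z Z" "\<And>Z. Z \<in> apex \<Longrightarrow> tau x Z = 0"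
    "\<And>Z Y. Z \<in> apex \<Longrightarrow> Y \<in> apex \<Longrightarrow> Y \<noteq> Z \<Longrightarrow> leg z Z \<inter> leg z Y = {x}" using tripod_centre[OF z] by blast
  have "\<forall>Z\<in>apex. \<exists>y. y \<in> leg z Z \<and> tau y Z = zco z Z"
    using leg_point[OF z _ zco_nonneg[OF z]] by blast
  then obtain y where y: "\<And>Z. Z \<in> apex \<Longrightarrow> y Z \<in> leg z Z" "\<And>Z. Z \<in> apex \<Longrightarrow> tau (y Z) Z = zco z Z" by metis
  have M: "marked_tree (top_of_set (leg z Z)) {x, y Z}" if "Z \<in> apex" for Z
    using leg_marked[OF z that x(1,2)[OF that] y(1,2)[OF that]] .
  have sub: "subtopology (top_of_set U) S = top_of_set S" if "S \<subseteq> U" for S U :: "pt set"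
    using that by (simp add: subtopology_subtopology Int_absorb1)
  have cl: "closedin (top_of_set U) S" if "closed S" "S \<subseteq> U" for S U :: "pt set"
    using that by (simp add: closed_subset)
  let ?A = "leg z vA1" and ?B = "leg z vB1" and ?C = "leg z vC1"
  have AB: "marked_tree (top_of_set (?A \<union> ?B)) ({x, y vA1} \<union> {x, y vB1})"
    by (rule marked_tree_glue[of _ ?A ?B x])
      (use M x in \<open>auto simp: sub cl leg_closed\<close>)
  have T: "Tz z = (?A \<union> ?B) \<union> ?C" using Tz_legs[of _ z] by (auto simp: leg_def)
  have i: "(?A \<union> ?B) \<inter> ?C = {x}" using x(3)[of vA1 vC1] x(3)[of vB1 vC1] by auto
  have "marked_tree (top_of_set (Tz z)) (({x, y vA1} \<union> {x, y vB1}) \<union> {x, y vC1})"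
    by (rule marked_tree_glue[of _ "?A \<union> ?B" ?C x])
      (use M[of vC1] AB i T in \<open>simp_all add: sub cl leg_closed closed_Un\<close>)
  moreover have "{\<xi> \<in> Tz z. JF (Fs \<xi>) \<noteq> {}} \<subseteq> ({x, y vA1} \<union> {x, y vB1}) \<union> {x, y vC1}"
  proof
    fix \<xi> assume \<xi>: "\<xi> \<in> {\<xi> \<in> Tz z. JF (Fs \<xi>) \<noteq> {}}"
    then obtain g where "g \<in> JF (Fs \<xi>)" by blast
    then obtain Z where Z: "Z \<in> apex" "apex_gen Z \<in> JF (Fs \<xi>)" using ggens_apex JF_sub by blast
    then have "\<xi> \<in> leg z Z" "tau \<xi> Z = zco z Z" using leg_end[OF z Z(1)] \<xi> by blast+
    then have "\<xi> = y Z" using leg_inj[OF Z(1) _ y(1)[OF Z(1)]] y(2)[OF Z(1)] by simp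
    then show "\<xi> \<in> ({x, y vA1} \<union> {x, y vB1}) \<union> {x, y vC1}" using Z(1) by auto
  qed
  ultimately show ?thesis by blast
qed

lemma tripod_connected: assumes z: "z \<in> Dt" shows "connected (Tz z)"
proof -
  obtain x where x: "\<And>Z. Z \<in> apex \<Longrightarrow> x \<in> leg z Z" using tripod_centre[OF z] by blast
  have "connected (leg z Z)" if "Z \<in> apex" for Z
    using homeomorphic_connected_space[OF homeomorphic_map_imp_homeomorphic_space[OF leg_homeo[OF z that]]]
    by (simp add: connectedin_def flip: connectedin_iff_connected)
  then have "connected (\<Union>(leg z ` apex))" using x by (intro connected_Union) blast+
  moreover have "Tz z = \<Union>(leg z ` apex)" using Tz_legs[of _ z] by (auto simp: leg_def)
  ultimately show ?thesis by simp
qed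

lemma tripod_two_points: assumes z: "z \<in> Dt" shows "\<exists>x\<in>Tz z. \<exists>y\<in>Tz z. x \<noteq> y"
proof -
  \<comment> \<open>The three coordinates of z add up to 1, so some leg is not a point.\<close>
  have "zco z vA1 \<noteq> 0 \<or> zco z vB1 \<noteq> 0 \<or> zco z vC1 \<noteq> 0" by auto
  then have "\<exists>Z\<in>apex. zco z Z \<noteq> 0" by blast
  then obtain Z where Z: "Z \<in> apex" "zco z Z \<noteq> 0" by blast
  obtain x where x: "x \<in> leg z Z" "tau x Z = 0" using leg_point[OF z Z(1), of 0] zco_nonneg[OF z] by auto
  obtain y where y: "y \<in> leg z Z" "tau y Z = zco z Z" using leg_point[OF z Z(1), of "zco z Z"] zco_nonneg[OF z] by auto
  show ?thesis using x y Z by (intro bexI[of _ x] bexI[of _ y]) (auto simp only: leg_def mem_Collect_eq)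
qed

section \<open>The fibres of \<rho> described by points of tripods and words\<close>

section \<open>Points of \<open>\<M>\<^sub>n\<close> and \<open>\<S>\<^sub>n\<close>\<close>

text \<open>The reflections in the axes together with those in x = 1 and y = 1 fold the plane onto
  the unit square, and \<open>h_b\<close> folds the square onto the triangle.\<close>

lemma Dt_covers: "\<exists>g\<in>Gam_hat. plane_act g z \<in> Dt"
proof -
  define R where "R = {z. \<exists>g\<in>Gam_hat. plane_act g z \<in> Dt}"
  have step: "z \<in> R" if s: "plane_act s z \<in> R" "s \<in> Gam_hat" for s z
  proof -
    obtain g where "g \<in> Gam_hat" "plane_act g (plane_act s z) \<in> Dt" using s(1) unfolding R_def by blast
    then have "s \<circ> g \<in> Gam_hat" "plane_act (s \<circ> g) z \<in> Dt"
      using Gamh_comp[OF s(2)] plane_act_comp[OF s(2)] by simp_all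
    then show ?thesis unfolding R_def by blast
  qed
  have a: "(x, y) \<in> R" if "(- x, y) \<in> R" for x y
    using step[of h_a "(x, y)"] that Gamh_gens by (simp add: plane_act_gens rf_a_def)
  have b: "(x, y) \<in> R" if "(1 - y, 1 - x) \<in> R" for x y
    using step[of h_b "(x, y)"] that Gamh_gens by (simp add: plane_act_gens rf_b_def)
  have c: "(x, y) \<in> R" if "(x, - y) \<in> R" for x y
    using step[of h_c "(x, y)"] that Gamh_gens by (simp add: plane_act_gens rf_c_def)
  \<comment> \<open>The reflection in y = 1 is the conjugate b a b; the next one, in x = 1, is b c
    b.\<close>
  have ty: "(x, y) \<in> R" if "(x, 2 - y) \<in> R" for x y
    using b[of y x] a[of "1 - y" "1 - x"] b[of "1 - x" "y - 1"] that by simp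
  have tx: "(x, y) \<in> R" if "(2 - x, y) \<in> R" for x y
    using b[of y x] c[of "1 - y" "1 - x"] b[of "x - 1" "1 - y"] that by simp
  \<comment> \<open>Folding at 0 and at 1 shortens a number until its modulus is at most 1.\<close>
  have red: "P t" if one: "\<And>t. \<bar>t\<bar> \<le> 1 \<Longrightarrow> P t" and neg: "\<And>t. P (- t) \<Longrightarrow> P t" and refl: "\<And>t. P (2 - t) \<Longrightarrow> P t"
    for P and t :: real
  proof -
    obtain k :: nat where "\<bar>t\<bar> \<le> real k" using real_arch_simple by blast
    then show ?thesis
    proof (induction k arbitrary: t)
      case 0 then show ?case using one by simp
    next
      case (Suc k)
      have pos: "P t" if t: "0 \<le> t" "t \<le> real (Suc k)" for t
      proof (cases "t \<le> 1")
        case True then show ?thesis using one t by simp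
      next
        case False
        then have "1 \<le> k" using t by (cases k) auto
        then have "1 \<le> real k" by simp
        then have "\<bar>2 - t\<bar> \<le> real k" using t(2) False \<open>1 \<le> real k\<close> unfolding of_nat_Suc by linarith
        then show ?thesis using Suc.IH refl by blast
      qed
      show ?case
        using pos[of t] neg[of t] pos[of "- t"] Suc.prems by (cases "0 \<le> t") simp_all
    qed
  qed
  have unit: "(x, y) \<in> R" if "0 \<le> x" "x \<le> 1" "0 \<le> y" "y \<le> 1" for x y
  proof -
    have D: "z \<in> R" if "z \<in> Dt" for z unfolding R_def using that Gamh_id by (force simp: plane_act_gens)
    show ?thesis
      using that D[of "(x, y)"] b[OF D[of "(1 - y, 1 - x)"]] by (cases "x + y \<le> 1") (auto simp: Dt_def)
  qed
  have strip: "(x, y) \<in> R" if "\<bar>x\<bar> \<le> 1" "\<bar>y\<bar> \<le> 1" for x y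
    using that unit[of "\<bar>x\<bar>" "\<bar>y\<bar>"] a[of x y] c[of x y] c[of "- x" y] by (auto simp: abs_if split: if_splits)
  have "(x, y) \<in> R" for x y
  proof (rule red[of "\<lambda>y. (x, y) \<in> R"])
    fix y :: real assume y: "\<bar>y\<bar> \<le> 1"
    show "(x, y) \<in> R"
      by (rule red[of "\<lambda>x. (x, y) \<in> R"]) (use strip y a tx in blast)+
  qed (use c ty in blast)+
  then have "z \<in> R" by (cases z) simp
  then show ?thesis by (simp add: R_def)
qed

interpretation Xact: bimod_action Xi Xi_right Gam sgG par
proof unfold_locales
  show "(par (lt g x) \<noteq> sgG (sect g [x])) = (par x \<noteq> sgG g)" if "g \<in> Gam" for g x by (rule parity[OF that])
qed (simp_all add: Gam_TA Gam_id Gam_comp Gam_inv Gam_sect Xi_right_Xi Xi_right_id Xi_right_comp sgG_comp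
      del: o_apply id_apply)

interpretation hact: bimod_action UNIV plane_right Gam_hat sgh parh
proof unfold_locales
  show "plane_right \<xi> id = \<xi>" for \<xi> by (simp only: plane_right_def plane_act_gens id_apply)
  show "plane_right \<xi> (g \<circ> h) = plane_right (plane_right \<xi> g) h" if "g \<in> Gam_hat" "h \<in> Gam_hat" for \<xi> g h
    using plane_act_comp[OF that] by (simp add: plane_right_def)
  show "(parh (lt g x) \<noteq> sgh (sect g [x])) = (parh x \<noteq> sgh g)" if "g \<in> Gam_hat" for g x by (rule parity_hat[OF that])
qed (simp_all add: Gamh_TA Gamh_id Gamh_comp Gamh_inv Gamh_sect sgh_comp del: o_apply id_apply)

lemma H_eq: "Xact.H = IMGf" "hact.H = nu ` IMGf"
proof -
  show "Xact.H = IMGf" by (simp add: Xact.H_def IMGf_eq)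
  show "hact.H = nu ` IMGf" unfolding hact.H_def IMGf_eq
  proof (intro equalityI subsetI)
    fix h assume h: "h \<in> {g \<in> Gam_hat. \<not> sgh g}"
    then obtain g where "g \<in> Gam" "nu g = h" using nu_surj by blast
    then show "h \<in> nu ` {g \<in> Gam. \<not> sgG g}" using h by (auto simp: sgG_def)
  qed (auto simp: sgG_def nu_Gamh)
qed

lemma Bf_eq: "Xact.Bf = bimod_f" "hact.Bf = mu ` bimod_f"
proof -
  show B: "Xact.Bf = bimod_f"
  proof (intro equalityI subsetI)
    fix m assume "m \<in> Xact.Bf"
    then obtain x k where m: "m = ([x], k)" "k \<in> Gam" "par x = sgG k" by (auto simp: Xact.Bf_def)
    show "m \<in> bimod_f"
    proof (cases "par x")
      case False
      then have "k \<in> IMGf" using m by (simp add: IMGf_eq)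
      moreover have "([x], id) \<in> {([L1], id), ([L2], id), ([L3], g_b), ([L4], g_b)}" using False by (cases x) auto
      moreover have "m = bimod_right ([x], id) k" by (simp add: m(1) bimod_right_simp)
      ultimately show ?thesis unfolding bimod_f_def by blast
    next
      case True
      have bb: "g_b \<circ> (g_b \<circ> k) = k" by (simp add: fun_eq_iff)
      have "g_b \<circ> k \<in> IMGf" using m True by (simp add: IMGf_eq Gam_comp Gam_gens sgG_comp del: o_apply)
      moreover have "([x], g_b) \<in> {([L1], id), ([L2], id), ([L3], g_b), ([L4], g_b)}" using True by (cases x) auto
      moreover have "m = bimod_right ([x], g_b) (g_b \<circ> k)" by (simp add: m(1) bimod_right_simp bb)
      ultimately show ?thesis unfolding bimod_f_def by blast
    qed
  next
    fix m assume "m \<in> bimod_f"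
    then obtain m' h where "m = bimod_right m' h" "m' \<in> {([L1], id), ([L2], id), ([L3], g_b), ([L4], g_b)}" "h \<in> IMGf"
      unfolding bimod_f_def by blast
    then show "m \<in> Xact.Bf"
      by (auto simp: Xact.Bf_def IMGf_eq bimod_right_simp sgG_comp Gam_comp Gam_gens simp del: o_apply)
  qed
  show "hact.Bf = mu ` bimod_f" unfolding B[symmetric]
  proof (intro equalityI subsetI)
    fix m assume "m \<in> hact.Bf"
    then obtain x k where m: "m = ([x], k)" "k \<in> Gam_hat" "parh x = sgh k" by (auto simp: hact.Bf_def)
    obtain g where g: "g \<in> Gam" "nu g = k" using nu_surj m by blast
    obtain y where y: "mu_letter y = x" using mu_letter.simps by (metis bletter.exhaust)
    have "([y], g) \<in> Xact.Bf" using g y m by (auto simp: Xact.Bf_def par_mu sgG_def)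
    moreover have "m = mu ([y], g)" using g y m by (simp add: mu_def)
    ultimately show "m \<in> mu ` Xact.Bf" by blast
  qed (auto simp: Xact.Bf_def hact.Bf_def mu_def par_mu sgG_def nu_Gamh)
qed

abbreviation "orb \<equiv> Xact.orb"
abbreviation "horb \<equiv> hact.orb"
abbreviation "J \<xi> \<equiv> JF (Fs \<xi>)"

lemma nu_ggens: assumes "S \<subseteq> ggens" "j \<in> gen S" shows "nu j = id"
  using assms(2)
proof (induction rule: gen.induct)
  case gen_id show ?case by (rule nu_gens)
next
  case (gen_mult s g)
  have "s \<in> Gam" "nu s = id" using gen_mult(1) assms(1) Gam_gens nu_gens by (auto simp: ggens_def)
  then show ?case using gen_mult nu_comp ggens_Gam[OF assms(1)] by (metis comp_id)
qed

lemma mw_ggens: "S \<subseteq> ggens \<Longrightarrow> j \<in> gen S \<Longrightarrow> mw (j w) = mw w"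
  using nu_mw[OF ggens_Gam] nu_ggens by (metis id_apply)

lemma sgG_sect: assumes "k \<in> Gam" "mw (k w) = mw w" shows "sgG (sect k w) = sgG k"
  using assms
proof (induction w arbitrary: k)
  case Nil then show ?case by (simp add: sect_Nil)
next
  case (Cons x w)
  have s: "sect k [x] \<in> Gam" by (rule Gam_sect[OF Cons(2)])
  have "k (x # w) = lt k x # sect k [x] w" using TA_Cons[OF Gam_TA[OF Cons(2)]] .
  then have m: "mu_letter (lt k x) = mu_letter x" "mw (sect k [x] w) = mw w" using Cons(3) by simp_all
  then have "sgG (sect k [x]) = sgG k" using parity[OF Cons(2), of x] by (auto simp: par_mu)
  moreover have "sect k (x # w) = sect (sect k [x]) w" by (rule sect_Cons[OF Gam_TA[OF Cons(2)]])
  ultimately show ?case using Cons.IH[OF s m(2)] by simp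
qed

lemma Fs_J: assumes "\<xi> \<in> T0" shows "gen (J \<xi>) \<subseteq> grp (Fs \<xi>)"
proof
  fix j assume "j \<in> gen (J \<xi>)"
  then show "j \<in> grp (Fs \<xi>)"
  proof (induction rule: gen.induct)
    case gen_id show ?case by (rule id_grp)
  next
    case (gen_mult s g)
    have "s \<in> ggens" using gen_mult JF_sub by blast
    then have "\<forall>X\<in>Fs \<xi>. s \<in> stab X" using gen_mult(1) JF_iff[OF Fs_ne[OF assms]] by blast
    then show ?case using gen_mult.IH stab_group by (auto simp: grp_def simp del: o_apply)
  qed
qed

lemma T0_grp_Gam: "\<xi> \<in> T0 \<Longrightarrow> k \<in> grp (Fs \<xi>) \<Longrightarrow> k \<in> Gam"
  using grp_Gam[OF Fs_ne] by blast

lemma M_n_eq: "M_n n = {orb \<xi> w h | \<xi> w h. \<xi> \<in> T0 \<and> length w = n \<and> h \<in> Gam}"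
proof (intro equalityI subsetI)
  fix y assume "y \<in> M_n n"
  then obtain \<xi> w h where y: "y = orb \<xi> w h" "\<xi> \<in> Xi" "length w = n" "h \<in> Gam"
    unfolding M_n_def Xi_n_def Xact.space_eq Xact.orb_def H_eq by blast
  obtain \<xi>0 g where g: "\<xi>0 \<in> T0" "g \<in> Gam" "\<xi> = Xi_right \<xi>0 g" using Xi_ex_T0[OF y(2)] by blast
  have G: "sect g w \<circ> h \<in> Gam" using Gam_comp Gam_sect g y by blast
  have "y = orb \<xi>0 (g w) (sect g w \<circ> h)" unfolding y(1)
    using Xact.orb_eq_iff[OF y(2) subsetD[OF T0_Xi g(1)] y(4) G] g by blast
  moreover have "length (g w) = n" using TA_length[OF Gam_TA[OF g(2)]] y(3) by simp
  ultimately show "y \<in> {orb \<xi> w h | \<xi> w h. \<xi> \<in> T0 \<and> length w = n \<and> h \<in> Gam}" using g(1) G by blast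
next
  fix y assume "y \<in> {orb \<xi> w h | \<xi> w h. \<xi> \<in> T0 \<and> length w = n \<and> h \<in> Gam}"
  then show "y \<in> M_n n" unfolding M_n_def Xi_n_def Xact.space_eq Xact.orb_def H_eq using T0_Xi by blast
qed

lemma orb_T0_eq: assumes "\<xi> \<in> T0" "\<xi>' \<in> T0" "h \<in> Gam" "h' \<in> Gam"
  shows "orb \<xi> w h = orb \<xi>' w' h' \<longleftrightarrow> \<xi>' = \<xi> \<and> (\<exists>k\<in>grp (Fs \<xi>). w' = k w \<and> sgG (sect k w \<circ> h) = sgG h')"
proof -
  have "orb \<xi> w h = orb \<xi>' w' h' \<longleftrightarrow> (\<exists>g\<in>Gam. \<xi> = Xi_right \<xi>' g \<and> w' = g w \<and> sgG (sect g w \<circ> h) = sgG h')"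
    using Xact.orb_eq_iff[OF subsetD[OF T0_Xi assms(1)] subsetD[OF T0_Xi assms(2)] assms(3,4)] .
  also have "\<dots> \<longleftrightarrow> \<xi>' = \<xi> \<and> (\<exists>k\<in>grp (Fs \<xi>). w' = k w \<and> sgG (sect k w \<circ> h) = sgG h')"
    using T0_stab[OF assms(2,1)] T0_grp_Gam[OF assms(1)] by (cases "\<xi>' = \<xi>") auto
  finally show ?thesis .
qed

lemma grp_inv: assumes "k \<in> grp F" "F \<noteq> {}" shows "iv k \<in> grp F" using assms stab_group by (auto simp: grp_def)

text \<open>Equal signs and equal binary words force the identifying stabilizer element to preserve
  the orientation, by \<open>sgG_sect\<close>, and \<open>rotation_orbit\<close> replaces it by an
  element of the kernel.\<close>

lemma orb_fibre_eq: assumes "\<xi> \<in> T0" "\<xi>' \<in> T0" "h \<in> Gam" "h' \<in> Gam" "sgG h = sgG h'" "mw w = mw w'"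
  shows "orb \<xi> w h = orb \<xi>' w' h' \<longleftrightarrow> \<xi>' = \<xi> \<and> (\<exists>j\<in>gen (J \<xi>). w' = j w)"
proof
  assume "orb \<xi> w h = orb \<xi>' w' h'"
  then obtain k where k: "\<xi>' = \<xi>" "k \<in> grp (Fs \<xi>)" "w' = k w" "sgG (sect k w \<circ> h) = sgG h'"
    unfolding orb_T0_eq[OF assms(1-4)] by blast
  have kG: "k \<in> Gam" by (rule T0_grp_Gam[OF assms(1) k(2)])
  have m: "mw (k w) = mw w" using k(3) assms(6) by simp
  have "\<not> sgG (sect k w)" using k(4) assms(5) sgG_comp[OF Gam_sect[OF kG] assms(3)] by blast
  then have "\<not> sgG k" using sgG_sect[OF kG m] by simp
  then show "\<xi>' = \<xi> \<and> (\<exists>j\<in>gen (J \<xi>). w' = j w)"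
    using rotation_orbit[OF Fs_ne[OF assms(1)], of k w] k m by (auto simp: grp_def)
next
  assume "\<xi>' = \<xi> \<and> (\<exists>j\<in>gen (J \<xi>). w' = j w)"
  then obtain j where j: "\<xi>' = \<xi>" "j \<in> gen (J \<xi>)" "w' = j w" by blast
  have jG: "j \<in> Gam" by (rule ggens_Gam[OF JF_sub j(2)])
  have "\<not> sgG j" using nu_ggens[OF JF_sub j(2)] by (simp add: sgG_def hact.sg_id)
  then have "\<not> sgG (sect j w)" using sgG_sect[OF jG mw_ggens[OF JF_sub j(2)]] by simp
  then have "sgG (sect j w \<circ> h) = sgG h'" using sgG_comp[OF Gam_sect[OF jG] assms(3)] assms(5) by blast
  then show "orb \<xi> w h = orb \<xi>' w' h'" unfolding orb_T0_eq[OF assms(1-4)] using j Fs_J[OF assms(1)] by blast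
qed

lemma P_n_eq: assumes "\<xi> \<in> Xi" "h \<in> Gam"
  shows "P_n (tensor Xi Xi_right Gam \<xi> (w, h)) = tensor UNIV plane_right Gam_hat (P_map \<xi>) (mw w, nu h)"
proof -
  have "tensor UNIV plane_right Gam_hat (P_map (Xi_right \<xi> (iv g))) (mu (bimod_left g (w, h)))
      = tensor UNIV plane_right Gam_hat (P_map \<xi>) (mw w, nu h)" if g: "g \<in> Gam" for g
  proof -
    have m: "mu (bimod_left g (w, h)) = bimod_left (nu g) (mw w, nu h)"
      using g assms(2) by (simp add: mu_def bimod_left_simp nu_mw nu_comp Gam_sect nu_sect del: o_apply)
    have "P_map \<xi> = plane_right (P_map (Xi_right \<xi> (iv g))) (nu g)"
      using P_map_right[OF Xi_right_Xi[OF assms(1) Gam_inv[OF g]] g] Xact.act_inv(2)[OF assms(1) g]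
      by (simp add: plane_right_def)
    moreover have "snd (mw w, nu h) \<in> Gam_hat" "snd (bimod_left (nu g) (mw w, nu h)) \<in> Gam_hat"
      using hact.bl_G[OF nu_Gamh[OF g], of "(mw w, nu h)"] nu_Gamh[OF assms(2)] by simp_all
    ultimately show ?thesis unfolding m
      using hact.tensor_eq_iff[of "P_map \<xi>" "(mw w, nu h)" "P_map (Xi_right \<xi> (iv g))" "bimod_left (nu g) (mw w, nu h)"] 
        nu_Gamh[OF g] by (metis UNIV_I)
  qed
  then have "(\<lambda>(\<xi>, m). tensor UNIV plane_right Gam_hat (P_map \<xi>) (mu m)) ` tensor Xi Xi_right Gam \<xi> (w, h)
      = {tensor UNIV plane_right Gam_hat (P_map \<xi>) (mw w, nu h)}"
    using Xact.tensor_eq[of \<xi> "(w, h)"] assms Gam_id by (auto simp: image_image)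
  then show ?thesis unfolding P_n_def by simp
qed

lemma rho_orb: assumes "\<xi> \<in> Xi" "h \<in> Gam" shows "rho (orb \<xi> w h) = horb (P_map \<xi>) (mw w) (nu h)"
proof -
  have "S_orbit (P_n (tensor Xi Xi_right Gam \<xi> (w, h \<circ> u))) = horb (P_map \<xi>) (mw w) (nu h)" if u: "u \<in> IMGf" for u
  proof -
    have uG: "u \<in> Gam" "\<not> sgG u" using u by (auto simp: IMGf_eq)
    have G: "h \<circ> u \<in> Gam" by (rule Gam_comp[OF assms(2) uG(1)])
    have "S_orbit (P_n (tensor Xi Xi_right Gam \<xi> (w, h \<circ> u))) = horb (P_map \<xi>) (mw w) (nu (h \<circ> u))"
      unfolding P_n_eq[OF assms(1) G] S_orbit_def hact.orb_def H_eq ..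
    also have "\<dots> = horb (P_map \<xi>) (mw w) (nu h)"
      using sgG_comp[OF assms(2) uG(1)] uG(2) nu_Gamh assms(2) G
      by (intro hact.orb_sg) (simp_all add: sgG_def del: o_apply)
    finally show ?thesis .
  qed
  moreover have "id \<in> IMGf" by (simp add: IMGf_eq Gam_id)
  ultimately have "(\<lambda>\<xi>. S_orbit (P_n \<xi>)) ` orb \<xi> w h = {horb (P_map \<xi>) (mw w) (nu h)}"
    unfolding Xact.orb_alt[OF assms] H_eq by (auto simp: image_image)
  then show ?thesis unfolding rho_def by simp
qed

lemma Xi_of_Tz: "\<xi> \<in> Tz z \<Longrightarrow> \<xi> \<in> T0" "\<xi> \<in> Tz z \<Longrightarrow> P_map \<xi> = z" by (auto simp: Tz_def)

text \<open>A point over the given class projects into the orbit of z and into the triangle, hence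
  to z. The element of \<Gamma>-hat comparing the binary words fixes z; its lift to the stabilizer
  of \<xi> produces a word over v and adjusts the sign to that of h.\<close>

lemma fibre_eq: assumes z: "z \<in> Dt" and h: "h \<in> Gam" and v: "length v = n"
  shows "fibre n (horb z v (nu h)) = {orb \<xi> w h | \<xi> w. \<xi> \<in> Tz z \<and> mw w = v}"
proof (intro equalityI subsetI)
  fix y assume "y \<in> fibre n (horb z v (nu h))"
  then have y: "y \<in> M_n n" "rho y = horb z v (nu h)" by (auto simp: fibre_def)
  then obtain \<xi> w h' where o: "y = orb \<xi> w h'" "\<xi> \<in> T0" "length w = n" "h' \<in> Gam" unfolding M_n_eq by blast
  have "horb (P_map \<xi>) (mw w) (nu h') = horb z v (nu h)" using y(2) rho_orb[OF subsetD[OF T0_Xi o(2)] o(4)] o(1) by simp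
  then obtain g where g: "g \<in> Gam_hat" "P_map \<xi> = plane_act g z" "v = g (mw w)" "sgh (sect g (mw w) \<circ> nu h') = sgh (nu h)"
    using hact.orb_eq_iff[OF UNIV_I UNIV_I nu_Gamh[OF o(4)] nu_Gamh[OF h]] by (auto simp: plane_right_def)
  have Pz: "P_map \<xi> = z" using Dt_fundamental[OF g(1) z] P_map_Dt[OF o(2)] g(2) by simp
  obtain k where k: "k \<in> grp (Fs \<xi>)" "nu k = g" using stabilizer_lift[OF o(2) g(1)] g(2) Pz by auto
  have kG: "k \<in> Gam" by (rule T0_grp_Gam[OF o(2) k(1)])
  have "sgG (sect k w \<circ> h') = sgG h"
    using g(4) by (simp add: sgG_def nu_comp Gam_sect kG o(4) nu_sect k(2) del: o_apply)
  then have "y = orb \<xi> (k w) h" unfolding o(1) orb_T0_eq[OF o(2,2,4) h] using k(1) by blast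
  moreover have "mw (k w) = v" using nu_mw[OF kG] k(2) g(3) by simp
  moreover have "\<xi> \<in> Tz z" using o(2) Pz by (simp add: Tz_def)
  ultimately show "y \<in> {orb \<xi> w h | \<xi> w. \<xi> \<in> Tz z \<and> mw w = v}" by blast
next
  fix y assume "y \<in> {orb \<xi> w h | \<xi> w. \<xi> \<in> Tz z \<and> mw w = v}"
  then obtain \<xi> w where o: "y = orb \<xi> w h" "\<xi> \<in> Tz z" "mw w = v" by blast
  note t = Xi_of_Tz[OF o(2)]
  have "length w = n" using o(3) v by auto
  then have "y \<in> M_n n" unfolding M_n_eq using o(1) t(1) h by blast
  moreover have "rho y = horb z v (nu h)" using rho_orb[OF subsetD[OF T0_Xi t(1)] h] o t(2) by simp
  ultimately show "y \<in> fibre n (horb z v (nu h))" by (simp add: fibre_def)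
qed

lemma S_n_eq: "S_n n = {horb z v (nu h) | z v h. z \<in> Dt \<and> length v = n \<and> h \<in> Gam}"
proof (intro equalityI subsetI)
  fix s assume "s \<in> S_n n"
  then obtain z v h where s: "s = horb z v h" "length v = n" "h \<in> Gam_hat"
    unfolding S_n_def Xi_hat_n_def hact.space_eq S_orbit_def hact.orb_def H_eq by blast
  obtain g where g: "g \<in> Gam_hat" "plane_act g z \<in> Dt" using Dt_covers by blast
  let ?g = "iv g"
  have ig: "?g \<in> Gam_hat" by (rule Gamh_inv[OF g(1)])
  have G: "sect ?g v \<circ> h \<in> Gam_hat" using Gamh_comp Gamh_sect ig s(3) by blast
  have "z = plane_right (plane_act g z) ?g" using hact.act_inv(1)[OF UNIV_I g(1), of z] by (simp add: plane_right_def)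
  then have eq: "s = horb (plane_act g z) (?g v) (sect ?g v \<circ> h)" unfolding s(1)
    using hact.orb_eq_iff[OF UNIV_I UNIV_I s(3) G] ig by blast
  obtain k where k: "k \<in> Gam" "nu k = sect ?g v \<circ> h" using nu_surj[OF G] by blast
  have "length (?g v) = n" using TA_length[OF Gamh_TA[OF ig]] s(2) by simp
  then show "s \<in> {horb z v (nu h) | z v h. z \<in> Dt \<and> length v = n \<and> h \<in> Gam}" unfolding eq k(2)[symmetric] using k(1) g(2) by blast
next
  fix s assume "s \<in> {horb z v (nu h) | z v h. z \<in> Dt \<and> length v = n \<and> h \<in> Gam}"
  then show "s \<in> S_n n" unfolding S_n_def Xi_hat_n_def hact.space_eq S_orbit_def hact.orb_def H_eq
    using nu_Gamh by blast
qed

lemma p_map_orb: assumes "\<xi> \<in> T0" "h \<in> Gam" "k \<in> Gam" "sgG k = (par x \<noteq> sgG h)" "length w = n"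
  shows "p_map n (orb \<xi> (w @ [x]) h) = orb \<xi> w k"
  using Xact.projection_eq[OF subsetD[OF T0_Xi assms(1)] assms(2-5)]
  unfolding p_map_def Xi_n_def H_eq Bf_eq .

lemma q_map_orb: assumes "h \<in> Gam" "k \<in> Gam" "sgG k = (parh x \<noteq> sgG h)" "length v = n"
  shows "q_map n (horb z (v @ [x]) (nu h)) = horb z v (nu k)"
  using hact.projection_eq[OF UNIV_I nu_Gamh[OF assms(1)] nu_Gamh[OF assms(2)] assms(3)[unfolded sgG_def] assms(4), of z]
  unfolding q_map_def Xi_hat_n_def S_orbit_def hat_append_def H_eq Bf_eq by (simp add: conj_assoc)

lemma hat_append_orb: assumes "h \<in> Gam_hat"
  shows "S_orbit (hat_append (tensor UNIV plane_right Gam_hat z (v, id)) ([x], h)) = horb z (v @ [x]) h"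
proof -
  have "bimod_mult (v, id) ([x], h) = (v @ [x], h)" by (simp only: bimod_mult_simp id_apply sect_id id_comp)
  then show ?thesis
    using hact.append_eq[of z "(v, id)" "([x], h)"] Gamh_id assms
    by (simp add: hat_append_def S_orbit_def hact.orb_def H_eq)
qed

section \<open>The special points and their recursion\<close>

section \<open>The sets \<open>Z\<^sub>g\<^sub>,\<^sub>n\<close>\<close>

lemma ggens_invol: "g \<in> ggens \<Longrightarrow> g \<circ> g = id" by (auto simp: ggens_def fun_eq_iff)

lemma ggens_iv: assumes "g \<in> ggens" shows "iv g = g"
proof -
  have "g \<in> TA" using assms Gam_gens Gam_TA by (auto simp: ggens_def)
  then have "iv g = iv g \<circ> (g \<circ> g)" using ggens_invol[OF assms] by simp
  also have "\<dots> = g" using TA_inv(2)[OF \<open>g \<in> TA\<close>] by (simp add: comp_assoc[symmetric])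
  finally show ?thesis .
qed

text \<open>An element fixing w whose section at w acts trivially on the plane acts trivially
  itself, by \<open>pl_sect_trivial\<close>. So it lies in the group generated by
  \<open>J \<xi>\<close>, to which the recursion \<open>Jw\<close> applies.\<close>

lemma loop_iff: assumes \<xi>: "\<xi> \<in> T0" and g: "g \<in> ggens"
  shows "(\<exists>k\<in>grp (Fs \<xi>). k w = w \<and> sect k w = g) \<longleftrightarrow> g \<in> Jw (J \<xi>) w"
proof
  assume "\<exists>k\<in>grp (Fs \<xi>). k w = w \<and> sect k w = g"
  then obtain k where k: "k \<in> grp (Fs \<xi>)" "k w = w" "sect k w = g" by blast
  have "pl (sect k w) = id" using g k(3) pl_gens by (auto simp: ggens_def)
  then have "pl k = id" using pl_sect_trivial[OF T0_grp_Gam[OF \<xi> k(1)], of w] k(2) by simp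
  then have "k \<in> gen (J \<xi>)" using inter_kernel[OF Fs_ne[OF \<xi>]] k(1) by (auto simp: grp_def)
  then have "g \<in> gen (Jw (J \<xi>) w)" using Jw_sect[of "J \<xi>" k w, OF JF_sub _ k(2)] k(3) by simp
  then show "g \<in> Jw (J \<xi>) w" using gen_ggens_mem[OF Jw_sub[OF JF_sub] g] by simp
next
  assume "g \<in> Jw (J \<xi>) w"
  then have "g \<in> gen (Jw (J \<xi>) w)" by (rule gen_incl)
  then obtain k where "k \<in> gen (J \<xi>)" "k w = w" "sect k w = g" using Jw_lift[OF JF_sub] by blast
  then show "\<exists>k\<in>grp (Fs \<xi>). k w = w \<and> sect k w = g" using Fs_J[OF \<xi>] by blast
qed

text \<open>Conjugation does not change the images of an element in the abelian quotients of \<open>\<Gamma>\<close>, which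
  distinguish the three generators.\<close>

lemma Jw_invariant: assumes \<xi>: "\<xi> \<in> T0" and k: "k \<in> grp (Fs \<xi>)" and g: "g \<in> Jw (J \<xi>) w"
  shows "g \<in> Jw (J \<xi>) (k w)"
proof -
  have gg: "g \<in> ggens" using g Jw_sub[OF JF_sub] by blast
  obtain m where m: "m \<in> gen (J \<xi>)" "m w = w" "sect m w = g" using Jw_lift[OF JF_sub gen_incl[OF g]] by blast
  have G: "k \<in> Gam" "m \<in> Gam" "iv k \<in> Gam" "k \<circ> m \<in> Gam"
    using T0_grp_Gam[OF \<xi> k] ggens_Gam[OF JF_sub m(1)] Gam_inv Gam_comp by blast+
  let ?m = "(k \<circ> m) \<circ> iv k" and ?s = "sect k w"
  have mg: "?m \<in> grp (Fs \<xi>)"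
  proof -
    have "m \<in> grp (Fs \<xi>)" "iv k \<in> grp (Fs \<xi>)" using Fs_J[OF \<xi>] m(1) grp_inv[OF k Fs_ne[OF \<xi>]] by auto
    then show ?thesis using k stab_group by (auto simp: grp_def simp del: o_apply)
  qed
  have "pl m = id" using nu_ggens[OF JF_sub m(1)] by (simp only: plane_act_gens)
  then have "pl ?m = pl (iv k) \<circ> pl k" using G by (simp only: pl_comp id_comp)
  also have "\<dots> = pl (k \<circ> iv k)" by (rule pl_comp[OF G(1,3), symmetric])
  also have "\<dots> = id" using TA_inv(1)[OF Gam_TA[OF G(1)]] by (simp only: pl_gens)
  finally have "?m \<in> gen (J \<xi>)" using inter_kernel[OF Fs_ne[OF \<xi>]] mg by (auto simp: grp_def)
  moreover have "?m (k w) = k w" using TA_inv(4)[OF Gam_TA[OF G(1)]] m(2) by simp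
  ultimately have mem: "sect ?m (k w) \<in> gen (Jw (J \<xi>) (k w))" by (rule Jw_sect[OF JF_sub])
  have sG: "?s \<in> Gam" "g \<in> Gam" "iv ?s \<in> Gam" "?s \<circ> g \<in> Gam" using Gam_sect G(1,2) m(3) Gam_inv Gam_comp by metis+
  have "sect (?m \<circ> k) w = sect ?m (k w) \<circ> ?s" by (rule sect_comp) (use Gam_TA Gam_comp G in blast)+
  moreover have "?m \<circ> k = k \<circ> m" using TA_inv(2)[OF Gam_TA[OF G(1)]] by (simp add: comp_assoc)
  moreover have "sect (k \<circ> m) w = ?s \<circ> g" using sect_comp[OF Gam_TA[OF G(1)] Gam_TA[OF G(2)], of w] m by simp
  ultimately have "sect ?m (k w) \<circ> ?s = ?s \<circ> g" by simp
  then have eq: "(?s \<circ> g) = sect ?m (k w) \<circ> ?s" by simp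
  have mG: "sect ?m (k w) \<in> Gam" using ggens_Gam[OF Jw_sub[OF JF_sub] mem] .
  have e: "e_al (sect ?m (k w)) = e_al g" "e_be (sect ?m (k w)) = e_be g" "e_ga (sect ?m (k w)) = e_ga g"
    using arg_cong[OF eq, of e_al] arg_cong[OF eq, of e_be] arg_cong[OF eq, of e_ga]
    unfolding e_comps[OF sG(1,2)] e_comps[OF mG sG(1)] by blast+
  show ?thesis
    using gg gen_e[OF Jw_sub[OF JF_sub] mem] e by (auto simp: ggens_def)
qed

text \<open>Being fixed by \<open>kappa g\<close> means that some element stabilizing \<xi> fixes w
  with section g. The representatives \<open>id\<close> and \<open>g_a\<close> stand for the two
  signs, so every h is covered.\<close>

lemma Z_set_eq: assumes g: "g \<in> ggens"
  shows "Z_set g n = {orb \<xi> w h | \<xi> w h. \<xi> \<in> T0 \<and> length w = n \<and> h \<in> Gam \<and> g \<in> Jw (J \<xi>) w}"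
proof -
  have gG: "g \<in> Gam" using g Gam_gens by (auto simp: ggens_def)
  let ?t = "\<lambda>\<xi> w h. tensor Xi Xi_right Gam \<xi> (w, h)"
  have right: "tensor_right (?t \<xi> w h) k = ?t \<xi> w (h \<circ> k)" if "\<xi> \<in> T0" "h \<in> Gam" "k \<in> Gam" for \<xi> w h k
    using Xact.tensor_right_eq[of \<xi> "(w, h)" k] that T0_Xi by (auto simp: bimod_right_simp)
  have teq: "?t \<xi> w g = ?t \<xi> w id \<longleftrightarrow> g \<in> Jw (J \<xi>) w" if \<xi>: "\<xi> \<in> T0" for \<xi> w
  proof -
    have X: "\<xi> \<in> Xi" using \<xi> T0_Xi by blast
    have "?t \<xi> w id = ?t \<xi> w g \<longleftrightarrow> (\<exists>k\<in>Gam. \<xi> = Xi_right \<xi> k \<and> (w, g) = (k w, sect k w))"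
      using Xact.tensor_eq_iff[OF X _ X, of "(w, id)" "(w, g)"] Gam_id gG by (simp add: bimod_left_simp)
    also have "\<dots> \<longleftrightarrow> (\<exists>k\<in>Gam. k \<in> grp (Fs \<xi>) \<and> k w = w \<and> sect k w = g)"
      by (intro bex_cong refl) (auto simp: T0_stab[OF \<xi> \<xi>])
    also have "\<dots> \<longleftrightarrow> (\<exists>k\<in>grp (Fs \<xi>). k w = w \<and> sect k w = g)"
      using T0_grp_Gam[OF \<xi>] by blast
    finally show ?thesis using loop_iff[OF \<xi> g] by auto
  qed
  have fixed: "{\<eta> \<in> K_set g n. kappa g \<eta> = \<eta>} = {?t \<xi> w id | \<xi> w. \<xi> \<in> T0 \<and> length w = n \<and> g \<in> Jw (J \<xi>) w}"
    (is "?L = ?R")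
  proof (intro equalityI subsetI)
    fix y assume "y \<in> ?L"
    then obtain \<xi> w where y: "y = ?t \<xi> w id" "\<xi> \<in> T0" "length w = n" "tensor_right y g = y"
      unfolding K_set_def T_n_def kappa_def ggens_iv[OF g] by blast
    then have "?t \<xi> w g = ?t \<xi> w id" using right[OF y(2) Gam_id gG] by simp
    then show "y \<in> ?R" using teq y by blast
  next
    fix y assume "y \<in> ?R"
    then obtain \<xi> w where y: "y = ?t \<xi> w id" "\<xi> \<in> T0" "length w = n" "?t \<xi> w g = ?t \<xi> w id" using teq by blast
    have r: "tensor_right y g = y" using right[OF y(2) Gam_id gG] y by simp
    have "y \<in> T_n n" unfolding T_n_def using y by blast
    then show "y \<in> ?L" unfolding K_set_def kappa_def ggens_iv[OF g] using r by (auto intro!: image_eqI[of _ _ y])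
  qed
  have o: "tensor_orbit IMGf (?t \<xi> w id) = orb \<xi> w id" for \<xi> w unfolding Xact.orb_def H_eq ..
  have oa: "tensor_orbit IMGf (tensor_right (?t \<xi> w id) g_a) = orb \<xi> w g_a" if "\<xi> \<in> T0" for \<xi> w
    using Xact.orb_right[OF subsetD[OF T0_Xi that] Gam_id Gam_gens(4)] by (simp add: H_eq)
  have hor: "orb \<xi> w h = orb \<xi> w id \<or> orb \<xi> w h = orb \<xi> w g_a" if "\<xi> \<in> T0" "h \<in> Gam" for \<xi> w h
    using Xact.orb_sg[OF subsetD[OF T0_Xi that(1)] that(2)] Gam_id Gam_gens(4) sgG_gens(1,5) by blast
  show ?thesis unfolding Z_set_def fixed
  proof (intro equalityI subsetI)
    fix y assume "y \<in> (\<Union>\<eta>\<in>{?t \<xi> w id | \<xi> w. \<xi> \<in> T0 \<and> length w = n \<and> g \<in> Jw (J \<xi>) w}.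
      {tensor_orbit IMGf \<eta>, tensor_orbit IMGf (tensor_right \<eta> g_a)})"
    then obtain \<xi> w where y: "\<xi> \<in> T0" "length w = n" "g \<in> Jw (J \<xi>) w" "y = orb \<xi> w id \<or> y = orb \<xi> w g_a"
      using o oa by auto
    then show "y \<in> {orb \<xi> w h | \<xi> w h. \<xi> \<in> T0 \<and> length w = n \<and> h \<in> Gam \<and> g \<in> Jw (J \<xi>) w}"
      using Gam_id Gam_gens(4) by blast
  next
    fix y assume "y \<in> {orb \<xi> w h | \<xi> w h. \<xi> \<in> T0 \<and> length w = n \<and> h \<in> Gam \<and> g \<in> Jw (J \<xi>) w}"
    then obtain \<xi> w h where y: "y = orb \<xi> w h" "\<xi> \<in> T0" "length w = n" "h \<in> Gam" "g \<in> Jw (J \<xi>) w" by blast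
    have "y \<in> {tensor_orbit IMGf (?t \<xi> w id), tensor_orbit IMGf (tensor_right (?t \<xi> w id) g_a)}"
      using hor[OF y(2,4), of w] y(1) o oa[OF y(2)] by simp
    then show "y \<in> (\<Union>\<eta>\<in>{?t \<xi> w id | \<xi> w. \<xi> \<in> T0 \<and> length w = n \<and> g \<in> Jw (J \<xi>) w}.
      {tensor_orbit IMGf \<eta>, tensor_orbit IMGf (tensor_right \<eta> g_a)})" using y(2,3,5) by blast
  qed
qed

lemma Z_fibre: assumes z: "z \<in> Dt" and h: "h \<in> Gam" and v: "length v = n" and g: "g \<in> ggens"
  shows "Z_set g n \<inter> fibre n (horb z v (nu h)) = {orb \<xi> w h | \<xi> w. \<xi> \<in> Tz z \<and> mw w = v \<and> g \<in> Jw (J \<xi>) w}"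
proof (intro equalityI subsetI)
  fix y assume y: "y \<in> Z_set g n \<inter> fibre n (horb z v (nu h))"
  then obtain \<xi> w h' where 1: "y = orb \<xi> w h'" "\<xi> \<in> T0" "h' \<in> Gam" "g \<in> Jw (J \<xi>) w" unfolding Z_set_eq[OF g] by blast
  obtain \<xi>' w' where 2: "y = orb \<xi>' w' h" "\<xi>' \<in> Tz z" "mw w' = v" using y unfolding fibre_eq[OF z h v] by blast
  have "orb \<xi> w h' = orb \<xi>' w' h" using 1 2 by simp
  then obtain k where k: "\<xi>' = \<xi>" "k \<in> grp (Fs \<xi>)" "w' = k w"
    unfolding orb_T0_eq[OF 1(2) Xi_of_Tz(1)[OF 2(2)] 1(3) h] by blast
  then have "g \<in> Jw (J \<xi>') w'" using Jw_invariant[OF 1(2) k(2) 1(4)] by simp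
  then show "y \<in> {orb \<xi> w h | \<xi> w. \<xi> \<in> Tz z \<and> mw w = v \<and> g \<in> Jw (J \<xi>) w}" using 2 by blast
next
  fix y assume "y \<in> {orb \<xi> w h | \<xi> w. \<xi> \<in> Tz z \<and> mw w = v \<and> g \<in> Jw (J \<xi>) w}"
  then obtain \<xi> w where y: "y = orb \<xi> w h" "\<xi> \<in> Tz z" "mw w = v" "g \<in> Jw (J \<xi>) w" by blast
  have "length w = n" using y(3) v by auto
  then show "y \<in> Z_set g n \<inter> fibre n (horb z v (nu h))"
    unfolding Z_set_eq[OF g] fibre_eq[OF z h v] using y h Xi_of_Tz(1)[OF y(2)] by blast
qed

section \<open>The special points of the fibres\<close>

text \<open>The recursion for the special points: a letter \<open>x\<close> over \<open>y\<close> turns a loop \<open>prv g\<close> into a loop \<open>g\<close>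
  if and only if \<open>x = let_of g y\<close> or \<open>\<alpha>\<close> identifies the two letters over \<open>y\<close>.\<close>

definition prv :: "aut \<Rightarrow> aut" where "prv g = (if g = g_beta then g_gamma else g_beta)"

definition let_of :: "aut \<Rightarrow> bletter \<Rightarrow> letter" where
  "let_of g y = (if g = g_alpha then (case y of B1 \<Rightarrow> L1 | B2 \<Rightarrow> L3)
    else if g = g_gamma then (case y of B1 \<Rightarrow> L2 | B2 \<Rightarrow> L4)
    else (case y of B1 \<Rightarrow> L1 | B2 \<Rightarrow> L4))"

lemma mu_let_of: "mu_letter (let_of g y) = y" by (cases y) (auto simp: let_of_def)

lemma prv_ggens: "prv g \<in> ggens" by (auto simp: prv_def ggens_def)

lemma Jx_prv: assumes "g \<in> ggens"
  shows "g \<in> Jx J' x \<longleftrightarrow> prv g \<in> J' \<and> (x = let_of g (mu_letter x) \<or> g_alpha \<in> J')"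
proof -
  have "g = g_alpha \<or> g = g_gamma \<or> g = g_beta" using assms by (auto simp: ggens_def)
  then show ?thesis
    using gens_distinct(1-3) gens_distinct(1-3)[symmetric] by (elim disjE; cases x) (simp_all add: Jx_mem prv_def let_of_def)
qed

lemma mu_letter_eq: "mu_letter x = mu_letter y \<longleftrightarrow> y = x \<or> y = lt g_alpha x"
  by (cases x; cases y) (simp_all add: lt_gens)

text \<open>An element with trivial section leaves the suffix untouched.\<close>

lemma gen_word_append: assumes "\<xi> \<in> T0" "j \<in> gen (J \<xi>)" shows "\<exists>k\<in>gen (J \<xi>). k (w @ u) = j w @ u"
proof -
  obtain k where k: "k \<in> gen (J \<xi>)" "k w = j w" "sect k w = id" using orbit_trivial_section[OF JF_sub assms(2)] by blast
  have "k (w @ u) = k w @ sect k w u" by (rule TA_append[OF Gam_TA[OF ggens_Gam[OF JF_sub k(1)]]])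
  then show ?thesis using k by auto
qed

lemma gen_word_swap: assumes "\<xi> \<in> T0" "g_alpha \<in> Jw (J \<xi>) w" shows "\<exists>k\<in>gen (J \<xi>). k (w @ [x]) = w @ [lt g_alpha x]"
proof -
  obtain k where k: "k \<in> gen (J \<xi>)" "k w = w" "sect k w = g_alpha" using Jw_lift[OF JF_sub gen_incl[OF assms(2)]] by blast
  have "k (w @ [x]) = k w @ sect k w [x]" by (rule TA_append[OF Gam_TA[OF ggens_Gam[OF JF_sub k(1)]]])
  then show ?thesis using k TA_single[OF Gam_TA[OF Gam_gens(1)]] by auto
qed

text \<open>Multiplying j by the inverse of an element which moves w in the same way with trivial
  section yields an element that fixes w' and has the same section as j; that section can move x
  only if \<alpha> is available at w'.\<close>

lemma gen_word_snocD: assumes \<xi>: "\<xi> \<in> T0" and j: "j \<in> gen (J \<xi>)" "j (w @ [x]) = w' @ [x']"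
  shows "j w = w'" "x' = x \<or> g_alpha \<in> Jw (J \<xi>) w'"
proof -
  have jG: "j \<in> Gam" by (rule ggens_Gam[OF JF_sub j(1)])
  have "w' @ [x'] = j w @ sect j w [x]" using j(2) TA_append[OF Gam_TA[OF jG], of w "[x]"] by simp
  then have jw: "j w = w'" "sect j w [x] = [x']" using TA_length[OF Gam_TA[OF jG], of w] TA_single[OF Gam_TA[OF Gam_sect[OF jG]], of w x] by auto
  show "j w = w'" by (rule jw(1))
  obtain k where k: "k \<in> gen (J \<xi>)" "k w = j w" "sect k w = id" using orbit_trivial_section[OF JF_sub j(1)] by blast
  have kG: "k \<in> Gam" by (rule ggens_Gam[OF JF_sub k(1)])
  have J1: "s \<circ> s = id" if "s \<in> J \<xi>" for s using that JF_sub ggens_invol by blast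
  have ik: "iv k \<in> gen (J \<xi>)" by (rule gen_inv[OF k(1) J1])
  let ?m = "j \<circ> iv k"
  have m: "?m \<in> gen (J \<xi>)" by (rule gen_comp[OF j(1) ik])
  have ikw: "iv k w' = w" using TA_inv(4)[OF Gam_TA[OF kG], of w] k(2) jw(1) by simp
  then have mw: "?m w' = w'" using jw(1) by simp
  have "sect (iv k \<circ> k) w = sect (iv k) w' \<circ> sect k w"
    using sect_comp[OF Gam_TA[OF Gam_inv[OF kG]] Gam_TA[OF kG], of w] k(2) jw(1) by simp
  then have "sect (iv k) w' = id" using TA_inv(2)[OF Gam_TA[OF kG]] k(3) by (simp only: sect_id comp_id)
  moreover have "sect ?m w' = sect j w \<circ> sect (iv k) w'"
    using sect_comp[OF Gam_TA[OF jG] Gam_TA[OF Gam_inv[OF kG]], of w'] ikw by simp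
  ultimately have "sect ?m w' = sect j w" by simp
  then have "sect j w \<in> gen (Jw (J \<xi>) w')" using Jw_sect[of "J \<xi>" ?m w', OF JF_sub m mw] by simp
  then have "lt (sect j w) x = x \<or> g_alpha \<in> Jw (J \<xi>) w'" using Jx_sect[OF Jw_sub[OF JF_sub]] by blast
  moreover have "lt (sect j w) x = x'" using jw(2) TA_single[OF Gam_TA[OF Gam_sect[OF jG]], of w x] by simp
  ultimately show "x' = x \<or> g_alpha \<in> Jw (J \<xi>) w'" by blast
qed

text \<open>At a word ending in a letter over y, g can only come from \<open>prv g\<close> at the
  shorter word, where the class is unique by induction. The letter \<open>let_of g y\<close> always
  works, and the other letter over y works only if \<alpha> exchanges the two, which keeps the
  class. For the empty word the point is the end of a leg.\<close>

lemma special_unique: assumes z: "z \<in> Dt" and g: "g \<in> ggens"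
  shows "\<exists>\<xi> w. \<xi> \<in> Tz z \<and> mw w = v \<and> g \<in> Jw (J \<xi>) w \<and>
    (\<forall>\<xi>' w'. \<xi>' \<in> Tz z \<longrightarrow> mw w' = v \<longrightarrow> g \<in> Jw (J \<xi>') w' \<longrightarrow> \<xi>' = \<xi> \<and> (\<exists>j\<in>gen (J \<xi>). w' = j w))"
  using g
proof (induction v arbitrary: g rule: rev_induct)
  case Nil
  obtain \<xi> where \<xi>: "\<xi> \<in> Tz z" "g \<in> J \<xi>" "\<And>\<xi>'. \<xi>' \<in> Tz z \<Longrightarrow> g \<in> J \<xi>' \<Longrightarrow> \<xi>' = \<xi>"
    using tripod_end_unique[OF z Nil] by blast
  have "\<exists>j\<in>gen (J \<xi>). w' = j []" if "mw w' = []" for w' :: "letter list"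
    using that by (intro bexI[of _ id]) (simp_all add: gen.gen_id)
  moreover have "g \<in> Jw (J \<xi>) []" using \<xi>(2) by simp
  moreover have "\<xi>' = \<xi>" if "\<xi>' \<in> Tz z" "mw w' = []" "g \<in> Jw (J \<xi>') w'" for \<xi>' and w' :: "letter list"
    using \<xi>(3)[OF that(1)] that(2,3) by simp
  moreover have "mw [] = []" by simp
  ultimately show ?case using \<xi>(1) by blast
next
  case (snoc y v)
  obtain \<xi> w where 1: "\<xi> \<in> Tz z" "mw w = v" "prv g \<in> Jw (J \<xi>) w"
    "\<And>\<xi>' w'. \<xi>' \<in> Tz z \<Longrightarrow> mw w' = v \<Longrightarrow> prv g \<in> Jw (J \<xi>') w' \<Longrightarrow> \<xi>' = \<xi> \<and> (\<exists>j\<in>gen (J \<xi>). w' = j w)"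
    using snoc.IH[OF prv_ggens] by blast
  have T: "\<xi> \<in> T0" by (rule Xi_of_Tz(1)[OF 1(1)])
  let ?x = "let_of g y"
  have mem: "g \<in> Jw (J \<xi>) (w @ [?x])" unfolding Jw_snoc Jx_prv[OF snoc.prems] mu_let_of using 1(3) by simp
  have "\<xi>' = \<xi> \<and> (\<exists>j\<in>gen (J \<xi>). u = j (w @ [?x]))"
    if u: "\<xi>' \<in> Tz z" "mw u = v @ [y]" "g \<in> Jw (J \<xi>') u" for \<xi>' u
  proof -
    obtain w' x' where u': "u = w' @ [x']" "mw w' = v" "mu_letter x' = y"
      using u(2) by (cases u rule: rev_cases) auto
    have p: "prv g \<in> Jw (J \<xi>') w'" "x' = ?x \<or> g_alpha \<in> Jw (J \<xi>') w'"
      using u(3) unfolding u'(1) Jw_snoc Jx_prv[OF snoc.prems] u'(3) by blast+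
    obtain j where j: "\<xi>' = \<xi>" "j \<in> gen (J \<xi>)" "w' = j w" using 1(4)[OF u(1) u'(2) p(1)] by blast
    obtain k where k: "k \<in> gen (J \<xi>)" "k (w @ [?x]) = w' @ [?x]" using gen_word_append[OF T j(2)] j(3) by blast
    show ?thesis
    proof (cases "x' = ?x")
      case True
      then have "u = k (w @ [?x])" using k(2) u'(1) by simp
      then show ?thesis using j(1) k(1) by blast
    next
      case False
      then have al: "g_alpha \<in> Jw (J \<xi>) w'" using p(2) j(1) by blast
      have "mu_letter ?x = mu_letter x'" using u'(3) mu_let_of by simp
      then have "x' = lt g_alpha ?x" using False unfolding mu_letter_eq by blast
      then obtain l where l: "l \<in> gen (J \<xi>)" "l (w' @ [?x]) = w' @ [x']" using gen_word_swap[OF T al] by blast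
      have "l \<circ> k \<in> gen (J \<xi>)" "u = (l \<circ> k) (w @ [?x])" using gen_comp[OF l(1) k(1)] l(2) k(2) u'(1) by simp_all
      then show ?thesis using j(1) by blast
    qed
  qed
  moreover have "mw (w @ [?x]) = v @ [y]" using 1(2) mu_let_of by simp
  ultimately show ?case using 1(1) mem by blast
qed

lemma Z_fibre_point: assumes z: "z \<in> Dt" and h: "h \<in> Gam" and v: "length v = n" and g: "g \<in> ggens"
  and p: "\<xi> \<in> Tz z" "mw w = v" "g \<in> Jw (J \<xi>) w"
  shows "Z_set g n \<inter> fibre n (horb z v (nu h)) = {orb \<xi> w h}"
proof -
  obtain \<xi>0 w0 where 1: "\<xi>0 \<in> Tz z" "mw w0 = v"
    "\<And>\<xi>' w'. \<xi>' \<in> Tz z \<Longrightarrow> mw w' = v \<Longrightarrow> g \<in> Jw (J \<xi>') w' \<Longrightarrow> \<xi>' = \<xi>0 \<and> (\<exists>j\<in>gen (J \<xi>0). w' = j w0)"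
    using special_unique[OF z g, of v] by blast
  have "orb \<xi>' w' h = orb \<xi>0 w0 h" if "\<xi>' \<in> Tz z" "mw w' = v" "g \<in> Jw (J \<xi>') w'" for \<xi>' w'
    using orb_fibre_eq[OF Xi_of_Tz(1)[OF 1(1)] Xi_of_Tz(1)[OF that(1)] h h refl, of w0 w'] 1(3)[OF that] 1(2) that(2) by simp
  then show ?thesis unfolding Z_fibre[OF z h v g] using p by blast
qed

lemma Z_pt_eq: assumes z: "z \<in> Dt" and h: "h \<in> Gam" and v: "length v = n" and g: "g \<in> ggens"
  and p: "\<xi> \<in> Tz z" "mw w = v" "g \<in> Jw (J \<xi>) w"
  shows "Z_pt g n (horb z v (nu h)) = orb \<xi> w h"
  unfolding Z_pt_def Z_fibre_point[OF assms] by simp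

section \<open>Sheets of the projection and induction on the level\<close>

section \<open>The topology of the fibres\<close>

lemma openin_prod_discrete:
  "openin (prod_topology X (discrete_topology D)) U \<longleftrightarrow>
    U \<subseteq> topspace X \<times> D \<and> (\<forall>d\<in>D. openin X {x. (x, d) \<in> U})"
proof
  assume U: "openin (prod_topology X (discrete_topology D)) U"
  have "openin X {x. (x, d) \<in> U}" if "d \<in> D" for d
  proof -
    have "continuous_map X (prod_topology X (discrete_topology D)) (\<lambda>x. (x, d))"
      using that by (intro continuous_map_pairedI) auto
    from openin_continuous_map_preimage[OF this U]
    have "openin X {x \<in> topspace X. (x, d) \<in> U}" .
    moreover have "{x \<in> topspace X. (x, d) \<in> U} = {x. (x, d) \<in> U}" using openin_subset[OF U] by auto
    ultimately show ?thesis by simp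
  qed
  then show "U \<subseteq> topspace X \<times> D \<and> (\<forall>d\<in>D. openin X {x. (x, d) \<in> U})" using openin_subset[OF U] by simp
next
  assume U: "U \<subseteq> topspace X \<times> D \<and> (\<forall>d\<in>D. openin X {x. (x, d) \<in> U})"
  have "U = (\<Union>d\<in>D. {x. (x, d) \<in> U} \<times> {d})" using U by auto
  moreover have "openin (prod_topology X (discrete_topology D)) ({x. (x, d) \<in> U} \<times> {d})" if "d \<in> D" for d
    using U that by (simp add: openin_prod_Times_iff)
  ultimately show "openin (prod_topology X (discrete_topology D)) U"
    by (metis (no_types, lifting) imageE openin_Union)
qed

lemma topspace_Xi_top: "topspace Xi_top = Xi" by (simp add: Xi_top_def Xi_def simplicial_order_complex)

lemma topspace_M_top: "topspace (M_top n) = M_n n"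
proof -
  have "(\<lambda>(\<xi>, m). tensor Xi Xi_right Gam \<xi> m) ` (Xi \<times> bimod_power Gam n) = Xi_n n"
    unfolding Xi_n_def Xact.space_eq bimod_power_def by force
  then show ?thesis by (simp add: M_top_def Xi_n_top_def topspace_Xi_top M_n_def)
qed

text \<open>\<open>M_top\<close> is a quotient of a disjoint union of copies of \<open>Xi\<close>,
  one for each bimodule element.\<close>

lemma openin_M_top: "openin (M_top n) U \<longleftrightarrow> U \<subseteq> M_n n \<and>
    (\<forall>w h. length w = n \<longrightarrow> h \<in> Gam \<longrightarrow> openin Xi_top {\<xi> \<in> Xi. orb \<xi> w h \<in> U})"
proof -
  let ?P = "prod_topology Xi_top (discrete_topology (bimod_power Gam n))"
  let ?q = "\<lambda>(\<xi>, m). tensor Xi Xi_right Gam \<xi> m"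
  have "quotient_map ?P (M_top n) (tensor_orbit IMGf \<circ> ?q)"
    unfolding M_top_def Xi_n_top_def
    by (rule quotient_map_compose[OF quotient_map_quotient_topology]) (rule quotient_map_quotient_topology)
  then have "openin (M_top n) U \<longleftrightarrow> U \<subseteq> M_n n \<and> openin ?P {x \<in> topspace ?P. (tensor_orbit IMGf \<circ> ?q) x \<in> U}"
    using openin_subset[of "M_top n" U] unfolding quotient_map_def topspace_M_top by blast
  also have "openin ?P {x \<in> topspace ?P. (tensor_orbit IMGf \<circ> ?q) x \<in> U} \<longleftrightarrow>
    (\<forall>m\<in>bimod_power Gam n. openin Xi_top {\<xi>. (\<xi>, m) \<in> {x \<in> topspace ?P. (tensor_orbit IMGf \<circ> ?q) x \<in> U}})"
    unfolding openin_prod_discrete by auto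
  also have "\<dots> \<longleftrightarrow> (\<forall>m\<in>bimod_power Gam n. openin Xi_top {\<xi> \<in> Xi. orb \<xi> (fst m) (snd m) \<in> U})"
  proof (intro ball_cong refl)
    fix m assume m: "m \<in> bimod_power Gam n"
    have "{\<xi>. (\<xi>, m) \<in> {x \<in> topspace ?P. (tensor_orbit IMGf \<circ> ?q) x \<in> U}} = {\<xi> \<in> Xi. orb \<xi> (fst m) (snd m) \<in> U}"
      using m by (auto simp: topspace_Xi_top Xact.orb_def H_eq)
    then show "openin Xi_top {\<xi>. (\<xi>, m) \<in> {x \<in> topspace ?P. (tensor_orbit IMGf \<circ> ?q) x \<in> U}} \<longleftrightarrow>
      openin Xi_top {\<xi> \<in> Xi. orb \<xi> (fst m) (snd m) \<in> U}" by simp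
  qed
  also have "\<dots> \<longleftrightarrow> (\<forall>w h. length w = n \<longrightarrow> h \<in> Gam \<longrightarrow> openin Xi_top {\<xi> \<in> Xi. orb \<xi> w h \<in> U})"
    by (auto simp: bimod_power_def)
  finally show ?thesis .
qed

lemma closedin_M_top: "closedin (M_top n) C \<longleftrightarrow> C \<subseteq> M_n n \<and>
    (\<forall>w h. length w = n \<longrightarrow> h \<in> Gam \<longrightarrow> closedin Xi_top {\<xi> \<in> Xi. orb \<xi> w h \<in> C})"
proof -
  have mem: "orb \<xi> w h \<in> M_n n" if "\<xi> \<in> Xi" "length w = n" "h \<in> Gam" for \<xi> w h
    unfolding M_n_def Xi_n_def Xact.space_eq Xact.orb_def H_eq using that by blast
  have "openin Xi_top {\<xi> \<in> Xi. orb \<xi> w h \<in> M_n n - C} \<longleftrightarrow> closedin Xi_top {\<xi> \<in> Xi. orb \<xi> w h \<in> C}"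
    if "length w = n" "h \<in> Gam" for w h
  proof -
    have "{\<xi> \<in> Xi. orb \<xi> w h \<in> M_n n - C} = Xi - {\<xi> \<in> Xi. orb \<xi> w h \<in> C}" using mem that by auto
    then show ?thesis by (auto simp: closedin_def topspace_Xi_top)
  qed
  then show ?thesis unfolding closedin_def[of "M_top n"] topspace_M_top openin_M_top by auto
qed

lemma Xi_right_continuous: "continuous_on S (\<lambda>\<xi>. Xi_right \<xi> g)"
  unfolding Xi_right_def by (intro continuous_on_coordinatewise_then_product continuous_on_subset[OF continuous_on_product_coordinates]) auto

lemma cell_T0: "s0 \<in> order_complex subgroups \<Longrightarrow> cell s0 \<subseteq> T0"
  unfolding T0_def by (rule cell_subset_realization[OF simplicial_order_complex])

lemma cell_iff: "\<xi> \<in> T0 \<Longrightarrow> \<xi> \<in> cell s \<longleftrightarrow> {V. \<xi> V \<noteq> 0} \<subseteq> s"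
  using T0_facts(1,3,6) by (auto simp: realization_def)

lemma cell_translate: assumes s0: "s0 \<in> order_complex subgroups" and g: "g \<in> Gam"
  shows "cell ((\<lambda>V. rc V g) ` s0) = (\<lambda>\<xi>. Xi_right \<xi> g) ` cell s0"
proof -
  have sub: "(\<lambda>\<xi>. Xi_right \<xi> k) ` cell t \<subseteq> cell ((\<lambda>V. rc V k) ` t)" if k: "k \<in> Gam" for k t
  proof (rule image_subsetI)
    fix \<xi> assume \<xi>: "\<xi> \<in> cell t"
    then show "Xi_right \<xi> k \<in> cell ((\<lambda>V. rc V k) ` t)"
      unfolding realization_def supp_Xi_right[OF k]
      using sum_supp_Xi_right[OF k, of "\<lambda>V x. x" \<xi>] supp_Xi_right[OF k, of \<xi>] by (auto simp: Xi_right_eq)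
  qed
  have ig: "iv g \<in> Gam" by (rule Gam_inv[OF g])
  show ?thesis
  proof
    show "cell ((\<lambda>V. rc V g) ` s0) \<subseteq> (\<lambda>\<xi>. Xi_right \<xi> g) ` cell s0"
    proof
      fix \<eta> assume "\<eta> \<in> cell ((\<lambda>V. rc V g) ` s0)"
      then have "Xi_right \<eta> (iv g) \<in> cell ((\<lambda>V. rc V (iv g)) ` (\<lambda>V. rc V g) ` s0)" using sub[OF ig] by blast
      then have "Xi_right \<eta> (iv g) \<in> cell s0" by (simp add: image_image rc_inv[OF g])
      moreover have "\<eta> = Xi_right (Xi_right \<eta> (iv g)) g"
        using Xi_right_comp[OF ig g, of \<eta>] by (simp only: TA_inv Gam_TA g Xi_right_id)
      ultimately show "\<eta> \<in> (\<lambda>\<xi>. Xi_right \<xi> g) ` cell s0" by blast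
    qed
  qed (rule sub[OF g])
qed

text \<open>In the weak topology closedness is tested on single simplices, and each simplex is the
  translate of one in \<open>T0\<close>, where identifications are governed by the stabilizers of
  points.\<close>

lemma closedin_orb_image: assumes w: "length w = n" and h: "h \<in> Gam" and C: "closed C" "C \<subseteq> T0"
  shows "closedin (M_top n) ((\<lambda>\<xi>. orb \<xi> w h) ` C)"
  unfolding closedin_M_top
proof (intro conjI allI impI)
  show "(\<lambda>\<xi>. orb \<xi> w h) ` C \<subseteq> M_n n" unfolding M_n_eq using w h C by blast
  fix w' :: "letter list" and h' assume w': "length w' = n" "h' \<in> Gam"
  let ?B = "{\<eta> \<in> Xi. orb \<eta> w' h' \<in> (\<lambda>\<xi>. orb \<xi> w h) ` C}"
  show "closedin Xi_top ?B"
    unfolding Xi_top_def closedin_realization[OF simplicial_order_complex]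
  proof (intro conjI ballI)
    show "?B \<subseteq> realization (order_complex coset_poset)" by (auto simp: Xi_def)
    fix s assume "s \<in> order_complex coset_poset"
    then obtain s0 g where s0: "s0 \<in> order_complex subgroups" "g \<in> Gam" "s = (\<lambda>V. rc V g) ` s0"
      using translate_simplex by blast
    define R where "R k \<longleftrightarrow> w = k (g w') \<and> sgG (sect k (g w') \<circ> (sect g w' \<circ> h')) = sgG h" for k
    have G: "sect g w' \<circ> h' \<in> Gam" using Gam_comp Gam_sect s0(2) w'(2) by blast
    have one: "orb (Xi_right \<xi> g) w' h' = orb \<xi>' w h \<longleftrightarrow> \<xi>' = \<xi> \<and> (\<exists>k\<in>grp (Fs \<xi>). R k)"
      if T: "\<xi> \<in> T0" "\<xi>' \<in> T0" for \<xi> \<xi>'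
    proof -
      have X: "\<xi> \<in> Xi" using T(1) T0_Xi by blast
      have "orb (Xi_right \<xi> g) w' h' = orb \<xi> (g w') (sect g w' \<circ> h')"
        using Xact.orb_eq_iff[OF Xi_right_Xi[OF X s0(2)] X w'(2) G] s0(2) by blast
      then show ?thesis using orb_T0_eq[OF T G h, of "g w'" w] by (simp add: R_def)
    qed
    text \<open>The stabilizer of a point depends only on the face carrying it, so the preimage in a simplex
      is a finite union of closed sets.\<close>
    let ?ts = "{t. t \<subseteq> s0 \<and> (\<exists>k\<in>\<Inter>t. R k)}"
    have fs0: "finite s0" using s0(1) by (auto simp: order_complex_def)
    let ?A = "\<Union>t\<in>?ts. cell t \<inter> C"
    have "?B \<inter> cell s = (\<lambda>\<xi>. Xi_right \<xi> g) ` ?A"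
    proof (intro equalityI subsetI)
      fix \<eta> assume \<eta>: "\<eta> \<in> ?B \<inter> cell s"
      then obtain \<xi> where \<xi>: "\<xi> \<in> cell s0" "\<eta> = Xi_right \<xi> g" unfolding s0(3) cell_translate[OF s0(1,2)] by blast
      have T: "\<xi> \<in> T0" using \<xi>(1) cell_T0[OF s0(1)] by blast
      obtain \<xi>' where "\<xi>' \<in> C" "orb \<eta> w' h' = orb \<xi>' w h" using \<eta> by blast
      then have r: "\<xi> \<in> C" "\<exists>k\<in>grp (Fs \<xi>). R k" using one[OF T] C(2) unfolding \<xi>(2) by blast+
      then obtain k where k: "k \<in> grp (Fs \<xi>)" "R k" by blast
      let ?t = "{V. \<xi> V \<noteq> 0}"
      have "?t \<subseteq> s0" using \<xi>(1) cell_iff[OF T] by blast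
      moreover have "k \<in> \<Inter>?t" using k(1) grp_Fs[OF T] by blast
      ultimately have "?t \<in> ?ts" using k(2) by blast
      moreover have "\<xi> \<in> cell ?t" using cell_iff[OF T] by blast
      ultimately show "\<eta> \<in> (\<lambda>\<xi>. Xi_right \<xi> g) ` ?A" using r(1) \<xi>(2) by blast
    next
      fix \<eta> assume "\<eta> \<in> (\<lambda>\<xi>. Xi_right \<xi> g) ` ?A"
      then obtain \<xi> t k where t: "\<eta> = Xi_right \<xi> g" "\<xi> \<in> cell t" "\<xi> \<in> C" "t \<subseteq> s0" "k \<in> \<Inter>t" "R k" by blast
      have T: "\<xi> \<in> T0" using t(3) C(2) by blast
      have sup: "{V. \<xi> V \<noteq> 0} \<subseteq> t" using t(2) cell_iff[OF T] by blast
      then have "k \<in> grp (Fs \<xi>)" using grp_Fs[OF T] t(5) by blast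
      then have "orb \<eta> w' h' = orb \<xi> w h" using one[OF T T] t(1,6) by blast
      moreover have "\<eta> \<in> cell s" unfolding s0(3) cell_translate[OF s0(1,2)] t(1)
        using sup t(4) cell_iff[OF T] by blast
      moreover have "\<eta> \<in> Xi" using Xi_right_Xi[OF subsetD[OF T0_Xi T] s0(2)] t(1) by simp
      ultimately show "\<eta> \<in> ?B \<inter> cell s" using t(3) by blast
    qed
    moreover have "compact ?A"
    proof (intro compact_UN)
      show "finite ?ts" by (rule finite_subset[of _ "Pow s0"]) (use fs0 in auto)
      fix t assume "t \<in> ?ts"
      then have "finite t" using fs0 finite_subset by blast
      then show "compact (cell t \<inter> C)" by (rule compact_Int_closed[OF compact_cell C(1)])
    qed
    then have "compact ((\<lambda>\<xi>. Xi_right \<xi> g) ` ?A)" by (rule compact_continuous_image[OF Xi_right_continuous])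
    ultimately show "closed (?B \<inter> cell s)" using compact_imp_closed_fun by simp
  qed
qed

lemma continuous_map_orb: assumes w: "length w = n" and h: "h \<in> Gam"
  shows "continuous_map (top_of_set T0) (M_top n) (\<lambda>\<xi>. orb \<xi> w h)"
  unfolding continuous_map_def
proof (intro conjI allI impI)
  show "(\<lambda>\<xi>. orb \<xi> w h) \<in> topspace (top_of_set T0) \<rightarrow> topspace (M_top n)"
    unfolding topspace_M_top M_n_eq using w h by auto
  fix U assume "openin (M_top n) U"
  then have "openin Xi_top {\<xi> \<in> Xi. orb \<xi> w h \<in> U}" unfolding openin_M_top using w h by blast
  then have U: "openin (top_of_set (cell s)) ({\<xi> \<in> Xi. orb \<xi> w h \<in> U} \<inter> cell s)" if "s \<in> order_complex coset_poset" for s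
    using that unfolding Xi_top_def openin_realization by blast
  have fin: "finite (order_complex subgroups)"
    using finite_subgroups by (auto simp: order_complex_def intro: finite_subset[of _ "Pow subgroups"])
  have eq: "top_of_set T0 = realization_topology (order_complex subgroups)"
    unfolding T0_def by (rule realization_topology_finite[OF simplicial_order_complex fin, symmetric])
  have "openin (realization_topology (order_complex subgroups)) {x \<in> T0. orb x w h \<in> U}"
    unfolding openin_realization
  proof (intro conjI ballI)
    show "{x \<in> T0. orb x w h \<in> U} \<subseteq> realization (order_complex subgroups)" by (auto simp: T0_def)
    fix s assume s: "s \<in> order_complex subgroups"
    then have "s \<in> order_complex coset_poset" using order_complex_mono[OF subgroups_coset_poset] by blast
    moreover have "{x \<in> T0. orb x w h \<in> U} \<inter> cell s
        = {\<xi> \<in> Xi. orb \<xi> w h \<in> U} \<inter> cell s"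
      using cell_T0[OF s] T0_Xi by blast
    ultimately show "openin (top_of_set (cell s)) ({x \<in> T0. orb x w h \<in> U} \<inter> cell s)"
      using U by simp
  qed
  then show "openin (top_of_set T0) {x \<in> topspace (top_of_set T0). orb x w h \<in> U}" unfolding eq[symmetric] by simp
qed

text \<open>Preimages and images under f are computed through Z, one piece at a time, and a finite
  union of closed pieces is closed; so f is continuous and closed.\<close>

lemma cover_homeo:
  assumes fin: "finite I"
    and a: "\<And>i. i \<in> I \<Longrightarrow> continuous_map Z X (a i)" "\<And>i. i \<in> I \<Longrightarrow> closed_map Z X (a i)"
      "topspace X = (\<Union>i\<in>I. a i ` topspace Z)"
    and b: "\<And>i. i \<in> I \<Longrightarrow> continuous_map Z Y (b i)" "\<And>i. i \<in> I \<Longrightarrow> closed_map Z Y (b i)"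
      "topspace Y = (\<Union>i\<in>I. b i ` topspace Z)"
    and f: "\<And>i z. i \<in> I \<Longrightarrow> z \<in> topspace Z \<Longrightarrow> f (a i z) = b i z" "inj_on f (topspace X)"
  shows "homeomorphic_map X Y f"
proof (rule bijective_closed_imp_homeomorphic_map)
  show im: "f ` topspace X = topspace Y" unfolding a(3) b(3) image_UN using f(1) by (auto simp: image_image)
  show "continuous_map X Y f" unfolding continuous_map_closedin
  proof (intro conjI allI impI ballI)
    show "f \<in> topspace X \<rightarrow> topspace Y" using im by blast
    fix C assume C: "closedin Y C"
    have "{x \<in> topspace X. f x \<in> C} = (\<Union>i\<in>I. a i ` {z \<in> topspace Z. b i z \<in> C})"
      unfolding a(3) using f(1) by (auto simp: image_iff) metis+
    moreover have "closedin X (a i ` {z \<in> topspace Z. b i z \<in> C})" if "i \<in> I" for i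
      using a(2)[OF that] closedin_continuous_map_preimage[OF b(1)[OF that] C] unfolding closed_map_def by blast
    ultimately show "closedin X {x \<in> topspace X. f x \<in> C}" using fin by (auto intro: closedin_Union)
  qed
  show "closed_map X Y f" unfolding closed_map_def
  proof (intro allI impI)
    fix D assume D: "closedin X D"
    have "f ` D = (\<Union>i\<in>I. b i ` {z \<in> topspace Z. a i z \<in> D})"
    proof (intro equalityI subsetI)
      fix y assume "y \<in> f ` D"
      then obtain x where x: "x \<in> D" "y = f x" by blast
      then obtain i z where "i \<in> I" "z \<in> topspace Z" "x = a i z" using closedin_subset[OF D] unfolding a(3) by blast
      then show "y \<in> (\<Union>i\<in>I. b i ` {z \<in> topspace Z. a i z \<in> D})" using x f(1) by auto
    next
      fix y assume "y \<in> (\<Union>i\<in>I. b i ` {z \<in> topspace Z. a i z \<in> D})"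
      then obtain i z where "i \<in> I" "z \<in> topspace Z" "a i z \<in> D" "y = b i z" by blast
      then show "y \<in> f ` D" using f(1) by (metis imageI)
    qed
    moreover have "closedin Y (b i ` {z \<in> topspace Z. a i z \<in> D})" if "i \<in> I" for i
      using b(2)[OF that] closedin_continuous_map_preimage[OF a(1)[OF that] D] unfolding closed_map_def by blast
    ultimately show "closedin Y (f ` D)" using fin by (auto intro: closedin_Union)
  qed
qed (rule f(2))

lemma finite_words: "finite {w. mw w = v}"
proof (rule finite_subset)
  show "{w. mw w = v} \<subseteq> {w. set w \<subseteq> UNIV \<and> length w = length v}" by auto
  have "(UNIV :: letter set) = {L1, L2, L3, L4}" using letter.exhaust by auto
  then have "finite (UNIV :: letter set)" by (metis finite.emptyI finite.insertI)
  then show "finite {w :: letter list. set w \<subseteq> UNIV \<and> length w = length v}" by (rule finite_lists_length_eq)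
qed

lemma orb_map: assumes w: "length w = n" and h: "h \<in> Gam" and A: "(\<lambda>\<xi>. orb \<xi> w h) ` Tz z \<subseteq> A"
  shows "continuous_map (top_of_set (Tz z)) (subtopology (M_top n) A) (\<lambda>\<xi>. orb \<xi> w h)"
    "closed_map (top_of_set (Tz z)) (subtopology (M_top n) A) (\<lambda>\<xi>. orb \<xi> w h)"
proof -
  have sub: "Tz z \<subseteq> T0" by (auto simp: Tz_def)
  have "continuous_map (subtopology (top_of_set T0) (Tz z)) (M_top n) (\<lambda>\<xi>. orb \<xi> w h)"
    by (rule continuous_map_from_subtopology[OF continuous_map_orb[OF w h]])
  moreover have "subtopology (top_of_set T0) (Tz z) = top_of_set (Tz z)"
    using sub by (simp add: subtopology_subtopology Int_absorb1)
  ultimately show "continuous_map (top_of_set (Tz z)) (subtopology (M_top n) A) (\<lambda>\<xi>. orb \<xi> w h)"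
    using A by (simp add: continuous_map_in_subtopology image_subset_iff_funcset)
  show "closed_map (top_of_set (Tz z)) (subtopology (M_top n) A) (\<lambda>\<xi>. orb \<xi> w h)"
    unfolding closed_map_def
  proof (intro allI impI)
    fix C assume "closedin (top_of_set (Tz z)) C"
    then have C: "closed C" "C \<subseteq> Tz z" using Tz_closed closedin_closed_trans closedin_subset by (blast, fastforce)
    then have "closedin (M_top n) ((\<lambda>\<xi>. orb \<xi> w h) ` C)" using closedin_orb_image[OF w h] sub by blast
    then show "closedin (subtopology (M_top n) A) ((\<lambda>\<xi>. orb \<xi> w h) ` C)"
      using A C(2) by (intro closedin_subset_topspace) blast+
  qed
qed

definition sheet :: "plane \<Rightarrow> bletter list \<Rightarrow> aut \<Rightarrow> letter \<Rightarrow> mpt set" where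
  "sheet z v h x = {orb \<xi> (w @ [x]) h | \<xi> w. \<xi> \<in> Tz z \<and> mw w = v}"

lemma fibre_sub: "fibre n s \<subseteq> M_n n" by (auto simp: fibre_def)

lemma topspace_fibre_top: "topspace (fibre_top n s) = fibre n s"
  using fibre_sub by (auto simp: fibre_top_def topspace_M_top)

lemma fibre_zero: assumes z: "z \<in> Dt" and h: "h \<in> Gam"
  shows "homeomorphic_map (top_of_set (Tz z)) (fibre_top 0 (horb z [] (nu h))) (\<lambda>\<xi>. orb \<xi> [] h)"
proof -
  have f: "fibre 0 (horb z [] (nu h)) = (\<lambda>\<xi>. orb \<xi> [] h) ` Tz z" unfolding fibre_eq[OF z h, of "[]" 0, simplified] by auto
  have inj: "inj_on (\<lambda>\<xi>. orb \<xi> [] h) (Tz z)"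
  proof (rule inj_onI)
    fix \<xi> \<xi>' assume "\<xi> \<in> Tz z" "\<xi>' \<in> Tz z" "orb \<xi> [] h = orb \<xi>' [] h"
    then show "\<xi> = \<xi>'" using orb_fibre_eq[OF Xi_of_Tz(1) Xi_of_Tz(1) h h refl refl] by blast
  qed
  have "(\<lambda>\<xi>. orb \<xi> [] h) ` Tz z \<subseteq> fibre 0 (horb z [] (nu h))" unfolding f by blast
  note m = orb_map[of "[]" 0, OF _ h this, folded fibre_top_def]
  show ?thesis
    by (rule bijective_closed_imp_homeomorphic_map) (use m f inj in \<open>simp_all add: topspace_fibre_top\<close>)
qed

text \<open>The element k represents the sign of the projected class: removing a letter over y
  changes the sign of h by the parity of y.\<close>

locale fibre_step =
  fixes n :: nat and z :: plane and v :: "bletter list" and h k :: aut and y :: bletter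
  assumes z: "z \<in> Dt" and h: "h \<in> Gam" and v: "length v = n" and k: "k \<in> Gam" "sgG k = (parh y \<noteq> sgG h)"
begin

abbreviation "s0 \<equiv> horb z v (nu k)"
abbreviation "s1 \<equiv> horb z (v @ [y]) (nu h)"
abbreviation "sh \<equiv> sheet z v h"

lemma q_s1: "q_map n s1 = s0" by (rule q_map_orb[OF h k v])

lemma s1_fibre: "fibre (Suc n) s1 = {orb \<xi> w h | \<xi> w. \<xi> \<in> Tz z \<and> mw w = v @ [y]}"
  using fibre_eq[OF z h, of "v @ [y]" "Suc n"] v by simp

lemma p_orb: assumes "\<xi> \<in> Tz z" "mw w = v" "mu_letter x = y" shows "p_map n (orb \<xi> (w @ [x]) h) = orb \<xi> w k"
proof -
  have "length w = n" using assms(2) v by auto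
  then show ?thesis using p_map_orb[OF Xi_of_Tz(1)[OF assms(1)] h k(1), of x w n] k(2) assms(3) by (simp add: par_mu)
qed

lemma sheet_sub: assumes "mu_letter x = y" shows "sh x \<subseteq> fibre (Suc n) s1"
proof
  fix b assume "b \<in> sh x"
  then obtain \<xi> w where b: "b = orb \<xi> (w @ [x]) h" "\<xi> \<in> Tz z" "mw w = v" unfolding sheet_def by blast
  then have "mw (w @ [x]) = v @ [y]" using assms by simp
  then show "b \<in> fibre (Suc n) s1" unfolding s1_fibre using b by blast
qed

lemma sheet_topspace: assumes "mu_letter x = y" shows "topspace (subtopology (M_top (Suc n)) (sh x)) = sh x"
  using sheet_sub[OF assms] fibre_sub by (auto simp: topspace_M_top)

lemma p_inj: assumes "mu_letter x = y" shows "inj_on (p_map n) (sh x)"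
proof (rule inj_onI)
  fix a b assume "a \<in> sh x" "b \<in> sh x" and eq: "p_map n a = p_map n b"
  then obtain \<xi> w \<xi>' w' where a: "a = orb \<xi> (w @ [x]) h" "\<xi> \<in> Tz z" "mw w = v"
    and b: "b = orb \<xi>' (w' @ [x]) h" "\<xi>' \<in> Tz z" "mw w' = v" unfolding sheet_def by blast
  note T = Xi_of_Tz(1)[OF a(2)] and T' = Xi_of_Tz(1)[OF b(2)]
  have m: "mw w = mw w'" "mw (w @ [x]) = mw (w' @ [x])" using a(3) b(3) by simp_all
  have "orb \<xi> w k = orb \<xi>' w' k" using eq p_orb[OF a(2,3) assms] p_orb[OF b(2,3) assms] a(1) b(1) by simp
  then obtain j where j: "\<xi>' = \<xi>" "j \<in> gen (J \<xi>)" "w' = j w" unfolding orb_fibre_eq[OF T T' k(1) k(1) refl m(1)] by blast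
  obtain l where "l \<in> gen (J \<xi>)" "l (w @ [x]) = w' @ [x]" using gen_word_append[OF T j(2), of w "[x]"] j(3) by auto
  then show "a = b" unfolding a(1) b(1) orb_fibre_eq[OF T T' h h refl m(2)] using j(1) by metis
qed

text \<open>Both spaces are covered by images of the tripod, indexed by the words over v, and the
  projection respects the indexing.\<close>

lemma sheet_homeo: assumes x: "mu_letter x = y"
  shows "homeomorphic_map (subtopology (M_top (Suc n)) (sh x)) (fibre_top n s0) (p_map n)"
proof (rule cover_homeo[where I = "{w. mw w = v}" and Z = "top_of_set (Tz z)"
      and a = "\<lambda>w \<xi>. orb \<xi> (w @ [x]) h" and b = "\<lambda>w \<xi>. orb \<xi> w k"])
  show "finite {w. mw w = v}" by (rule finite_words)
  have len: "length w = n" if "mw w = v" for w using that v by auto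
  show "continuous_map (top_of_set (Tz z)) (subtopology (M_top (Suc n)) (sh x)) (\<lambda>\<xi>. orb \<xi> (w @ [x]) h)"
    "closed_map (top_of_set (Tz z)) (subtopology (M_top (Suc n)) (sh x)) (\<lambda>\<xi>. orb \<xi> (w @ [x]) h)"
    if "w \<in> {w. mw w = v}" for w
    using that len[of w] h by (intro orb_map; force simp: sheet_def)+
  show "continuous_map (top_of_set (Tz z)) (fibre_top n s0) (\<lambda>\<xi>. orb \<xi> w k)"
    "closed_map (top_of_set (Tz z)) (fibre_top n s0) (\<lambda>\<xi>. orb \<xi> w k)"
    if "w \<in> {w. mw w = v}" for w
    unfolding fibre_top_def fibre_eq[OF z k(1) v] using that len[of w] k(1) by (intro orb_map; force)+
  show "topspace (subtopology (M_top (Suc n)) (sh x)) = (\<Union>w\<in>{w. mw w = v}. (\<lambda>\<xi>. orb \<xi> (w @ [x]) h) ` topspace (top_of_set (Tz z)))"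
    unfolding sheet_topspace[OF x] by (auto simp: sheet_def)
  show "topspace (fibre_top n s0) = (\<Union>w\<in>{w. mw w = v}. (\<lambda>\<xi>. orb \<xi> w k) ` topspace (top_of_set (Tz z)))"
    unfolding topspace_fibre_top fibre_eq[OF z k(1) v] by auto
  show "p_map n (orb \<xi> (w @ [x]) h) = orb \<xi> w k" if "w \<in> {w. mw w = v}" "\<xi> \<in> topspace (top_of_set (Tz z))" for w \<xi>
    using that by (simp add: p_orb x)
  show "inj_on (p_map n) (topspace (subtopology (M_top (Suc n)) (sh x)))"
    unfolding sheet_topspace[OF x] by (rule p_inj[OF x])
qed

lemma sheet_closed: assumes x: "mu_letter x = y" shows "closedin (M_top (Suc n)) (sh x)"
proof -
  have "sh x = (\<Union>w\<in>{w. mw w = v}. (\<lambda>\<xi>. orb \<xi> (w @ [x]) h) ` Tz z)" by (auto simp: sheet_def)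
  moreover have "closedin (M_top (Suc n)) ((\<lambda>\<xi>. orb \<xi> (w @ [x]) h) ` Tz z)" if "mw w = v" for w
    using that v h Tz_closed by (intro closedin_orb_image) (auto simp: Tz_def)
  ultimately show ?thesis using finite_words[of v] by (auto intro: closedin_Union)
qed

lemma sheet_subtopology: assumes "mu_letter x = y"
  shows "subtopology (fibre_top (Suc n) s1) (sh x) = subtopology (M_top (Suc n)) (sh x)"
  using sheet_sub[OF assms] by (simp add: fibre_top_def subtopology_subtopology Int_absorb1)

abbreviation "x1 \<equiv> let_of g_alpha y"
abbreviation "x2 \<equiv> let_of g_gamma y"

lemma x12: "x2 = lt g_alpha x1" "x1 \<noteq> x2"
  using gens_distinct gens_distinct(1-3)[symmetric] by (cases y; simp add: let_of_def lt_gens)+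

lemma sheets_un: "sh x1 \<union> sh x2 = fibre (Suc n) s1"
proof
  show "sh x1 \<union> sh x2 \<subseteq> fibre (Suc n) s1" using sheet_sub mu_let_of by blast
  show "fibre (Suc n) s1 \<subseteq> sh x1 \<union> sh x2"
  proof
    fix b assume "b \<in> fibre (Suc n) s1"
    then obtain \<xi> u where b: "b = orb \<xi> u h" "\<xi> \<in> Tz z" "mw u = v @ [y]" unfolding s1_fibre by blast
    then obtain w x where u: "u = w @ [x]" "mw w = v" "mu_letter x = y" by (cases u rule: rev_cases) auto
    have "mu_letter x1 = mu_letter x" using u(3) mu_let_of by simp
    then have "x = x1 \<or> x = x2" unfolding mu_letter_eq x12(1) .
    then show "b \<in> sh x1 \<union> sh x2" using b u unfolding sheet_def by blast
  qed
qed

text \<open>A common point comes from an element changing the last letter, so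
  \<open>gen_word_snocD\<close> makes \<alpha> available at its projection. That projection is
  unique by \<open>special_unique\<close>, and the first sheet contains only one point above
  it.\<close>

lemma sheets_int: assumes p: "\<xi> \<in> Tz z" "mw w = v" "g_alpha \<in> Jw (J \<xi>) w"
  shows "sh x1 \<inter> sh x2 = {orb \<xi> (w @ [x1]) h}"
proof (intro equalityI subsetI)
  fix b assume "b \<in> sh x1 \<inter> sh x2"
  then obtain \<eta> u \<eta>' u' where 1: "b = orb \<eta> (u @ [x1]) h" "\<eta> \<in> Tz z" "mw u = v"
    and 2: "b = orb \<eta>' (u' @ [x2]) h" "\<eta>' \<in> Tz z" "mw u' = v" unfolding sheet_def by blast
  note T = Xi_of_Tz(1)[OF 1(2)] and T' = Xi_of_Tz(1)[OF 2(2)]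
  have m: "mw (u @ [x1]) = mw (u' @ [x2])" using 1(3) 2(3) mu_let_of by simp
  have "orb \<eta> (u @ [x1]) h = orb \<eta>' (u' @ [x2]) h" using 1(1) 2(1) by simp
  then obtain j where j: "\<eta>' = \<eta>" "j \<in> gen (J \<eta>)" "u' @ [x2] = j (u @ [x1])"
    unfolding orb_fibre_eq[OF T T' h h refl m] by blast
  have al: "g_alpha \<in> Jw (J \<eta>) u'" using gen_word_snocD(2)[OF T j(2) j(3)[symmetric]] x12(2) by simp
  have eq: "orb \<eta> u' k = orb \<xi> w k"
    using Z_fibre_point[OF z k(1) v _ p] Z_fibre_point[OF z k(1) v _ 1(2) 2(3) al] by (simp add: ggens_def)
  have a: "orb \<eta> (u' @ [x1]) h \<in> sh x1" "orb \<xi> (w @ [x1]) h \<in> sh x1" using 1(2) 2(3) p unfolding sheet_def by blast+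
  have "orb \<eta> (u' @ [x1]) h = orb \<xi> (w @ [x1]) h"
    using inj_onD[OF p_inj[OF mu_let_of] _ a] eq p_orb[OF 1(2) 2(3) mu_let_of] p_orb[OF p(1,2) mu_let_of] by simp
  moreover have "orb \<eta> (u @ [x1]) h = orb \<eta> (u' @ [x1]) h"
  proof -
    have ju: "j u = u'" by (rule gen_word_snocD(1)[OF T j(2) j(3)[symmetric]])
    then obtain l where "l \<in> gen (J \<eta>)" "l (u @ [x1]) = u' @ [x1]" using gen_word_append[OF T j(2), of u "[x1]"] by auto
    moreover have "mw (u @ [x1]) = mw (u' @ [x1])" using 1(3) 2(3) by simp
    ultimately show ?thesis unfolding orb_fibre_eq[OF T T h h refl \<open>mw (u @ [x1]) = mw (u' @ [x1])\<close>] by metis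
  qed
  ultimately show "b \<in> {orb \<xi> (w @ [x1]) h}" using 1(1) by simp
next
  fix b assume b: "b \<in> {orb \<xi> (w @ [x1]) h}"
  note T = Xi_of_Tz(1)[OF p(1)]
  obtain l where l: "l \<in> gen (J \<xi>)" "l (w @ [x1]) = w @ [x2]" using gen_word_swap[OF T p(3), of x1] x12(1) by auto
  have m: "mw (w @ [x1]) = mw (w @ [x2])" using mu_let_of by simp
  have "orb \<xi> (w @ [x1]) h = orb \<xi> (w @ [x2]) h" unfolding orb_fibre_eq[OF T T h h refl m] using l by metis
  then show "b \<in> sh x1 \<inter> sh x2" using b p(1,2) unfolding sheet_def by blast
qed

text \<open>\<open>Jw_snoc\<close> and \<open>Jx_prv\<close> turn the loop \<open>prv g\<close> at w
  into the loop g at w followed by \<open>let_of g y\<close>; injectivity on the sheet makes it the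
  only point above.\<close>

lemma Z_lift: assumes g: "g \<in> ggens"
  shows "{b \<in> M_n (Suc n). p_map n b = Z_pt (prv g) n s0} \<inter> sh (let_of g y) = {Z_pt g (Suc n) s1}"
proof -
  obtain \<xi> w where p: "\<xi> \<in> Tz z" "mw w = v" "prv g \<in> Jw (J \<xi>) w" using special_unique[OF z prv_ggens[of g], of v] by blast
  let ?b = "orb \<xi> (w @ [let_of g y]) h"
  have Z0: "Z_pt (prv g) n s0 = orb \<xi> w k" by (rule Z_pt_eq[OF z k(1) v prv_ggens p])
  have pb: "p_map n ?b = orb \<xi> w k" by (rule p_orb[OF p(1,2) mu_let_of])
  have bs: "?b \<in> sh (let_of g y)" using p unfolding sheet_def by blast
  have mem: "g \<in> Jw (J \<xi>) (w @ [let_of g y])" unfolding Jw_snoc Jx_prv[OF g] mu_let_of using p(3) by simp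
  have Z1: "Z_pt g (Suc n) s1 = ?b"
    by (rule Z_pt_eq[OF z h _ g p(1) _ mem]) (use p(2) v mu_let_of in simp_all)
  have "b = ?b" if "b \<in> sh (let_of g y)" "p_map n b = orb \<xi> w k" for b
    using inj_onD[OF p_inj[OF mu_let_of] _ that(1) bs] that(2) pb by simp
  moreover have "?b \<in> M_n (Suc n)" using bs sheet_sub[OF mu_let_of] fibre_sub by blast
  ultimately show ?thesis unfolding Z0 Z1 using bs pb by blast
qed

end

lemma sign_exists: "\<exists>k\<in>Gam. sgG k = b"
  using Gam_id Gam_gens(4) sgG_gens(1,5) by (cases b) blast+

text \<open>The vertex set has to contain the special points: the sheets of the next level are glued
  above the point of \<alpha>, and the special points there lie above those of \<beta> and \<gamma>.
  Connectedness and a second point are carried along for \<open>two_sheets\<close>.\<close>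

lemma fibre_tree: assumes z: "z \<in> Dt"
  shows "length v = n \<Longrightarrow> h \<in> Gam \<Longrightarrow>
    (\<exists>V. marked_tree (fibre_top n (horb z v (nu h))) V \<and> (\<forall>g\<in>ggens. Z_set g n \<inter> fibre n (horb z v (nu h)) \<subseteq> V)) \<and>
    connected_space (fibre_top n (horb z v (nu h))) \<and>
    (\<exists>a\<in>fibre n (horb z v (nu h)). \<exists>b\<in>fibre n (horb z v (nu h)). a \<noteq> b)"
proof (induction n arbitrary: v h)
  case 0
  then have v: "v = []" and h: "h \<in> Gam" by auto
  let ?s = "horb z [] (nu h)"
  note H = fibre_zero[OF z h]
  obtain H' where H': "homeomorphic_maps (top_of_set (Tz z)) (fibre_top 0 ?s) (\<lambda>\<xi>. orb \<xi> [] h) H'"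
    using H homeomorphic_map_maps by blast
  then have Hi: "homeomorphic_map (fibre_top 0 ?s) (top_of_set (Tz z)) H'"
    using homeomorphic_maps_sym homeomorphic_maps_map by blast
  have inv: "H' (orb \<xi> [] h) = \<xi>" if "\<xi> \<in> Tz z" for \<xi> using H' that by (simp add: homeomorphic_maps_def)
  obtain V where V: "marked_tree (top_of_set (Tz z)) V" "{\<xi> \<in> Tz z. J \<xi> \<noteq> {}} \<subseteq> V" using tripod_marked[OF z] by blast
  have M: "marked_tree (fibre_top 0 ?s) {a \<in> topspace (fibre_top 0 ?s). H' a \<in> V}" by (rule marked_tree_transfer[OF Hi V(1)])
  have f: "fibre 0 ?s = (\<lambda>\<xi>. orb \<xi> [] h) ` Tz z" unfolding fibre_eq[OF z h, of "[]" 0, simplified] by auto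
  have "Z_set g 0 \<inter> fibre 0 ?s \<subseteq> {a \<in> topspace (fibre_top 0 ?s). H' a \<in> V}" if g: "g \<in> ggens" for g
  proof
    fix b assume b: "b \<in> Z_set g 0 \<inter> fibre 0 ?s"
    then obtain \<xi> where \<xi>: "b = orb \<xi> [] h" "\<xi> \<in> Tz z" "g \<in> J \<xi>" unfolding Z_fibre[OF z h, of "[]" 0, OF _ g, simplified] by auto
    then show "b \<in> {a \<in> topspace (fibre_top 0 ?s). H' a \<in> V}" using b V(2) inv by (auto simp: topspace_fibre_top)
  qed
  moreover have "connected_space (fibre_top 0 ?s)"
    using homeomorphic_connected_space[OF homeomorphic_map_imp_homeomorphic_space[OF H]] tripod_connected[OF z]
    by (simp add: connectedin_def flip: connectedin_iff_connected)
  moreover have "\<exists>a\<in>fibre 0 ?s. \<exists>b\<in>fibre 0 ?s. a \<noteq> b"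
  proof -
    obtain \<xi> \<xi>' where x: "\<xi> \<in> Tz z" "\<xi>' \<in> Tz z" "\<xi> \<noteq> \<xi>'" using tripod_two_points[OF z] by blast
    then have "orb \<xi> [] h \<noteq> orb \<xi>' [] h" using inv[OF x(1)] inv[OF x(2)] by auto
    then show ?thesis unfolding f using x by blast
  qed
  ultimately show ?case using M unfolding v by blast
next
  case (Suc n)
  obtain u y where u: "v = u @ [y]" "length u = n" using Suc.prems(1) by (cases v rule: rev_cases) auto
  obtain k where k: "k \<in> Gam" "sgG k = (parh y \<noteq> sgG h)" using sign_exists by blast
  interpret fibre_step n z u h k y by unfold_locales (use z Suc.prems(2) u(2) k in simp_all)
  obtain V where V: "marked_tree (fibre_top n s0) V" "\<And>g. g \<in> ggens \<Longrightarrow> Z_set g n \<inter> fibre n s0 \<subseteq> V"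
    and con: "connected_space (fibre_top n s0)" and two: "\<exists>a\<in>fibre n s0. \<exists>b\<in>fibre n s0. a \<noteq> b"
    using Suc.IH[OF u(2) k(1)] by blast
  obtain \<xi> w where p: "\<xi> \<in> Tz z" "mw w = u" "g_alpha \<in> Jw (J \<xi>) w"
    using special_unique[OF z, of g_alpha u] by (auto simp: ggens_def)
  let ?c = "orb \<xi> (w @ [x1]) h"
  note int = sheets_int[OF p]
  let ?S = "\<lambda>x. {a \<in> topspace (subtopology (M_top (Suc n)) (sh x)). p_map n a \<in> V}"
  have mt: "marked_tree (subtopology (fibre_top (Suc n) s1) (sh x)) (?S x)" if "mu_letter x = y" for x
    unfolding sheet_subtopology[OF that] by (rule marked_tree_transfer[OF sheet_homeo[OF that] V(1)])
  have cl: "closedin (fibre_top (Suc n) s1) (sh x)" if "mu_letter x = y" for x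
    unfolding fibre_top_def using sheet_closed[OF that] sheet_sub[OF that] by (rule closedin_subset_topspace)
  have zp: "orb \<eta> w' k \<in> V" if "\<eta> \<in> Tz z" "mw w' = u" "g \<in> ggens" "g \<in> Jw (J \<eta>) w'" for \<eta> w' g
    using V(2)[OF that(3)] Z_fibre[OF z k(1) u(2) that(3)] that by blast
  have pc: "p_map n ?c \<in> V" unfolding p_orb[OF p(1,2) mu_let_of] by (rule zp[OF p(1,2) _ p(3)]) (simp add: ggens_def)
  have c: "?c \<in> ?S x1" "?c \<in> ?S x2" using int pc by (auto simp only: sheet_topspace[OF mu_let_of] mem_Collect_eq)
  have "marked_tree (fibre_top (Suc n) s1) (?S x1 \<union> ?S x2)"
    by (rule marked_tree_glue[OF cl cl _ int mt mt c]) (simp_all only: mu_let_of sheets_un topspace_fibre_top)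
  moreover have "Z_set g (Suc n) \<inter> fibre (Suc n) s1 \<subseteq> ?S x1 \<union> ?S x2" if g: "g \<in> ggens" for g
  proof
    fix b assume b: "b \<in> Z_set g (Suc n) \<inter> fibre (Suc n) s1"
    have "length (u @ [y]) = Suc n" using u(2) by simp
    from Z_fibre[OF z h this g] b obtain \<eta> w' where 1: "b = orb \<eta> w' h" "\<eta> \<in> Tz z" "mw w' = u @ [y]" "g \<in> Jw (J \<eta>) w'" by blast
    then obtain w'' x where 2: "w' = w'' @ [x]" "mw w'' = u" "mu_letter x = y" by (cases w' rule: rev_cases) auto
    have "prv g \<in> Jw (J \<eta>) w''" using 1(4) unfolding 2(1) Jw_snoc Jx_prv[OF g] by blast
    then have "p_map n b \<in> V" unfolding 1(1) 2(1) p_orb[OF 1(2) 2(2,3)] by (rule zp[OF 1(2) 2(2) prv_ggens])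
    moreover have "b \<in> sh x1 \<union> sh x2" using b unfolding sheets_un by blast
    ultimately show "b \<in> ?S x1 \<union> ?S x2" by (auto simp only: sheet_topspace[OF mu_let_of] mem_Collect_eq)
  qed
  moreover have "connected_space (fibre_top (Suc n) s1)"
  proof -
    have "connectedin (M_top (Suc n)) (sh x)" if "mu_letter x = y" for x
      unfolding connectedin_def
      using homeomorphic_connected_space[OF homeomorphic_map_imp_homeomorphic_space[OF sheet_homeo[OF that]]] con
        sheet_sub[OF that] fibre_sub by (auto simp: topspace_M_top)
    then have "connectedin (M_top (Suc n)) (sh x1 \<union> sh x2)"
      using int mu_let_of by (intro connectedin_Un) auto
    then show ?thesis unfolding sheets_un fibre_top_def connectedin_def by blast
  qed
  moreover have "\<exists>a\<in>fibre (Suc n) s1. \<exists>b\<in>fibre (Suc n) s1. a \<noteq> b"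
  proof -
    have "p_map n ` sh x1 = fibre n s0"
      using homeomorphic_imp_surjective_map[OF sheet_homeo[OF mu_let_of[of g_alpha y]]]
      by (simp only: sheet_topspace[OF mu_let_of] topspace_fibre_top)
    obtain a b where ab: "a \<in> fibre n s0" "b \<in> fibre n s0" "a \<noteq> b" using two by blast
    then obtain a' b' where ab': "a' \<in> sh x1" "b' \<in> sh x1" "a = p_map n a'" "b = p_map n b'"
      unfolding \<open>p_map n ` sh x1 = fibre n s0\<close>[symmetric] by blast
    have "sh x1 \<subseteq> fibre (Suc n) s1" by (rule sheet_sub[OF mu_let_of])
    moreover have "a' \<noteq> b'" using ab(3) ab'(3,4) by auto
    ultimately show ?thesis using ab'(1,2) by (intro bexI[of _ a'] bexI[of _ b']) auto
  qed
  ultimately show ?case unfolding u(1) by blast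
qed

context fibre_step
begin

lemma branched:
  assumes p: "\<xi> \<in> Tz z" "mw w = v" "g_alpha \<in> Jw (J \<xi>) w"
  shows "branched_covering_of_degree 2 (fibre_top (Suc n) s1) (fibre_top n s0) (p_map n)"
    "critical_points (fibre_top (Suc n) s1) (fibre_top n s0) (p_map n) = {orb \<xi> (w @ [x1]) h}"
proof -
  have cl: "closedin (fibre_top (Suc n) s1) (sh x)" if "mu_letter x = y" for x
    unfolding fibre_top_def using sheet_closed[OF that] sheet_sub[OF that] by (rule closedin_subset_topspace)
  have un: "sh x1 \<union> sh x2 = topspace (fibre_top (Suc n) s1)" by (simp only: sheets_un topspace_fibre_top)
  have H: "homeomorphic_map (subtopology (fibre_top (Suc n) s1) (sh x)) (fibre_top n s0) (p_map n)" if "mu_letter x = y" for x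
    unfolding sheet_subtopology[OF that] by (rule sheet_homeo[OF that])
  have tr: "(\<exists>V. marked_tree (fibre_top n s0) V)" "connected_space (fibre_top n s0)"
    "\<exists>a\<in>fibre n s0. \<exists>b\<in>fibre n s0. a \<noteq> b" using fibre_tree[OF z v k(1)] by blast+
  have Hd: "Hausdorff_space (fibre_top n s0)" using tr(1) marked_tree_space by blast
  have big: "\<exists>a\<in>topspace (fibre_top n s0). a \<noteq> p_map n (orb \<xi> (w @ [x1]) h)"
    using tr(3) unfolding topspace_fibre_top by metis
  note two = two_sheets[OF cl[OF mu_let_of] cl[OF mu_let_of] un sheets_int[OF p] H[OF mu_let_of] H[OF mu_let_of] Hd tr(2) big]
  show "branched_covering_of_degree 2 (fibre_top (Suc n) s1) (fibre_top n s0) (p_map n)" by (rule two(1))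
  show "critical_points (fibre_top (Suc n) s1) (fibre_top n s0) (p_map n) = {orb \<xi> (w @ [x1]) h}" by (rule two(2))
qed

lemma special_alpha: "\<exists>\<xi> w. \<xi> \<in> Tz z \<and> mw w = v \<and> g_alpha \<in> Jw (J \<xi>) w"
  using special_unique[OF z, of g_alpha v] by (auto simp: ggens_def)

lemma branched_s1:
  "branched_covering_of_degree 2 (fibre_top (Suc n) s1) (fibre_top n (q_map n s1)) (p_map n)"
  "is_singleton (crit_set n s1)"
proof -
  obtain \<xi> w where p: "\<xi> \<in> Tz z" "mw w = v" "g_alpha \<in> Jw (J \<xi>) w" using special_alpha by blast
  show "branched_covering_of_degree 2 (fibre_top (Suc n) s1) (fibre_top n (q_map n s1)) (p_map n)"
    unfolding q_s1 by (rule branched(1)[OF p])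
  show "is_singleton (crit_set n s1)" unfolding crit_set_def q_s1 branched(2)[OF p] by simp
qed

lemma sheet_tree: assumes "mu_letter x = y" shows "finite_tree (subtopology (M_top (Suc n)) (sh x))"
proof -
  obtain V where "marked_tree (fibre_top n s0) V" using fibre_tree[OF z v k(1)] by blast
  from marked_tree_transfer[OF sheet_homeo[OF assms] this] show ?thesis by (rule marked_tree_imp_finite_tree)
qed

lemma crit_s1: "sh x1 \<inter> sh x2 = {crit_pt n s1}" "p_map n (crit_pt n s1) = Z_pt g_alpha n (q_map n s1)"
proof -
  obtain \<xi> w where p: "\<xi> \<in> Tz z" "mw w = v" "g_alpha \<in> Jw (J \<xi>) w" using special_alpha by blast
  have c: "crit_pt n s1 = orb \<xi> (w @ [x1]) h" unfolding crit_pt_def crit_set_def q_s1 branched(2)[OF p] by simp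
  show "sh x1 \<inter> sh x2 = {crit_pt n s1}" unfolding c by (rule sheets_int[OF p])
  have "g_alpha \<in> ggens" by (simp add: ggens_def)
  from Z_pt_eq[OF z k(1) v this p] show "p_map n (crit_pt n s1) = Z_pt g_alpha n (q_map n s1)"
    unfolding c q_s1 p_orb[OF p(1,2) mu_let_of] by simp
qed

lemma Z_lift_s1:
  "{b \<in> M_n (Suc n). p_map n b = Z_pt g_beta n (q_map n s1)} \<inter> sh x1 = {Z_pt g_alpha (Suc n) s1}"
  "{b \<in> M_n (Suc n). p_map n b = Z_pt g_beta n (q_map n s1)} \<inter> sh x2 = {Z_pt g_gamma (Suc n) s1}"
  "y = B1 \<Longrightarrow> {b \<in> M_n (Suc n). p_map n b = Z_pt g_gamma n (q_map n s1)} \<inter> sh x1 = {Z_pt g_beta (Suc n) s1}"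
  "y = B2 \<Longrightarrow> {b \<in> M_n (Suc n). p_map n b = Z_pt g_gamma n (q_map n s1)} \<inter> sh x2 = {Z_pt g_beta (Suc n) s1}"
proof -
  have g: "g_alpha \<in> ggens" "g_beta \<in> ggens" "g_gamma \<in> ggens" by (simp_all add: ggens_def)
  note d = gens_distinct(1-3) gens_distinct(1-3)[symmetric]
  have prv: "prv g_alpha = g_beta" "prv g_gamma = g_beta" "prv g_beta = g_gamma" using d by (simp_all add: prv_def)
  have lb: "y = B1 \<Longrightarrow> let_of g_beta y = x1" "y = B2 \<Longrightarrow> let_of g_beta y = x2" using d by (simp_all add: let_of_def)
  show "{b \<in> M_n (Suc n). p_map n b = Z_pt g_beta n (q_map n s1)} \<inter> sh x1 = {Z_pt g_alpha (Suc n) s1}"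
    using Z_lift[OF g(1)] unfolding q_s1 prv .
  show "{b \<in> M_n (Suc n). p_map n b = Z_pt g_beta n (q_map n s1)} \<inter> sh x2 = {Z_pt g_gamma (Suc n) s1}"
    using Z_lift[OF g(3)] unfolding q_s1 prv .
  show "{b \<in> M_n (Suc n). p_map n b = Z_pt g_gamma n (q_map n s1)} \<inter> sh x1 = {Z_pt g_beta (Suc n) s1}" if "y = B1"
    using Z_lift[OF g(2)] unfolding q_s1 prv lb(1)[OF that] .
  show "{b \<in> M_n (Suc n). p_map n b = Z_pt g_gamma n (q_map n s1)} \<inter> sh x2 = {Z_pt g_beta (Suc n) s1}" if "y = B2"
    using Z_lift[OF g(2)] unfolding q_s1 prv lb(2)[OF that] .
qed

end

theorem theorem6p2:
  fixes n :: nat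
  shows
    "(\<forall>\<xi> \<in> S_n n. finite_tree (fibre_top n \<xi>)) \<and>
     (\<forall>\<xi> \<in> S_n (Suc n).
        branched_covering_of_degree 2
          (fibre_top (Suc n) \<xi>) (fibre_top n (q_map n \<xi>)) (p_map n) \<and>
        is_singleton (crit_set n \<xi>)) \<and>
     (\<forall>\<xi> \<in> S_n n. \<forall>g \<in> {g_alpha, g_beta, g_gamma}. is_singleton (Z_set g n \<inter> fibre n \<xi>)) \<and>
     (\<forall>\<xi> \<in> S_n (Suc n). \<forall>\<zeta> \<in> D_n n.
        \<forall>x \<in> {([B1], id), bimod_right ([B1], id) h_a, ([B2], id), bimod_right ([B2], id) h_a}.
        \<xi> = S_orbit (hat_append \<zeta> x) \<longrightarrow>
        (\<exists>T1 T2. T1 \<union> T2 = fibre (Suc n) \<xi> \<and>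
          finite_tree (subtopology (M_top (Suc n)) T1) \<and>
          finite_tree (subtopology (M_top (Suc n)) T2) \<and>
          T1 \<inter> T2 = {crit_pt n \<xi>} \<and>
          homeomorphic_map (subtopology (M_top (Suc n)) T1) (fibre_top n (q_map n \<xi>)) (p_map n) \<and>
          homeomorphic_map (subtopology (M_top (Suc n)) T2) (fibre_top n (q_map n \<xi>)) (p_map n) \<and>
          p_map n (crit_pt n \<xi>) = Z_pt g_alpha n (q_map n \<xi>) \<and>
          {y \<in> M_n (Suc n). p_map n y = Z_pt g_beta n (q_map n \<xi>)} \<inter> T1
            = {Z_pt g_alpha (Suc n) \<xi>} \<and>
          {y \<in> M_n (Suc n). p_map n y = Z_pt g_beta n (q_map n \<xi>)} \<inter> T2
            = {Z_pt g_gamma (Suc n) \<xi>} \<and>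
          (x \<in> {([B1], id), bimod_right ([B1], id) h_a} \<longrightarrow>
            {y \<in> M_n (Suc n). p_map n y = Z_pt g_gamma n (q_map n \<xi>)} \<inter> T1
              = {Z_pt g_beta (Suc n) \<xi>}) \<and>
          (x \<in> {([B2], id), bimod_right ([B2], id) h_a} \<longrightarrow>
            {y \<in> M_n (Suc n). p_map n y = Z_pt g_gamma n (q_map n \<xi>)} \<inter> T2
              = {Z_pt g_beta (Suc n) \<xi>})))"
proof (intro conjI ballI impI)
  fix \<xi> assume "\<xi> \<in> S_n n"
  then obtain z v h where s: "\<xi> = horb z v (nu h)" "z \<in> Dt" "length v = n" "h \<in> Gam" unfolding S_n_eq by blast
  show "finite_tree (fibre_top n \<xi>)" using fibre_tree[OF s(2-4)] marked_tree_imp_finite_tree unfolding s(1) by blast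
  fix g assume "g \<in> {g_alpha, g_beta, g_gamma}"
  then have g: "g \<in> ggens" by (simp add: ggens_def)
  obtain \<eta> w where p: "\<eta> \<in> Tz z" "mw w = v" "g \<in> Jw (J \<eta>) w" using special_unique[OF s(2) g, of v] by blast
  show "is_singleton (Z_set g n \<inter> fibre n \<xi>)" unfolding s(1) Z_fibre_point[OF s(2,4,3) g p] by simp
next
  fix \<xi> assume "\<xi> \<in> S_n (Suc n)"
  then obtain z v' h where s: "\<xi> = horb z v' (nu h)" "z \<in> Dt" "length v' = Suc n" "h \<in> Gam" unfolding S_n_eq by blast
  obtain v y where vy: "v' = v @ [y]" "length v = n" using s(3) by (cases v' rule: rev_cases) auto
  obtain k where k: "k \<in> Gam" "sgG k = (parh y \<noteq> sgG h)" using sign_exists by blast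
  interpret fibre_step n z v h k y by unfold_locales (use s vy k in simp_all)
  show "branched_covering_of_degree 2 (fibre_top (Suc n) \<xi>) (fibre_top n (q_map n \<xi>)) (p_map n)"
    unfolding s(1) vy(1) by (rule branched_s1(1))
  show "is_singleton (crit_set n \<xi>)" unfolding s(1) vy(1) by (rule branched_s1(2))
next
  fix \<xi> \<zeta> x
  assume "\<zeta> \<in> D_n n" and x: "x \<in> {([B1], id), bimod_right ([B1], id) h_a, ([B2], id), bimod_right ([B2], id) h_a}"
    and \<xi>: "\<xi> = S_orbit (hat_append \<zeta> x)"
  then obtain z v where \<zeta>: "\<zeta> = tensor UNIV plane_right Gam_hat z (v, id)" "z \<in> Dt" "length v = n"
    unfolding D_n_def Dt_hull by blast
  have r: "bimod_right ([b], id) h_a = ([b], h_a)" for b by (simp only: bimod_right_simp id_comp)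
  \<comment> \<open>The two possible twists, \<open>id\<close> and \<open>h_a\<close>, are the
    images under \<nu> of \<open>id\<close> and a.\<close>
  have "\<exists>b. \<exists>l\<in>Gam. x = ([b], nu l)"
    using x nu_gens(1,5) Gam_id Gam_gens(4) unfolding r by (metis insertE singletonD)
  then obtain b l where l: "x = ([b], nu l)" "l \<in> Gam" by blast
  have b: "x \<in> {([B1], id), bimod_right ([B1], id) h_a} \<Longrightarrow> b = B1" "x \<in> {([B2], id), bimod_right ([B2], id) h_a} \<Longrightarrow> b = B2"
    unfolding r l(1) by auto
  obtain k where k: "k \<in> Gam" "sgG k = (parh b \<noteq> sgG l)" using sign_exists by blast
  interpret fibre_step n z v l k b by unfold_locales (use \<zeta> l k in simp_all)
  have eq: "\<xi> = s1" unfolding \<xi> \<zeta>(1) l(1) by (rule hat_append_orb[OF nu_Gamh[OF l(2)]])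
  have H: "homeomorphic_map (subtopology (M_top (Suc n)) (sh x)) (fibre_top n (q_map n s1)) (p_map n)"
    if "mu_letter x = b" for x unfolding q_s1 by (rule sheet_homeo[OF that])
  show "\<exists>T1 T2. T1 \<union> T2 = fibre (Suc n) \<xi> \<and>
          finite_tree (subtopology (M_top (Suc n)) T1) \<and>
          finite_tree (subtopology (M_top (Suc n)) T2) \<and>
          T1 \<inter> T2 = {crit_pt n \<xi>} \<and>
          homeomorphic_map (subtopology (M_top (Suc n)) T1) (fibre_top n (q_map n \<xi>)) (p_map n) \<and>
          homeomorphic_map (subtopology (M_top (Suc n)) T2) (fibre_top n (q_map n \<xi>)) (p_map n) \<and>
          p_map n (crit_pt n \<xi>) = Z_pt g_alpha n (q_map n \<xi>) \<and>
          {y \<in> M_n (Suc n). p_map n y = Z_pt g_beta n (q_map n \<xi>)} \<inter> T1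
            = {Z_pt g_alpha (Suc n) \<xi>} \<and>
          {y \<in> M_n (Suc n). p_map n y = Z_pt g_beta n (q_map n \<xi>)} \<inter> T2
            = {Z_pt g_gamma (Suc n) \<xi>} \<and>
          (x \<in> {([B1], id), bimod_right ([B1], id) h_a} \<longrightarrow>
            {y \<in> M_n (Suc n). p_map n y = Z_pt g_gamma n (q_map n \<xi>)} \<inter> T1
              = {Z_pt g_beta (Suc n) \<xi>}) \<and>
          (x \<in> {([B2], id), bimod_right ([B2], id) h_a} \<longrightarrow>
            {y \<in> M_n (Suc n). p_map n y = Z_pt g_gamma n (q_map n \<xi>)} \<inter> T2
              = {Z_pt g_beta (Suc n) \<xi>})"
    unfolding eq
    by (rule exI[of _ "sh x1"], rule exI[of _ "sh x2"], intro conjI impI)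
      (rule sheets_un sheet_tree[OF mu_let_of] crit_s1 H[OF mu_let_of] Z_lift_s1(1,2)
        | (rule Z_lift_s1(3)[OF b(1)], assumption) | (rule Z_lift_s1(4)[OF b(2)], assumption))+
qed

end
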